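(* Let $e\in\mathfrak g$ be nilpotent, $\{e,h,f\}$ an $\mathfrak{sl}_2$-triple containing it, $\mathfrak g=\bigoplus_{i\in\mathbb Z}\mathfrak g_i$ the grading by eigenvalues of $\operatorname{ad}h$, and $\mathfrak k=\mathfrak z(e,h,f)$. The following are equivalent: (i) $e$ is a member of a rectangular principal nilpotent pair; (ii) $e$ is even (i.e. $\mathfrak g_i=0$ for all odd $i$), and every regular nilpotent element of $\mathfrak k$ is a regular element of $\mathfrak g_0$ (i.e. its centralizer in $\mathfrak g_0$ has dimension $\operatorname{rk}\mathfrak g_0=\operatorname{rk}\mathfrak g$). Moreover, if (ii) holds and $e'$ is any regular nilpotent element of $\mathfrak k$, then $(e,e')$ is a principal nilpotent pair.
   Context: Let $\mathfrak g$ be a complex semisimple Lie algebra with adjoint group $G$; $\mathfrak z(\cdot)$ denotes (simultaneous) centralizers in $\mathfrak g$. A principal nilpotent pair is a pair $(e_1,e_2)\in\mathfrak g\oplus\mathfrak g$ with $[e_1,e_2]=0$, $\dim\mathfrak z(e_1,e_2)=\operatorname{rk}\mathfrak g$, and such that for every $(t_1,t_2)\in(\mathbb C^* )^2$ there is $g\in G$ with $\operatorname{Ad}g(e_i)=t_ie_i$. An $\mathfrak{sl}_2$-triple $\{e,h,f\}$ satisfies $[h,e]=2e$, $[h,f]=-2f$, $[e,f]=h$. A principal nilpotent pair $(e_1,e_2)$ is rectangular if there exist $\mathfrak{sl}_2$-triples $\{e_1,h_1,f_1\}$ and $\{e_2,h_2,f_2\}$ such that every element of the first commutes with every element of the second.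 A regular nilpotent element of the reductive algebra $\mathfrak k$ means a principal nilpotent element of $[\mathfrak k,\mathfrak k]$. *)

theory Defs
  imports Complex_Main
begin

definition lie_algebra :: "(complex \<Rightarrow> 'g::ab_group_add \<Rightarrow> 'g) \<Rightarrow> ('g \<Rightarrow> 'g \<Rightarrow> 'g) \<Rightarrow> bool" where
  "lie_algebra sc br \<longleftrightarrow>
     vector_space sc \<and>
     (\<exists>B. finite B \<and> module.span sc B = UNIV) \<and>
     (\<forall>x y z. br (x + y) z = br x z + br y z) \<and>
     (\<forall>x y z. br x (y + z) = br x y + br x z) \<and>
     (\<forall>c x y. br (sc c x) y = sc c (br x y)) \<and>
     (\<forall>c x y. br x (sc c y) = sc c (br x y)) \<and>
     (\<forall>x. br x x = 0) \<and>
     (\<forall>x y z. br x (br y z) + br y (br z x) + br z (br x y) = 0)"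

definition lie_ideal :: "(complex \<Rightarrow> 'g::ab_group_add \<Rightarrow> 'g) \<Rightarrow> ('g \<Rightarrow> 'g \<Rightarrow> 'g) \<Rightarrow> 'g set \<Rightarrow> bool" where
  "lie_ideal sc br I \<longleftrightarrow> module.subspace sc I \<and> (\<forall>x y. y \<in> I \<longrightarrow> br x y \<in> I)"

definition brk_span :: "(complex \<Rightarrow> 'g::ab_group_add \<Rightarrow> 'g) \<Rightarrow> ('g \<Rightarrow> 'g \<Rightarrow> 'g) \<Rightarrow> 'g set \<Rightarrow> 'g set \<Rightarrow> 'g set" where
  "brk_span sc br A B = module.span sc {br x y | x y. x \<in> A \<and> y \<in> B}"

fun derived_series :: "(complex \<Rightarrow> 'g::ab_group_add \<Rightarrow> 'g) \<Rightarrow> ('g \<Rightarrow> 'g \<Rightarrow> 'g) \<Rightarrow> 'g set \<Rightarrow> nat \<Rightarrow> 'g set" where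
  "derived_series sc br I 0 = I"
| "derived_series sc br I (Suc n) =
     brk_span sc br (derived_series sc br I n) (derived_series sc br I n)"

definition solvable_lie :: "(complex \<Rightarrow> 'g::ab_group_add \<Rightarrow> 'g) \<Rightarrow> ('g \<Rightarrow> 'g \<Rightarrow> 'g) \<Rightarrow> 'g set \<Rightarrow> bool" where
  "solvable_lie sc br I \<longleftrightarrow> (\<exists>n. derived_series sc br I n = {0})"

definition semisimple_lie :: "(complex \<Rightarrow> 'g::ab_group_add \<Rightarrow> 'g) \<Rightarrow> ('g \<Rightarrow> 'g \<Rightarrow> 'g) \<Rightarrow> bool" where
  "semisimple_lie sc br \<longleftrightarrow> lie_algebra sc br \<and>
     (\<forall>I. lie_ideal sc br I \<and> solvable_lie sc br I \<longrightarrow> I = {0})"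

definition centralizer :: "('g \<Rightarrow> 'g \<Rightarrow> 'g::ab_group_add) \<Rightarrow> 'g set \<Rightarrow> 'g set" where
  "centralizer br S = {y. \<forall>x\<in>S. br x y = 0}"

text \<open>Rank of a reductive subalgebra S: minimal dimension of the centralizer in S of an
  element of S (= dimension of a Cartan subalgebra for reductive S).\<close>
definition lie_rank :: "(complex \<Rightarrow> 'g::ab_group_add \<Rightarrow> 'g) \<Rightarrow> ('g \<Rightarrow> 'g \<Rightarrow> 'g) \<Rightarrow> 'g set \<Rightarrow> nat" where
  "lie_rank sc br S = Min ((\<lambda>x. vector_space.dim sc (S \<inter> centralizer br {x})) ` S)"

definition ad_nilpotent_on :: "('g \<Rightarrow> 'g \<Rightarrow> 'g::ab_group_add) \<Rightarrow> 'g set \<Rightarrow> 'g \<Rightarrow> bool" where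
  "ad_nilpotent_on br S x \<longleftrightarrow> (\<exists>n. \<forall>y\<in>S. (br x ^^ n) y = 0)"

definition nilpotent_elt :: "('g \<Rightarrow> 'g \<Rightarrow> 'g::ab_group_add) \<Rightarrow> 'g \<Rightarrow> bool" where
  "nilpotent_elt br x \<longleftrightarrow> ad_nilpotent_on br UNIV x"

definition sl2_triple :: "(complex \<Rightarrow> 'g::ab_group_add \<Rightarrow> 'g) \<Rightarrow> ('g \<Rightarrow> 'g \<Rightarrow> 'g) \<Rightarrow> 'g \<Rightarrow> 'g \<Rightarrow> 'g \<Rightarrow> bool" where
  "sl2_triple sc br e h f \<longleftrightarrow> br h e = sc 2 e \<and> br h f = sc (-2) f \<and> br e f = h"

text \<open>exp(ad x) for ad-nilpotent x (the sum is finite: (ad x)^d = 0 with d = dim g).\<close>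
definition exp_ad :: "(complex \<Rightarrow> 'g::ab_group_add \<Rightarrow> 'g) \<Rightarrow> ('g \<Rightarrow> 'g \<Rightarrow> 'g) \<Rightarrow> 'g \<Rightarrow> 'g \<Rightarrow> 'g" where
  "exp_ad sc br x y = (\<Sum>k\<le>vector_space.dim sc (UNIV::'g set). sc (1 / fact k) ((br x ^^ k) y))"

text \<open>Adjoint group G of g: the group generated by the exp(ad x), x nilpotent
  (closed under inverses since exp(ad x)^-1 = exp(ad(-x))).\<close>
inductive_set adjoint_group :: "(complex \<Rightarrow> 'g::ab_group_add \<Rightarrow> 'g) \<Rightarrow> ('g \<Rightarrow> 'g \<Rightarrow> 'g) \<Rightarrow> ('g \<Rightarrow> 'g) set"
  for sc br where
  "id \<in> adjoint_group sc br"
| "\<lbrakk>\<phi> \<in> adjoint_group sc br; nilpotent_elt br x\<rbrakk> \<Longrightarrow> exp_ad sc br x \<circ> \<phi> \<in> adjoint_group sc br"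

definition principal_nilpotent_pair :: "(complex \<Rightarrow> 'g::ab_group_add \<Rightarrow> 'g) \<Rightarrow> ('g \<Rightarrow> 'g \<Rightarrow> 'g) \<Rightarrow> 'g \<Rightarrow> 'g \<Rightarrow> bool" where
  "principal_nilpotent_pair sc br e1 e2 \<longleftrightarrow>
     br e1 e2 = 0 \<and>
     vector_space.dim sc (centralizer br {e1, e2}) = lie_rank sc br UNIV \<and>
     (\<forall>t1 t2. t1 \<noteq> 0 \<and> t2 \<noteq> 0 \<longrightarrow>
        (\<exists>\<phi>\<in>adjoint_group sc br. \<phi> e1 = sc t1 e1 \<and> \<phi> e2 = sc t2 e2))"

definition rectangular_pnp :: "(complex \<Rightarrow> 'g::ab_group_add \<Rightarrow> 'g) \<Rightarrow> ('g \<Rightarrow> 'g \<Rightarrow> 'g) \<Rightarrow> 'g \<Rightarrow> 'g \<Rightarrow> bool" where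
  "rectangular_pnp sc br e1 e2 \<longleftrightarrow> principal_nilpotent_pair sc br e1 e2 \<and>
     (\<exists>h1 f1 h2 f2. sl2_triple sc br e1 h1 f1 \<and> sl2_triple sc br e2 h2 f2 \<and>
        (\<forall>a\<in>{e1, h1, f1}. \<forall>b\<in>{e2, h2, f2}. br a b = 0))"

definition grade_space :: "(complex \<Rightarrow> 'g::ab_group_add \<Rightarrow> 'g) \<Rightarrow> ('g \<Rightarrow> 'g \<Rightarrow> 'g) \<Rightarrow> 'g \<Rightarrow> int \<Rightarrow> 'g set" where
  "grade_space sc br h i = {x. br h x = sc (of_int i) x}"

text \<open>Regular nilpotent element of a reductive subalgebra k: a principal nilpotent element
  of [k,k], i.e. x in [k,k], ad-nilpotent on [k,k], with centralizer in [k,k] of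
  dimension rk [k,k].\<close>
definition regular_nilpotent_in :: "(complex \<Rightarrow> 'g::ab_group_add \<Rightarrow> 'g) \<Rightarrow> ('g \<Rightarrow> 'g \<Rightarrow> 'g) \<Rightarrow> 'g set \<Rightarrow> 'g \<Rightarrow> bool" where
  "regular_nilpotent_in sc br k x \<longleftrightarrow>
     (let d = brk_span sc br k k in
       x \<in> d \<and> ad_nilpotent_on br d x \<and>
       vector_space.dim sc (d \<inter> centralizer br {x}) = lie_rank sc br d)"

definition regular_in :: "(complex \<Rightarrow> 'g::ab_group_add \<Rightarrow> 'g) \<Rightarrow> ('g \<Rightarrow> 'g \<Rightarrow> 'g) \<Rightarrow> 'g set \<Rightarrow> 'g \<Rightarrow> bool" where
  "regular_in sc br S x \<longleftrightarrow> x \<in> S \<and> vector_space.dim sc (S \<inter> centralizer br {x}) = lie_rank sc br S"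

end

theory Submission
  imports Defs "HOL-Computational_Algebra.Fundamental_Theorem_Algebra"
begin

text \<open>
  Two commuting \<open>sl\<^sub>2\<close>-triples make \<open>g\<close> an \<open>sl\<^sub>2 \<times> sl\<^sub>2\<close>-module. If \<open>e' \<in> k\<close>, then the
  centraliser \<open>W\<close> of \<open>e'\<close> is stable under the triple of \<open>e\<close>, so \<open>dim z(e, e') = dim W\<^sub>0 + dim W\<^sub>1\<close>, where
  \<open>W\<^sub>0 = z(e') \<inter> g\<^sub>0\<close> has dimension at least \<open>rk g\<^sub>0 = rk g\<close>. Hence \<open>dim z(e, e') = rk g\<close> forces \<open>W\<^sub>1 = 0\<close>, so
  that \<open>e\<close> is even, and \<open>e'\<close> is regular in \<open>g\<^sub>0\<close>; the converse is the same computation together with the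
  existence of regular nilpotent elements of \<open>k\<close> and the theorem of Jacobson and Morozov in \<open>k\<close>. That one
  regular nilpotent element of \<open>k\<close> may be replaced by any other one follows from their conjugacy.

  All of this works in any centraliser on which the Killing form of \<open>g\<close> is nondegenerate. Borel-type
  subalgebras \<open>b\<close> with nilradical \<open>n = b\<^sup>\<bottom>\<close> are defined by the positive eigenvalues of a regular semisimple
  element; for two of them \<open>b\<^sub>1 = (b\<^sub>1 \<inter> b\<^sub>2) + n\<^sub>1\<close>, which gives both the equality of the dimensions of Cartan
  subalgebras and, by unipotent conjugation, their conjugacy. Neutral elements of regular triples in a common
  Cartan subalgebra are brought into the same chamber by minimising their distance under reflections.
\<close>

text \<open>The class of subalgebras is chosen so that reductivity never has to be discussed. If
  \<open>L\<close> is a centraliser, the Jordan parts of its elements stay in \<open>L\<close>; if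
  moreover the Killing form of g is nondegenerate on \<open>L\<close>, then Jacobson-Morozov, Cartan
  subalgebras and the rank are accessible by orthogonality. The class contains g, k and
  \<open>gr h 0\<close> and is closed under centralisers of semisimple elements, so one conjugacy
  theorem serves for all of them. Positivity enters in two ways: conjugating eigenvalues turns a
  trace into a sum of squared moduli, which replaces the rationality argument in Cartan's criterion,
  and a total order on the eigenvalues replaces a choice of positive roots. Cartan subalgebras are
  conjugated by finite products of exponentials and only through integral elements; this suffices
  because neutral elements of triples are integral. Replacing one regular nilpotent element by
  another never identifies the two: they are put into triples with a common neutral element, and the
  dimension of the centraliser in \<open>gr h 0\<close> depends on that element alone.\<close>

locale cspace = finite_dimensional_vector_space sc Basis
  for sc :: "complex \<Rightarrow> 'g::ab_group_add \<Rightarrow> 'g" (infixr "*s" 75) and Basis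
begin

section \<open>Linear operators and dimension counts\<close>

definition lin :: "('g \<Rightarrow> 'g) \<Rightarrow> bool" where
  "lin T \<longleftrightarrow> (\<forall>x y. T (x + y) = T x + T y) \<and> (\<forall>c x. T (c *s x) = c *s T x)"

lemma lin_add: "lin T \<Longrightarrow> T (x + y) = T x + T y"
  and lin_scale: "lin T \<Longrightarrow> T (c *s x) = c *s T x"
  by (auto simp: lin_def)

lemma lin_linear: "lin T \<longleftrightarrow> Vector_Spaces.linear sc sc T"
  using vector_space_axioms by (auto simp: lin_def Vector_Spaces.linear_iff)

lemma lin_0: "lin T \<Longrightarrow> T 0 = 0"
  using lin_scale[of T 0 0] by simp

lemma lin_neg: "lin T \<Longrightarrow> T (- x) = - T x"
  using lin_scale[of T "-1" x] by simp

lemma lin_diff: "lin T \<Longrightarrow> T (x - y) = T x - T y"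
  using lin_add[of T x "-y"] lin_neg[of T y] by simp

lemma lin_sum: "lin T \<Longrightarrow> T (sum f A) = (\<Sum>a\<in>A. T (f a))"
  by (induction A rule: infinite_finite_induct) (auto simp: lin_0 lin_add)

lemma lin_compose: "lin S \<Longrightarrow> lin T \<Longrightarrow> lin (\<lambda>x. S (T x))"
  by (simp add: lin_def)

lemma lin_plus: "lin S \<Longrightarrow> lin T \<Longrightarrow> lin (\<lambda>x. S x + T x)"
  by (simp add: lin_def algebra_simps scale_right_distrib)

lemma lin_minus: "lin S \<Longrightarrow> lin T \<Longrightarrow> lin (\<lambda>x. S x - T x)"
  by (simp add: lin_def algebra_simps scale_right_diff_distrib)

lemma lin_smult: "lin S \<Longrightarrow> lin (\<lambda>x. c *s S x)"
  by (simp add: lin_def scale_right_distrib mult.commute)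

lemma lin_ident: "lin (\<lambda>x. x)"
  by (simp add: lin_def)

lemma lin_zero: "lin (\<lambda>x. 0)"
  by (simp add: lin_def)

lemma lin_sums: "(\<And>i. i \<in> A \<Longrightarrow> lin (S i)) \<Longrightarrow> lin (\<lambda>x. \<Sum>i\<in>A. S i x)"
  by (induction A rule: infinite_finite_induct) (auto simp: lin_zero intro: lin_plus)

lemma lin_funpow: "lin T \<Longrightarrow> lin (T ^^ n)"
  by (induction n) (auto simp: lin_def)

lemma lin_shift: "lin T \<Longrightarrow> lin (\<lambda>u. T u - c *s u)"
  by (intro lin_minus lin_smult lin_ident)

lemma lin_subspace_kernel: "lin T \<Longrightarrow> subspace {x. T x = 0}"
  by (rule subspaceI) (auto simp: lin_0 lin_add lin_scale)

lemma lin_subspace_vimage: "lin T \<Longrightarrow> subspace W \<Longrightarrow> subspace {x. T x \<in> W}"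
  by (rule subspaceI) (auto simp: lin_0 lin_add lin_scale subspace_0 subspace_add subspace_scale)

lemma lin_subspace_image: "lin T \<Longrightarrow> subspace W \<Longrightarrow> subspace (T ` W)"
  unfolding lin_linear
  by (rule module_hom.subspace_image) (auto simp: linear_iff_module_hom)

lemma lin_span_eqI:
  assumes "lin S" "lin T" "\<And>x. x \<in> C \<Longrightarrow> S x = T x" "x \<in> span C"
  shows "S x = T x"
  using assms(4)
proof (induction rule: span_induct_alt)
  case base
  then show ?case using assms by (simp add: lin_0)
next
  case (step c x y)
  then show ?case using assms by (simp add: lin_add lin_scale)
qed

lemma ex_lin_left_inverse:
  assumes "lin T" "subspace W" "\<And>x. x \<in> W \<Longrightarrow> T x = 0 \<Longrightarrow> x = 0"
  obtains S where "lin S" "\<And>x. x \<in> W \<Longrightarrow> S (T x) = x" "\<And>x. S x \<in> W"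
proof -
  interpret vector_space_pair sc sc by unfold_locales
  have "inj_on T W"
    by (rule inj_onI) (metis assms lin_diff right_minus_eq subspace_diff)
  from linear_exists_left_inverse_on[OF assms(1)[unfolded lin_linear] assms(2) this]
  obtain S where "S ` UNIV \<subseteq> W" "Vector_Spaces.linear sc sc S" "\<forall>v\<in>W. S (T v) = v"
    by auto
  then show ?thesis by (intro that[of S]) (auto simp: lin_linear)
qed

lemma ex_projection:
  assumes "subspace W"
  obtains P where "lin P" "\<And>x. x \<in> W \<Longrightarrow> P x = x" "\<And>x. P x \<in> W"
  using ex_lin_left_inverse[OF lin_ident assms] by metis

text \<open>The zero set inside \<open>W\<close> of a projection onto the kernel is a complement of
  that kernel; \<open>T\<close> is injective there and has the same image as on
  \<open>W\<close>.\<close>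

lemma rank_nullity:
  assumes T: "lin T" and W: "subspace W"
  shows "dim W = dim {x \<in> W. T x = 0} + dim (T ` W)"
proof -
  let ?K = "{x \<in> W. T x = 0}"
  have sK: "subspace ?K"
    using subspace_inter[OF W lin_subspace_kernel[OF T]] by (simp add: Int_def)
  obtain P where P: "lin P" "\<And>x. x \<in> ?K \<Longrightarrow> P x = x" "\<And>x. P x \<in> ?K"
    using ex_projection[OF sK] by blast
  obtain K where K: "K \<subseteq> ?K" "independent K" "span K = ?K" "card K = dim ?K"
    using basis_exists[of ?K] by (metis (no_types, lifting) sK span_eq_iff span_subspace)
  let ?U = "{x \<in> W. P x = 0}"
  have sU: "subspace ?U"
    using subspace_inter[OF W lin_subspace_kernel[OF P(1)]] by (simp add: Int_def)
  obtain U where U: "U \<subseteq> ?U" "independent U" "span U = ?U" "card U = dim ?U"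
    using basis_exists[of ?U] by (metis (no_types, lifting) sU span_eq_iff span_subspace)
  have finK: "finite K" "finite U" using K U finiteI_independent by auto
  have disj: "K \<inter> U = {}"
  proof -
    have "x = 0" if "x \<in> K" "x \<in> U" for x
    proof -
      have "x \<in> ?K" "P x = 0" using that K(1) U(1) by auto
      then show ?thesis using P(2)[of x] by simp
    qed
    then show ?thesis using K(2) dependent_zero by fastforce
  qed
  have ind: "independent (K \<union> U)"
    unfolding independent_explicit_module
  proof (intro allI impI)
    fix t c v assume t: "finite t" "t \<subseteq> K \<union> U" and s: "(\<Sum>v\<in>t. c v *s v) = 0" and v: "v \<in> t"
    have split: "(\<Sum>v\<in>t. c v *s v) = (\<Sum>v\<in>t \<inter> K. c v *s v) + (\<Sum>v\<in>t \<inter> U. c v *s v)"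
      using t disj by (subst sum.union_disjoint[symmetric]) (auto intro!: sum.cong)
    have a: "(\<Sum>v\<in>t \<inter> K. c v *s v) \<in> ?K" unfolding K(3)[symmetric]
      by (rule span_sum) (auto intro: span_scale span_base)
    have b: "(\<Sum>v\<in>t \<inter> U. c v *s v) \<in> ?U" unfolding U(3)[symmetric]
      by (rule span_sum) (auto intro: span_scale span_base)
    have "P (\<Sum>v\<in>t. c v *s v) = (\<Sum>v\<in>t \<inter> K. c v *s v)"
      unfolding split lin_add[OF P(1)] using P(2)[OF a] b by simp
    then have a0: "(\<Sum>v\<in>t \<inter> K. c v *s v) = 0" using s P(1) by (simp add: lin_0)
    then have b0: "(\<Sum>v\<in>t \<inter> U. c v *s v) = 0" using s split by simp
    show "c v = 0"
    proof (cases "v \<in> K")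
      case True
      with a0 show ?thesis using independentD[OF K(2), of "t \<inter> K" c v] t v by auto
    next
      case False
      with b0 show ?thesis using independentD[OF U(2), of "t \<inter> U" c v] t v by auto
    qed
  qed
  have spn: "W \<subseteq> span (K \<union> U)"
  proof
    fix x assume x: "x \<in> W"
    have "P x \<in> ?K" by (rule P)
    moreover have "x - P x \<in> ?U"
      using x P W by (auto simp: lin_diff subspace_diff)
    ultimately have "P x \<in> span K" "x - P x \<in> span U" using K U by auto
    then have "P x \<in> span (K \<union> U)" "x - P x \<in> span (K \<union> U)"
      by (auto intro: span_mono[THEN subsetD])
    then have "P x + (x - P x) \<in> span (K \<union> U)" by (rule span_add)
    then show "x \<in> span (K \<union> U)" by simp
  qed
  have "K \<union> U \<subseteq> W" using K(1) U(1) by auto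
  from dim_unique[OF this spn ind refl] have "dim W = card (K \<union> U)" .
  then have d: "dim W = dim ?K + dim ?U"
    using disj finK K U by (simp add: card_Un_disjoint)
  have im: "T ` W = T ` ?U"
  proof -
    have "T x \<in> T ` ?U" if x: "x \<in> W" for x
    proof -
      have "x - P x \<in> ?U" using x P W by (auto simp: lin_diff subspace_diff)
      moreover have "T (x - P x) = T x" using P(3)[of x] T by (simp add: lin_diff)
      ultimately show ?thesis by (metis (no_types, lifting) imageI)
    qed
    then show ?thesis by auto
  qed
  interpret finite_dimensional_vector_space_pair_1 sc Basis sc by unfold_locales
  have "inj_on T (span ?U)"
  proof -
    have "x = 0" if "x \<in> ?U" "T x = 0" for x
      using that P(2)[of x] by auto
    then have "x = y" if "x \<in> ?U" "y \<in> ?U" "T x = T y" for x y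
      using that sU T by (metis (no_types, lifting) lin_diff right_minus_eq subspace_diff)
    then show ?thesis using sU by (simp add: span_eq_iff[THEN iffD2] inj_on_def)
  qed
  from dim_image_eq[OF T[unfolded lin_linear] this] show ?thesis using d im by simp
qed

lemma dim_lin_inj:
  assumes "lin T" "subspace W" "\<And>x. x \<in> W \<Longrightarrow> T x = 0 \<Longrightarrow> x = 0"
  shows "dim (T ` W) = dim W"
proof -
  have "{x \<in> W. T x = 0} = {0}" using assms by (auto simp: lin_0 subspace_0)
  then show ?thesis using rank_nullity[OF assms(1,2)] by simp
qed

text \<open>With \<open>P\<close> a projection onto \<open>A\<close>, the operator
  \<open>Q = 1 - P\<close> kills exactly \<open>A\<close>, and \<open>A + B\<close> and
  \<open>B\<close> have the same image under it; rank-nullity on both gives the formula.\<close>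

lemma dim_sum_Int:
  assumes A: "subspace A" and B: "subspace B"
  shows "dim {x + y |x y. x \<in> A \<and> y \<in> B} + dim (A \<inter> B) = dim A + dim B"
proof -
  let ?S = "{x + y |x y. x \<in> A \<and> y \<in> B}"
  obtain P where P: "lin P" "\<And>x. x \<in> A \<Longrightarrow> P x = x" "\<And>x. P x \<in> A"
    using ex_projection[OF A] by blast
  define Q where "Q = (\<lambda>x. x - P x)"
  have Q: "lin Q" unfolding Q_def by (intro lin_minus lin_ident P)
  have Q0: "Q x = 0 \<longleftrightarrow> x \<in> A" for x using P by (metis Q_def right_minus_eq)
  have 1: "dim B = dim (A \<inter> B) + dim (Q ` B)"
    using rank_nullity[OF Q B] Q0 by (simp add: Int_def conj_commute)
  have sS: "subspace ?S" using A B by (rule subspace_sums)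
  have "A \<subseteq> ?S" using subspace_0[OF B] by (metis (mono_tags, lifting) add.right_neutral mem_Collect_eq subsetI)
  then have "{x \<in> ?S. Q x = 0} = A" using Q0 by auto
  moreover have "Q ` ?S = Q ` B"
  proof -
    have "Q (x + y) = Q y" if "x \<in> A" for x y using Q Q0[of x] that by (simp add: lin_add)
    moreover have "Q y \<in> Q ` ?S" if "y \<in> B" for y
    proof -
      have "0 + y \<in> ?S" using that subspace_0[OF A] by blast
      then show ?thesis by simp
    qed
    ultimately show ?thesis by auto
  qed
  ultimately have "dim ?S = dim A + dim (Q ` B)"
    using rank_nullity[OF Q sS] by simp
  with 1 show ?thesis by simp
qed

subsection \<open>Generalised eigenspaces\<close>

definition gev :: "('g \<Rightarrow> 'g) \<Rightarrow> complex \<Rightarrow> 'g set" where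
  "gev T a = {v. \<exists>n. ((\<lambda>u. T u - a *s u) ^^ n) v = 0}"

lemma funpow_0_mono:
  assumes "lin T" "(T ^^ n) v = 0" "n \<le> m"
  shows "(T ^^ m) v = 0"
proof -
  have "(T ^^ m) v = (T ^^ (m - n)) ((T ^^ n) v)"
    using assms(3) by (metis comp_apply funpow_add le_add_diff_inverse2)
  then show ?thesis using assms lin_funpow lin_0 by simp
qed

lemma subspace_gev:
  assumes T: "lin T" shows "subspace (gev T a)"
proof (rule subspaceI)
  let ?S = "\<lambda>u. T u - a *s u"
  have S: "lin ?S" using T by (rule lin_shift)
  show "0 \<in> gev T a" by (auto simp: gev_def intro: exI[of _ 0])
  show "x + y \<in> gev T a" if xy: "x \<in> gev T a" "y \<in> gev T a" for x y
  proof -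
    obtain n m where nm: "(?S ^^ n) x = 0" "(?S ^^ m) y = 0" using xy by (auto simp: gev_def)
    have "(?S ^^ (n + m)) x = 0" using S nm(1) by (rule funpow_0_mono) simp
    moreover have "(?S ^^ (n + m)) y = 0" using S nm(2) by (rule funpow_0_mono) simp
    ultimately have "(?S ^^ (n + m)) (x + y) = 0" using lin_funpow[OF S] by (simp add: lin_add)
    then show ?thesis by (auto simp: gev_def)
  qed
  show "c *s x \<in> gev T a" if "x \<in> gev T a" for c x
    using that lin_funpow[OF S] by (auto simp: gev_def lin_scale)
qed

lemma eigenvector_gev: "T v = a *s v \<Longrightarrow> v \<in> gev T a"
  by (auto simp: gev_def intro!: exI[of _ 1])

text \<open>On \<open>gev T a\<close> the operator T - b is a - b plus a nilpotent, hence
  invertible; the induction on the nilpotency order inverts it inside \<open>W\<close>.\<close>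

lemma gev_surj:
  assumes T: "lin T" and W: "subspace W" "\<And>x. x \<in> W \<Longrightarrow> T x \<in> W"
    and ab: "a \<noteq> b" and v: "v \<in> gev T a" "v \<in> W"
  obtains u where "u \<in> gev T a" "u \<in> W" "T u - b *s u = v"
proof -
  let ?S = "\<lambda>u. T u - a *s u"
  have S: "lin ?S" using T by (rule lin_shift)
  have "\<exists>u. u \<in> gev T a \<and> u \<in> W \<and> T u - b *s u = v" if "(?S ^^ n) v = 0" "v \<in> W" for n v
    using that
  proof (induction n arbitrary: v)
    case 0
    then show ?case using subspace_0[OF W(1)] subspace_0[OF subspace_gev[OF T]] T
      by (auto intro!: exI[of _ 0] simp: lin_0)
  next
    case (Suc n)
    have "(?S ^^ n) (?S v) = 0" using Suc.prems(1) by (metis comp_apply funpow_Suc_right)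
    moreover have "?S v \<in> W" using Suc.prems W by (simp add: subspace_diff subspace_scale)
    ultimately obtain u where u: "u \<in> gev T a" "u \<in> W" "T u - b *s u = ?S v" using Suc.IH by blast
    have vg: "v \<in> gev T a" using Suc.prems(1) unfolding gev_def by blast
    let ?u = "(1 / (a - b)) *s (v - u)"
    have "T ?u - b *s ?u = (1 / (a - b)) *s ((T v - b *s v) - (T u - b *s u))"
      using T by (simp add: lin_diff lin_scale scale_right_diff_distrib mult.commute)
    also have "\<dots> = (1 / (a - b)) *s ((a - b) *s v)"
      unfolding u(3) by (simp add: scale_left_diff_distrib)
    also have "\<dots> = v" using ab by simp
    finally have "T ?u - b *s ?u = v" .
    moreover have "?u \<in> gev T a" "?u \<in> W"
      using u Suc.prems vg W subspace_gev[OF T] by (auto intro!: subspace_scale subspace_diff)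
    ultimately show ?case by blast
  qed
  then show thesis using v that unfolding gev_def by blast
qed

lemma gev_shift_back:
  assumes "T v - b *s v \<in> gev T b"
  shows "v \<in> gev T b"
proof -
  obtain n where "((\<lambda>u. T u - b *s u) ^^ n) (T v - b *s v) = 0" using assms by (auto simp: gev_def)
  then have "((\<lambda>u. T u - b *s u) ^^ Suc n) v = 0" by (simp add: funpow_Suc_right del: funpow.simps)
  then show ?thesis unfolding gev_def by blast
qed

text \<open>Summands with eigenvalue other than \<open>b\<close> lie in the image of T - b by
  \<open>gev_surj\<close>. Subtracting a preimage from \<open>v\<close> leaves a vector that T - b
  maps into \<open>gev T b\<close>, and such a vector is itself in \<open>gev T b\<close>.\<close>

lemma gev_decomp_step:
  assumes T: "lin T" and W: "subspace W" "\<And>x. x \<in> W \<Longrightarrow> T x \<in> W" and v: "v \<in> W"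
    and d: "T v - b *s v \<in> span (\<Union>a. gev T a \<inter> W)"
  shows "v \<in> span (\<Union>a. gev T a \<inter> W)"
proof -
  have key: "\<exists>u z. u \<in> span (\<Union>a. gev T a \<inter> W) \<and> u \<in> W \<and> z \<in> gev T b \<inter> W \<and> T u - b *s u + z = y"
    if "y \<in> span (\<Union>a. gev T a \<inter> W)" for y
    using that
  proof (induction rule: span_induct_alt)
    case base
    show ?case using subspace_0[OF W(1)] subspace_0[OF subspace_gev[OF T]] T
      by (auto intro!: exI[of _ 0] simp: lin_0 span_zero)
  next
    case (step c x y)
    then obtain u z where uz: "u \<in> span (\<Union>a. gev T a \<inter> W)" "u \<in> W" "z \<in> gev T b \<inter> W" "T u - b *s u + z = y"
      by blast
    obtain a where x: "x \<in> gev T a" "x \<in> W" using step(1) by blast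
    show ?case
    proof (cases "a = b")
      case True
      have "T u - b *s u + (c *s x + z) = c *s x + y" using uz(4) by (auto simp: algebra_simps)
      moreover have "c *s x + z \<in> gev T b \<inter> W"
        using True x uz W subspace_gev[OF T] by (auto intro!: subspace_add subspace_scale)
      ultimately show ?thesis using uz by blast
    next
      case False
      obtain w where w: "w \<in> gev T a" "w \<in> W" "T w - b *s w = x"
        using gev_surj[OF T W False x] by blast
      have "T (c *s w + u) - b *s (c *s w + u) + z = c *s (T w - b *s w) + (T u - b *s u + z)"
        using T by (simp add: lin_add lin_scale algebra_simps scale_right_diff_distrib scale_right_distrib mult.commute)
      then have "T (c *s w + u) - b *s (c *s w + u) + z = c *s x + y"
        using w uz by simp
      moreover have "c *s w + u \<in> span (\<Union>a. gev T a \<inter> W)"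
        using w uz by (intro span_add span_scale) (auto intro: span_base)
      moreover have "c *s w + u \<in> W" using w uz W by (intro subspace_add subspace_scale)
      ultimately show ?thesis using uz by blast
    qed
  qed
  obtain u z where uz: "u \<in> span (\<Union>a. gev T a \<inter> W)" "u \<in> W" "z \<in> gev T b \<inter> W" "T u - b *s u + z = T v - b *s v"
    using key[OF d] by blast
  have "T (v - u) - b *s (v - u) = z"
    using uz(4) T by (auto simp: lin_diff scale_right_diff_distrib algebra_simps)
  then have "v - u \<in> gev T b" using gev_shift_back uz(3) by (metis IntD1)
  then have "v - u \<in> gev T b \<inter> W" using uz v W by (auto intro: subspace_diff)
  then have "v - u \<in> span (\<Union>a. gev T a \<inter> W)" by (blast intro: span_base)
  from span_add[OF this uz(1)] show ?thesis by simp
qed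

definition papp :: "('g \<Rightarrow> 'g) \<Rightarrow> complex poly \<Rightarrow> 'g \<Rightarrow> 'g" where
  "papp T p v = (\<Sum>i\<le>degree p. coeff p i *s (T ^^ i) v)"

lemma papp_ge: "degree p \<le> n \<Longrightarrow> papp T p v = (\<Sum>i\<le>n. coeff p i *s (T ^^ i) v)"
  unfolding papp_def
  by (rule sum.mono_neutral_left) (auto simp: coeff_eq_0)

lemma papp_linear_factor:
  assumes T: "lin T"
  shows "papp T ([:- a, 1:] * q) v = papp T q (T v - a *s v)"
proof -
  let ?n = "degree q"
  have "degree ([:- a, 1:] * q) \<le> Suc ?n"
    by (rule order.trans[OF degree_mult_le]) simp
  then have "papp T ([:- a, 1:] * q) v = (\<Sum>i\<le>Suc ?n. coeff (smult (- a) q + pCons 0 q) i *s (T ^^ i) v)"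
    by (subst papp_ge[where n = "Suc ?n"]) (simp_all)
  also have "\<dots> = (\<Sum>i\<le>Suc ?n. coeff (pCons 0 q) i *s (T ^^ i) v) - (\<Sum>i\<le>Suc ?n. (a * coeff q i) *s (T ^^ i) v)"
    by (simp add: sum_subtractf[symmetric] scale_left_distrib scale_left_diff_distrib del: sum.atMost_Suc)
  also have "(\<Sum>i\<le>Suc ?n. coeff (pCons 0 q) i *s (T ^^ i) v) = (\<Sum>i\<le>?n. coeff q i *s (T ^^ i) (T v))"
    by (subst sum.atMost_Suc_shift) (simp add: funpow_swap1)
  also have "(\<Sum>i\<le>Suc ?n. (a * coeff q i) *s (T ^^ i) v) = (\<Sum>i\<le>?n. coeff q i *s (T ^^ i) (a *s v))"
    using lin_funpow[OF T] by (simp add: coeff_eq_0 lin_scale mult.commute)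
  also have "(\<Sum>i\<le>?n. coeff q i *s (T ^^ i) (T v)) - (\<Sum>i\<le>?n. coeff q i *s (T ^^ i) (a *s v)) = papp T q (T v - a *s v)"
    unfolding papp_def using lin_funpow[OF T]
    by (simp add: sum_subtractf[symmetric] lin_diff scale_right_diff_distrib)
  finally show ?thesis .
qed

lemma ex_annihilating_poly: "\<exists>p. p \<noteq> 0 \<and> papp T p v = 0"
proof -
  let ?f = "\<lambda>i. (T ^^ i) v"
  let ?N = "card Basis"
  show ?thesis
  proof (cases "inj_on ?f {..?N}")
    case True
    have "card (?f ` {..?N}) = Suc ?N" using card_image[OF True] by simp
    then have "dependent (?f ` {..?N})"
      by (intro dependent_biggerset_general) (use dim_subset_UNIV[of "?f ` {..?N}"] in \<open>auto simp: dimension_def\<close>)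
    then obtain u where u: "\<exists>w\<in>?f ` {..?N}. u w \<noteq> 0" "(\<Sum>w\<in>?f ` {..?N}. u w *s w) = 0"
      by (auto simp: dependent_finite)
    define p where "p = (\<Sum>i\<le>?N. monom (u (?f i)) i)"
    have cp: "coeff p i = (if i \<le> ?N then u (?f i) else 0)" for i
      by (auto simp: p_def coeff_sum if_distrib cong: if_cong)
    have "degree p \<le> ?N" by (rule degree_le) (auto simp: cp)
    then have "papp T p v = (\<Sum>i\<le>?N. u (?f i) *s ?f i)" by (simp add: papp_ge cp)
    also have "\<dots> = 0" using u(2) by (simp add: sum.reindex[OF True] o_def)
    finally have "papp T p v = 0" .
    moreover have "p \<noteq> 0"
    proof -
      obtain i where "i \<le> ?N" "u (?f i) \<noteq> 0" using u(1) by auto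
      then have "coeff p i \<noteq> 0" by (simp add: cp)
      then show ?thesis by auto
    qed
    ultimately show ?thesis by blast
  next
    case False
    \<comment> \<open>Equal iterates collapse in the set of iterates, so no dependence can be read
      off from it; the relation between the two powers is itself the polynomial.\<close>
    then obtain i j where ij: "i < j" "?f i = ?f j" unfolding inj_on_def by (metis linorder_neq_iff)
    define p :: "complex poly" where "p = monom 1 j - monom 1 i"
    have cp: "coeff p n = (if n = j then 1 else 0) - (if n = i then 1 else 0)" for n by (auto simp: p_def)
    have "degree p \<le> j" by (rule degree_le) (use ij in \<open>auto simp: cp\<close>)
    then have "papp T p v = (\<Sum>n\<le>j. coeff p n *s ?f n)" by (rule papp_ge)
    also have "\<dots> = (\<Sum>n\<le>j. (if n = j then ?f j else 0)) - (\<Sum>n\<le>j. (if n = i then ?f i else 0))"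
      unfolding sum_subtractf[symmetric] by (rule sum.cong) (auto simp: cp)
    also have "\<dots> = 0" using ij by simp
    finally have "papp T p v = 0" .
    moreover have "coeff p j \<noteq> 0" using ij by (simp add: cp)
    ultimately show ?thesis by (metis coeff_0)
  qed
qed

text \<open>A root \<open>a\<close> of an annihilating polynomial, supplied by the fundamental
  theorem of algebra, lowers the degree for \<open>(T - a) v\<close>; \<open>gev_decomp_step\<close>
  leads back to \<open>v\<close>.\<close>

lemma gev_span:
  assumes T: "lin T" and W: "subspace W" "\<And>x. x \<in> W \<Longrightarrow> T x \<in> W" and v: "v \<in> W"
  shows "v \<in> span (\<Union>a. gev T a \<inter> W)"
proof -
  have "v \<in> span (\<Union>a. gev T a \<inter> W)" if "p \<noteq> 0" "papp T p v = 0" "v \<in> W" for p v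
    using that
  proof (induction "degree p" arbitrary: p v)
    case 0
    then obtain c where "p = [:c:]" "c \<noteq> 0" by (metis degree_eq_zeroE pCons_0_0)
    with 0 have "v = 0" by (simp add: papp_def)
    then show ?case by (simp add: span_zero)
  next
    case (Suc n)
    then have "\<not> constant (poly p)" by (simp add: constant_degree)
    then obtain a where "poly p a = 0" using fundamental_theorem_of_algebra by blast
    then obtain q where q: "p = [:- a, 1:] * q" unfolding poly_eq_0_iff_dvd by blast
    have q0: "q \<noteq> 0" using q Suc.prems by auto
    then have "degree p = Suc (degree q)" unfolding q by (subst degree_mult_eq) auto
    then have dq: "n = degree q" using Suc by simp
    have "papp T q (T v - a *s v) = 0" using Suc.prems q papp_linear_factor[OF T] by simp
    moreover have "T v - a *s v \<in> W" using Suc.prems W by (intro subspace_diff subspace_scale) auto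
    ultimately have "T v - a *s v \<in> span (\<Union>a. gev T a \<inter> W)" using Suc.hyps(1)[OF dq q0] by blast
    then show ?case using gev_decomp_step[OF T W Suc.prems(3)] by blast
  qed
  then show ?thesis using ex_annihilating_poly v by blast
qed

lemma gev_invariant:
  assumes S: "lin S" and ST: "\<And>x. S (T x) = T (S x)" and v: "v \<in> gev T a"
  shows "S v \<in> gev T a"
proof -
  have c: "((\<lambda>u. T u - a *s u) ^^ n) (S v) = S (((\<lambda>u. T u - a *s u) ^^ n) v)" for n
    by (induction n) (use S ST in \<open>auto simp: lin_diff lin_scale\<close>)
  obtain n where "((\<lambda>u. T u - a *s u) ^^ n) v = 0" using v by (auto simp: gev_def)
  then have "((\<lambda>u. T u - a *s u) ^^ n) (S v) = 0" using c S by (simp add: lin_0)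
  then show ?thesis by (auto simp: gev_def)
qed

lemma gev_disjoint:
  assumes T: "lin T" and "v \<in> gev T a" "v \<in> gev T b" "a \<noteq> b"
  shows "v = 0"
proof -
  let ?S = "\<lambda>u. T u - a *s u"
  obtain n where n: "(?S ^^ n) v = 0" using assms by (auto simp: gev_def)
  have "v = 0" if "(?S ^^ n) v = 0" "v \<in> gev T b" for n v
    using that
  proof (induction n arbitrary: v)
    case (Suc n)
    have "(?S ^^ n) (?S v) = 0" using Suc.prems(1) by (metis comp_apply funpow_Suc_right)
    moreover have "?S v \<in> gev T b"
      using gev_invariant[OF T _ Suc.prems(2)] Suc.prems(2) subspace_gev[OF T]
      by (simp add: subspace_diff subspace_scale)
    ultimately have "?S v = 0" by (rule Suc.IH)
    then have Tv: "T v = a *s v" by simp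
    obtain m where m: "((\<lambda>u. T u - b *s u) ^^ m) v = 0" using Suc.prems by (auto simp: gev_def)
    have "((\<lambda>u. T u - b *s u) ^^ m) v = (a - b) ^ m *s v"
    proof (induction m)
      case (Suc m)
      then show ?case using T Tv
        by (simp add: lin_scale scale_left_diff_distrib algebra_simps)
    qed simp
    with m assms(4) show ?case by simp
  qed simp
  with n assms show ?thesis by blast
qed

text \<open>A power of T - b kills the summand at \<open>b\<close>; by induction it kills every
  other summand, which then lies in two generalised eigenspaces.\<close>

lemma gev_sum_zero:
  assumes T: "lin T" and F: "finite F" and w: "\<And>a. a \<in> F \<Longrightarrow> w a \<in> gev T a" and s: "(\<Sum>a\<in>F. w a) = 0"
    and a: "a \<in> F"
  shows "w a = 0"
  using F w s a
proof (induction F arbitrary: w a rule: finite_induct)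
  case (insert b F)
  let ?S = "\<lambda>u. T u - b *s u"
  have S: "lin ?S" using T by (rule lin_shift)
  obtain n where n: "(?S ^^ n) (w b) = 0" using insert.prems(1)[of b] by (auto simp: gev_def)
  have inv: "(?S ^^ m) u \<in> gev T c" if "u \<in> gev T c" for m c u
    using that
  proof (induction m arbitrary: u)
    case (Suc m)
    then show ?case using gev_invariant[OF T] subspace_gev[OF T]
      by (simp add: subspace_diff subspace_scale)
  qed simp
  have "(\<Sum>a\<in>F. (?S ^^ n) (w a)) = (?S ^^ n) (\<Sum>a\<in>insert b F. w a)"
    using insert.hyps n lin_funpow[OF S] by (simp add: lin_add lin_sum)
  also have "\<dots> = 0" using insert.prems(2) lin_funpow[OF S] by (simp add: lin_0)
  finally have z: "(\<Sum>a\<in>F. (?S ^^ n) (w a)) = 0" .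
  have c0: "w c = 0" if c: "c \<in> F" for c
  proof -
    have "(?S ^^ n) (w c) = 0"
      by (rule insert.IH[OF _ z c]) (use insert.prems(1) inv in auto)
    then have "w c \<in> gev T b" by (auto simp: gev_def)
    moreover have "w c \<in> gev T c" using insert.prems(1) c by auto
    ultimately show ?thesis using gev_disjoint[OF T] c insert.hyps by metis
  qed
  then have "w b = 0" using insert.prems(2) insert.hyps by simp
  with c0 insert.prems(3) show ?case by auto
qed simp

definition spec :: "('g \<Rightarrow> 'g) \<Rightarrow> complex set" where
  "spec T = {a. gev T a \<noteq> {0}}"

lemma finite_spec:
  assumes T: "lin T" shows "finite (spec T)"
proof (rule ccontr)
  assume inf: "infinite (spec T)"
  have "\<forall>a\<in>spec T. \<exists>v. v \<in> gev T a \<and> v \<noteq> 0"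
    using subspace_0[OF subspace_gev[OF T]] by (auto simp: spec_def)
  then obtain w where w: "\<And>a. a \<in> spec T \<Longrightarrow> w a \<in> gev T a \<and> w a \<noteq> 0" by metis
  have inj: "inj_on w (spec T)"
    by (rule inj_onI) (metis w gev_disjoint[OF T])
  have "independent (w ` spec T)"
    unfolding independent_explicit_module
  proof (intro allI impI)
    fix t c v assume t: "finite t" "t \<subseteq> w ` spec T" and s: "(\<Sum>v\<in>t. c v *s v) = 0" and v: "v \<in> t"
    obtain F where F: "F \<subseteq> spec T" "t = w ` F" using t(2) by (metis subset_imageE)
    have injF: "inj_on w F" using inj F inj_on_subset by blast
    have finF: "finite F" using t F injF finite_imageD by blast
    obtain a where a: "a \<in> F" "v = w a" using v F by auto
    have "(\<Sum>a\<in>F. c (w a) *s w a) = 0" using s F injF by (simp add: sum.reindex)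
    from gev_sum_zero[OF T finF _ this a(1)] have "c (w a) *s w a = 0"
      using w F subspace_gev[OF T] by (meson subset_eq subspace_scale)
    then show "c v = 0" using w a F by auto
  qed
  then have "finite (w ` spec T)" by (rule finiteI_independent)
  with inf inj show False using finite_imageD by blast
qed

lemma gev_decomp:
  assumes T: "lin T" and W: "subspace W" "\<And>x. x \<in> W \<Longrightarrow> T x \<in> W" and v: "v \<in> W"
  shows "\<exists>w. (\<forall>a. w a \<in> gev T a \<inter> W) \<and> v = (\<Sum>a\<in>spec T. w a)"
proof -
  have "v \<in> span (\<Union>a. gev T a \<inter> W)" using gev_span[OF T W(1) _ v] W(2) by blast
  then show ?thesis
  proof (induction rule: span_induct_alt)
    case base
    then show ?case using subspace_0[OF W(1)] subspace_0[OF subspace_gev[OF T]]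
      by (intro exI[of _ "\<lambda>_. 0"]) auto
  next
    case (step c x y)
    then obtain w where w: "\<And>a. w a \<in> gev T a \<inter> W" "y = (\<Sum>a\<in>spec T. w a)" by blast
    obtain b where b: "x \<in> gev T b" "x \<in> W" using step by blast
    have "c *s x = (\<Sum>a\<in>spec T. if a = b then c *s x else 0)"
      using b finite_spec[OF T] by (auto simp: spec_def)
    then have "c *s x + y = (\<Sum>a\<in>spec T. (if a = b then c *s x else 0) + w a)"
      using w(2) by (simp add: sum.distrib)
    moreover have "(if a = b then c *s x else 0) + w a \<in> gev T a \<inter> W" for a
      using w(1)[of a] b W subspace_gev[OF T, of a]
      by (auto intro: subspace_add subspace_scale)
    ultimately show ?case by (intro exI[of _ "\<lambda>a. (if a = b then c *s x else 0) + w a"]) blast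
  qed
qed

text \<open>The component of \<open>v\<close> in \<open>gev T a\<close>. The choice is harmless
  because the decomposition is unique by \<open>gev_sum_zero\<close>; \<open>comp_eqI\<close> is the
  form in which this is used.\<close>

definition gcomp :: "('g \<Rightarrow> 'g) \<Rightarrow> complex \<Rightarrow> 'g \<Rightarrow> 'g" where
  "gcomp T a v = (SOME w. (\<forall>a. w a \<in> gev T a) \<and> v = (\<Sum>a\<in>spec T. w a)) a"

lemma comp_aux:
  assumes T: "lin T"
  shows "(\<forall>a. gcomp T a v \<in> gev T a) \<and> v = (\<Sum>a\<in>spec T. gcomp T a v)"
proof -
  have "\<exists>w. (\<forall>a. w a \<in> gev T a) \<and> v = (\<Sum>a\<in>spec T. w a)"
    using gev_decomp[OF T subspace_UNIV] by auto
  from someI_ex[OF this] show ?thesis unfolding gcomp_def by simp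
qed

lemma comp_gev: "lin T \<Longrightarrow> gcomp T a v \<in> gev T a"
  and sum_comp: "lin T \<Longrightarrow> (\<Sum>a\<in>spec T. gcomp T a v) = v"
  using comp_aux[of T v] by auto

lemma comp_not_spec: "lin T \<Longrightarrow> a \<notin> spec T \<Longrightarrow> gcomp T a v = 0"
  using comp_gev[of T a v] by (auto simp: spec_def)

lemma comp_eqI:
  assumes T: "lin T" and w: "\<And>a. w a \<in> gev T a" and F: "finite F" "\<And>a. a \<notin> F \<Longrightarrow> w a = 0" and v: "v = (\<Sum>a\<in>F. w a)"
  shows "gcomp T a v = w a"
proof -
  let ?G = "spec T \<union> F"
  have fin: "finite ?G" using F finite_spec[OF T] by simp
  have 1: "(\<Sum>a\<in>?G. gcomp T a v) = v"
    using sum_comp[OF T, of v] fin comp_not_spec[OF T] by (subst sum.mono_neutral_right[of _ "spec T"]) auto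
  have 2: "(\<Sum>a\<in>?G. w a) = v"
    unfolding v using fin F by (subst sum.mono_neutral_right[of _ F]) auto
  have "(\<Sum>a\<in>?G. gcomp T a v - w a) = 0" using 1 2 by (simp add: sum_subtractf)
  moreover have "gcomp T a v - w a \<in> gev T a" for a
    using comp_gev[OF T] w subspace_gev[OF T] by (auto intro: subspace_diff)
  ultimately have "a \<in> ?G \<Longrightarrow> gcomp T a v - w a = 0"
    using gev_sum_zero[OF T fin, of "\<lambda>a. gcomp T a v - w a"] by blast
  moreover have "a \<notin> ?G \<Longrightarrow> gcomp T a v = w a" using comp_not_spec[OF T] F by auto
  ultimately show ?thesis by auto
qed

lemma comp_of_gev:
  assumes T: "lin T" and v: "v \<in> gev T b"
  shows "gcomp T a v = (if a = b then v else 0)"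
  by (rule comp_eqI[OF T, where F = "{b}"]) (use v subspace_0[OF subspace_gev[OF T]] in auto)

lemma lin_comp:
  assumes T: "lin T" shows "lin (gcomp T a)"
  unfolding lin_def
proof (intro conjI allI)
  fix x y c
  show "gcomp T a (x + y) = gcomp T a x + gcomp T a y"
    by (rule comp_eqI[OF T, where F = "spec T"])
      (use finite_spec[OF T] comp_not_spec[OF T] comp_gev[OF T] subspace_gev[OF T] sum_comp[OF T] in
        \<open>auto intro: subspace_add simp: sum.distrib\<close>)
  show "gcomp T a (c *s x) = c *s gcomp T a x"
    by (rule comp_eqI[OF T, where F = "spec T"])
      (use finite_spec[OF T] comp_not_spec[OF T] comp_gev[OF T] subspace_gev[OF T] sum_comp[OF T] in
        \<open>auto intro: subspace_scale simp: scale_sum_right[symmetric]\<close>)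
qed

lemma comp_mem:
  assumes T: "lin T" and W: "subspace W" "\<And>x. x \<in> W \<Longrightarrow> T x \<in> W" and v: "v \<in> W"
  shows "gcomp T a v \<in> W"
proof -
  obtain w where w: "\<And>a. w a \<in> gev T a \<inter> W" "v = (\<Sum>a\<in>spec T. w a)"
    using gev_decomp[OF assms] by blast
  have w0: "w a = 0" if "a \<notin> spec T" for a using w(1)[of a] that by (auto simp: spec_def)
  have "gcomp T a v = w a"
    by (rule comp_eqI[OF T _ finite_spec[OF T] _ w(2)]) (use w w0 in auto)
  then show ?thesis using w(1) by auto
qed

lemma comp_commute:
  assumes T: "lin T" and S: "lin S" "\<And>x. S (T x) = T (S x)"
  shows "gcomp T a (S v) = S (gcomp T a v)"
proof -
  have "S v = (\<Sum>a\<in>spec T. S (gcomp T a v))"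
    using lin_sum[OF S(1), of "\<lambda>a. gcomp T a v" "spec T"] sum_comp[OF T, of v] by simp
  then have "gcomp T a (S v) = (\<lambda>a. S (gcomp T a v)) a"
    by (intro comp_eqI[OF T _ finite_spec[OF T]])
      (use gev_invariant[OF S comp_gev[OF T]] comp_not_spec[OF T] S(1) in \<open>auto simp: lin_0\<close>)
  then show ?thesis .
qed

lemma spec_eigenvector:
  assumes T: "lin T" and W: "subspace W" "\<And>x. x \<in> W \<Longrightarrow> T x \<in> W" and v: "v \<in> gev T a" "v \<in> W" "v \<noteq> 0"
  obtains u where "u \<in> W" "u \<noteq> 0" "T u = a *s u"
proof -
  let ?S = "\<lambda>u. T u - a *s u"
  obtain n where "(?S ^^ n) v = 0" using v by (auto simp: gev_def)
  then have "\<exists>u\<in>W. u \<noteq> 0 \<and> ?S u = 0" using v(2,3)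
  proof (induction n arbitrary: v)
    case (Suc n)
    show ?case
    proof (cases "?S v = 0")
      case False
      have "(?S ^^ n) (?S v) = 0" using Suc.prems(1) by (metis comp_apply funpow_Suc_right)
      moreover have "?S v \<in> W" using Suc.prems W by (simp add: subspace_diff subspace_scale)
      ultimately show ?thesis using Suc.IH False by blast
    qed (use Suc in blast)
  qed simp
  then show thesis using that by auto
qed

lemma ex_eigenvector:
  assumes T: "lin T" and W: "subspace W" "\<And>x. x \<in> W \<Longrightarrow> T x \<in> W" and v: "v \<in> W" "v \<noteq> 0"
  obtains a u where "u \<in> W" "u \<noteq> 0" "T u = a *s u"
proof -
  have "\<exists>a. gcomp T a v \<noteq> 0" using sum_comp[OF T, of v] v by (metis sum.neutral)
  then obtain a where "gcomp T a v \<noteq> 0" by blast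
  then show thesis
    using spec_eigenvector[OF T W comp_gev[OF T] comp_mem[OF T W v(1)]] that by blast
qed

subsection \<open>Nilpotent and diagonalisable operators\<close>

definition nilp :: "('g \<Rightarrow> 'g) \<Rightarrow> bool" where
  "nilp T \<longleftrightarrow> (\<exists>n. \<forall>v. (T ^^ n) v = 0)"

text \<open>If \<open>m\<close> is the least power that kills \<open>v\<close>, the first
  \<open>m\<close> iterates are independent, so \<open>m\<close> is at most the dimension. The
  uniform bound allows nilpotence to be tested vector by vector.\<close>

lemma nilp_power_dim:
  assumes T: "lin T" and n: "(T ^^ n) v = 0"
  shows "(T ^^ card Basis) v = 0"
proof (rule ccontr)
  assume c: "(T ^^ card Basis) v \<noteq> 0"
  define m where "m = (LEAST m. (T ^^ m) v = 0)"
  have m: "(T ^^ m) v = 0" unfolding m_def using n by (rule LeastI)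
  have lt: "(T ^^ i) v \<noteq> 0" if "i < m" for i using that not_less_Least m_def by blast
  have mN: "card Basis < m" using c m funpow_0_mono[OF T m] by (meson not_le)
  have "independent ((\<lambda>i. (T ^^ i) v) ` {..<m}) \<and> inj_on (\<lambda>i. (T ^^ i) v) {..<m}"
  proof -
    have z: "\<forall>i<m. c i = 0" if s: "(\<Sum>i<m. c i *s (T ^^ i) v) = 0" for c
    proof (intro allI impI)
      fix i assume "i < m" then show "c i = 0"
      proof (induction i rule: less_induct)
        case (less i)
        \<comment> \<open>Applying the power m - 1 - i kills all terms beyond \<open>i\<close>, and
          the coefficients before \<open>i\<close> vanish by induction.\<close>
        have "(\<Sum>j<m. c j *s (T ^^ (m - 1 - i + j)) v) = (T ^^ (m - 1 - i)) (\<Sum>j<m. c j *s (T ^^ j) v)"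
          using lin_funpow[OF T] by (simp add: lin_sum lin_scale funpow_add)
        also have "\<dots> = 0" using s lin_funpow[OF T] by (simp add: lin_0)
        also have "(\<Sum>j<m. c j *s (T ^^ (m - 1 - i + j)) v) = (\<Sum>j\<in>{i}. c j *s (T ^^ (m - 1 - i + j)) v)"
        proof (rule sum.mono_neutral_right)
          show "\<forall>j\<in>{..<m} - {i}. c j *s (T ^^ (m - 1 - i + j)) v = 0"
          proof
            fix j assume j: "j \<in> {..<m} - {i}"
            show "c j *s (T ^^ (m - 1 - i + j)) v = 0"
            proof (cases "j < i")
              case True then show ?thesis using less by simp
            next
              case False
              then have "m \<le> m - 1 - i + j" using j less.prems by auto
              then show ?thesis using funpow_0_mono[OF T m] by simp
            qed
          qed
        qed (use less in auto)
        finally have "c i *s (T ^^ (m - 1)) v = 0" using less.prems by simp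
        then show ?case using lt[of "m - 1"] less.prems by simp
      qed
    qed
    have inj: "inj_on (\<lambda>i. (T ^^ i) v) {..<m}"
    proof (rule inj_onI, rule ccontr)
      fix i j assume ij: "i \<in> {..<m}" "j \<in> {..<m}" "(T ^^ i) v = (T ^^ j) v" "i \<noteq> j"
      define c :: "nat \<Rightarrow> complex" where "c = (\<lambda>l. if l = i then 1 else if l = j then -1 else 0)"
      have "(\<Sum>l<m. c l *s (T ^^ l) v) = (\<Sum>l\<in>{i,j}. c l *s (T ^^ l) v)"
        by (rule sum.mono_neutral_right) (use ij in \<open>auto simp: c_def\<close>)
      also have "\<dots> = 0" using ij by (simp add: c_def)
      finally have "c i = 0" using z ij by auto
      then show False by (simp add: c_def)
    qed
    have "independent ((\<lambda>i. (T ^^ i) v) ` {..<m})"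
    proof
      assume "dependent ((\<lambda>i. (T ^^ i) v) ` {..<m})"
      then obtain u where u: "\<exists>w\<in>(\<lambda>i. (T ^^ i) v) ` {..<m}. u w \<noteq> 0" "(\<Sum>w\<in>(\<lambda>i. (T ^^ i) v) ` {..<m}. u w *s w) = 0"
        by (auto simp: dependent_finite)
      have "(\<Sum>i<m. u ((T ^^ i) v) *s (T ^^ i) v) = 0" using u(2) by (simp add: sum.reindex[OF inj])
      from z[OF this] show False using u(1) by auto
    qed
    with inj show ?thesis by blast
  qed
  then have "m \<le> card Basis"
    using independent_card_le_dim[of "(\<lambda>i. (T ^^ i) v) ` {..<m}" UNIV] by (simp add: card_image)
  with mN show False by simp
qed

lemma nilp_iff:
  assumes T: "lin T"
  shows "nilp T \<longleftrightarrow> (\<forall>v. \<exists>n. (T ^^ n) v = 0)"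
  unfolding nilp_def using nilp_power_dim[OF T] by metis

lemma nilp_gev: "lin T \<Longrightarrow> nilp T \<longleftrightarrow> gev T 0 = UNIV"
  by (auto simp: nilp_iff gev_def)

lemma funpow_commute:
  assumes "\<And>x. S (T x) = T (S x)"
  shows "((\<lambda>x. S (T x)) ^^ n) v = (S ^^ n) ((T ^^ n) v)"
proof -
  have c: "(T ^^ n) (S x) = S ((T ^^ n) x)" for n x
    by (induction n) (simp_all add: assms)
  have "(S ^^ n) (T x) = T ((S ^^ n) x)" for n x
    by (induction n) (simp_all add: assms)
  then show ?thesis by (induction n) simp_all
qed

lemma nilp_commute:
  assumes "lin S" "\<And>x. S (T x) = T (S x)" "nilp T"
  shows "nilp (\<lambda>x. S (T x))"
proof -
  obtain n where "\<And>v. (T ^^ n) v = 0" using assms(3) by (auto simp: nilp_def)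
  then have "((\<lambda>x. S (T x)) ^^ n) v = 0" for v
    using funpow_commute[of S T n v] assms lin_funpow lin_0 by simp
  then show ?thesis unfolding nilp_def by blast
qed

definition diag :: "('g \<Rightarrow> 'g) \<Rightarrow> bool" where
  "diag T \<longleftrightarrow> lin T \<and> (\<forall>a. \<forall>v\<in>gev T a. T v = a *s v)"

lemma diag_gev: "diag T \<Longrightarrow> gev T a = {v. T v = a *s v}"
  by (auto simp: diag_def intro: eigenvector_gev)

lemma diagI:
  assumes T: "lin T" and s: "\<And>v. v \<in> span {v. \<exists>a. T v = a *s v}"
  shows "diag T"
proof -
  have c: "T (gcomp T a v) = a *s gcomp T a v" for a v
    using s[of v]
  proof (induction rule: span_induct_alt)
    case base then show ?case using T lin_comp[OF T] by (simp add: lin_0)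
  next
    case (step c x y)
    then obtain b where b: "T x = b *s x" by blast
    then have "gcomp T a x = (if a = b then x else 0)" using comp_of_gev[OF T eigenvector_gev] by blast
    with b step(2) show ?case using T lin_comp[OF T]
      by (auto simp: lin_add lin_scale lin_0 scale_right_distrib mult.commute)
  qed
  have "T v = a *s v" if "v \<in> gev T a" for a v
    using c[of a v] comp_of_gev[OF T that, of a] by simp
  then show ?thesis using T by (simp add: diag_def)
qed

lemma diag_nilp_zero:
  assumes "diag T" "nilp T" shows "T v = 0"
proof -
  have "v \<in> gev T 0" using assms nilp_gev[of T] by (auto simp: diag_def)
  then show ?thesis using assms by (auto simp: diag_def)
qed

subsection \<open>Trace\<close>

definition tr :: "('g \<Rightarrow> 'g) \<Rightarrow> complex" where
  "tr T = (\<Sum>b\<in>Basis. representation Basis (T b) b)"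

definition is_basis :: "'g set \<Rightarrow> bool" where
  "is_basis C \<longleftrightarrow> independent C \<and> span C = UNIV"

lemma is_basis_Basis: "is_basis Basis"
  using independent_Basis span_Basis by (simp add: is_basis_def)

lemma is_basis_finite: "is_basis C \<Longrightarrow> finite C"
  using finiteI_independent by (auto simp: is_basis_def)

lemma is_basis_expand: "is_basis C \<Longrightarrow> (\<Sum>c\<in>C. representation C v c *s c) = v"
  using is_basis_finite[of C] by (intro sum_representation_eq) (auto simp: is_basis_def)

lemma is_basis_repr_add: "is_basis C \<Longrightarrow> representation C (x + y) c = representation C x c + representation C y c"
  and is_basis_repr_scale: "is_basis C \<Longrightarrow> representation C (a *s x) c = a * representation C x c"
  by (auto simp: is_basis_def representation_add representation_scale)

lemma is_basis_repr_sum: "is_basis C \<Longrightarrow> representation C (sum f A) c = (\<Sum>a\<in>A. representation C (f a) c)"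
  by (induction A rule: infinite_finite_induct) (auto simp: is_basis_repr_add representation_zero)

lemma is_basis_repr_lin:
  assumes C: "is_basis C" and D: "is_basis D" and T: "lin T"
  shows "representation C (T v) c = (\<Sum>d\<in>D. representation D v d * representation C (T d) c)"
proof -
  have "representation C (T v) c = representation C (T (\<Sum>d\<in>D. representation D v d *s d)) c"
    using is_basis_expand[OF D] by simp
  also have "\<dots> = (\<Sum>d\<in>D. representation D v d * representation C (T d) c)"
    using T C by (simp add: lin_sum lin_scale is_basis_repr_sum is_basis_repr_scale)
  finally show ?thesis .
qed

text \<open>Both sides are the same double sum of matrix coefficients. Allowing two bases covers two
  facts at once: independence of the basis, with one map the identity, and cyclicity, with both
  bases equal.\<close>

lemma trace_cyclic_bases:
  assumes C: "is_basis C" and D: "is_basis D" and S: "lin S" and T: "lin T"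
  shows "(\<Sum>c\<in>C. representation C (S (T c)) c) = (\<Sum>d\<in>D. representation D (T (S d)) d)"
proof -
  have "(\<Sum>c\<in>C. representation C (S (T c)) c)
      = (\<Sum>c\<in>C. \<Sum>d\<in>D. representation D (T c) d * representation C (S d) c)"
    by (simp only: is_basis_repr_lin[OF C D S, symmetric])
  also have "\<dots> = (\<Sum>d\<in>D. \<Sum>c\<in>C. representation C (S d) c * representation D (T c) d)"
    by (subst sum.swap) (simp add: mult.commute)
  also have "\<dots> = (\<Sum>d\<in>D. representation D (T (S d)) d)"
    by (simp only: is_basis_repr_lin[OF D C T, symmetric])
  finally show ?thesis .
qed

lemma tr_basis:
  assumes C: "is_basis C" and T: "lin T"
  shows "tr T = (\<Sum>c\<in>C. representation C (T c) c)"
  unfolding tr_def using trace_cyclic_bases[OF is_basis_Basis C lin_ident T] by simp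

lemma tr_cyclic: "lin S \<Longrightarrow> lin T \<Longrightarrow> tr (\<lambda>x. S (T x)) = tr (\<lambda>x. T (S x))"
  unfolding tr_def using trace_cyclic_bases[OF is_basis_Basis is_basis_Basis] by blast

lemma tr_add: "tr (\<lambda>x. S x + T x) = tr S + tr T"
  unfolding tr_def using is_basis_repr_add[OF is_basis_Basis] by (simp add: sum.distrib)

lemma tr_scale: "tr (\<lambda>x. c *s T x) = c * tr T"
  unfolding tr_def using is_basis_repr_scale[OF is_basis_Basis] by (simp add: sum_distrib_left)

lemma tr_diff: "tr (\<lambda>x. S x - T x) = tr S - tr T"
  using tr_add[of S "\<lambda>x. (-1) *s T x"] tr_scale[of "-1" T] by simp

lemma tr_zero: "tr (\<lambda>x. 0) = 0"
  using tr_scale[of 0 "\<lambda>x. x"] by simp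

text \<open>Replacing \<open>T\<close> by \<open>T P\<close>, with \<open>P\<close> a projection onto the range of \<open>T\<close>, preserves the trace
  and lowers the nilpotency index.\<close>
lemma tr_nilp:
  assumes "lin T" "nilp T" shows "tr T = 0"
proof -
  have *: "tr T = 0" if "lin T" "\<And>v. (T ^^ Suc n) v = 0" for n T
    using that
  proof (induction n arbitrary: T)
    case 0
    then have "T = (\<lambda>x. 0)" by auto
    then show ?case by (simp add: tr_zero)
  next
    case (Suc n)
    have T: "lin T" by fact
    obtain P where P: "lin P" "\<And>x. x \<in> range T \<Longrightarrow> P x = x" "\<And>x. P x \<in> range T"
      using ex_projection[OF lin_subspace_image[OF T subspace_UNIV]] by blast
    let ?S = "\<lambda>x. T (P x)"
    have pow: "(?S ^^ m) x = (T ^^ m) (P x)" if "m > 0" for m x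
      using that
    proof (induction m)
      case (Suc m)
      show ?case
      proof (cases "m = 0")
        case False
        have "P ((T ^^ m) (P x)) = (T ^^ m) (P x)" using False P(2) by (cases m) auto
        then show ?thesis using Suc False by simp
      qed simp
    qed simp
    have n0: "(?S ^^ Suc n) v = 0" for v
    proof -
      obtain u where "P v = T u" using P(3) by blast
      then have "(?S ^^ Suc n) v = (T ^^ Suc (Suc n)) u" using pow[of "Suc n" v] by (simp add: funpow_swap1)
      then show ?thesis using Suc.prems by simp
    qed
    have "tr T = tr (\<lambda>x. P (T x))" using P(2) by simp
    also have "\<dots> = tr ?S" using tr_cyclic[OF P(1) T] .
    also have "\<dots> = 0" by (rule Suc.IH[OF lin_compose[OF T P(1)] n0])
    finally show ?case .
  qed
  obtain n where n: "\<And>v. (T ^^ n) v = 0" using assms unfolding nilp_def by blast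
  have "(T ^^ Suc n) v = 0" for v using funpow_0_mono[OF assms(1) n, of "Suc n"] by simp
  from *[OF assms(1) this] show ?thesis .
qed

lemma tr_eigenbasis:
  assumes C: "is_basis C" and T: "lin T" and e: "\<And>c. c \<in> C \<Longrightarrow> T c = m c *s c"
  shows "tr T = (\<Sum>c\<in>C. m c)"
proof -
  have "representation C (T c) c = m c" if "c \<in> C" for c
    using e[OF that] that C is_basis_repr_scale[OF C] by (simp add: representation_basis is_basis_def)
  then show ?thesis using tr_basis[OF C T] by simp
qed

lemma ex_basis_subset:
  assumes "span E = UNIV" obtains C where "is_basis C" "C \<subseteq> E"
proof -
  obtain C where "C \<subseteq> E" "independent C" "E \<subseteq> span C" using maximal_independent_subset[of E] by blast
  moreover have "span C = UNIV" using calculation assms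
    by (metis span_mono span_span top.extremum_uniqueI)
  ultimately show thesis using that by (auto simp: is_basis_def)
qed

subsection \<open>Symmetric bilinear forms\<close>

definition is_form :: "('g \<Rightarrow> 'g \<Rightarrow> complex) \<Rightarrow> bool" where
  "is_form B \<longleftrightarrow> (\<forall>x y z. B (x + y) z = B x z + B y z) \<and> (\<forall>c x y. B (c *s x) y = c * B x y) \<and> (\<forall>x y. B x y = B y x)"

definition nondeg :: "('g \<Rightarrow> 'g \<Rightarrow> complex) \<Rightarrow> 'g set \<Rightarrow> bool" where
  "nondeg B L \<longleftrightarrow> subspace L \<and> (\<forall>x\<in>L. (\<forall>y\<in>L. B x y = 0) \<longrightarrow> x = 0)"

lemma form_simps:
  assumes "is_form B"
  shows "B (x + y) z = B x z + B y z" "B z (x + y) = B z x + B z y"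
    "B (c *s x) y = c * B x y" "B x (c *s y) = c * B x y" "B 0 x = 0" "B x 0 = 0"
    "B (- x) y = - B x y" "B x (- y) = - B x y" "B (x - y) z = B x z - B y z" "B z (x - y) = B z x - B z y"
proof -
  have s: "B x y = B y x" for x y using assms by (simp add: is_form_def)
  have 1: "B (x + y) z = B x z + B y z" for x y z using assms unfolding is_form_def by blast
  have 2: "B z (x + y) = B z x + B z y" for x y z using 1[of x y z] s[of z x] s[of z y] s[of z "x + y"] by simp
  have 3: "B (c *s x) y = c * B x y" for c x y using assms unfolding is_form_def by blast
  have 4: "B x (c *s y) = c * B x y" for c x y using 3[of c y x] s[of x y] s[of x "c *s y"] by simp
  have 5: "B (- x) y = - B x y" "B x (- y) = - B x y" for x y using 3[of "-1" x y] 4[of x "-1" y] by auto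
  show "B (x + y) z = B x z + B y z" "B z (x + y) = B z x + B z y"
    "B (c *s x) y = c * B x y" "B x (c *s y) = c * B x y" by (fact 1 2 3 4)+
  show "B 0 x = 0" "B x 0 = 0" using 3[of 0 0 x] 4[of x 0 0] by auto
  show "B (- x) y = - B x y" "B x (- y) = - B x y" by (fact 5)+
  show "B (x - y) z = B x z - B y z" "B z (x - y) = B z x - B z y"
    using 1[of x "-y" z] 2[of z x "-y"] 5 by auto
qed

lemma independent_coeffs_eq:
  assumes "independent C" "finite C" and "(\<Sum>c\<in>C. a c *s c) = (\<Sum>c\<in>C. b c *s c)" "c \<in> C"
  shows "a c = b c"
proof -
  have "(\<Sum>c\<in>C. (a c - b c) *s c) = 0" using assms by (simp add: scale_left_diff_distrib sum_subtractf)
  from independentD[OF assms(1,2) order.refl this assms(4)] show ?thesis by simp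
qed

text \<open>The map that sends x to \<open>\<Sum>c\<in>D. B x c *s c\<close>, for a basis
  \<open>D\<close> of \<open>L\<close> containing \<open>C\<close>, is injective on \<open>L\<close>
  by nondegeneracy, hence onto \<open>L\<close>.\<close>

lemma nondeg_basis_values:
  assumes B: "is_form B" and L: "nondeg B L" and C: "C \<subseteq> L" "independent C"
  obtains d where "d \<in> L" "\<And>c. c \<in> C \<Longrightarrow> B d c = \<phi> c"
proof -
  have sL: "subspace L" using L by (simp add: nondeg_def)
  obtain D where D: "C \<subseteq> D" "D \<subseteq> L" "independent D" "L \<subseteq> span D"
    using maximal_independent_subset_extend[OF C] by blast
  have fD: "finite D" using D finiteI_independent by blast
  have sD: "span D = L" using D sL by (simp add: span_subspace)
  define T where "T x = (\<Sum>c\<in>D. B x c *s c)" for x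
  have T: "lin T" using B
    by (auto simp: lin_def T_def is_form_def scale_left_distrib sum.distrib scale_sum_right)
  have TL: "T x \<in> L" for x using D sL by (auto simp: T_def intro!: subspace_sum subspace_scale)
  have inj: "x = 0" if x: "x \<in> L" "T x = 0" for x
  proof -
    have c0: "B x c = 0" if "c \<in> D" for c
      using independent_coeffs_eq[OF D(3) fD, of "B x" "\<lambda>_. 0" c] x that by (simp add: T_def)
    have "B x y = 0" if "y \<in> L" for y
      using that unfolding sD[symmetric]
    proof (induction rule: span_induct_alt)
      case base then show ?case using B unfolding is_form_def by (metis mult_zero_left scale_zero_left)
    next
      case (step a u v)
      then show ?case using B c0 unfolding is_form_def by (metis add.right_neutral mult_zero_right)
    qed
    then show ?thesis using L x by (simp add: nondeg_def)
  qed
  have "dim (T ` L) = dim L" by (rule dim_lin_inj[OF T sL inj])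
  then have "T ` L = L" using subspace_dim_equal[OF lin_subspace_image[OF T sL] sL] TL by auto
  moreover have "(\<Sum>c\<in>D. \<phi> c *s c) \<in> L" using D sL by (auto intro!: subspace_sum subspace_scale)
  ultimately obtain d where d: "d \<in> L" "T d = (\<Sum>c\<in>D. \<phi> c *s c)" by (metis imageE)
  show thesis by (rule that[of d]) (use d D independent_coeffs_eq[OF D(3) fD] in \<open>auto simp: T_def\<close>)
qed

lemma nondeg_represent:
  assumes B: "is_form B" and L: "nondeg B L"
    and \<phi>: "\<And>x y. \<phi> (x + y) = \<phi> x + \<phi> y" "\<And>c x. \<phi> (c *s x) = c * \<phi> x"
  obtains d where "d \<in> L" "\<And>z. z \<in> L \<Longrightarrow> B d z = \<phi> z"
proof -
  obtain C where C: "C \<subseteq> L" "independent C" "L \<subseteq> span C" using maximal_independent_subset by blast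
  obtain d where d: "d \<in> L" "\<And>c. c \<in> C \<Longrightarrow> B d c = \<phi> c" using nondeg_basis_values[OF B L C(1,2)] by blast
  have "B d z = \<phi> z" if "z \<in> span C" for z
    using that
  proof (induction rule: span_induct_alt)
    case base then show ?case using B \<phi>(2)[of 0 0] unfolding is_form_def by (metis mult_zero_left scale_zero_left)
  next
    case (step a u v)
    then show ?case using d(2)[of u] by (simp add: form_simps[OF B] \<phi>)
  qed
  then show thesis using that d C by blast
qed

definition perp :: "('g \<Rightarrow> 'g \<Rightarrow> complex) \<Rightarrow> 'g set \<Rightarrow> 'g set \<Rightarrow> 'g set" where
  "perp B L W = {x \<in> L. \<forall>w\<in>W. B x w = 0}"

lemma form_sum: "is_form B \<Longrightarrow> B (sum f A) y = (\<Sum>a\<in>A. B (f a) y)"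
  "is_form B \<Longrightarrow> B y (sum f A) = (\<Sum>a\<in>A. B y (f a))"
  by (induction A rule: infinite_finite_induct) (auto simp: form_simps)

lemma form_sym: "is_form B \<Longrightarrow> B x y = B y x"
  by (simp add: is_form_def)

lemma subspace_perp: "is_form B \<Longrightarrow> subspace L \<Longrightarrow> subspace (perp B L W)"
  by (rule subspaceI) (auto simp: perp_def subspace_0 subspace_add subspace_scale form_simps)

text \<open>On \<open>L\<close> the map that sends x to \<open>\<Sum>c\<in>C. B x c *s c\<close>,
  for a basis \<open>C\<close> of \<open>W\<close>, has kernel \<open>perp B L W\<close> and image
  \<open>W\<close>.\<close>

lemma dim_perp:
  assumes B: "is_form B" and L: "nondeg B L" and W: "subspace W" "W \<subseteq> L"
  shows "dim (perp B L W) + dim W = dim L"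
proof -
  have sL: "subspace L" using L by (simp add: nondeg_def)
  obtain C where C: "C \<subseteq> W" "independent C" "W \<subseteq> span C" using maximal_independent_subset by blast
  have fC: "finite C" using C finiteI_independent by blast
  have sC: "span C = W" using C W by (simp add: span_subspace)
  define T where "T x = (\<Sum>c\<in>C. B x c *s c)" for x
  have T: "lin T" using B
    by (auto simp: lin_def T_def is_form_def scale_left_distrib sum.distrib scale_sum_right)
  have "{x \<in> L. T x = 0} = perp B L W"
  proof -
    have "B x w = 0" if x: "T x = 0" and w: "w \<in> W" for x w
    proof -
      have c0: "B x c = 0" if "c \<in> C" for c
        using independent_coeffs_eq[OF C(2) fC, of "B x" "\<lambda>_. 0" c] x that by (simp add: T_def)
      show ?thesis using w unfolding sC[symmetric]
        by (induction rule: span_induct_alt) (auto simp: form_simps[OF B] c0)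
    qed
    moreover have "T x = 0" if "\<forall>w\<in>W. B x w = 0" for x
      unfolding T_def by (rule sum.neutral) (use that C(1) in auto)
    ultimately show ?thesis by (auto simp: perp_def)
  qed
  moreover have "T ` L = W"
  proof
    show "T ` L \<subseteq> W" using C W by (auto simp: T_def intro!: subspace_sum subspace_scale)
    show "W \<subseteq> T ` L"
    proof
      fix w assume w: "w \<in> W"
      have CL: "C \<subseteq> L" using C W by blast
      obtain d where d: "d \<in> L" "\<And>c. c \<in> C \<Longrightarrow> B d c = representation C w c"
        using nondeg_basis_values[OF B L CL C(2)] by blast
      have "T d = (\<Sum>c\<in>C. representation C w c *s c)" using d(2) by (simp add: T_def)
      also have "\<dots> = w" using w C fC sC by (intro sum_representation_eq) auto
      finally show "w \<in> T ` L" using d by blast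
    qed
  qed
  ultimately show ?thesis using rank_nullity[OF T sL] by simp
qed

lemma perp_perp:
  assumes B: "is_form B" and L: "nondeg B L" and W: "subspace W" "W \<subseteq> L"
  shows "perp B L (perp B L W) = W"
proof -
  have sL: "subspace L" using L by (simp add: nondeg_def)
  have s: "subspace (perp B L W)" "subspace (perp B L (perp B L W))" using subspace_perp[OF B sL] by auto
  have sub: "W \<subseteq> perp B L (perp B L W)" using W form_sym[OF B] by (auto simp: perp_def)
  have "dim (perp B L (perp B L W)) = dim W"
    using dim_perp[OF B L W] dim_perp[OF B L s(1)] by (auto simp: perp_def)
  then show ?thesis using subspace_dim_equal[OF W(1) s(2) sub] by simp
qed

lemma represent_mod_radical:
  assumes B: "is_form B" and L: "subspace L"
    and \<phi>: "\<And>x y. \<phi> (x + y) = \<phi> x + \<phi> y" "\<And>c x. \<phi> (c *s x) = c * \<phi> x"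
    and rad: "\<And>x. x \<in> perp B L L \<Longrightarrow> \<phi> x = 0"
  obtains d where "d \<in> L" "\<And>z. z \<in> L \<Longrightarrow> B d z = \<phi> z"
proof -
  let ?R = "perp B L L"
  have sR: "subspace ?R" using subspace_perp[OF B L] .
  obtain P where P: "lin P" "\<And>x. x \<in> ?R \<Longrightarrow> P x = x" "\<And>x. P x \<in> ?R" using ex_projection[OF sR] by blast
  define U where "U = {x \<in> L. P x = 0}"
  have sU: "subspace U"
    using subspace_inter[OF L lin_subspace_kernel[OF P(1)]] by (simp add: Int_def U_def)
  have PL: "P x \<in> L" for x using P(3)[of x] by (simp add: perp_def)
  have split: "x - P x \<in> U" if "x \<in> L" for x
    using that L P(2)[OF P(3)[of x]] P(1) PL by (simp add: U_def lin_diff subspace_diff)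
  have R0: "B u (P x) = 0" "B (P x) u = 0" if "u \<in> L" for u x
    using P(3)[of x] that form_sym[OF B, of u "P x"] by (auto simp: perp_def)
  have nd: "nondeg B U"
    unfolding nondeg_def
  proof (intro conjI ballI impI sU)
    fix u assume u: "u \<in> U" "\<forall>y\<in>U. B u y = 0"
    have uL: "u \<in> L" using u by (simp add: U_def)
    have "B u y = 0" if "y \<in> L" for y
    proof -
      have "B u (y - P y) = 0" using u split[OF that] by blast
      then show ?thesis using R0(1)[OF uL, of y] by (simp add: form_simps[OF B])
    qed
    then have "u \<in> ?R" using uL by (simp add: perp_def)
    then show "u = 0" using P(2) u by (simp add: U_def)
  qed
  obtain d where d: "d \<in> U" "\<And>z. z \<in> U \<Longrightarrow> B d z = \<phi> z" using nondeg_represent[OF B nd \<phi>] by blast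
  have dL: "d \<in> L" using d by (simp add: U_def)
  have "B d z = \<phi> z" if "z \<in> L" for z
  proof -
    have "B d z = B d (z - P z)" using R0(1)[OF dL, of z] by (simp add: form_simps[OF B])
    also have "\<dots> = \<phi> (z - P z)" using d(2) split[OF that] by blast
    also have "\<dots> = \<phi> (z - P z) + \<phi> (P z)" using rad[OF P(3)] by simp
    also have "\<dots> = \<phi> z" using \<phi>(1)[of "z - P z" "P z"] by simp
    finally show ?thesis .
  qed
  with dL that show thesis by blast
qed

lemma lin_inj_surj:
  assumes T: "lin T" and W: "subspace W" "\<And>x. x \<in> W \<Longrightarrow> T x \<in> W" "\<And>x. x \<in> W \<Longrightarrow> T x = 0 \<Longrightarrow> x = 0"
    and y: "y \<in> W"
  obtains x where "x \<in> W" "T x = y"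
proof -
  have "dim (T ` W) = dim W" by (rule dim_lin_inj[OF T W(1) W(3)])
  then have "T ` W = W" using subspace_dim_equal[OF lin_subspace_image[OF T W(1)] W(1)] W(2) by auto
  then show thesis using y that by (metis imageE)
qed

end

section \<open>Lie algebras, derivations and functions of an operator\<close>

locale lie = cspace sc Basis
  for sc :: "complex \<Rightarrow> 'g::ab_group_add \<Rightarrow> 'g" (infixr "*s" 75) and Basis +
  fixes br :: "'g \<Rightarrow> 'g \<Rightarrow> 'g"
  assumes br_add: "br (x + y) z = br x z + br y z" "br z (x + y) = br z x + br z y"
    and br_scale: "br (c *s x) y = c *s br x y" "br x (c *s y) = c *s br x y"
    and br_self: "br x x = 0"
    and br_cyclic: "br x (br y z) + br y (br z x) + br z (br x y) = 0"
begin

lemma lin_br: "lin (br x)"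
  by (simp add: lin_def br_add br_scale)

lemma lin_br_left: "lin (\<lambda>x. br x y)"
  by (simp add: lin_def br_add br_scale)

lemma br_skew: "br x y = - br y x"
proof -
  have "br (x + y) (x + y) = 0" by (rule br_self)
  then have "br x y + br y x = 0" using br_self[of x] br_self[of y] by (simp add: br_add add.commute)
  then show ?thesis by (simp add: eq_neg_iff_add_eq_0)
qed

lemmas br_lin = br_add br_scale lin_0[OF lin_br] lin_0[OF lin_br_left] lin_neg[OF lin_br] lin_neg[OF lin_br_left]
  lin_diff[OF lin_br] lin_diff[OF lin_br_left]

lemmas br_sum = lin_sum[OF lin_br]
lemmas br_sum_left = lin_sum[OF lin_br_left]

lemma jacobi: "br x (br y z) = br (br x y) z + br y (br x z)"
proof -
  have "br y (br z x) = - br y (br x z)" using br_skew[of z x] by (simp add: br_lin)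
  moreover have "br z (br x y) = - br (br x y) z" by (rule br_skew)
  ultimately show ?thesis using br_cyclic[of x y z] by (simp add: algebra_simps)
qed

lemma br_br: "br (br x y) z = br x (br y z) - br y (br x z)"
  using jacobi[of x y z] by simp

lemma br_0_commute: "br x y = 0 \<longleftrightarrow> br y x = 0"
  using br_skew[of x y] by simp

lemma nilpotent_elt_nilp: "nilpotent_elt br x \<longleftrightarrow> nilp (br x)"
  by (simp add: nilpotent_elt_def ad_nilpotent_on_def nilp_def)

lemma subspace_centralizer: "subspace (centralizer br S)"
  by (rule subspaceI) (auto simp: centralizer_def br_lin)

lemma centralizer_br:
  assumes "x \<in> centralizer br S" "y \<in> centralizer br S"
  shows "br x y \<in> centralizer br S"
  using assms by (auto simp: centralizer_def jacobi[of _ x y] br_lin)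

definition der :: "('g \<Rightarrow> 'g) \<Rightarrow> bool" where
  "der D \<longleftrightarrow> lin D \<and> (\<forall>x y. D (br x y) = br (D x) y + br x (D y))"

lemma der_lin: "der D \<Longrightarrow> lin D" and der_br: "der D \<Longrightarrow> D (br x y) = br (D x) y + br x (D y)"
  by (auto simp: der_def)

lemma der_ad: "der (br x)"
  by (simp add: der_def lin_br jacobi[of x])

text \<open>By the Leibniz rule D - (a + b) sends [x, y] to [(D - a) x, y] + [x, (D - b) y], so
  after \<open>n + m\<close> applications one of the two factors is exhausted in every term.\<close>

lemma gev_br:
  assumes D: "der D" and x: "x \<in> gev D a" and y: "y \<in> gev D b"
  shows "br x y \<in> gev D (a + b)"
proof -
  let ?A = "\<lambda>a u. D u - a *s u"
  have step: "?A (a + b) (br x y) = br (?A a x) y + br x (?A b y)" for x y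
    using D by (simp add: der_br br_lin scale_left_distrib algebra_simps)
  have l: "lin (?A c ^^ n)" for c n by (rule lin_funpow[OF lin_shift[OF der_lin[OF D]]])
  have "(?A (a + b) ^^ (n + m)) (br x y) = 0" if "(?A a ^^ n) x = 0" "(?A b ^^ m) y = 0" for n m x y
    using that
  proof (induction "n + m" arbitrary: n m x y)
    case 0 then show ?case by (simp add: br_lin)
  next
    case (Suc k)
    show ?case
    proof (cases "n = 0 \<or> m = 0")
      case True
      then have "br x y = 0" using Suc.prems by (auto simp: br_lin)
      then show ?thesis using lin_0[OF l] by simp
    next
      case False
      then obtain n' m' where nm: "n = Suc n'" "m = Suc m'" by (metis not0_implies_Suc)
      have 1: "(?A (a + b) ^^ k) (br (?A a x) y) = 0"
      proof -
        have "(?A a ^^ n') (?A a x) = 0" using Suc.prems(1) unfolding nm by (simp add: funpow_Suc_right del: funpow.simps)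
        from Suc.hyps(1)[OF _ this Suc.prems(2)] show ?thesis using Suc.hyps(2) nm by auto
      qed
      have 2: "(?A (a + b) ^^ k) (br x (?A b y)) = 0"
      proof -
        have "(?A b ^^ m') (?A b y) = 0" using Suc.prems(2) unfolding nm by (simp add: funpow_Suc_right del: funpow.simps)
        from Suc.hyps(1)[OF _ Suc.prems(1) this] show ?thesis using Suc.hyps(2) nm by auto
      qed
      have "(?A (a + b) ^^ (n + m)) (br x y) = (?A (a + b) ^^ k) (?A (a + b) (br x y))"
        unfolding Suc.hyps(2)[symmetric] by (simp only: funpow_Suc_right comp_apply)
      also have "\<dots> = 0" unfolding step using 1 2 lin_add[OF l] by simp
      finally show ?thesis .
    qed
  qed
  then show ?thesis using x y unfolding gev_def by blast
qed

text \<open>If \<open>T\<close> is a derivation and \<open>g\<close> is additive, then \<open>opg T g\<close> is again a derivation: \<open>g = id\<close> gives the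
  semisimple part of \<open>T\<close>, and \<open>g = cnj\<close> a complex conjugate whose product with \<open>T\<close> has trace
  \<open>\<Sum>\<bar>\<lambda>\<bar>\<^sup>2\<close> over the eigenvalues \<open>\<lambda>\<close> of \<open>T\<close>.\<close>
definition opg :: "('g \<Rightarrow> 'g) \<Rightarrow> (complex \<Rightarrow> complex) \<Rightarrow> 'g \<Rightarrow> 'g" where
  "opg T g v = (\<Sum>a\<in>spec T. g a *s gcomp T a v)"

lemma lin_opg: "lin T \<Longrightarrow> lin (opg T g)"
  unfolding opg_def by (intro lin_sums lin_smult lin_comp)

lemma opg_gev:
  assumes T: "lin T" and v: "v \<in> gev T a" shows "opg T g v = g a *s v"
proof -
  have "opg T g v = (\<Sum>b\<in>spec T. if b = a then g a *s v else 0)"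
    unfolding opg_def using comp_of_gev[OF T v] by (auto intro!: sum.cong)
  also have "\<dots> = g a *s v" using v finite_spec[OF T] by (auto simp: spec_def)
  finally show ?thesis .
qed

lemma lin_eq_gev:
  assumes D: "lin D" and "lin S" "lin T" "\<And>a v. v \<in> gev D a \<Longrightarrow> S v = T v"
  shows "S v = T v"
proof -
  have "S (\<Sum>a\<in>spec D. gcomp D a v) = T (\<Sum>a\<in>spec D. gcomp D a v)"
    unfolding lin_sum[OF assms(2)] lin_sum[OF assms(3)]
    by (rule sum.cong[OF refl assms(4)[OF comp_gev[OF D]]])
  then show ?thesis using sum_comp[OF D] by simp
qed

text \<open>On brackets of generalised eigenvectors for \<open>a\<close> and \<open>b\<close> the
  two sides are multiples by g (a + b) and by g a + g b.\<close>

lemma der_opg: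
  assumes D: "der D" and g: "\<And>a b. g (a + b) = g a + g b"
  shows "der (opg D g)"
proof -
  have l: "lin D" using D by (rule der_lin)
  note lo = lin_opg[OF l, of g]
  have "opg D g (br x y) = br (opg D g x) y + br x (opg D g y)" for x y
  proof (rule lin_eq_gev[OF l, of "\<lambda>y. opg D g (br x y)"])
    show "lin (\<lambda>y. opg D g (br x y))" by (rule lin_compose[OF lo lin_br])
    show "lin (\<lambda>y. br (opg D g x) y + br x (opg D g y))" by (intro lin_plus lin_br lin_compose[OF lin_br lo])
    fix b y assume y: "y \<in> gev D b"
    show "opg D g (br x y) = br (opg D g x) y + br x (opg D g y)"
    proof (rule lin_eq_gev[OF l, of "\<lambda>x. opg D g (br x y)"])
      show "lin (\<lambda>x. opg D g (br x y))" by (rule lin_compose[OF lo lin_br_left])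
      show "lin (\<lambda>x. br (opg D g x) y + br x (opg D g y))"
        by (intro lin_plus lin_br_left lin_compose[OF lin_br_left lo])
      fix a x assume x: "x \<in> gev D a"
      show "opg D g (br x y) = br (opg D g x) y + br x (opg D g y)"
        using opg_gev[OF l gev_br[OF D x y]] opg_gev[OF l x] opg_gev[OF l y] g
        by (simp add: br_scale scale_left_distrib)
    qed
  qed
  then show ?thesis using lo by (simp add: der_def)
qed

lemma opg_commute:
  assumes T: "lin T" and S: "lin S" "\<And>x. S (T x) = T (S x)"
  shows "S (opg T g v) = opg T g (S v)"
  unfolding opg_def using comp_commute[OF T S] S(1) by (simp add: lin_sum lin_scale)

lemma opg_kernel:
  assumes T: "lin T" and "T v = 0" and "g 0 = 0"
  shows "opg T g v = 0"
  using opg_gev[OF T eigenvector_gev[of T v 0]] assms by simp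

lemma diag_opg: assumes T: "lin T" shows "diag (opg T g)"
proof (rule diagI[OF lin_opg[OF T]])
  fix v
  have "(\<Sum>a\<in>spec T. gcomp T a v) \<in> span {v. \<exists>a. opg T g v = a *s v}"
    using opg_gev[OF T comp_gev[OF T]] by (intro span_sum span_base) blast
  then show "v \<in> span {v. \<exists>a. opg T g v = a *s v}" using sum_comp[OF T] by simp
qed

lemma nilp_opg_part: assumes T: "lin T" shows "nilp (\<lambda>z. T z - opg T (\<lambda>a. a) z)"
proof -
  let ?N = "\<lambda>z. T z - opg T (\<lambda>a. a) z"
  have N: "lin ?N" by (intro lin_minus T lin_opg)
  have e: "(?N ^^ n) v = ((\<lambda>u. T u - a *s u) ^^ n) v \<and> (?N ^^ n) v \<in> gev T a" if v: "v \<in> gev T a" for n a v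
  proof (induction n)
    case (Suc n)
    let ?u = "(?N ^^ n) v"
    have "opg T (\<lambda>a. a) ?u = a *s ?u" using opg_gev[OF T] Suc by blast
    moreover have "T ?u - a *s ?u \<in> gev T a"
    proof -
      have u: "?u \<in> gev T a" using Suc by blast
      then have "T ?u \<in> gev T a" by (rule gev_invariant[OF T, of T, OF refl])
      then show ?thesis by (intro subspace_diff subspace_scale subspace_gev[OF T] u)
    qed
    ultimately show ?case using Suc by simp
  qed (use v in simp)
  have g0: "v \<in> gev ?N 0" if vg: "v \<in> gev T a" for v a
  proof -
    obtain n where n: "((\<lambda>u. T u - a *s u) ^^ n) v = 0" using vg unfolding gev_def by blast
    then have "(?N ^^ n) v = 0" using e[OF vg, of n] by simp
    then show ?thesis by (auto simp: gev_def)
  qed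
  have "(\<Sum>a\<in>spec T. gcomp T a v) \<in> gev ?N 0" for v
    using g0[OF comp_gev[OF T]] by (intro subspace_sum subspace_gev N)
  then show ?thesis using sum_comp[OF T] nilp_gev[OF N] by auto
qed

lemma ex_gev_basis:
  assumes T: "lin T" obtains C m where "is_basis C" "\<And>c. c \<in> C \<Longrightarrow> c \<in> gev T (m c)"
proof -
  have "v \<in> span (\<Union>a. gev T a)" for v
    using gev_span[OF T subspace_UNIV, of v] by simp
  then obtain C where C: "is_basis C" "C \<subseteq> (\<Union>a. gev T a)" using ex_basis_subset by (metis UNIV_eq_I)
  then have "\<forall>c\<in>C. \<exists>a. c \<in> gev T a" by blast
  then obtain m where "\<forall>c\<in>C. c \<in> gev T (m c)" by metis
  with C that show thesis by blast
qed

text \<open>Write \<open>T\<close> as \<open>opg T (\<lambda>a. a)\<close> plus a nilpotent. The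
  nilpotent commutes with \<open>opg T cnj\<close>, so its contribution to the trace vanishes and
  the sum of the squared moduli of the eigenvalues remains.\<close>

lemma tr_opg_cnj:
  assumes T: "lin T" and t: "tr (\<lambda>z. opg T cnj (T z)) = 0"
  shows "nilp T"
proof -
  note lo = lin_opg[OF T]
  let ?N = "\<lambda>z. T z - opg T (\<lambda>a. a) z"
  have N: "lin ?N" by (intro lin_minus T lo)
  have comm: "opg T cnj (?N x) = ?N (opg T cnj x)" for x
  proof -
    have 1: "opg T cnj (T x) = T (opg T cnj x)" for x using opg_commute[OF T T, of cnj x] by simp
    have "opg T cnj (opg T (\<lambda>a. a) x) = opg T (\<lambda>a. a) (opg T cnj x)"
      by (rule opg_commute[OF T lo 1])
    then show ?thesis using 1 lo by (simp add: lin_diff)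
  qed
  have "nilp (\<lambda>z. opg T cnj (?N z))"
    using nilp_commute[where S = "opg T cnj" and T = ?N] lo comm nilp_opg_part[OF T] by blast
  then have "tr (\<lambda>z. opg T cnj (?N z)) = 0"
    using tr_nilp lin_compose[where S = "opg T cnj" and T = ?N] lo N by blast
  then have 0: "tr (\<lambda>z. opg T cnj (opg T (\<lambda>a. a) z)) = 0"
    using t tr_diff[of "\<lambda>z. opg T cnj (T z)" "\<lambda>z. opg T cnj (opg T (\<lambda>a. a) z)"]
    unfolding lin_diff[OF lo] by (metis diff_0_right diff_eq_diff_eq eq_iff_diff_eq_0)
  obtain C m where C: "is_basis C" "\<And>c. c \<in> C \<Longrightarrow> c \<in> gev T (m c)" using ex_gev_basis[OF T] by blast
  have fC: "finite C" using C is_basis_finite by blast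
  have "opg T cnj (opg T (\<lambda>a. a) c) = (m c * cnj (m c)) *s c" if "c \<in> C" for c
    using opg_gev[OF T C(2)[OF that]] lo by (simp add: lin_scale)
  from tr_eigenbasis[OF C(1) lin_compose[OF lo lo] this] 0
  have "(\<Sum>c\<in>C. m c * cnj (m c)) = 0" by simp
  then have "complex_of_real (\<Sum>c\<in>C. (cmod (m c))\<^sup>2) = 0"
    by (simp add: complex_norm_square del: of_real_power)
  then have "(\<Sum>c\<in>C. (cmod (m c))\<^sup>2) = 0" using of_real_eq_0_iff by blast
  then have "m c = 0" if "c \<in> C" for c
    using that fC by (simp add: sum_nonneg_eq_0_iff)
  then have "C \<subseteq> gev T 0" using C(2) by force
  then have "span C \<subseteq> gev T 0" using span_minimal subspace_gev[OF T] by blast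
  then show ?thesis using C(1) nilp_gev[OF T] by (auto simp: is_basis_def)
qed

subsection \<open>The Killing form\<close>

definition kf :: "'g \<Rightarrow> 'g \<Rightarrow> complex" where
  "kf x y = tr (\<lambda>z. br x (br y z))"

lemma is_form_kf: "is_form kf"
  unfolding is_form_def kf_def
  using tr_cyclic[OF lin_br lin_br] by (auto simp: br_add br_scale tr_add tr_scale)

lemmas kf_simps = form_simps[OF is_form_kf]
lemmas kf_sum = form_sum[OF is_form_kf]
lemmas kf_sym = form_sym[OF is_form_kf]

lemma tr_cyclic3:
  assumes "lin R" "lin S" "lin T"
  shows "tr (\<lambda>x. R (S (T x))) = tr (\<lambda>x. S (T (R x)))"
  using tr_cyclic[OF assms(1) lin_compose[OF assms(2,3)]] .

lemma kf_inv: "kf (br x y) z = kf x (br y z)"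
proof -
  have "kf (br x y) z = tr (\<lambda>w. br x (br y (br z w))) - tr (\<lambda>w. br y (br x (br z w)))"
    unfolding kf_def br_br tr_diff ..
  moreover have "kf x (br y z) = tr (\<lambda>w. br x (br y (br z w))) - tr (\<lambda>w. br x (br z (br y w)))"
    unfolding kf_def br_br br_lin tr_diff ..
  ultimately show ?thesis using tr_cyclic3[OF lin_br lin_br lin_br, of y x z] by simp
qed

lemma kf_inv': "kf (br x y) z = - kf y (br x z)"
  using kf_inv[of y x z] br_skew[of x y] by (simp add: kf_simps)

text \<open>The commutator of \<open>D\<close> and ad a is ad (D a), and cyclicity moves one factor.
  Traces of a derivation against brackets thus become values of the Killing form.\<close>

lemma tr_der_br:
  assumes D: "der D" shows "tr (\<lambda>z. D (br (br a b) z)) = kf (D a) b"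
proof -
  have l: "lin D" using D by (rule der_lin)
  have "tr (\<lambda>z. D (br (br a b) z)) = tr (\<lambda>z. D (br a (br b z))) - tr (\<lambda>z. D (br b (br a z)))"
    unfolding br_br lin_diff[OF l] tr_diff ..
  moreover have "kf (D a) b = tr (\<lambda>z. D (br a (br b z))) - tr (\<lambda>z. br a (D (br b z)))"
  proof -
    have "br (D a) (br b z) = D (br a (br b z)) - br a (D (br b z))" for z
      using der_br[OF D, of a "br b z"] by simp
    then show ?thesis unfolding kf_def by (simp add: tr_diff)
  qed
  ultimately show ?thesis using tr_cyclic3[OF lin_br[of a] l lin_br[of b]] by simp
qed

text \<open>ad x and ad y commute, so their product inherits nilpotence and has trace zero. This is
  the source of most orthogonality relations below.\<close>

lemma kf_nilp_commute:
  assumes "nilp (br x)" "br x y = 0"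
  shows "kf x y = 0"
proof -
  have c: "br y (br x z) = br x (br y z)" for z
    using jacobi[of x y z] assms(2) by (simp add: br_lin)
  have "kf y x = 0" unfolding kf_def
    by (rule tr_nilp[OF lin_compose[OF lin_br lin_br] nilp_commute[OF lin_br c assms(1)]])
  then show ?thesis using kf_sym by simp
qed

subsection \<open>Engel's theorem\<close>

abbreviation prodspan :: "'g set \<Rightarrow> 'g set \<Rightarrow> 'g set" where
  "prodspan A B \<equiv> brk_span sc br A B"

lemma prodspan_mono: "A \<subseteq> A' \<Longrightarrow> B \<subseteq> B' \<Longrightarrow> prodspan A B \<subseteq> prodspan A' B'"
  unfolding brk_span_def by (rule span_mono) blast

lemma prodspan_mem: "x \<in> A \<Longrightarrow> y \<in> B \<Longrightarrow> br x y \<in> prodspan A B"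
  unfolding brk_span_def by (rule span_base) blast

lemma prodspan_minimal: "subspace W \<Longrightarrow> (\<And>x y. x \<in> A \<Longrightarrow> y \<in> B \<Longrightarrow> br x y \<in> W) \<Longrightarrow> prodspan A B \<subseteq> W"
  unfolding brk_span_def by (rule span_minimal) blast

lemma subspace_prodspan: "subspace (prodspan A B)"
  unfolding brk_span_def by (rule subspace_span)

lemma funpow_prodspan_mono: "A \<subseteq> B \<Longrightarrow> (prodspan M ^^ k) A \<subseteq> (prodspan M ^^ k) B"
  by (induction k) (auto intro: prodspan_mono[THEN subsetD, rotated 2])

definition subalg :: "'g set \<Rightarrow> bool" where
  "subalg M \<longleftrightarrow> subspace M \<and> (\<forall>x\<in>M. \<forall>y\<in>M. br x y \<in> M)"

text \<open>A maximal subalgebra \<open>M\<close> acting nilpotently is normalised by some \<open>y\<close> outside it, and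
  \<open>M + \<complex>y\<close> still acts nilpotently.\<close>
lemma engel:
  assumes N: "subalg N" and nil: "\<And>x. x \<in> N \<Longrightarrow> nilp (br x)"
  shows "\<exists>k. (prodspan N ^^ k) UNIV = {0}"
proof -
  define P where "P M \<longleftrightarrow> subalg M \<and> M \<subseteq> N \<and> (\<exists>k. (prodspan M ^^ k) UNIV = {0})" for M
  have "P {0}" unfolding P_def
  proof (intro conjI exI[of _ 1])
    show "(prodspan {0} ^^ 1) UNIV = {0}"
      using prodspan_minimal[of "{0}" "{0}" UNIV] subspace_0[OF subspace_prodspan] by (auto simp: br_lin)
    show "subalg {0}" by (simp add: subalg_def br_lin)
    show "{0} \<subseteq> N" using N by (auto simp: subalg_def subspace_0)
  qed
  moreover have "\<forall>M. P M \<longrightarrow> dim M < Suc dimension" using dim_subset_UNIV by (simp add: le_imp_less_Suc)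
  ultimately obtain M where M: "P M" and max: "\<And>M'. P M' \<Longrightarrow> dim M' \<le> dim M"
    using ex_has_greatest_nat[of P "{0}" dim "Suc dimension"] by (metis less_imp_le)
  obtain k where k: "(prodspan M ^^ k) UNIV = {0}" using M unfolding P_def by blast
  have sM: "subspace M" and cM: "\<And>x y. x \<in> M \<Longrightarrow> y \<in> M \<Longrightarrow> br x y \<in> M" and MN: "M \<subseteq> N"
    using M by (auto simp: P_def subalg_def)
  have "M = N"
  proof (rule ccontr)
    assume ne: "M \<noteq> N"
    let ?W = "\<lambda>j. (prodspan M ^^ j) N"
    have WN: "?W j \<subseteq> N" for j
    proof (induction j)
      case (Suc j)
      have "prodspan M (?W j) \<subseteq> N"
        by (rule prodspan_minimal) (use N MN Suc in \<open>auto simp: subalg_def\<close>)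
      then show ?case by simp
    qed simp
    \<comment> \<open>Repeated bracketing with \<open>M\<close> drives \<open>N\<close> into
      \<open>M\<close>; the last iterate that is not inside \<open>M\<close> contains an element
      outside \<open>M\<close> which \<open>M\<close> brackets into \<open>M\<close>.\<close>
    have Wk: "?W k \<subseteq> M" using funpow_prodspan_mono[of N UNIV k M] k sM by (auto simp: subspace_0)
    define j where "j = (LEAST j. ?W j \<subseteq> M)"
    have j: "?W j \<subseteq> M" unfolding j_def using Wk by (rule LeastI)
    have "j \<noteq> 0" using j ne MN by auto
    then obtain i where i: "j = Suc i" by (cases j) auto
    have "\<not> ?W i \<subseteq> M" using not_less_Least[of i "\<lambda>j. ?W j \<subseteq> M"] i by (simp add: j_def)
    then obtain y where y: "y \<in> ?W i" "y \<notin> M" by blast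
    have yN: "y \<in> N" using WN y by blast
    have My: "br m y \<in> M" if "m \<in> M" for m using prodspan_mem[OF that y(1)] j i by auto
    have yM: "br y m \<in> M" if "m \<in> M" for m
      using My[OF that] br_skew[of y m] sM by (simp add: subspace_neg)
    define M' where "M' = {m + c *s y |m c. m \<in> M}"
    have M'N: "M' \<subseteq> N" using MN yN N by (auto simp: M'_def subalg_def intro!: subspace_add subspace_scale)
    have sM': "subspace M'"
    proof (rule subspaceI)
      have "0 = 0 + 0 *s y" by simp
      then show "0 \<in> M'" unfolding M'_def using subspace_0[OF sM] by blast
      show "u + v \<in> M'" if uv: "u \<in> M'" "v \<in> M'" for u v
      proof -
        obtain m c m' c' where "u = m + c *s y" "v = m' + c' *s y" "m \<in> M" "m' \<in> M"
          using uv by (auto simp: M'_def)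
        then have "u + v = (m + m') + (c + c') *s y" "m + m' \<in> M" using sM
          by (auto simp: scale_left_distrib algebra_simps subspace_add)
        then show ?thesis unfolding M'_def by blast
      qed
      show "a *s u \<in> M'" if u: "u \<in> M'" for a u
      proof -
        obtain m c where "u = m + c *s y" "m \<in> M" using u by (auto simp: M'_def)
        then have "a *s u = a *s m + (a * c) *s y" "a *s m \<in> M" using sM
          by (auto simp: scale_right_distrib subspace_scale)
        then show ?thesis unfolding M'_def by blast
      qed
    qed
    have MM': "M \<subseteq> M'"
    proof
      fix m assume "m \<in> M"
      moreover have "m = m + 0 *s y" by simp
      ultimately show "m \<in> M'" unfolding M'_def by blast
    qed
    have subM': "subalg M'"
      unfolding subalg_def
    proof (intro conjI ballI)
      fix u v assume "u \<in> M'" "v \<in> M'"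
      then obtain m c m' c' where "u = m + c *s y" "v = m' + c' *s y" "m \<in> M" "m' \<in> M"
        by (auto simp: M'_def)
      then have "br u v \<in> M" using cM My yM sM
        by (auto simp: br_lin br_self intro!: subspace_add subspace_scale)
      then show "br u v \<in> M'" using MM' by blast
    qed (rule sM')
    let ?U = "\<lambda>i. (prodspan M ^^ i) UNIV"
    have sU: "subspace (?U i)" for i by (cases i) (auto simp: subspace_prodspan)
    have decU: "?U (Suc i) \<subseteq> ?U i" for i
    proof (induction i)
      case (Suc i)
      have "prodspan M (?U (Suc i)) \<subseteq> prodspan M (?U i)" by (rule prodspan_mono[OF order.refl Suc])
      then show ?case by simp
    qed simp
    have MU: "br m u \<in> ?U (Suc i)" if "m \<in> M" "u \<in> ?U i" for m u and i :: nat using prodspan_mem[OF that] by simp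
    have yU: "br y u \<in> ?U i" if "u \<in> ?U i" for u and i :: nat
      using that
    proof (induction i arbitrary: u)
      case (Suc i)
      have "?U (Suc i) \<subseteq> {u. br y u \<in> ?U (Suc i)}"
      proof -
        have "prodspan M (?U i) \<subseteq> {u. br y u \<in> ?U (Suc i)}"
        proof (rule prodspan_minimal[OF lin_subspace_vimage[OF lin_br sU]])
          fix m u assume mu: "m \<in> M" "u \<in> ?U i"
          have "br (br y m) u \<in> ?U (Suc i)" by (rule MU[OF yM[OF mu(1)] mu(2)])
          moreover have "br m (br y u) \<in> ?U (Suc i)" by (rule MU[OF mu(1) Suc.IH[OF mu(2)]])
          ultimately show "br m u \<in> {u. br y u \<in> ?U (Suc i)}"
            using sU[of "Suc i"] by (simp add: jacobi[of y m u] subspace_add)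
        qed
        then show ?thesis by simp
      qed
      then show ?case using Suc.prems by blast
    qed simp
    obtain p where p: "\<And>v. (br y ^^ p) v = 0" using nil[OF yN] unfolding nilp_def by blast
    \<comment> \<open>\<open>M\<close> maps \<open>?U i\<close> into the next term of the
      filtration, so modulo that term a product of \<open>j\<close> factors from \<open>M'\<close>
      reduces to the \<open>j\<close>-th power of ad y.\<close>
    have stepj: "(prodspan M' ^^ j) (?U i) \<subseteq> {u + v |u v. u \<in> (br y ^^ j) ` (?U i) \<and> v \<in> ?U (Suc i)}" for i j
    proof (induction j)
      case 0
      have "u = u + 0" for u :: 'g by simp
      then show ?case using subspace_0[OF sU] by fastforce
    next
      case (Suc j)
      let ?R = "{u + v |u v. u \<in> (br y ^^ Suc j) ` (?U i) \<and> v \<in> ?U (Suc i)}"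
      have "prodspan M' ((prodspan M' ^^ j) (?U i)) \<subseteq> ?R"
      proof (rule prodspan_minimal)
        show "subspace ?R" by (rule subspace_sums[OF lin_subspace_image[OF lin_funpow[OF lin_br] sU] sU])
        fix x w assume x: "x \<in> M'" and w: "w \<in> (prodspan M' ^^ j) (?U i)"
        obtain m c where mc: "x = m + c *s y" "m \<in> M" using x by (auto simp: M'_def)
        obtain u v where uv: "w = (br y ^^ j) u + v" "u \<in> ?U i" "v \<in> ?U (Suc i)" using w Suc by blast
        have yj: "(br y ^^ j) u \<in> ?U i" using uv(2) by (induction j) (auto intro: yU)
        have "c *s br y ((br y ^^ j) u) = (br y ^^ Suc j) (c *s u)"
          using lin_funpow[OF lin_br[of y], of j] by (simp add: lin_scale br_lin)
        then have 1: "br x w = (br y ^^ Suc j) (c *s u) + (br m ((br y ^^ j) u) + br m v + c *s br y v)"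
          unfolding mc uv by (simp add: br_lin scale_right_distrib algebra_simps)
        have 2: "br m ((br y ^^ j) u) + br m v + c *s br y v \<in> ?U (Suc i)"
        proof (intro subspace_add subspace_scale sU)
          show "br m ((br y ^^ j) u) \<in> ?U (Suc i)" by (rule MU[OF mc(2) yj])
          show "br m v \<in> ?U (Suc i)" using MU[OF mc(2) uv(3)] decU[of "Suc i"] by blast
          show "br y v \<in> ?U (Suc i)" by (rule yU[OF uv(3)])
        qed
        have 3: "(br y ^^ Suc j) (c *s u) \<in> (br y ^^ Suc j) ` (?U i)"
          using uv(2) sU by (auto intro: subspace_scale)
        show "br x w \<in> ?R" using 1 2 3 by blast
      qed
      then show ?case by simp
    qed
    have stepp: "(prodspan M' ^^ p) (?U i) \<subseteq> ?U (Suc i)" for i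
    proof -
      have "(br y ^^ p) ` (?U i) \<subseteq> {0}" using p by auto
      then have "{u + v |u v. u \<in> (br y ^^ p) ` (?U i) \<and> v \<in> ?U (Suc i)} \<subseteq> ?U (Suc i)" by fastforce
      then show ?thesis using stepj[of p i] by (rule order.trans[rotated])
    qed
    have "(prodspan M' ^^ (i * p)) UNIV \<subseteq> ?U i" for i
    proof (induction i)
      case (Suc i)
      have "(prodspan M' ^^ (Suc i * p)) UNIV = (prodspan M' ^^ p) ((prodspan M' ^^ (i * p)) UNIV)"
        by (simp add: funpow_add)
      also have "\<dots> \<subseteq> (prodspan M' ^^ p) (?U i)" by (rule funpow_prodspan_mono[OF Suc])
      also have "\<dots> \<subseteq> ?U (Suc i)" by (rule stepp)
      finally show ?case .
    qed simp
    from this[of k] have "(prodspan M' ^^ (k * p)) UNIV \<subseteq> {0}" using k by simp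
    moreover have "subspace ((prodspan M' ^^ n) UNIV)" for n by (cases n) (auto simp: subspace_prodspan)
    ultimately have "(prodspan M' ^^ (k * p)) UNIV = {0}" using subspace_0 by blast
    then have "P M'" unfolding P_def using subM' M'N by blast
    then have "dim M' \<le> dim M" by (rule max)
    then have "M = M'" using subspace_dim_equal[OF sM sM' MM'] by blast
    moreover have "y \<in> M'"
    proof -
      have "y = 0 + 1 *s y" by simp
      then show ?thesis unfolding M'_def using subspace_0[OF sM] by blast
    qed
    ultimately show False using y by blast
  qed
  then show ?thesis using k by blast
qed

lemma derived_series_subset:
  assumes "subalg N"
  shows "derived_series sc br N n \<subseteq> N \<and> derived_series sc br N n \<subseteq> (prodspan N ^^ n) UNIV"
proof (induction n)
  case (Suc n)
  have "prodspan (derived_series sc br N n) (derived_series sc br N n) \<subseteq> N"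
    by (rule prodspan_minimal) (use assms Suc in \<open>auto simp: subalg_def\<close>)
  moreover have "prodspan (derived_series sc br N n) (derived_series sc br N n) \<subseteq> prodspan N ((prodspan N ^^ n) UNIV)"
    using Suc by (intro prodspan_mono) auto
  ultimately show ?case by simp
qed simp

text \<open>Let \<open>R\<close> be the radical of the form. For \<open>x \<in> [R, R]\<close> the derivation \<open>D = opg (ad x) cnj\<close> satisfies
  \<open>tr (D \<circ> ad x) = 0\<close>, because \<open>tr (D \<circ> ad [a, b])\<close> is the form at \<open>(D a, b)\<close>; so \<open>ad x\<close> is nilpotent.\<close>
lemma kf_nondeg:
  assumes ss: "semisimple_lie sc br"
  shows "nondeg kf UNIV"
proof -
  define R where "R = {x. \<forall>y. kf x y = 0}"
  have sR: "subspace R" by (rule subspaceI) (auto simp: R_def kf_simps)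
  have idR: "br x y \<in> R" if "y \<in> R" for x y using that kf_inv'[of x y] by (auto simp: R_def)
  let ?I = "prodspan R R"
  have IR: "?I \<subseteq> R" by (rule prodspan_minimal[OF sR]) (rule idR)
  have idI: "br x y \<in> ?I" if y: "y \<in> ?I" for x y
  proof -
    have "?I \<subseteq> {y. br x y \<in> ?I}"
    proof (rule prodspan_minimal[OF lin_subspace_vimage[OF lin_br subspace_prodspan]])
      fix u v assume uv: "u \<in> R" "v \<in> R"
      have "br (br x u) v \<in> ?I" "br u (br x v) \<in> ?I" using uv idR by (auto intro: prodspan_mem)
      then show "br u v \<in> {y. br x y \<in> ?I}" using jacobi[of x u v] subspace_add[OF subspace_prodspan] by simp
    qed
    then show ?thesis using y by blast
  qed
  have subI: "subalg ?I" using idI by (auto simp: subalg_def subspace_prodspan)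
  have nil: "nilp (br x)" if x: "x \<in> ?I" for x
  proof (rule tr_opg_cnj[OF lin_br])
    let ?D = "opg (br x) cnj"
    have D: "der ?D" by (rule der_opg[OF der_ad]) simp
    have s: "subspace {x'. tr (\<lambda>z. ?D (br x' z)) = 0}"
      by (rule subspaceI) (auto simp: br_lin lin_0[OF der_lin[OF D]] tr_zero lin_add[OF der_lin[OF D]] tr_add
          lin_scale[OF der_lin[OF D]] tr_scale)
    have "?I \<subseteq> {x'. tr (\<lambda>z. ?D (br x' z)) = 0}"
    proof (rule prodspan_minimal[OF s])
      fix a b assume "a \<in> R" "b \<in> R"
      then show "br a b \<in> {x'. tr (\<lambda>z. ?D (br x' z)) = 0}"
        using tr_der_br[OF D, of a b] kf_sym[of "?D a" b] by (simp add: R_def)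
    qed
    then show "tr (\<lambda>z. ?D (br x z)) = 0" using x by blast
  qed
  obtain k where k: "(prodspan ?I ^^ k) UNIV = {0}" using engel[OF subI nil] by blast
  \<comment> \<open>The derived series is dominated by the iterated brackets of
    \<open>engel\<close>, so \<open>[R, R]\<close> is a solvable ideal and vanishes; then
    \<open>R\<close> is abelian, hence solvable, and vanishes too.\<close>
  have "derived_series sc br ?I k = {0}"
  proof -
    have "0 \<in> derived_series sc br ?I k" by (cases k) (auto intro: subspace_0 subspace_prodspan)
    then show ?thesis using derived_series_subset[OF subI, of k] k by auto
  qed
  moreover have "lie_ideal sc br ?I" using idI by (simp add: lie_ideal_def subspace_prodspan)
  ultimately have I0: "?I = {0}" using ss unfolding semisimple_lie_def solvable_lie_def by blast
  have "derived_series sc br R 1 = {0}" using I0 by simp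
  moreover have "lie_ideal sc br R" using idR sR by (simp add: lie_ideal_def)
  ultimately have "R = {0}" using ss unfolding semisimple_lie_def solvable_lie_def by blast
  then show ?thesis unfolding nondeg_def R_def by auto
qed

subsection \<open>Semisimple elements\<close>

lemma comp_shift:
  assumes x: "x \<in> gev (br s) c"
  shows "gcomp (br s) (a + c) (br x v) = br x (gcomp (br s) a v)"
proof -
  let ?w = "\<lambda>b. br x (gcomp (br s) (b - c) v)"
  have "gcomp (br s) (a + c) (br x v) = ?w (a + c)"
  proof (rule comp_eqI[OF lin_br, where F = "(\<lambda>a. a + c) ` spec (br s)"])
    show "?w b \<in> gev (br s) b" for b
      using gev_br[OF der_ad x comp_gev[OF lin_br], of "b - c"] by simp
    show "finite ((\<lambda>a. a + c) ` spec (br s))" using finite_spec[OF lin_br] by blast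
    show "?w b = 0" if b: "b \<notin> (\<lambda>a. a + c) ` spec (br s)" for b
    proof -
      have "b - c \<notin> spec (br s)" using b by (metis diff_add_cancel image_eqI)
      then show ?thesis using comp_not_spec[OF lin_br] by (simp add: br_lin)
    qed
    have "br x v = br x (\<Sum>a\<in>spec (br s). gcomp (br s) a v)" using sum_comp[OF lin_br] by simp
    also have "\<dots> = (\<Sum>b\<in>(\<lambda>a. a + c) ` spec (br s). ?w b)"
      by (subst sum.reindex) (auto simp: br_sum inj_on_def)
    finally show "br x v = (\<Sum>b\<in>(\<lambda>a. a + c) ` spec (br s). ?w b)" .
  qed
  then show ?thesis by simp
qed

text \<open>Each application of ad x shifts the eigenvalue of ad s by \<open>c\<close>. This runs
  through infinitely many values, while the spectrum is finite.\<close>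

lemma gev_nilp:
  assumes x: "x \<in> gev (br s) c" and c: "c \<noteq> 0"
  shows "nilp (br x)"
proof -
  have sh: "(br x ^^ n) v \<in> gev (br s) (a + of_nat n * c)" if "v \<in> gev (br s) a" for v a n
  proof (induction n)
    case (Suc n)
    from gev_br[OF der_ad x Suc] show ?case by (simp add: algebra_simps)
  qed (use that in simp)
  have g: "v \<in> gev (br x) 0" if v: "v \<in> gev (br s) a" for v a
  proof -
    have "inj (\<lambda>n. a + of_nat n * c)" using c by (auto intro!: injI)
    then have "infinite (range (\<lambda>n. a + of_nat n * c))" using finite_imageD by blast
    then have "\<not> range (\<lambda>n. a + of_nat n * c) \<subseteq> spec (br s)"
      using finite_spec[OF lin_br, of s] finite_subset by metis
    then obtain n where "a + of_nat n * c \<notin> spec (br s)" by blast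
    then have "(br x ^^ n) v = 0" using sh[OF v, of n] by (auto simp: spec_def)
    then show ?thesis by (auto simp: gev_def)
  qed
  have "(\<Sum>a\<in>spec (br s). gcomp (br s) a v) \<in> gev (br x) 0" for v
    by (rule subspace_sum[OF subspace_gev[OF lin_br]]) (rule g[OF comp_gev[OF lin_br]])
  then show ?thesis using sum_comp[OF lin_br] nilp_gev[OF lin_br] by auto
qed

lemma eigen_nilp:
  assumes "br s x = c *s x" "c \<noteq> 0"
  shows "nilp (br x)"
  using gev_nilp[OF eigenvector_gev] assms by blast

definition semis :: "'g \<Rightarrow> bool" where "semis s \<longleftrightarrow> diag (br s)"

lemma semis_gev: "semis s \<Longrightarrow> gev (br s) a = {v. br s v = a *s v}"
  by (simp add: semis_def diag_gev)

lemma semis_comp: "semis s \<Longrightarrow> br s (gcomp (br s) a v) = a *s gcomp (br s) a v"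
  using comp_gev[OF lin_br] semis_gev by blast

lemma semisI: "(\<And>v. v \<in> span {v. \<exists>a. br s v = a *s v}) \<Longrightarrow> semis s"
  unfolding semis_def by (rule diagI[OF lin_br])

lemma comp_self: "gcomp (br s) 0 s = s"
  using comp_of_gev[OF lin_br eigenvector_gev[of "br s" s 0], of 0] by (simp add: br_self)

lemma comp_0_fix: "br s v = 0 \<Longrightarrow> gcomp (br s) a v = (if a = 0 then v else 0)"
  using comp_of_gev[OF lin_br eigenvector_gev[of "br s" v 0], of a] by simp

lemma semis_joint_span:
  assumes s: "semis s" "semis s'" "br s s' = 0" and W: "subspace W" "\<And>v. v \<in> W \<Longrightarrow> br s v \<in> W" "\<And>v. v \<in> W \<Longrightarrow> br s' v \<in> W"
    and v: "v \<in> W"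
  shows "v \<in> span {v \<in> W. \<exists>a b. br s v = a *s v \<and> br s' v = b *s v}"
proof -
  let ?E = "{v \<in> W. \<exists>a b. br s v = a *s v \<and> br s' v = b *s v}"
  have comm: "br s (br s' x) = br s' (br s x)" for x
    using jacobi[of s s' x] s(3) by (simp add: br_lin)
  have 1: "u \<in> span ?E" if u: "u \<in> W" "br s u = a *s u" for u a
  proof -
    let ?Wa = "W \<inter> {u. br s u = a *s u}"
    have "subspace ?Wa" using W(1) lin_subspace_kernel[OF lin_shift[OF lin_br, of s a]]
      by (intro subspace_inter) auto
    moreover have "br s' x \<in> ?Wa" if "x \<in> ?Wa" for x using that W comm by (auto simp: br_lin)
    ultimately have "gcomp (br s') b u \<in> ?Wa" for b
      using comp_mem[OF lin_br, of ?Wa s' u b] u by blast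
    then have "gcomp (br s') b u \<in> ?E" for b using semis_comp[OF s(2)] by blast
    then have "(\<Sum>b\<in>spec (br s'). gcomp (br s') b u) \<in> span ?E" by (intro span_sum span_base)
    then show ?thesis using sum_comp[OF lin_br] by simp
  qed
  have "gcomp (br s) a v \<in> span ?E" for a
    using 1[OF comp_mem[OF lin_br W(1,2) v] semis_comp[OF s(1)]] by blast
  then have "(\<Sum>a\<in>spec (br s). gcomp (br s) a v) \<in> span ?E" by (intro span_sum)
  then show ?thesis using sum_comp[OF lin_br] by simp
qed

lemma semis_add:
  assumes s: "semis s" "semis s'" "br s s' = 0"
  shows "semis (s + c *s s')"
proof (rule semisI)
  fix v
  have "v \<in> span {v \<in> UNIV. \<exists>a b. br s v = a *s v \<and> br s' v = b *s v}"
    by (rule semis_joint_span[OF s]) auto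
  moreover have "{v \<in> UNIV. \<exists>a b. br s v = a *s v \<and> br s' v = b *s v} \<subseteq> {v. \<exists>a. br (s + c *s s') v = a *s v}"
  proof clarify
    fix v a b assume "br s v = a *s v" "br s' v = b *s v"
    then have "br (s + c *s s') v = (a + c * b) *s v" by (simp add: br_lin scale_left_distrib)
    then show "\<exists>a. br (s + c *s s') v = a *s v" by blast
  qed
  ultimately show "v \<in> span {v. \<exists>a. br (s + c *s s') v = a *s v}" using span_mono by blast
qed

lemma semis_scale: "semis s \<Longrightarrow> semis (c *s s)"
  using semis_add[of 0 s c] diagI[OF lin_br[of 0]] span_base
  by (auto simp: br_lin semis_def)

text \<open>The common centraliser of a commuting semisimple pair thereby becomes the centraliser of
  a single semisimple element.\<close>

lemma semis_generic:
  assumes s: "semis s" "semis s'" "br s s' = 0"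
  obtains c where "semis (s + c *s s')" "\<And>v. br (s + c *s s') v = 0 \<longleftrightarrow> br s v = 0 \<and> br s' v = 0"
proof -
  \<comment> \<open>The excluded values are those for which eigenvalues \<open>a\<close> and
    \<open>b\<close> could cancel in a + c b; excluding 0 keeps \<open>c\<close> invertible.\<close>
  let ?F = "insert 0 ((\<lambda>(a, b). - a / b) ` (spec (br s) \<times> spec (br s')))"
  have "finite ?F" using finite_spec[OF lin_br] by blast
  then obtain c where c: "c \<notin> ?F" using ex_new_if_finite[OF infinite_UNIV_char_0] by blast
  have comm: "br s (br s' x) = br s' (br s x)" for x
    using jacobi[of s s' x] s(3) by (simp add: br_lin)
  have "br s v = 0 \<and> br s' v = 0" if v: "br (s + c *s s') v = 0" for v
  proof -
    have z: "gcomp (br s) a v = 0" if a: "a \<noteq> 0" for a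
    proof (rule ccontr)
      let ?u = "gcomp (br s) a v"
      assume u: "?u \<noteq> 0"
      have "br (s + c *s s') ?u = gcomp (br s) a (br (s + c *s s') v)"
        by (rule comp_commute[symmetric, OF lin_br lin_br]) (simp add: br_lin comm)
      then have "a *s ?u + c *s br s' ?u = 0"
        using v semis_comp[OF s(1)] lin_0[OF lin_comp[OF lin_br]] by (simp add: br_lin)
      then have "c *s br s' ?u = (- a) *s ?u" by (simp add: eq_neg_iff_add_eq_0 add.commute)
      then have "(1 / c) *s (c *s br s' ?u) = (1 / c) *s ((- a) *s ?u)" by simp
      then have e: "br s' ?u = (- a / c) *s ?u" using c by simp
      then have "- a / c \<in> spec (br s')" using u eigenvector_gev[of "br s'" ?u] by (auto simp: spec_def)
      moreover have "a \<in> spec (br s)" using u comp_not_spec[OF lin_br] by blast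
      ultimately have "- a / (- a / c) \<in> ?F" by (intro insertI2 image_eqI[of _ _ "(a, - a / c)"]) auto
      then show False using c a by simp
    qed
    have "(\<Sum>a\<in>spec (br s). gcomp (br s) a v) = (\<Sum>a\<in>spec (br s). if a = 0 then gcomp (br s) 0 v else 0)"
      by (rule sum.cong) (use z in auto)
    then have "v = gcomp (br s) 0 v"
      using sum_comp[OF lin_br, of s v] finite_spec[OF lin_br, of s] comp_not_spec[OF lin_br, of 0 s v] by (auto split: if_splits)
    then have "br s v = 0" using semis_comp[OF s(1), of 0 v] by simp
    moreover from this v have "br s' v = 0" using c by (simp add: br_lin)
    ultimately show ?thesis by blast
  qed
  moreover have "br (s + c *s s') v = 0" if "br s v = 0 \<and> br s' v = 0" for v using that by (simp add: br_lin)
  ultimately show thesis using that[of c] semis_add[OF s] by blast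
qed

lemma kf_eigen:
  assumes "br s x = a *s x" "br s y = b *s y" "a + b \<noteq> 0"
  shows "kf x y = 0"
proof -
  have "a * kf x y = kf (br s x) y" using assms by (simp add: kf_simps)
  also have "\<dots> = - b * kf x y" unfolding kf_inv' assms(2) by (simp add: kf_simps)
  finally have "(a + b) * kf x y = 0" by (simp add: algebra_simps)
  then show ?thesis using assms by simp
qed

lemma kf_range: "br s x = 0 \<Longrightarrow> kf x (br s y) = 0"
  using kf_inv'[of s x y] by (simp add: kf_simps)

end

section \<open>Inner derivations, Jordan decomposition and the class \<open>good\<close>\<close>

locale sslie = lie sc Basis br
  for sc :: "complex \<Rightarrow> 'g::ab_group_add \<Rightarrow> 'g" (infixr "*s" 75) and Basis br +
  assumes kf_nd: "nondeg kf UNIV"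
begin

lemma br_faithful: "(\<And>v. br x v = 0) \<Longrightarrow> x = 0"
  using kf_nd tr_zero unfolding nondeg_def kf_def by auto

text \<open>Let \<open>d\<close> represent the functional that sends z to the trace of D composed
  with ad z. Then D - ad d is a derivation with trace zero against every ad z, so by
  \<open>tr_der_br\<close> all its values are orthogonal to the whole algebra.\<close>

lemma der_inner:
  assumes D: "der D" obtains d where "\<And>v. br d v = D v"
proof -
  have l: "lin D" using D by (rule der_lin)
  obtain d where d: "\<And>z. kf d z = tr (\<lambda>v. D (br z v))"
    using nondeg_represent[OF is_form_kf kf_nd, of "\<lambda>z. tr (\<lambda>v. D (br z v))"]
    by (auto simp: br_lin lin_add[OF l] lin_scale[OF l] tr_add tr_scale)
  define E where "E v = D v - br d v" for v
  have E: "der E"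
    unfolding der_def
  proof (intro conjI allI)
    show "lin E" using lin_minus[OF l lin_br[of d]] by (simp add: E_def[abs_def])
    show "E (br x y) = br (E x) y + br x (E y)" for x y
      using der_br[OF D, of x y] jacobi[of d x y] by (simp add: E_def br_lin algebra_simps)
  qed
  have E0: "tr (\<lambda>v. E (br z v)) = 0" for z
    using d[of z] by (simp add: E_def tr_diff kf_def)
  have "kf (E a) b = 0" for a b using tr_der_br[OF E, of a b] E0 by simp
  then have "E a = 0" for a using kf_nd by (simp add: nondeg_def)
  then show thesis using that[of d] by (simp add: E_def)
qed

lemma opg_inner:
  assumes "\<And>a b. g (a + b) = g a + g b"
  obtains s where "\<And>v. br s v = opg (br x) g v" "\<And>y. br x y = 0 \<Longrightarrow> br s y = 0"
proof -
  obtain s where s: "\<And>v. br s v = opg (br x) g v" using der_inner[OF der_opg[OF der_ad assms]] by blast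
  have "g 0 = 0" using assms[of 0 0] by simp
  then have "br s y = 0" if "br x y = 0" for y using that opg_kernel[OF lin_br] s by simp
  with s that show thesis by blast
qed

text \<open>\<open>opg (br x) (\<lambda>a. a)\<close> is a derivation, hence ad s for some
  \<open>s\<close>. The inheritance of kernel and eigenvectors is what keeps \<open>s\<close> inside
  every centraliser that contains \<open>x\<close>.\<close>

lemma jordan:
  obtains s n where "x = s + n" "semis s" "nilp (br n)" "\<And>y. br x y = 0 \<Longrightarrow> br s y = 0"
    "\<And>a y. br x y = a *s y \<Longrightarrow> br s y = a *s y"
proof -
  obtain s where s: "\<And>v. br s v = opg (br x) (\<lambda>a. a) v" "\<And>y. br x y = 0 \<Longrightarrow> br s y = 0"
    using opg_inner[of "\<lambda>a. a" x] by blast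
  have bs: "br s = opg (br x) (\<lambda>a. a)" using s(1) by auto
  have "br (x - s) = (\<lambda>z. br x z - opg (br x) (\<lambda>a. a) z)" using s(1) by (auto simp: br_lin)
  then have "nilp (br (x - s))" using nilp_opg_part[OF lin_br] by simp
  moreover have "semis s" unfolding semis_def bs by (rule diag_opg[OF lin_br])
  moreover have "br s y = a *s y" if "br x y = a *s y" for a y
    using opg_gev[OF lin_br eigenvector_gev[where T = "br x", OF that], of "\<lambda>a. a"] s by simp
  ultimately show thesis using that[of s "x - s"] s(2) by simp
qed

text \<open>\<open>x'\<close> induces the complex conjugate of the semisimple part of ad x, so that
  \<open>kf x' x\<close> is the sum of the squared moduli of the eigenvalues of ad x. Orthogonality
  to \<open>x'\<close> thus means nilpotence.\<close>

lemma conj_elt: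
  obtains x' where "\<And>y. br x y = 0 \<Longrightarrow> br x' y = 0" "kf x' x = 0 \<Longrightarrow> nilp (br x)"
proof -
  obtain s where s: "\<And>v. br s v = opg (br x) cnj v" "\<And>y. br x y = 0 \<Longrightarrow> br s y = 0"
    using opg_inner[of cnj x] by auto
  have "nilp (br x)" if "kf s x = 0"
    by (rule tr_opg_cnj[OF lin_br]) (use that s in \<open>simp add: kf_def\<close>)
  with s that show thesis by blast
qed

text \<open>These subalgebras take the place of reductive ones. Being a centraliser keeps Jordan
  parts and the elements of \<open>conj_elt\<close> inside \<open>L\<close>; the form is that of the
  whole algebra, since the intrinsic Killing form of \<open>L\<close> would degenerate on its
  centre.\<close>

definition good :: "'g set \<Rightarrow> bool" where
  "good L \<longleftrightarrow> (\<exists>S. L = centralizer br S) \<and> nondeg kf L"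

lemma good_subspace: "good L \<Longrightarrow> subspace L"
  and good_br: "good L \<Longrightarrow> x \<in> L \<Longrightarrow> y \<in> L \<Longrightarrow> br x y \<in> L"
  and good_nd: "good L \<Longrightarrow> nondeg kf L"
  using subspace_centralizer centralizer_br by (auto simp: good_def)

lemma good_closed:
  assumes "good L" "x \<in> L" "\<And>y. br x y = 0 \<Longrightarrow> br s y = 0"
  shows "s \<in> L"
  using assms br_0_commute by (auto simp: good_def centralizer_def)

lemma good_UNIV: "good UNIV"
  using kf_nd by (auto simp: good_def centralizer_def intro!: exI[of _ "{}"])

lemma good_jordan:
  assumes "good L" "x \<in> L"
  obtains s n where "x = s + n" "semis s" "nilp (br n)" "\<And>y. br x y = 0 \<Longrightarrow> br s y = 0" "s \<in> L" "n \<in> L"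
    "\<And>a y. br x y = a *s y \<Longrightarrow> br s y = a *s y"
proof -
  obtain s n where sn: "x = s + n" "semis s" "nilp (br n)" "\<And>y. br x y = 0 \<Longrightarrow> br s y = 0"
      "\<And>a y. br x y = a *s y \<Longrightarrow> br s y = a *s y" using jordan[of x] by blast
  have "s \<in> L" by (rule good_closed[OF assms sn(4)])
  moreover from this have "n \<in> L" using sn(1) assms good_subspace[of L] subspace_diff[of L x s] by simp
  ultimately show thesis using sn that by blast
qed

definition zc :: "'g set \<Rightarrow> 'g \<Rightarrow> 'g set" where
  "zc L s = L \<inter> {y. br s y = 0}"

lemma zc_centralizer: "zc L s = L \<inter> centralizer br {s}"
  by (simp add: zc_def centralizer_def)

lemma good_comp: "good L \<Longrightarrow> s \<in> L \<Longrightarrow> v \<in> L \<Longrightarrow> gcomp (br s) a v \<in> L"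
  using comp_mem[OF lin_br good_subspace] good_br by blast

text \<open>Eigenspaces of ad s pair trivially unless their eigenvalues are opposite, so an element
  of the zero eigenspace that is orthogonal to this eigenspace is orthogonal to all of
  \<open>L\<close>.\<close>

lemma good_zc:
  assumes L: "good L" and s: "semis s" "s \<in> L"
  shows "good (zc L s)"
proof -
  obtain S where S: "L = centralizer br S" using L by (auto simp: good_def)
  have "zc L s = centralizer br (insert s S)" by (auto simp: zc_def centralizer_def S)
  moreover have "nondeg kf (zc L s)"
    unfolding nondeg_def
  proof (intro conjI ballI impI)
    show "subspace (zc L s)" unfolding zc_def
      by (intro subspace_inter good_subspace[OF L] lin_subspace_kernel[OF lin_br])
    fix z assume z: "z \<in> zc L s" "\<forall>y\<in>zc L s. kf z y = 0"
    have "kf z y = 0" if y: "y \<in> L" for y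
    proof -
      have "kf z (gcomp (br s) a y) = 0" for a
      proof (cases "a = 0")
        case True
        then have "gcomp (br s) a y \<in> zc L s"
          using good_comp[OF L s(2) y] semis_comp[OF s(1), of 0 y] by (simp add: zc_def)
        then show ?thesis using z by blast
      next
        case False
        then show ?thesis using kf_eigen[of s z 0 "gcomp (br s) a y" a] z semis_comp[OF s(1)] by (simp add: zc_def)
      qed
      then have "kf z (\<Sum>a\<in>spec (br s). gcomp (br s) a y) = 0" by (simp add: kf_sum)
      then show ?thesis using sum_comp[OF lin_br] by simp
    qed
    then show "z = 0" using z good_nd[OF L] by (simp add: nondeg_def zc_def)
  qed
  ultimately show ?thesis unfolding good_def by blast
qed

lemma zc_zc:
  assumes "\<And>v. br c v = 0 \<longleftrightarrow> br s v = 0 \<and> br s' v = 0"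
  shows "zc L c = zc (zc L s) s'"
  using assms by (auto simp: zc_def)

subsection \<open>Representations of \<open>sl\<^sub>2\<close>\<close>

lemma e_pow_h:
  assumes "br h e = 2 *s e"
  shows "br h ((br e ^^ n) v) = (br e ^^ n) (br h v) + (2 * of_nat n) *s (br e ^^ n) v"
proof (induction n arbitrary: v)
  case (Suc n)
  have "br h (br e u) = br e (br h u) + 2 *s br e u" for u
    using jacobi[of h e u] assms by (simp add: br_lin)
  with Suc show ?case by (simp add: br_lin scale_right_distrib scale_left_distrib algebra_simps)
qed simp

text \<open>The commutator of a power of \<open>e\<close> with \<open>f\<close>. The usual factor h
  + i reads h - i here because \<open>h\<close> stands to the left of the power of
  \<open>e\<close>.\<close>

lemma e_pow_f:
  assumes "br h e = 2 *s e" "br e f = h"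
  shows "(br e ^^ Suc i) (br f w) = br f ((br e ^^ Suc i) w)
    + of_nat (Suc i) *s (br h ((br e ^^ i) w) - of_nat i *s (br e ^^ i) w)"
proof (induction i)
  case 0
  show ?case using jacobi[of e f w] assms by (simp add: br_lin add.commute)
next
  case (Suc i)
  let ?u = "(br e ^^ Suc i) w"
  have ef: "br e (br f u) = br f (br e u) + br h u" for u
    using jacobi[of e f u] assms by (simp add: br_lin add.commute)
  have eh: "br e (br h u) = br h (br e u) - 2 *s br e u" for u
    using jacobi[of h e u] assms by (simp add: br_lin)
  have "(br e ^^ Suc (Suc i)) (br f w) = br e ((br e ^^ Suc i) (br f w))" by simp
  also have "\<dots> = br e (br f ?u) + of_nat (Suc i) *s (br e (br h ((br e ^^ i) w)) - of_nat i *s ?u)"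
    unfolding Suc by (simp add: br_lin)
  also have "\<dots> = br f (br e ?u) + br h ?u + of_nat (Suc i) *s (br h ?u - 2 *s ?u - of_nat i *s ?u)"
    unfolding ef eh by simp
  also have "\<dots> = br f (br e ?u) + of_nat (Suc (Suc i)) *s (br h ?u - of_nat (Suc i) *s ?u)"
  proof -
    have "br h U + a *s (br h U - 2 *s U - b *s U) = (a + 1) *s br h U - (a * (2 + b)) *s U" for a b U
      by (simp add: scale_right_diff_distrib scale_left_distrib scale_right_distrib algebra_simps)
    moreover have "c *s (br h U - d *s U) = c *s br h U - (c * d) *s U" for c d U
      by (simp add: scale_right_diff_distrib)
    moreover have "of_nat (Suc i) * (2 + of_nat i) = (of_nat (Suc (Suc i)) * of_nat (Suc i) :: complex)"
      by (simp add: algebra_simps)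
    moreover have "of_nat (Suc i) + 1 = (of_nat (Suc (Suc i)) :: complex)" by simp
    ultimately show ?thesis by (simp only: add.assoc)
  qed
  finally show ?case by simp
qed

text \<open>A filtration of the kernel of ad e. Since h - i maps step \<open>i\<close> into step
  \<open>i + 1\<close>, it yields integral weights and diagonalisability of \<open>h\<close> on the
  kernel without an appeal to complete reducibility.\<close>

definition kim :: "'g \<Rightarrow> nat \<Rightarrow> 'g set" where
  "kim e i = {u. br e u = 0 \<and> u \<in> range (br e ^^ i)}"

lemma subspace_kim: "subspace (kim e i)"
proof -
  have "kim e i = {u. br e u = 0} \<inter> range (br e ^^ i)" by (auto simp: kim_def)
  then show ?thesis
    using lin_subspace_kernel[OF lin_br, of e] lin_subspace_image[OF lin_funpow[OF lin_br] subspace_UNIV]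
    by (simp add: subspace_inter)
qed

lemma kim_step:
  assumes "br h e = 2 *s e" "br e f = h" and u: "u \<in> kim e i"
  shows "br h u - of_nat i *s u \<in> kim e (Suc i)"
proof -
  obtain w where w: "u = (br e ^^ i) w" and eu: "br e u = 0" using u by (auto simp: kim_def)
  have "(br e ^^ Suc i) (br f w) = of_nat (Suc i) *s (br h u - of_nat i *s u)"
    unfolding e_pow_f[OF assms(1,2)] w[symmetric] using eu w by (simp add: br_lin)
  then have "(1 / of_nat (Suc i)) *s (br e ^^ Suc i) (br f w)
    = (1 / of_nat (Suc i)) *s (of_nat (Suc i) *s (br h u - of_nat i *s u))" by simp
  also have "\<dots> = br h u - of_nat i *s u" by (simp del: of_nat_Suc)
  finally have "br h u - of_nat i *s u = (br e ^^ Suc i) ((1 / of_nat (Suc i)) *s br f w)"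
    using lin_scale[OF lin_funpow[OF lin_br]] by metis
  then have "br h u - of_nat i *s u \<in> range (br e ^^ Suc i)" by (rule range_eqI)
  moreover have "br e (br h u) = 0" using jacobi[of h e u] eu assms by (simp add: br_lin)
  ultimately show ?thesis using eu by (simp add: kim_def br_lin)
qed

text \<open>An eigenvector in step \<open>i\<close> either has eigenvalue \<open>i\<close> or is a
  multiple of its image under h - i and so lies in step \<open>i + 1\<close>; the steps are
  eventually zero.\<close>

lemma kim_eigen:
  assumes "br h e = 2 *s e" "br e f = h" and u: "u \<in> kim e i" "br h u = a *s u" "u \<noteq> 0"
  obtains n where "a = of_nat n" "i \<le> n"
proof -
  have "nilp (br e)" by (rule eigen_nilp[of h e 2]) (use assms in auto)
  then obtain N where N: "\<And>v. (br e ^^ N) v = 0" by (auto simp: nilp_def)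
  have "\<exists>n. a = of_nat n \<and> i \<le> n" if "u \<in> kim e i" for i
    using that
  proof (induction "N - i" arbitrary: i)
    case 0
    then obtain w where "u = (br e ^^ i) w" "N \<le> i" by (auto simp: kim_def)
    then have "u = 0" using funpow_0_mono[OF lin_br N] by simp
    then show ?case using u by simp
  next
    case (Suc k)
    show ?case
    proof (cases "a = of_nat i")
      case False
      have "br h u - of_nat i *s u = (a - of_nat i) *s u" using u by (simp add: scale_left_diff_distrib)
      then have "(a - of_nat i) *s u \<in> kim e (Suc i)" using kim_step[OF assms(1,2) Suc.prems] by simp
      then have "(1 / (a - of_nat i)) *s ((a - of_nat i) *s u) \<in> kim e (Suc i)"
        using subspace_kim subspace_scale by blast
      then have "u \<in> kim e (Suc i)" using False by simp
      moreover have "k = N - Suc i" using Suc by simp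
      ultimately show ?thesis using Suc.hyps(1) by (metis Suc_leD)
    qed blast
  qed
  then show thesis using u that by blast
qed

lemma ker_eigen:
  assumes "br h e = 2 *s e" "br e f = h" and "br e u = 0" "br h u = a *s u" "u \<noteq> 0"
  obtains n where "a = of_nat n"
  using kim_eigen[OF assms(1,2), of u 0 a] assms by (auto simp: kim_def)

text \<open>Descending induction on the step: h - i sends \<open>u\<close> into the next step, where
  all weights exceed \<open>i\<close> and h - i can be inverted; subtracting the preimage leaves a
  vector of weight exactly \<open>i\<close>.\<close>

lemma kim_span:
  assumes he: "br h e = 2 *s e" and ef: "br e f = h" and u: "u \<in> kim e i"
  shows "u \<in> span {v \<in> kim e i. \<exists>n\<ge>i. br h v = of_nat n *s v}"
proof -
  have "nilp (br e)" by (rule eigen_nilp[of h e 2]) (use assms in auto)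
  then obtain N where N: "\<And>v. (br e ^^ N) v = 0" by (auto simp: nilp_def)
  show ?thesis using u
  proof (induction "N - i" arbitrary: i u)
    case 0
    then obtain w where "u = (br e ^^ i) w" "N \<le> i" by (auto simp: kim_def)
    then have "u = 0" using funpow_0_mono[OF lin_br N] by simp
    then show ?case by (simp add: span_zero)
  next
    case (Suc k)
    let ?E = "\<lambda>i. {v \<in> kim e i. \<exists>n\<ge>i. br h v = of_nat n *s v}"
    have sub: "kim e (Suc i) \<subseteq> kim e i"
    proof
      fix v assume "v \<in> kim e (Suc i)"
      then obtain w where w: "br e v = 0" "v = (br e ^^ Suc i) w" by (auto simp: kim_def)
      then have "v = (br e ^^ i) (br e w)" by (simp add: funpow_swap1)
      then show "v \<in> kim e i" using w by (auto simp: kim_def)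
    qed
    have k: "k = N - Suc i" using Suc by simp
    have "br h u - of_nat i *s u \<in> span (?E (Suc i))"
      by (rule Suc.hyps(1)[OF k kim_step[OF he ef Suc.prems]])
    moreover have "\<exists>y \<in> span (?E (Suc i)) \<inter> kim e (Suc i). br h y - of_nat i *s y = x" if "x \<in> span (?E (Suc i))" for x
      using that
    proof (induction rule: span_induct_alt)
      case base
      show ?case by (rule bexI[of _ 0]) (auto simp: br_lin span_zero subspace_0[OF subspace_kim])
    next
      case (step c x y)
      then obtain z where z: "z \<in> span (?E (Suc i))" "z \<in> kim e (Suc i)" "br h z - of_nat i *s z = y" by blast
      obtain n where n: "x \<in> kim e (Suc i)" "n \<ge> Suc i" "br h x = of_nat n *s x" using step by blast
      let ?d = "of_nat n - of_nat i :: complex"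
      have d: "?d \<noteq> 0" using n by simp
      let ?z = "(c / ?d) *s x + z"
      have "br h ?z - of_nat i *s ?z = (c / ?d) *s (?d *s x) + (br h z - of_nat i *s z)"
        using n(3) by (simp add: br_lin scale_right_distrib scale_left_diff_distrib scale_right_diff_distrib algebra_simps)
      also have "\<dots> = c *s x + y" using d z by simp
      finally have "br h ?z - of_nat i *s ?z = c *s x + y" .
      moreover have "?z \<in> span (?E (Suc i)) \<inter> kim e (Suc i)"
      proof
        have "x \<in> span (?E (Suc i))" using step(1) by (rule span_base)
        then show "?z \<in> span (?E (Suc i))" using z(1) by (intro span_add span_scale)
        show "?z \<in> kim e (Suc i)" using n(1) z(2) by (intro subspace_add subspace_scale subspace_kim)
      qed
      ultimately show ?case by blast
    qed
    ultimately obtain y where y: "y \<in> span (?E (Suc i))" "y \<in> kim e (Suc i)"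
        "br h y - of_nat i *s y = br h u - of_nat i *s u" by blast
    have "br h (u - y) = of_nat i *s (u - y)" using y(3) by (simp add: br_lin scale_right_diff_distrib algebra_simps)
    moreover have "u - y \<in> kim e i" using Suc.prems y(2) sub subspace_diff[OF subspace_kim] by blast
    ultimately have "u - y \<in> span (?E i)" by (intro span_base) auto
    moreover have "?E (Suc i) \<subseteq> ?E i" using sub Suc_leD by blast
    then have "y \<in> span (?E i)" using y(1) span_mono by blast
    ultimately have "(u - y) + y \<in> span (?E i)" by (rule span_add)
    then show ?case by simp
  qed
qed

text \<open>Given \<open>h\<close> and any \<open>f\<^sub>0\<close> with \<open>[e, f\<^sub>0] = h\<close>, the element \<open>[h, f\<^sub>0] + 2 f\<^sub>0\<close> centralises \<open>e\<close>,
  and \<open>ad h + 2\<close> is invertible on the centraliser of \<open>e\<close>.\<close>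
lemma morozov:
  assumes L: "subalg L" and e: "e \<in> L" "br h e = 2 *s e" and f0: "f0 \<in> L" "br e f0 = h"
  obtains f where "f \<in> L" "sl2_triple sc br e h f"
proof -
  have sL: "subspace L" and bL: "\<And>x y. x \<in> L \<Longrightarrow> y \<in> L \<Longrightarrow> br x y \<in> L" using L by (auto simp: subalg_def)
  let ?Z = "L \<inter> {z. br e z = 0}"
  have sZ: "subspace ?Z" by (intro subspace_inter sL lin_subspace_kernel[OF lin_br])
  have hL: "h \<in> L" using bL e f0 by metis
  have eh: "br e (br h u) = br h (br e u) - 2 *s br e u" for u
    using jacobi[of h e u] e by (simp add: br_lin)
  let ?T = "\<lambda>z. br h z - (-2) *s z"
  define y where "y = br h f0 + 2 *s f0"
  have "br e y = 0" using f0(2) eh[of f0] by (simp add: y_def br_lin br_self)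
  then have yZ: "y \<in> ?Z" using hL f0 bL sL by (auto simp: y_def intro!: subspace_add subspace_scale)
  obtain z where z: "z \<in> ?Z" "?T z = y"
  proof (rule lin_inj_surj[OF lin_shift[OF lin_br, of h "-2"] sZ _ _ yZ])
    show "?T z \<in> ?Z" if "z \<in> ?Z" for z
      using that hL bL sL eh[of z] by (auto simp: br_lin intro!: subspace_add subspace_scale)
    show "z = 0" if z: "z \<in> ?Z" "?T z = 0" for z
    proof (rule ccontr)
      assume "z \<noteq> 0"
      moreover have "br h z = (-2) *s z" using z(2) by (simp only: right_minus_eq)
      ultimately obtain n where "(-2::complex) = of_nat n" using ker_eigen[OF e(2) f0(2), of z "-2"] z(1) by blast
      then have "Re (-2) = Re (of_nat n)" by (rule arg_cong)
      then show False by simp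
    qed
  qed blast
  have "f0 - z \<in> L" using f0 z sL by (auto intro: subspace_diff)
  moreover have "br e (f0 - z) = h" using f0 z by (simp add: br_lin)
  moreover have "br h (f0 - z) = (-2) *s (f0 - z)"
    using z(2) by (simp add: y_def br_lin scale_right_diff_distrib algebra_simps)
  ultimately show thesis using that[of "f0 - z"] e by (simp add: sl2_triple_def)
qed

section \<open>The theorem of Jacobson and Morozov\<close>

lemma good_subalg: "good L \<Longrightarrow> subalg L"
  using good_subspace good_br by (simp add: subalg_def)

text \<open>By invariance of the form, whatever in \<open>L\<close> is orthogonal to
  \<open>[x, L]\<close> centralises \<open>x\<close>; taking orthogonals once more puts
  \<open>y\<close> into \<open>[x, L]\<close>.\<close>

lemma image_br_perp:
  assumes L: "good L" and x: "x \<in> L" and y: "y \<in> L" and p: "\<And>z. z \<in> zc L x \<Longrightarrow> kf y z = 0"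
  obtains w where "w \<in> L" "br x w = y"
proof -
  note sL = good_subspace[OF L]
  have im: "subspace (br x ` L)" "br x ` L \<subseteq> L" using lin_subspace_image[OF lin_br sL] good_br[OF L x] by auto
  have "perp kf L (br x ` L) \<subseteq> zc L x"
  proof
    fix z assume z: "z \<in> perp kf L (br x ` L)"
    have "kf (br x z) w = 0" if "w \<in> L" for w
      using z that kf_inv'[of x z w] by (auto simp: perp_def)
    moreover have "br x z \<in> L" using z x good_br[OF L] by (auto simp: perp_def)
    ultimately have "br x z = 0" using good_nd[OF L] by (simp add: nondeg_def)
    then show "z \<in> zc L x" using z by (simp add: zc_def perp_def)
  qed
  then have "y \<in> perp kf L (perp kf L (br x ` L))" using y p by (auto simp: perp_def)
  then have "y \<in> br x ` L" using perp_perp[OF is_form_kf good_nd[OF L] im] by simp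
  then show thesis using that by blast
qed

text \<open>A nilpotent \<open>x\<close> is orthogonal to its centraliser, so
  \<open>x = [x, w]\<close>, and the semisimple part of \<open>- w\<close> scales \<open>x\<close>.
  Twice this part need not lie in \<open>[x, L]\<close>; it is corrected by an element that commutes
  with it and with \<open>x\<close>, after which \<open>morozov\<close> applies.\<close>

theorem jacobson_morozov:
  assumes L: "good L" and x: "x \<in> L" and nil: "nilp (br x)"
  obtains h f where "h \<in> L" "f \<in> L" "sl2_triple sc br x h f"
proof -
  note sL = good_subspace[OF L]
  have "kf x z = 0" if "z \<in> zc L x" for z using kf_nilp_commute[OF nil] that by (simp add: zc_def)
  then obtain w where w: "w \<in> L" "br x w = x" using image_br_perp[OF L x x] by blast
  have w': "- w \<in> L" "br (- w) x = 1 *s x" using w sL subspace_neg br_skew[of x w] by (auto simp: br_lin)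
  obtain s where s: "semis s" "s \<in> L" "br s x = 1 *s x" using good_jordan[OF L w'(1)] w'(2) by metis
  define h0 where "h0 = 2 *s s"
  have h0: "semis h0" "h0 \<in> L" "br h0 x = 2 *s x"
    using s sL semis_scale by (auto simp: h0_def br_lin subspace_scale)
  let ?C = "zc (zc L x) h0"
  have C: "z \<in> ?C \<longleftrightarrow> z \<in> L \<and> br x z = 0 \<and> br h0 z = 0" for z by (auto simp: zc_def)
  have Ccl: "z' \<in> ?C" if z: "z \<in> ?C" "\<And>y. br z y = 0 \<Longrightarrow> br z' y = 0" for z z'
  proof -
    have "br z x = 0" "br z h0 = 0" "z \<in> L" using z br_0_commute by (auto simp: C)
    then show ?thesis using z(2) good_closed[OF L, of z z'] br_0_commute by (auto simp: C)
  qed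
  have sC: "subspace ?C" unfolding zc_def by (intro subspace_inter sL lin_subspace_kernel[OF lin_br])
  \<comment> \<open>The radical of the form on \<open>?C\<close> consists of nilpotent elements by
    \<open>conj_elt\<close>. They commute with \<open>h0\<close>, so the functional given by
    \<open>h0\<close> vanishes on the radical.\<close>
  obtain d where d: "d \<in> ?C" "\<And>z. z \<in> ?C \<Longrightarrow> kf d z = - kf h0 z"
  proof (rule represent_mod_radical[OF is_form_kf sC, of "\<lambda>z. - kf h0 z"])
    fix z assume z: "z \<in> perp kf ?C ?C"
    then have zC: "z \<in> ?C" by (simp add: perp_def)
    obtain z' where z': "\<And>y. br z y = 0 \<Longrightarrow> br z' y = 0" "kf z' z = 0 \<Longrightarrow> nilp (br z)" using conj_elt[of z] by blast
    have "z' \<in> ?C" by (rule Ccl[OF zC z'(1)])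
    then have "kf z z' = 0" using z by (simp add: perp_def)
    then have "nilp (br z)" using z' kf_sym by simp
    moreover have "br z h0 = 0" using zC br_0_commute by (auto simp: C)
    ultimately have "kf z h0 = 0" by (rule kf_nilp_commute)
    then show "- kf h0 z = 0" using kf_sym[of h0 z] by simp
  qed (auto simp: kf_simps)
  define h where "h = h0 + d"
  have hL: "h \<in> L" using h0 d sL by (auto simp: h_def C intro: subspace_add)
  have hx: "br h x = 2 *s x" using h0 d br_0_commute[of x d] by (simp add: h_def br_lin C)
  have h0h: "br h0 h = 0" using d by (simp add: h_def br_lin br_self C)
  \<comment> \<open>\<open>h\<close> has weight 0 under \<open>h0\<close>, so only the weight 0 part
    of \<open>z\<close> counts, and that part lies in \<open>?C\<close>.\<close>
  have "kf h z = 0" if z: "z \<in> zc L x" for z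
  proof -
    have szc: "subspace (zc L x)" unfolding zc_def by (intro subspace_inter sL lin_subspace_kernel[OF lin_br])
    have st: "br h0 u \<in> zc L x" if "u \<in> zc L x" for u
      using that good_br[OF L h0(2)] jacobi[of h0 x u] h0(3) by (simp add: zc_def br_lin)
    have "kf h (gcomp (br h0) a z) = 0" for a
    proof (cases "a = 0")
      case True
      have "gcomp (br h0) 0 z \<in> ?C"
        using comp_mem[OF lin_br szc st z] semis_comp[OF h0(1), of 0 z] by (simp add: zc_def[of "zc L x"])
      then show ?thesis using d(2) True by (simp add: h_def kf_simps)
    next
      case False
      then show ?thesis using kf_eigen[of h0 h 0 "gcomp (br h0) a z" a] h0h semis_comp[OF h0(1)] by simp
    qed
    then have "kf h (\<Sum>a\<in>spec (br h0). gcomp (br h0) a z) = 0" by (simp add: kf_sum)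
    then show ?thesis using sum_comp[OF lin_br] by simp
  qed
  then obtain f0 where f0: "f0 \<in> L" "br x f0 = h" using image_br_perp[OF L x hL] by blast
  obtain f where "f \<in> L" "sl2_triple sc br x h f"
    using morozov[OF good_subalg[OF L] x hx f0] by blast
  then show thesis using that hL by blast
qed

section \<open>Weights and strings of a triple\<close>

lemma sl2D:
  assumes "sl2_triple sc br e h f"
  shows "br h e = 2 *s e" "br h f = (-2) *s f" "br e f = h"
  using assms by (auto simp: sl2_triple_def)

lemma sl2_flip:
  assumes "sl2_triple sc br e h f" shows "sl2_triple sc br f (- h) e"
  using assms br_skew[of f e] by (simp add: sl2_triple_def br_lin)

lemma sl2_nilp:
  assumes "sl2_triple sc br e h f" shows "nilp (br e)" "nilp (br f)"
  using eigen_nilp[of h e 2] eigen_nilp[of h f "-2"] sl2D[OF assms] by auto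

lemma sl2_weight:
  assumes t: "sl2_triple sc br e h f" and v: "br e v = 0" "br h v = of_nat j *s v"
  shows "br h ((br f ^^ i) v) = (of_nat j - 2 * of_nat i) *s (br f ^^ i) v"
    and "br e ((br f ^^ Suc i) v) = (of_nat (Suc i) * (of_nat j - of_nat i)) *s (br f ^^ i) v"
proof -
  note t' = sl2D[OF sl2_flip[OF t]]
  let ?u = "(br f ^^ i) v"
  have "br (- h) ?u = (br f ^^ i) (br (- h) v) + (2 * of_nat i) *s ?u" by (rule e_pow_h[OF t'(1)])
  then have "- br h ?u = - (of_nat j *s ?u) + (2 * of_nat i) *s ?u"
    using v lin_funpow[OF lin_br[of f], of i] by (simp add: br_lin lin_neg lin_scale)
  then have "- (- br h ?u) = - (- (of_nat j *s ?u) + (2 * of_nat i) *s ?u)" by (rule arg_cong)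
  then have "br h ?u = of_nat j *s ?u - (2 * of_nat i) *s ?u" by simp
  then show 1: "br h ?u = (of_nat j - 2 * of_nat i) *s ?u" by (simp add: scale_left_diff_distrib)
  have "(br f ^^ Suc i) (br e v) = br e ((br f ^^ Suc i) v) + of_nat (Suc i) *s (br (- h) ?u - of_nat i *s ?u)"
    by (rule e_pow_f[OF t'(1,3)])
  then have "0 = br e ((br f ^^ Suc i) v) + of_nat (Suc i) *s (br (- h) ?u - of_nat i *s ?u)"
    using v lin_0[OF lin_funpow[OF lin_br[of f], of "Suc i"]] by metis
  moreover have "br (- h) ?u - of_nat i *s ?u = - ((of_nat j - of_nat i) *s ?u)"
  proof -
    have "br (- h) ?u - of_nat i *s ?u = (- (of_nat j - 2 * of_nat i) - of_nat i) *s ?u"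
      unfolding scale_left_diff_distrib scale_minus_left using 1 by (simp add: br_lin scale_left_diff_distrib)
    also have "- (of_nat j - 2 * of_nat i) - of_nat i = (- (of_nat j - of_nat i) :: complex)" by simp
    finally show ?thesis by (simp only: scale_minus_left)
  qed
  ultimately show "br e ((br f ^^ Suc i) v) = (of_nat (Suc i) * (of_nat j - of_nat i)) *s ?u"
    by (simp del: of_nat_Suc funpow.simps)
qed

text \<open>Induction on the power of ad e that kills \<open>x\<close>. The vector e^m x is a
  combination of highest weight vectors of weight at least \<open>m\<close>; on each of these f^m
  followed by e^m is a nonzero scalar, so a combination of string vectors can be subtracted from
  \<open>x\<close>.\<close>

lemma sl2_span:
  assumes t: "sl2_triple sc br e h f"
  shows "x \<in> span {(br f ^^ i) v |i j v. br e v = 0 \<and> br h v = of_nat j *s v \<and> i \<le> j}" (is "_ \<in> span ?G")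
proof -
  note d = sl2D[OF t]
  have "x \<in> span ?G" if "(br e ^^ m) x = 0" for m x
    using that
  proof (induction m arbitrary: x)
    case 0 then show ?case by (simp add: span_zero)
  next
    case (Suc m)
    let ?u = "(br e ^^ m) x"
    have "?u \<in> kim e m" using Suc.prems by (auto simp: kim_def)
    then have "?u \<in> span {v \<in> kim e m. \<exists>n\<ge>m. br h v = of_nat n *s v}" by (rule kim_span[OF d(1,3)])
    moreover have "\<exists>w\<in>span ?G. (br e ^^ m) w = u" if "u \<in> span {v \<in> kim e m. \<exists>n\<ge>m. br h v = of_nat n *s v}" for u
      using that
    proof (induction rule: span_induct_alt)
      case base
      show ?case by (rule bexI[of _ 0]) (auto simp: lin_0[OF lin_funpow[OF lin_br]] span_zero)
    next
      case (step c v y)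
      then obtain w where w: "w \<in> span ?G" "(br e ^^ m) w = y" by blast
      obtain n where n: "br e v = 0" "n \<ge> m" "br h v = of_nat n *s v" using step by (auto simp: kim_def)
      have ex: "\<exists>a. a \<noteq> 0 \<and> (br e ^^ k) ((br f ^^ k) v) = a *s v" if "k \<le> n" for k
        using that
      proof (induction k)
        case (Suc k)
        then obtain a where a: "a \<noteq> 0" "(br e ^^ k) ((br f ^^ k) v) = a *s v" by auto
        have "(br e ^^ Suc k) ((br f ^^ Suc k) v) = (br e ^^ k) (br e ((br f ^^ Suc k) v))"
          by (simp only: funpow_Suc_right comp_apply)
        also have "\<dots> = (of_nat (Suc k) * (of_nat n - of_nat k) * a) *s v"
          unfolding sl2_weight(2)[OF t n(1,3)] using lin_scale[OF lin_funpow[OF lin_br]] a by simp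
        finally show ?case using a(1) Suc.prems
          by (intro exI[of _ "of_nat (Suc k) * (of_nat n - of_nat k) * a"]) (auto simp del: of_nat_Suc funpow.simps)
      qed (auto intro!: exI[of _ 1])
      obtain a where a: "a \<noteq> 0" "(br e ^^ m) ((br f ^^ m) v) = a *s v" using ex[OF n(2)] by blast
      let ?w = "(c / a) *s (br f ^^ m) v + w"
      have "(br f ^^ m) v \<in> span ?G" using n by (intro span_base) blast
      then have "?w \<in> span ?G" using w by (intro span_add span_scale)
      moreover have "(br e ^^ m) ?w = c *s v + y"
        using a w lin_funpow[OF lin_br[of e], of m] by (simp add: lin_add lin_scale)
      ultimately show ?case by blast
    qed
    ultimately obtain w where w: "w \<in> span ?G" "(br e ^^ m) w = ?u" by blast
    have "(br e ^^ m) (x - w) = 0" using w lin_diff[OF lin_funpow[OF lin_br]] by simp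
    then have "x - w \<in> span ?G" by (rule Suc.IH)
    from span_add[OF this w(1)] show ?case by simp
  qed
  moreover obtain N where "\<And>v. (br e ^^ N) v = 0" using sl2_nilp[OF t] by (auto simp: nilp_def)
  ultimately show ?thesis by blast
qed

lemma sl2_int_span:
  assumes t: "sl2_triple sc br e h f"
  shows "x \<in> span {v. \<exists>i::int. br h v = of_int i *s v}"
proof -
  have "{(br f ^^ i) v |i j v. br e v = 0 \<and> br h v = of_nat j *s v \<and> i \<le> j} \<subseteq> {v. \<exists>i::int. br h v = of_int i *s v}"
  proof clarify
    fix i j v assume v: "br e v = 0" "br h v = of_nat j *s v"
    have "br h ((br f ^^ i) v) = of_int (int j - 2 * int i) *s (br f ^^ i) v"
      using sl2_weight(1)[OF t v, of i] by simp
    then show "\<exists>k::int. br h ((br f ^^ i) v) = of_int k *s (br f ^^ i) v" by blast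
  qed
  then show ?thesis using sl2_span[OF t, of x] span_mono by blast
qed

lemma sl2_semis: assumes t: "sl2_triple sc br e h f" shows "semis h"
proof (rule semisI)
  fix v
  have "{v. \<exists>i::int. br h v = of_int i *s v} \<subseteq> {v. \<exists>a. br h v = a *s v}" by blast
  then show "v \<in> span {v. \<exists>a. br h v = a *s v}" using sl2_int_span[OF t, of v] span_mono by blast
qed

definition intel :: "'g \<Rightarrow> bool" where
  "intel h \<longleftrightarrow> semis h \<and> spec (br h) \<subseteq> range of_int"

lemma intelI:
  assumes s: "semis h" and x: "\<And>x. x \<in> span {v. \<exists>i::int. br h v = of_int i *s v}"
  shows "intel h"
  unfolding intel_def
proof (intro conjI s subsetI)
  fix a assume a: "a \<in> spec (br h)"
  show "a \<in> range of_int"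
  proof (rule ccontr)
    assume na: "a \<notin> range of_int"
    have "gcomp (br h) a x = 0" for x
      using x[of x]
    proof (induction rule: span_induct_alt)
      case base then show ?case using lin_0[OF lin_comp[OF lin_br]] by blast
    next
      case (step c u y)
      then obtain i :: int where "br h u = of_int i *s u" by blast
      then have "gcomp (br h) a u = 0" using comp_of_gev[OF lin_br eigenvector_gev[of "br h" u "of_int i"], of a] na by auto
      then show ?case using step lin_comp[OF lin_br] by (simp add: lin_add lin_scale)
    qed
    moreover obtain v where "v \<in> gev (br h) a" "v \<noteq> 0" using a subspace_0[OF subspace_gev[OF lin_br]] by (auto simp: spec_def)
    ultimately show False using comp_of_gev[OF lin_br, of v h a a] by simp
  qed
qed

lemma sl2_intel: "sl2_triple sc br e h f \<Longrightarrow> intel h"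
  by (rule intelI[OF sl2_semis sl2_int_span])

lemma intel_semis: "intel h \<Longrightarrow> semis h" by (simp add: intel_def)

lemma intel_eigen:
  assumes "intel h" "br h v = a *s v" "v \<noteq> 0" obtains i :: int where "a = of_int i"
proof -
  have "a \<in> spec (br h)" using eigenvector_gev[of "br h" v a] assms by (auto simp: spec_def)
  then show thesis using assms(1) that by (auto simp: intel_def)
qed

text \<open>\<open>f\<close> sends e^(k+1) x to minus m + (m + 2) + ... + (m + 2 k) times e^k x.
  These factors are nonzero for m \<ge> 1, so vanishing descends from a high power of
  \<open>e\<close> to \<open>x\<close>.\<close>

lemma ef_inj:
  assumes t: "sl2_triple sc br e h f" and x: "br h x = of_int m *s x" "m \<ge> 1" "br e (br f x) = 0"
  shows "x = 0"
proof -
  note d = sl2D[OF t]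
  have fe: "br f (br e u) = br e (br f u) - br h u" for u
    using jacobi[of e f u] d by (simp add: br_lin add.commute)
  let ?x = "\<lambda>k. (br e ^^ k) x"
  have hx: "br h (?x k) = of_int (m + 2 * int k) *s ?x k" for k
    using e_pow_h[OF d(1), of k x] x(1) lin_scale[OF lin_funpow[OF lin_br[of e]]]
    by (simp add: scale_left_distrib)
  define c :: "nat \<Rightarrow> int" where "c k = (\<Sum>i<k. m + 2 * int i)" for k
  have fx: "br f (?x (Suc k)) = of_int (- c (Suc k)) *s ?x k" for k
  proof (induction k)
    case 0
    then show ?case using fe[of x] x by (simp add: c_def)
  next
    case (Suc k)
    have "br f (?x (Suc (Suc k))) = br e (br f (?x (Suc k))) - br h (?x (Suc k))" using fe by simp
    also have "\<dots> = of_int (- c (Suc k)) *s ?x (Suc k) - of_int (m + 2 * int (Suc k)) *s ?x (Suc k)"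
      unfolding Suc hx by (simp only: br_lin) simp
    also have "\<dots> = of_int (- c (Suc k) - (m + 2 * int (Suc k))) *s ?x (Suc k)"
      by (simp only: of_int_diff scale_left_diff_distrib)
    also have "- c (Suc k) - (m + 2 * int (Suc k)) = - c (Suc (Suc k))" by (simp add: c_def)
    finally show ?case .
  qed
  have cpos: "c (Suc k) > 0" for k
  proof -
    have "c k \<ge> 0" for k unfolding c_def using x(2) by (intro sum_nonneg) auto
    then show ?thesis using x(2) by (simp add: c_def add_nonneg_pos)
  qed
  obtain N where N: "\<And>v. (br e ^^ N) v = 0" using sl2_nilp[OF t] by (auto simp: nilp_def)
  have "?x (N - k) = 0" for k
  proof (induction k)
    case (Suc k)
    show ?case
    proof (cases "k < N")
      case True
      then have "N - k = Suc (N - Suc k)" by simp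
      then have "of_int (- c (Suc (N - Suc k))) *s ?x (N - Suc k) = 0" using Suc fx[of "N - Suc k"] by (simp add: br_lin)
      then show ?thesis using cpos[of "N - Suc k"] by simp
    qed (use Suc in simp)
  qed (use N in simp)
  from this[of N] show ?thesis by simp
qed

abbreviation gr :: "'g \<Rightarrow> int \<Rightarrow> 'g set" where "gr h i \<equiv> grade_space sc br h i"

lemma gr_def: "gr h i = {x. br h x = of_int i *s x}"
  by (simp add: grade_space_def)

lemma subspace_gr: "subspace (gr h i)"
  using lin_subspace_kernel[OF lin_shift[OF lin_br, of h "of_int i"]] by (simp add: gr_def)

lemma gr_br: "x \<in> gr h i \<Longrightarrow> y \<in> gr h j \<Longrightarrow> br x y \<in> gr h (i + j)"
  using jacobi[of h x y] by (simp add: gr_def br_lin scale_left_distrib)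

definition stable3 :: "'g \<Rightarrow> 'g \<Rightarrow> 'g \<Rightarrow> 'g set \<Rightarrow> bool" where
  "stable3 e h f W \<longleftrightarrow> subspace W \<and> (\<forall>w\<in>W. br e w \<in> W \<and> br h w \<in> W \<and> br f w \<in> W)"

text \<open>By \<open>ef_inj\<close> the map ad e after ad f is injective on the degree
  \<open>m\<close> part of \<open>W\<close>, hence bijective; \<open>f\<close> applied to a preimage
  solves the equation. This covers every stable \<open>W\<close>, such as the centraliser of an
  element commuting with the triple.\<close>

lemma sl2_surj:
  assumes t: "sl2_triple sc br e h f" and W: "stable3 e h f W" and w: "w \<in> W" "w \<in> gr h m" "m \<ge> 1"
  obtains u where "u \<in> W" "u \<in> gr h (m - 2)" "br e u = w"
proof -
  note d = sl2D[OF t]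
  have ee: "e \<in> gr h 2" "f \<in> gr h (-2)" using d by (simp_all add: gr_def)
  have sW: "subspace W" using W by (simp add: stable3_def)
  let ?T = "\<lambda>x. br e (br f x)"
  have T: "lin ?T" by (rule lin_compose[OF lin_br lin_br])
  obtain x where x: "x \<in> W \<inter> gr h m" "?T x = w"
  proof (rule lin_inj_surj[OF T subspace_inter[OF sW subspace_gr]])
    show "?T x \<in> W \<inter> gr h m" if x: "x \<in> W \<inter> gr h m" for x
    proof -
      have "br f x \<in> gr h (m - 2)" using gr_br[OF ee(2), of x m] x by simp
      then have "br e (br f x) \<in> gr h m" using gr_br[OF ee(1), of "br f x" "m - 2"] by simp
      then show ?thesis using x W by (simp add: stable3_def)
    qed
    show "x = 0" if "x \<in> W \<inter> gr h m" "?T x = 0" for x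
      using ef_inj[OF t, of x m] that w by (simp add: gr_def)
    show "w \<in> W \<inter> gr h m" using w by simp
  qed blast
  have "br f x \<in> gr h (m - 2)" using gr_br[OF ee(2), of x m] x by simp
  moreover have "br f x \<in> W" using x W by (simp add: stable3_def)
  ultimately show thesis using that x by blast
qed

lemma sl2_inj:
  assumes t: "sl2_triple sc br e h f" and v: "v \<in> gr h m" "m \<le> -1" "br e v = 0"
  shows "v = 0"
proof (rule ccontr)
  assume "v \<noteq> 0"
  then obtain n where "(of_int m :: complex) = of_nat n"
    using ker_eigen[OF sl2D(1,3)[OF t], of v "of_int m"] v by (auto simp: gr_def)
  then have "m = int n" by (metis of_int_eq_iff of_int_of_nat_eq)
  then show False using v by simp
qed

definition grge :: "'g \<Rightarrow> 'g set \<Rightarrow> int \<Rightarrow> 'g set" where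
  "grge h W m = {w \<in> W. \<forall>a. gcomp (br h) a w \<noteq> 0 \<longrightarrow> (\<exists>i\<ge>m. a = of_int i)}"

lemma subspace_grge: assumes "subspace W" shows "subspace (grge h W m)"
proof (rule subspaceI)
  note l = lin_comp[OF lin_br]
  show "0 \<in> grge h W m" using assms by (simp add: grge_def subspace_0 lin_0[OF l])
  show "x + y \<in> grge h W m" if "x \<in> grge h W m" "y \<in> grge h W m" for x y
    using that assms unfolding grge_def
    by (simp add: subspace_add lin_add[OF l]) (metis add.right_neutral)
  show "c *s x \<in> grge h W m" if "x \<in> grge h W m" for c x
    using that assms unfolding grge_def by (simp add: subspace_scale lin_scale[OF l])
qed

lemma dim_grge:
  assumes h: "semis h" and W: "subspace W" "\<And>w. w \<in> W \<Longrightarrow> br h w \<in> W"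
  shows "dim (grge h W m) = dim (W \<inter> gr h m) + dim (grge h W (m + 1))"
proof -
  let ?P = "gcomp (br h) (of_int m)"
  have l: "lin ?P" by (rule lin_comp[OF lin_br])
  have "{x \<in> grge h W m. ?P x = 0} = grge h W (m + 1)"
  proof -
    have "\<exists>i\<ge>m + 1. a = of_int i" if "gcomp (br h) a x \<noteq> 0" "\<exists>i\<ge>m. a = of_int i" "?P x = 0" for a x
    proof -
      obtain i where i: "i \<ge> m" "a = of_int i" using \<open>\<exists>i\<ge>m. a = of_int i\<close> by blast
      then have "i \<noteq> m" using that(1,3) by auto
      then show ?thesis using i by (intro exI[of _ i]) auto
    qed
    moreover have "?P x = 0" if "x \<in> grge h W (m + 1)" for x
      using that unfolding grge_def by force
    moreover have "grge h W (m + 1) \<subseteq> grge h W m" unfolding grge_def by force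
    ultimately show ?thesis unfolding grge_def by blast
  qed
  moreover have "?P ` grge h W m = W \<inter> gr h m"
  proof
    show "?P ` grge h W m \<subseteq> W \<inter> gr h m"
      using comp_mem[OF lin_br W] semis_comp[OF h] by (auto simp: grge_def gr_def)
    show "W \<inter> gr h m \<subseteq> ?P ` grge h W m"
    proof
      fix x assume x: "x \<in> W \<inter> gr h m"
      have c: "gcomp (br h) a x = (if a = of_int m then x else 0)" for a
        by (rule comp_of_gev[OF lin_br eigenvector_gev]) (use x in \<open>simp add: gr_def\<close>)
      then have "x \<in> grge h W m" using x by (auto simp: grge_def split: if_splits)
      moreover have "?P x = x" using c by simp
      ultimately show "x \<in> ?P ` grge h W m" by force
    qed
  qed
  ultimately show ?thesis using rank_nullity[OF l subspace_grge[OF W(1), of h m]] by simp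
qed

lemma grge_comp_sum:
  assumes "\<And>a. gcomp (br h) a w \<in> U" "subspace U" shows "w \<in> U"
proof -
  have "(\<Sum>a\<in>spec (br h). gcomp (br h) a w) \<in> U" by (intro subspace_sum assms)
  then show ?thesis using sum_comp[OF lin_br] by simp
qed

text \<open>The kernel of ad e sits in degrees \<ge> 0, and ad e maps degrees \<ge> 0 onto degrees
  \<ge> 2; rank-nullity leaves degrees 0 and 1.\<close>

lemma sl2_dim:
  assumes t: "sl2_triple sc br e h f" and W: "stable3 e h f W"
  shows "dim (zc W e) = dim (W \<inter> gr h 0) + dim (W \<inter> gr h 1)"
proof -
  note d = sl2D[OF t]
  have h: "semis h" by (rule sl2_semis[OF t])
  have sW: "subspace W" and Wh: "\<And>w. w \<in> W \<Longrightarrow> br h w \<in> W" and We: "\<And>w. w \<in> W \<Longrightarrow> br e w \<in> W"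
    using W by (auto simp: stable3_def)
  have eg: "e \<in> gev (br h) 2" by (rule eigenvector_gev[where T = "br h", OF d(1)])
  have ker: "{x \<in> grge h W 0. br e x = 0} = zc W e"
  proof -
    have "\<exists>i\<ge>0. a = of_int i" if x: "x \<in> W" "br e x = 0" "gcomp (br h) a x \<noteq> 0" for x a
    proof -
      have "br e (gcomp (br h) a x) = 0"
        using comp_shift[OF eg, of a x] x lin_0[OF lin_comp[OF lin_br]] by simp
      then obtain n where "a = of_nat n" using ker_eigen[OF d(1,3) _ semis_comp[OF h] x(3)] by blast
      then show ?thesis by (intro exI[of _ "int n"]) simp
    qed
    then show ?thesis unfolding grge_def zc_def by blast
  qed
  have im: "br e ` grge h W 0 = grge h W 2"
  proof
    show "br e ` grge h W 0 \<subseteq> grge h W 2"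
    proof clarify
      fix w assume w: "w \<in> grge h W 0"
      have "\<exists>i\<ge>2. a = of_int i" if "gcomp (br h) a (br e w) \<noteq> 0" for a
      proof -
        have "gcomp (br h) a (br e w) = br e (gcomp (br h) (a - 2) w)" using comp_shift[OF eg, of "a - 2" w] by simp
        then have "gcomp (br h) (a - 2) w \<noteq> 0" using that by (auto simp: br_lin)
        then obtain i where i: "i \<ge> 0" "a - 2 = of_int i" using w by (auto simp: grge_def)
        then have "a = of_int (i + 2)" by (simp add: algebra_simps)
        then show ?thesis using i(1) by (intro exI[of _ "i + 2"]) auto
      qed
      then show "br e w \<in> grge h W 2" using w We by (auto simp: grge_def)
    qed
    show "grge h W 2 \<subseteq> br e ` grge h W 0"
    proof
      fix w assume w: "w \<in> grge h W 2"
      show "w \<in> br e ` grge h W 0"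
      proof (rule grge_comp_sum[OF _ lin_subspace_image[OF lin_br subspace_grge[OF sW]]])
        fix a
        show "gcomp (br h) a w \<in> br e ` grge h W 0"
        proof (cases "gcomp (br h) a w = 0")
          case True
          then show ?thesis using subspace_0[OF lin_subspace_image[OF lin_br subspace_grge[OF sW]]] by simp
        next
          case False
          then obtain i where i: "i \<ge> 2" "a = of_int i" using w by (auto simp: grge_def)
          have "gcomp (br h) a w \<in> W" using comp_mem[OF lin_br sW Wh] w by (simp add: grge_def)
          moreover have "gcomp (br h) a w \<in> gr h i" using semis_comp[OF h] i by (simp add: gr_def)
          ultimately obtain u where u: "u \<in> W" "u \<in> gr h (i - 2)" "br e u = gcomp (br h) a w"
            using sl2_surj[OF t W, of "gcomp (br h) a w" i] i by auto
          have c: "gcomp (br h) b u = (if b = of_int (i - 2) then u else 0)" for b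
            by (rule comp_of_gev[OF lin_br eigenvector_gev]) (use u in \<open>simp add: gr_def\<close>)
          have "u \<in> grge h W 0" unfolding grge_def
          proof (intro CollectI conjI allI impI)
            fix b assume "gcomp (br h) b u \<noteq> 0"
            then have "b = of_int (i - 2)" using c by metis
            then show "\<exists>i\<ge>0. b = of_int i" using i by (intro exI[of _ "i - 2"]) auto
          qed (rule u)
          then show ?thesis using u by force
        qed
      qed
    qed
  qed
  have "dim (grge h W 0) = dim (zc W e) + dim (grge h W 2)"
    using rank_nullity[OF lin_br[of e] subspace_grge[OF sW, of h 0]] ker im by simp
  moreover have "dim (grge h W 0) = dim (W \<inter> gr h 0) + (dim (W \<inter> gr h 1) + dim (grge h W 2))"
    using dim_grge[OF h sW Wh, of 0] dim_grge[OF h sW Wh, of 1] by simp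
  ultimately show ?thesis by simp
qed

lemma gr0_zc: "W \<inter> gr h 0 = zc W h"
  by (auto simp: zc_def gr_def)

lemma good_stable3: "good L \<Longrightarrow> e \<in> L \<Longrightarrow> h \<in> L \<Longrightarrow> f \<in> L \<Longrightarrow> stable3 e h f L"
  using good_subspace good_br by (simp add: stable3_def)

subsection \<open>Borel-type subalgebras and the rank\<close>

text \<open>The positive cone of the lexicographic order makes all of \<open>\<complex>\<close> a totally ordered group.\<close>
definition cpos :: "complex \<Rightarrow> bool" where
  "cpos z \<longleftrightarrow> Re z > 0 \<or> Re z = 0 \<and> Im z > 0"

lemma cpos_add: "cpos a \<Longrightarrow> cpos b \<Longrightarrow> cpos (a + b)"
  and cpos_total: "cpos a \<or> a = 0 \<or> cpos (- a)"
  and cpos_asym: "cpos a \<Longrightarrow> \<not> cpos (- a)"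
  and not_cpos_0: "\<not> cpos 0"
  by (auto simp: cpos_def complex_eq_iff)

lemma cpos_int: "cpos (of_int i) \<longleftrightarrow> i > 0"
  by (simp add: cpos_def)

definition nn :: "'g set \<Rightarrow> 'g \<Rightarrow> 'g set" where
  "nn L s = {v \<in> L. \<forall>a. gcomp (br s) a v \<noteq> 0 \<longrightarrow> cpos a}"

definition bb :: "'g set \<Rightarrow> 'g \<Rightarrow> 'g set" where
  "bb L s = {v \<in> L. \<forall>a. gcomp (br s) a v \<noteq> 0 \<longrightarrow> a = 0 \<or> cpos a}"

lemma subspace_nn: assumes "subspace L" shows "subspace (nn L s)"
proof (rule subspaceI)
  note l = lin_comp[OF lin_br]
  show "0 \<in> nn L s" using assms by (simp add: nn_def subspace_0 lin_0[OF l])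
  show "x + y \<in> nn L s" if "x \<in> nn L s" "y \<in> nn L s" for x y
    using that assms unfolding nn_def
    by (simp add: subspace_add lin_add[OF l]) (metis add.right_neutral)
  show "c *s x \<in> nn L s" if "x \<in> nn L s" for c x
    using that assms unfolding nn_def by (simp add: subspace_scale lin_scale[OF l])
qed

lemma subspace_bb: assumes "subspace L" shows "subspace (bb L s)"
proof (rule subspaceI)
  note l = lin_comp[OF lin_br]
  show "0 \<in> bb L s" using assms by (simp add: bb_def subspace_0 lin_0[OF l])
  show "x + y \<in> bb L s" if "x \<in> bb L s" "y \<in> bb L s" for x y
    using that assms unfolding bb_def
    by (simp add: subspace_add lin_add[OF l]) (metis add.right_neutral)
  show "c *s x \<in> bb L s" if "x \<in> bb L s" for c x
    using that assms unfolding bb_def by (simp add: subspace_scale lin_scale[OF l])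
qed

lemma nn_bb: "nn L s \<subseteq> bb L s" by (auto simp: nn_def bb_def)
lemma bb_L: "bb L s \<subseteq> L" by (auto simp: bb_def)
lemma nn_L: "nn L s \<subseteq> L" by (auto simp: nn_def)

lemma zc_bb: "zc L s \<subseteq> bb L s"
  using comp_0_fix[of s] by (auto simp: zc_def bb_def split: if_splits)

lemma comp_br:
  "gcomp (br s) c (br x y) = (\<Sum>a\<in>spec (br s). br (gcomp (br s) a x) (gcomp (br s) (c - a) y))"
proof -
  have "gcomp (br s) c (br x y) = gcomp (br s) c (br (\<Sum>a\<in>spec (br s). gcomp (br s) a x) y)"
    using sum_comp[OF lin_br] by simp
  also have "\<dots> = (\<Sum>a\<in>spec (br s). gcomp (br s) c (br (gcomp (br s) a x) y))"
    by (simp add: br_sum_left lin_sum[OF lin_comp[OF lin_br]])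
  also have "\<dots> = (\<Sum>a\<in>spec (br s). br (gcomp (br s) a x) (gcomp (br s) (c - a) y))"
  proof (rule sum.cong)
    fix a
    show "gcomp (br s) c (br (gcomp (br s) a x) y) = br (gcomp (br s) a x) (gcomp (br s) (c - a) y)"
      using comp_shift[OF comp_gev[OF lin_br], where a = "c - a" and c = a and s = s and v = y and v1 = x] by simp
  qed simp
  finally show ?thesis .
qed

lemma comp_br_nonzero:
  assumes "gcomp (br s) c (br x y) \<noteq> 0"
  obtains a where "gcomp (br s) a x \<noteq> 0" "gcomp (br s) (c - a) y \<noteq> 0"
proof -
  have "\<exists>a. br (gcomp (br s) a x) (gcomp (br s) (c - a) y) \<noteq> 0"
  proof (rule ccontr)
    assume "\<not> ?thesis"
    then have "gcomp (br s) c (br x y) = 0" unfolding comp_br by simp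
    then show False using assms by simp
  qed
  then obtain a where a: "br (gcomp (br s) a x) (gcomp (br s) (c - a) y) \<noteq> 0" by blast
  then have "gcomp (br s) a x \<noteq> 0" "gcomp (br s) (c - a) y \<noteq> 0" using br_lin(5,6) by metis+
  then show thesis by (rule that)
qed

lemma br_bb_nn:
  assumes L: "subalg L" and x: "x \<in> bb L s" and y: "y \<in> nn L s"
  shows "br x y \<in> nn L s"
proof -
  have "cpos c" if c: "gcomp (br s) c (br x y) \<noteq> 0" for c
  proof -
    obtain a where "gcomp (br s) a x \<noteq> 0" "gcomp (br s) (c - a) y \<noteq> 0" using comp_br_nonzero[OF c] .
    then have "a = 0 \<or> cpos a" "cpos (c - a)" using x y by (auto simp: bb_def nn_def)
    then show ?thesis using cpos_add[of a "c - a"] by auto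
  qed
  then show ?thesis using x y L by (simp add: nn_def bb_def subalg_def)
qed

lemma br_bb_bb:
  assumes L: "subalg L" and x: "x \<in> bb L s" and y: "y \<in> bb L s"
  shows "br x y \<in> bb L s"
proof -
  have "c = 0 \<or> cpos c" if c: "gcomp (br s) c (br x y) \<noteq> 0" for c
  proof -
    obtain a where "gcomp (br s) a x \<noteq> 0" "gcomp (br s) (c - a) y \<noteq> 0" using comp_br_nonzero[OF c] .
    then have "a = 0 \<or> cpos a" "c - a = 0 \<or> cpos (c - a)" using x y by (auto simp: bb_def)
    then show ?thesis using cpos_add[of a "c - a"] by auto
  qed
  then show ?thesis using x y L by (simp add: bb_def subalg_def)
qed

lemma comp_comp: "gcomp (br s) a (gcomp (br s) b v) = (if a = b then gcomp (br s) b v else 0)"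
  by (rule comp_of_gev[OF lin_br comp_gev[OF lin_br]])

lemma bb_minus_comp:
  assumes L: "good L" and s: "s \<in> L" and v: "v \<in> bb L s"
  shows "v - gcomp (br s) 0 v \<in> nn L s"
proof -
  have "gcomp (br s) 0 v \<in> L" using good_comp[OF L s] v by (simp add: bb_def)
  then have "v - gcomp (br s) 0 v \<in> L" using v good_subspace[OF L] by (auto simp: bb_def intro: subspace_diff)
  moreover have "cpos a" if "gcomp (br s) a (v - gcomp (br s) 0 v) \<noteq> 0" for a
    using that v by (cases "a = 0") (auto simp: lin_diff[OF lin_comp[OF lin_br]] comp_comp bb_def)
  ultimately show ?thesis by (simp add: nn_def)
qed

lemma comp0_zc:
  assumes L: "good L" and s: "s \<in> L" "semis s" and v: "v \<in> L"
  shows "gcomp (br s) 0 v \<in> zc L s"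
  using good_comp[OF L s(1) v] semis_comp[OF s(2), of 0 v] by (simp add: zc_def)

text \<open>Along an upward closed set of eigenvalues, \<open>ad u\<close> removes the smallest one.\<close>
lemma nn_nilp:
  assumes u: "u \<in> nn UNIV s"
  shows "nilp (br u)"
proof -
  let ?up = "\<lambda>F. F \<subseteq> spec (br s) \<and> (\<forall>a\<in>F. \<forall>b\<in>spec (br s). cpos (b - a) \<longrightarrow> b \<in> F)"
  have key: "\<exists>n. (br u ^^ n) v = 0" if "?up F" "\<And>a. gcomp (br s) a v \<noteq> 0 \<Longrightarrow> a \<in> F" for F v
    using that
  proof (induction "card F" arbitrary: F v)
    case 0
    then have "F = {}" using finite_subset[OF _ finite_spec[OF lin_br]] by (metis card_eq_0_iff)
    then have "gcomp (br s) a v = 0" for a using 0 by blast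
    then have "v = 0" using sum_comp[OF lin_br, of s v] by simp
    then show ?case by (intro exI[of _ 0]) simp
  next
    case (Suc k)
    have fin: "finite F" using Suc.prems(1) finite_subset[OF _ finite_spec[OF lin_br]] by blast
    have "\<exists>m\<in>F. \<forall>a\<in>F. a = m \<or> cpos (a - m)"
    proof -
      have "\<exists>m\<in>G. \<forall>a\<in>G. a = m \<or> cpos (a - m)" if "finite G" "G \<noteq> {}" for G
        using that
      proof (induction G rule: finite_ne_induct)
        case (insert x G)
        then obtain m where m: "m \<in> G" "\<And>a. a \<in> G \<Longrightarrow> a = m \<or> cpos (a - m)" by blast
        show ?case
        proof (cases "x = m \<or> cpos (x - m)")
          case True then show ?thesis using m by (intro bexI[of _ m]) auto
        next
          case False
          then have mx: "cpos (m - x)" using cpos_total[of "x - m"] by auto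
          have "a = x \<or> cpos (a - x)" if "a \<in> insert x G" for a
            using that m(2)[of a] mx cpos_add[of "a - m" "m - x"] by auto
          then show ?thesis by (intro bexI[of _ x]) auto
        qed
      qed simp
      moreover have "F \<noteq> {}" using Suc(2) by auto
      ultimately show ?thesis using fin by blast
    qed
    then obtain m where m: "m \<in> F" "\<And>a. a \<in> F \<Longrightarrow> a = m \<or> cpos (a - m)" by blast
    let ?F = "F - {m}"
    have "k = card ?F" using Suc(2) fin m(1) by simp
    moreover have "?up ?F"
    proof (intro conjI ballI impI)
      fix a b assume ab: "a \<in> ?F" "b \<in> spec (br s)" "cpos (b - a)"
      have "b \<in> F" using Suc.prems(1) ab by blast
      moreover have "b \<noteq> m" using m(2)[of a] ab cpos_asym[of "b - a"] by auto
      ultimately show "b \<in> ?F" by blast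
    qed (use Suc.prems(1) in blast)
    moreover have "c \<in> ?F" if c: "gcomp (br s) c (br u v) \<noteq> 0" for c
    proof -
      obtain a where a: "gcomp (br s) a u \<noteq> 0" "gcomp (br s) (c - a) v \<noteq> 0" using comp_br_nonzero[OF c] .
      then have "cpos a" using u by (simp add: nn_def)
      moreover have ca: "c - a \<in> F" using Suc.prems(2) a by blast
      moreover have "c \<in> spec (br s)" using c comp_not_spec[OF lin_br] by blast
      ultimately have "c \<in> F" using Suc.prems(1)[THEN conjunct2, rule_format, of "c - a" c] by simp
      moreover have "c \<noteq> m" using m(2)[OF ca] \<open>cpos a\<close> cpos_asym[of a] not_cpos_0 by auto
      ultimately show ?thesis by blast
    qed
    ultimately obtain n where "(br u ^^ n) (br u v) = 0" using Suc.hyps(1)[of ?F "br u v"] by blast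
    then have "(br u ^^ Suc n) v = 0" by (simp add: funpow_swap1)
    then show ?case by blast
  qed
  have "\<exists>n. (br u ^^ n) v = 0" for v
    by (rule key[of "spec (br s)" v]) (use comp_not_spec[OF lin_br] in auto)
  then show ?thesis using nilp_iff[OF lin_br] by blast
qed

lemma kf_comp:
  assumes s: "semis s"
  shows "kf v w = (\<Sum>a\<in>spec (br s). kf (gcomp (br s) a v) (gcomp (br s) (- a) w))"
proof -
  have 1: "kf (gcomp (br s) a v) w = kf (gcomp (br s) a v) (gcomp (br s) (- a) w)" for a
  proof -
    have z: "kf (gcomp (br s) a v) (gcomp (br s) b w) = 0" if "b \<noteq> - a" for b
    proof (rule kf_eigen[OF semis_comp[OF s] semis_comp[OF s]])
      show "a + b \<noteq> 0" using that by (metis add.commute eq_neg_iff_add_eq_0)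
    qed
    have "kf (gcomp (br s) a v) w = kf (gcomp (br s) a v) (\<Sum>b\<in>spec (br s). gcomp (br s) b w)"
      using sum_comp[OF lin_br] by simp
    also have "\<dots> = (\<Sum>b\<in>spec (br s). kf (gcomp (br s) a v) (gcomp (br s) b w))" by (rule kf_sum)
    also have "\<dots> = (\<Sum>b\<in>spec (br s). if b = - a then kf (gcomp (br s) a v) (gcomp (br s) (- a) w) else 0)"
      by (rule sum.cong) (auto simp: z)
    also have "\<dots> = kf (gcomp (br s) a v) (gcomp (br s) (- a) w)"
      using finite_spec[OF lin_br] comp_not_spec[OF lin_br, of "- a" s w] by (auto simp: kf_simps)
    finally show ?thesis .
  qed
  have "kf v w = kf (\<Sum>a\<in>spec (br s). gcomp (br s) a v) w" using sum_comp[OF lin_br] by simp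
  also have "\<dots> = (\<Sum>a\<in>spec (br s). kf (gcomp (br s) a v) w)" by (rule kf_sum)
  finally show ?thesis using 1 by simp
qed

text \<open>Opposite eigenvalues pair, and \<open>bb\<close> contains all eigenvalues that are not
  negative. A component with eigenvalue zero or negative would therefore be orthogonal to the whole
  of \<open>L\<close>.\<close>

lemma perp_bb:
  assumes L: "good L" and s: "s \<in> L" "semis s"
  shows "perp kf L (bb L s) = nn L s"
proof
  show "nn L s \<subseteq> perp kf L (bb L s)"
  proof
    fix v assume v: "v \<in> nn L s"
    have "kf v w = 0" if w: "w \<in> bb L s" for w
    proof -
      have "kf (gcomp (br s) a v) (gcomp (br s) (- a) w) = 0" for a
      proof (cases "gcomp (br s) a v = 0")
        case False
        then have "cpos a" using v by (simp add: nn_def)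
        then have "\<not> (- a = 0 \<or> cpos (- a))" using cpos_asym not_cpos_0 by auto
        then have "gcomp (br s) (- a) w = 0" using w by (auto simp: bb_def)
        then show ?thesis by (simp add: kf_simps)
      qed (simp add: kf_simps)
      then show ?thesis unfolding kf_comp[OF s(2), of v w] by simp
    qed
    then show "v \<in> perp kf L (bb L s)" using v by (simp add: perp_def nn_def)
  qed
  show "perp kf L (bb L s) \<subseteq> nn L s"
  proof
    fix v assume v: "v \<in> perp kf L (bb L s)"
    then have vL: "v \<in> L" by (simp add: perp_def)
    have "cpos a" if a: "gcomp (br s) a v \<noteq> 0" for a
    proof (rule ccontr)
      assume na: "\<not> cpos a"
      have "kf (gcomp (br s) a v) y = 0" if y: "y \<in> L" for y
      proof -
        let ?y = "gcomp (br s) (- a) y"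
        have "?y \<in> bb L s"
          using good_comp[OF L s(1) y] comp_comp na cpos_total[of a] by (auto simp: bb_def split: if_splits)
        then have "0 = kf v ?y" using v by (simp add: perp_def)
        also have "\<dots> = (\<Sum>b\<in>spec (br s). if b = a then kf (gcomp (br s) a v) ?y else 0)"
          unfolding kf_comp[OF s(2), of v ?y] by (rule sum.cong) (auto simp: comp_comp kf_simps)
        also have "\<dots> = kf (gcomp (br s) a v) ?y"
          using a comp_not_spec[OF lin_br] finite_spec[OF lin_br] by auto
        finally have "kf (gcomp (br s) a v) ?y = 0" by simp
        moreover have "kf (gcomp (br s) a v) y = (\<Sum>b\<in>spec (br s). if b = a then kf (gcomp (br s) a v) ?y else 0)"
          unfolding kf_comp[OF s(2), of "gcomp (br s) a v" y] by (rule sum.cong) (auto simp: comp_comp kf_simps)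
        ultimately show ?thesis by (simp only: if_cancel sum.neutral_const)
      qed
      moreover have "gcomp (br s) a v \<in> L" by (rule good_comp[OF L s(1) vL])
      ultimately show False using a good_nd[OF L] by (auto simp: nondeg_def)
    qed
    then show "v \<in> nn L s" using vL by (simp add: nn_def)
  qed
qed

section \<open>Regular semisimple elements and the rank\<close>

definition abel :: "'g set \<Rightarrow> bool" where
  "abel A \<longleftrightarrow> (\<forall>x\<in>A. \<forall>y\<in>A. br x y = 0)"

lemma abel_subset: "abel A \<Longrightarrow> B \<subseteq> A \<Longrightarrow> abel B" by (auto simp: abel_def)

definition reg :: "'g set \<Rightarrow> 'g \<Rightarrow> bool" where
  "reg L s \<longleftrightarrow> s \<in> L \<and> semis s \<and> abel (zc L s)"

lemma regD: "reg L s \<Longrightarrow> s \<in> L" "reg L s \<Longrightarrow> semis s" "reg L s \<Longrightarrow> abel (zc L s)"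
  by (auto simp: reg_def)

lemma reg_nilp_zero:
  assumes L: "good L" and s: "reg L s" and v: "v \<in> zc L s" "nilp (br v)"
  shows "v = 0"
proof -
  have "kf v y = 0" if "y \<in> zc L s" for y
    using kf_nilp_commute[OF v(2)] s v that by (auto simp: reg_def abel_def)
  then show ?thesis using good_nd[OF good_zc[OF L regD(2,1)[OF s]]] v by (simp add: nondeg_def)
qed

lemma reg_toral:
  assumes L: "good L" and s: "reg L s" and v: "v \<in> zc L s"
  shows "semis v"
proof -
  obtain u n where un: "v = u + n" "semis u" "nilp (br n)" "n \<in> zc L s"
    using good_jordan[OF good_zc[OF L regD(2,1)[OF s]] v] by metis
  then have "n = 0" using reg_nilp_zero[OF L s] by blast
  then show ?thesis using un by simp
qed

text \<open>In the order of eigenvalues the lowest part of ad u is ad of the component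
  \<open>?t\<close> of \<open>u\<close> in the Cartan subalgebra. Nilpotence passes to that part,
  and a nilpotent element of the Cartan subalgebra is zero.\<close>

lemma bb_nilp_nn:
  assumes L: "good L" and s: "reg L s" and u: "u \<in> bb L s" "nilp (br u)"
  shows "u \<in> nn L s"
proof -
  note s' = regD[OF s]
  let ?t = "gcomp (br s) 0 u"
  have uL: "u \<in> L" using u by (simp add: bb_def)
  have tz: "?t \<in> zc L s" by (rule comp0_zc[OF L s'(1,2) uL])
  have lead: "gcomp (br s) a ((br u ^^ n) v) = (br ?t ^^ n) v \<and>
      (\<forall>b. gcomp (br s) b ((br u ^^ n) v) \<noteq> 0 \<longrightarrow> b = a \<or> cpos (b - a))" if v: "v \<in> gev (br s) a" for a v n
  proof (induction n)
    case 0
    then show ?case using comp_of_gev[OF lin_br v] by (auto split: if_splits)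
  next
    case (Suc n)
    let ?w = "(br u ^^ n) v"
    have IH: "gcomp (br s) a ?w = (br ?t ^^ n) v" "\<And>b. gcomp (br s) b ?w \<noteq> 0 \<Longrightarrow> b = a \<or> cpos (b - a)" using Suc by auto
    have "br (gcomp (br s) c u) (gcomp (br s) (a - c) ?w) = 0" if c: "c \<noteq> 0" for c
    proof (rule ccontr)
      assume "br (gcomp (br s) c u) (gcomp (br s) (a - c) ?w) \<noteq> 0"
      then have "gcomp (br s) c u \<noteq> 0" "gcomp (br s) (a - c) ?w \<noteq> 0" by (auto simp: br_lin)
      then have "cpos c" "a - c = a \<or> cpos (a - c - a)" using c u IH(2)[of "a - c"] by (auto simp: bb_def)
      then show False using c cpos_asym[of c] by auto
    qed
    then have "gcomp (br s) a (br u ?w) = (\<Sum>c\<in>spec (br s). if c = 0 then br ?t (gcomp (br s) a ?w) else 0)"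
      unfolding comp_br by (intro sum.cong) auto
    also have "\<dots> = br ?t (gcomp (br s) a ?w)"
      using finite_spec[OF lin_br] comp_not_spec[OF lin_br, of 0 s u] by (auto simp: br_lin)
    finally have 1: "gcomp (br s) a ((br u ^^ Suc n) v) = (br ?t ^^ Suc n) v" using IH(1) by simp
    have 2: "b = a \<or> cpos (b - a)" if b: "gcomp (br s) b (br u ?w) \<noteq> 0" for b
    proof -
      obtain c where "gcomp (br s) c u \<noteq> 0" "gcomp (br s) (b - c) ?w \<noteq> 0" using comp_br_nonzero[OF b] .
      then have c: "c = 0 \<or> cpos c" "b - c = a \<or> cpos (b - c - a)" using u IH(2) by (auto simp: bb_def)
      have "c + (b - c - a) = b - a" by simp
      then show ?thesis using c cpos_add[of c "b - c - a"] by auto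
    qed
    from 1 2 show ?case by simp
  qed
  have "nilp (br ?t)"
  proof -
    obtain N where N: "\<And>v. (br u ^^ N) v = 0" using u(2) by (auto simp: nilp_def)
    have "v \<in> gev (br ?t) 0" if v: "v \<in> gev (br s) a" for v a
    proof -
      have "(br ?t ^^ N) v = 0" using lead[OF v, of N] N lin_0[OF lin_comp[OF lin_br]] by simp
      then show ?thesis by (auto simp: gev_def)
    qed
    then have "v \<in> gev (br ?t) 0" for v
      using grge_comp_sum[of s v, OF _ subspace_gev[OF lin_br]] comp_gev[OF lin_br] by blast
    then show ?thesis using nilp_gev[OF lin_br] by blast
  qed
  then have "?t = 0" using reg_nilp_zero[OF L s tz] by blast
  then show ?thesis using bb_minus_comp[OF L s'(1) u(1)] by simp
qed

lemma nn_bb_nn: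
  assumes L: "good L" and s: "reg L s1" "reg L s2" and v: "v \<in> nn L s1" "v \<in> bb L s2"
  shows "v \<in> nn L s2"
proof -
  have "v \<in> nn UNIV s1" using v by (simp add: nn_def)
  then show ?thesis using bb_nilp_nn[OF L s(2) v(2)] nn_nilp by blast
qed

text \<open>Two Borel-type subalgebras meet in a subalgebra that surjects onto both Cartan quotients: the
  orthogonal of \<open>b\<^sub>1 \<inter> b\<^sub>2 + n\<^sub>1\<close> is \<open>(n\<^sub>1 + n\<^sub>2) \<inter> b\<^sub>1 = n\<^sub>1\<close>.\<close>
lemma bb_covered:
  assumes L: "good L" and s: "reg L s1" "reg L s2" and v: "v \<in> bb L s1"
  obtains x y where "x \<in> bb L s1" "x \<in> bb L s2" "y \<in> nn L s1" "v = x + y"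
proof -
  note sL = good_subspace[OF L]
  let ?b1 = "bb L s1" and ?b2 = "bb L s2" and ?n1 = "nn L s1" and ?n2 = "nn L s2"
  let ?W = "{x + y |x y. x \<in> ?b1 \<inter> ?b2 \<and> y \<in> ?n1}"
  have sW: "subspace ?W" by (rule subspace_sums[OF subspace_inter[OF subspace_bb[OF sL] subspace_bb[OF sL]] subspace_nn[OF sL]])
  have W1: "?W \<subseteq> ?b1" using nn_bb[of L s1] subspace_add[OF subspace_bb[OF sL]] by blast
  have WL: "?W \<subseteq> L" using W1 bb_L by blast
  note form = is_form_kf and nd = good_nd[OF L]
  have n1: "perp kf L ?n1 = ?b1"
    using perp_perp[OF form nd subspace_bb[OF sL] bb_L, of s1] perp_bb[OF L regD(1,2)[OF s(1)]] by simp
  have sub: "perp kf L (perp kf L ?W) \<supseteq> ?b1"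
  proof -
    have "perp kf L ?W \<subseteq> ?n1"
    proof
      fix z assume z: "z \<in> perp kf L ?W"
      then have zL: "z \<in> L" by (simp add: perp_def)
      have "kf z y = 0" if "y \<in> ?n1" for y
      proof -
        have "0 + y \<in> ?W" using that subspace_0[OF subspace_bb[OF sL]] by blast
        then show ?thesis using z by (simp add: perp_def)
      qed
      then have zb1: "z \<in> ?b1" using zL n1 by (auto simp: perp_def)
      have zb: "kf z x = 0" if "x \<in> ?b1 \<inter> ?b2" for x
      proof -
        have "x + 0 \<in> ?W" using that subspace_0[OF subspace_nn[OF sL]] by blast
        then show ?thesis using z by (simp add: perp_def)
      qed
      let ?S = "{x + y |x y. x \<in> ?n1 \<and> y \<in> ?n2}"
      have sS: "subspace ?S" by (rule subspace_sums[OF subspace_nn[OF sL] subspace_nn[OF sL]])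
      have SL: "?S \<subseteq> L" using nn_L subspace_add[OF sL] by blast
      have "perp kf L ?S \<subseteq> ?b1 \<inter> ?b2"
      proof
        fix w assume w: "w \<in> perp kf L ?S"
        have "kf w y = 0" if "y \<in> ?n1" for y
        proof -
          have "y + 0 \<in> ?S" using that subspace_0[OF subspace_nn[OF sL]] by blast
          then show ?thesis using w by (simp add: perp_def)
        qed
        moreover have "kf w y = 0" if "y \<in> ?n2" for y
        proof -
          have "0 + y \<in> ?S" using that subspace_0[OF subspace_nn[OF sL]] by blast
          then show ?thesis using w by (simp add: perp_def)
        qed
        moreover have "perp kf L ?n2 = ?b2"
          using perp_perp[OF form nd subspace_bb[OF sL] bb_L, of s2] perp_bb[OF L regD(1,2)[OF s(2)]] by simp
        ultimately show "w \<in> ?b1 \<inter> ?b2" using w n1 by (auto simp: perp_def)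
      qed
      then have "z \<in> perp kf L (perp kf L ?S)" using zb zL unfolding perp_def[of kf L "perp kf L ?S"] by blast
      then have "z \<in> ?S" using perp_perp[OF form nd sS SL] by simp
      then obtain x y where xy: "z = x + y" "x \<in> ?n1" "y \<in> ?n2" by blast
      have "y = z - x" using xy by simp
      then have "y \<in> ?b1" using zb1 xy(2) nn_bb subspace_diff[OF subspace_bb[OF sL]] by blast
      then have "y \<in> ?n1" by (rule nn_bb_nn[OF L s(2,1) xy(3)])
      then show "z \<in> ?n1" using xy subspace_add[OF subspace_nn[OF sL]] by blast
    qed
    then have "perp kf L ?n1 \<subseteq> perp kf L (perp kf L ?W)" unfolding perp_def[of kf L] by blast
    then show ?thesis using n1 by simp
  qed
  then have "v \<in> ?W" using v perp_perp[OF form nd sW WL] by blast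
  then show thesis using that by blast
qed

lemma dim_bb:
  assumes L: "good L" and s: "reg L s"
  shows "dim (bb L s) = dim (zc L s) + dim (nn L s)"
proof -
  note s' = regD[OF s] and sL = good_subspace[OF L]
  let ?P = "gcomp (br s) 0"
  have l: "lin ?P" by (rule lin_comp[OF lin_br])
  have "{x \<in> bb L s. ?P x = 0} = nn L s"
    using bb_minus_comp[OF L s'(1)] not_cpos_0 nn_bb by (auto simp: nn_def bb_def) 
  moreover have "?P ` bb L s = zc L s"
  proof
    show "?P ` bb L s \<subseteq> zc L s" using comp0_zc[OF L s'(1,2)] bb_L by blast
    show "zc L s \<subseteq> ?P ` bb L s"
    proof
      fix x assume x: "x \<in> zc L s"
      then have "?P x = x" using comp_0_fix[of s x 0] by (simp add: zc_def)
      then show "x \<in> ?P ` bb L s" using x zc_bb by force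
    qed
  qed
  ultimately show ?thesis using rank_nullity[OF l subspace_bb[OF sL], of s] by simp
qed

lemma dim_reg:
  assumes L: "good L" and s: "reg L s"
  shows "dim L = dim (zc L s) + 2 * dim (nn L s)"
  using dim_perp[OF is_form_kf good_nd[OF L] subspace_bb[OF good_subspace[OF L]] bb_L, of s]
    perp_bb[OF L regD(1,2)[OF s]] dim_bb[OF L s] by simp

text \<open>By \<open>bb_covered\<close>, \<open>bb L s1 \<inter> bb L s2\<close> and
  \<open>nn L s1\<close> add up to \<open>bb L s1\<close>, and they meet in
  \<open>nn L s1 \<inter> nn L s2\<close>. So the dimension of \<open>zc L s1\<close> is a
  difference that is symmetric in \<open>s1\<close> and \<open>s2\<close>.\<close>

lemma dim_reg_eq:
  assumes L: "good L" and s: "reg L s1" "reg L s2"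
  shows "dim (zc L s1) = dim (zc L s2)"
proof -
  note sL = good_subspace[OF L]
  have le: "dim (bb L s1) + dim (bb L s1 \<inter> nn L s1 \<inter> nn L s2) = dim (bb L s1 \<inter> bb L s2) + dim (nn L s1)"
    if s: "reg L s1" "reg L s2" for s1 s2
  proof -
    let ?A = "bb L s1 \<inter> bb L s2"
    have "{x + y |x y. x \<in> ?A \<and> y \<in> nn L s1} = bb L s1"
    proof
      show "{x + y |x y. x \<in> ?A \<and> y \<in> nn L s1} \<subseteq> bb L s1"
        using nn_bb[of L s1] subspace_add[OF subspace_bb[OF sL]] by blast
      show "bb L s1 \<subseteq> {x + y |x y. x \<in> ?A \<and> y \<in> nn L s1}"
      proof
        fix v assume v: "v \<in> bb L s1"
        show "v \<in> {x + y |x y. x \<in> ?A \<and> y \<in> nn L s1}"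
          by (rule bb_covered[OF L s v]) blast
      qed
    qed
    moreover have "?A \<inter> nn L s1 = bb L s1 \<inter> nn L s1 \<inter> nn L s2"
      using nn_bb_nn[OF L s] nn_bb by blast
    ultimately show ?thesis
      using dim_sum_Int[OF subspace_inter[OF subspace_bb[OF sL] subspace_bb[OF sL]] subspace_nn[OF sL], of s1 s2 s1] by simp
  qed
  have "bb L s1 \<inter> nn L s1 \<inter> nn L s2 = nn L s1 \<inter> nn L s2" "bb L s2 \<inter> nn L s2 \<inter> nn L s1 = nn L s1 \<inter> nn L s2"
    using nn_bb by blast+
  then have "dim (zc L s1) + dim (nn L s1 \<inter> nn L s2) = dim (bb L s1 \<inter> bb L s2)"
    "dim (zc L s2) + dim (nn L s1 \<inter> nn L s2) = dim (bb L s1 \<inter> bb L s2)"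
    using le[OF s] le[OF s(2,1)] dim_bb[OF L s(1)] dim_bb[OF L s(2)] by (simp_all add: Int_commute)
  then show ?thesis by simp
qed

lemma semis_0: "semis 0"
  by (rule semisI, rule span_base) (auto simp: br_lin intro: exI[of _ 0])

text \<open>Minimise the centraliser over semisimple elements. Semisimple elements of a minimal one
  are central in it, for \<open>semis_generic\<close> would produce a smaller one; nilpotent ones
  vanish, because the neutral element of a triple through them would be central. The Jordan
  decomposition does the rest.\<close>

lemma ex_reg:
  assumes L: "good L" shows "\<exists>s. reg L s"
proof -
  note sL = good_subspace[OF L]
  let ?Q = "\<lambda>s. s \<in> L \<and> semis s"
  obtain s where s: "?Q s" "\<And>s'. ?Q s' \<Longrightarrow> dim (zc L s) \<le> dim (zc L s')"
    using ex_has_least_nat[of ?Q 0 "\<lambda>s. dim (zc L s)"] subspace_0[OF sL] semis_0 by blast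
  let ?l = "zc L s"
  have l: "good ?l" by (rule good_zc[OF L]) (use s in auto)
  have cen: "br y z = 0" if y: "y \<in> ?l" "semis y" and z: "z \<in> ?l" for y z
  proof -
    have sy: "br s y = 0" "y \<in> L" using y by (auto simp: zc_def)
    obtain c where c: "semis (s + c *s y)" "\<And>v. br (s + c *s y) v = 0 \<longleftrightarrow> br s v = 0 \<and> br y v = 0"
      using semis_generic[OF _ y(2) sy(1)] s(1) by metis
    have "s + c *s y \<in> L" using s sy sL by (auto intro: subspace_add subspace_scale)
    then have "dim ?l \<le> dim (zc ?l y)" using s(2)[of "s + c *s y"] c zc_zc[OF c(2)] by simp
    moreover have "zc ?l y \<subseteq> ?l" by (auto simp: zc_def)
    moreover have "subspace (zc ?l y)" "subspace ?l"
      unfolding zc_def by (intro subspace_inter sL lin_subspace_kernel[OF lin_br])+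
    ultimately have "zc ?l y = ?l" using subspace_dim_equal by blast
    then show ?thesis using z by (auto simp: zc_def)
  qed
  have nonil: "n = 0" if n: "n \<in> ?l" "nilp (br n)" for n
  proof -
    obtain h f where h: "h \<in> ?l" "sl2_triple sc br n h f" using jacobson_morozov[OF l n] by blast
    have "br h n = 0" using cen[OF h(1) sl2_semis[OF h(2)] n(1)] .
    then show ?thesis using sl2D(1)[OF h(2)] by simp
  qed
  have "br y z = 0" if y: "y \<in> ?l" and z: "z \<in> ?l" for y z
  proof -
    obtain u n where "y = u + n" "semis u" "nilp (br n)" "u \<in> ?l" "n \<in> ?l" using good_jordan[OF l y] by metis
    then show ?thesis using nonil cen z by (metis add.right_neutral)
  qed
  then show ?thesis using s unfolding reg_def abel_def by blast
qed

lemma reg_zc: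
  assumes L: "good L" and h: "semis h" "h \<in> L" and s: "reg (zc L h) s"
  obtains s' where "reg L s'" "zc L s' = zc (zc L h) s"
proof -
  have sh: "br h s = 0" "s \<in> L" "semis s" using s by (auto simp: reg_def zc_def)
  obtain c where c: "semis (h + c *s s)" "\<And>v. br (h + c *s s) v = 0 \<longleftrightarrow> br h v = 0 \<and> br s v = 0"
    using semis_generic[OF h(1) sh(3,1)] by metis
  have "h + c *s s \<in> L" using h sh good_subspace[OF L] by (auto intro: subspace_add subspace_scale)
  then show thesis using that[of "h + c *s s"] c zc_zc[OF c(2)] s by (simp add: reg_def)
qed

text \<open>For \<open>x = u + n\<close> the centraliser of \<open>x\<close> is that of
  \<open>n\<close> inside \<open>zc L u\<close>, where \<open>sl2_dim\<close> bounds it below by the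
  centraliser of a neutral element. The latter is semisimple, so this centraliser contains a Cartan
  subalgebra of \<open>L\<close>.\<close>

lemma dim_zc_ge:
  assumes L: "good L" and s: "reg L s" and x: "x \<in> L"
  shows "dim (zc L s) \<le> dim (zc L x)"
proof -
  obtain u n where un: "x = u + n" "semis u" "nilp (br n)" "\<And>y. br x y = 0 \<Longrightarrow> br u y = 0" "u \<in> L" "n \<in> L"
    using good_jordan[OF L x] by metis
  let ?l = "zc L u"
  have l: "good ?l" by (rule good_zc[OF L un(2,5)])
  have "br x u = 0" using un(4)[OF br_self] br_0_commute by blast
  then have "br u n = 0" using un(1) br_0_commute[of x u] by (simp add: br_lin br_self)
  then have nl: "n \<in> ?l" using un by (simp add: zc_def)
  have eq: "zc L x = zc ?l n"
  proof -
    have "br n y = 0" if "br x y = 0" for y using un(1) un(4)[OF that] that by (simp add: br_lin)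
    then show ?thesis using un(1,4) by (auto simp: zc_def br_lin)
  qed
  obtain h f where hf: "h \<in> ?l" "f \<in> ?l" "sl2_triple sc br n h f" using jacobson_morozov[OF l nl un(3)] by blast
  have sh: "semis h" by (rule sl2_semis[OF hf(3)])
  have "dim (zc ?l n) \<ge> dim (zc ?l h)"
    using sl2_dim[OF hf(3) good_stable3[OF l nl hf(1,2)]] gr0_zc by simp
  moreover obtain s2 where s2: "reg (zc ?l h) s2" using ex_reg[OF good_zc[OF l sh hf(1)]] by blast
  obtain s1 where s1: "reg ?l s1" "zc ?l s1 = zc (zc ?l h) s2" using reg_zc[OF l sh hf(1) s2] by blast
  obtain s0 where s0: "reg L s0" "zc L s0 = zc ?l s1" using reg_zc[OF L un(2,5) s1(1)] by blast
  have "dim (zc L s0) \<le> dim (zc ?l h)" using s0 s1 by (intro dim_subset) (auto simp: zc_def)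
  ultimately show ?thesis using eq dim_reg_eq[OF L s s0(1)] by simp
qed

text \<open>\<open>Min\<close> is taken over an image of an infinite set; it carries information
  only because dimensions are bounded and the image is finite.\<close>

lemma lie_rank_eqI:
  assumes "x0 \<in> S" "\<And>x. x \<in> S \<Longrightarrow> dim (zc S x0) \<le> dim (zc S x)"
  shows "lie_rank sc br S = dim (zc S x0)"
proof -
  have fin: "finite ((\<lambda>x. dim (S \<inter> centralizer br {x})) ` S)"
    by (rule finite_subset[of _ "{..dimension}"]) (auto simp: dim_subset_UNIV)
  show ?thesis unfolding lie_rank_def
    by (rule Min_eqI[OF fin]) (use assms in \<open>auto simp: zc_centralizer\<close>)
qed

lemma lie_rank_reg: "good L \<Longrightarrow> reg L s \<Longrightarrow> lie_rank sc br L = dim (zc L s)"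
  by (rule lie_rank_eqI[OF regD(1) dim_zc_ge])

lemma lie_rank_le:
  assumes L: "good L" and x: "x \<in> L" shows "lie_rank sc br L \<le> dim (zc L x)"
proof -
  obtain s where s: "reg L s" using ex_reg[OF L] by blast
  show ?thesis using lie_rank_reg[OF L s] dim_zc_ge[OF L s x] by simp
qed

lemma lie_rank_zc:
  assumes L: "good L" and h: "semis h" "h \<in> L"
  shows "lie_rank sc br (zc L h) = lie_rank sc br L"
proof -
  have l: "good (zc L h)" by (rule good_zc[OF L h])
  obtain s where s: "reg (zc L h) s" using ex_reg[OF l] by blast
  obtain s' where "reg L s'" "zc L s' = zc (zc L h) s" using reg_zc[OF L h s] by blast
  then show ?thesis using lie_rank_reg[OF L] lie_rank_reg[OF l s] by simp
qed

text \<open>\<open>zc L s\<close> has the same rank as \<open>L\<close>; if its dimension does not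
  exceed that rank, it coincides with one of its own Cartan subalgebras and is abelian.\<close>

lemma reg_if_dim:
  assumes L: "good L" and s: "semis s" "s \<in> L" and d: "dim (zc L s) \<le> lie_rank sc br L"
  shows "reg L s"
proof -
  have l: "good (zc L s)" by (rule good_zc[OF L s])
  obtain u where u: "reg (zc L s) u" using ex_reg[OF l] by blast
  have "dim (zc (zc L s) u) \<ge> dim (zc L s)"
    using d lie_rank_zc[OF L s] lie_rank_reg[OF l u] by simp
  moreover have "zc (zc L s) u \<subseteq> zc L s" by (auto simp: zc_def)
  moreover have "subspace (zc (zc L s) u)" using good_subspace[OF good_zc[OF l regD(2,1)[OF u]]] .
  ultimately have "zc (zc L s) u = zc L s" using subspace_dim_equal good_subspace[OF l] by blast
  then show ?thesis using u s by (simp add: reg_def)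
qed

subsection \<open>The derived subalgebra\<close>

definition cen :: "'g set \<Rightarrow> 'g set" where
  "cen L = {z \<in> L. \<forall>x\<in>L. br x z = 0}"

lemma subspace_cen: "subspace L \<Longrightarrow> subspace (cen L)"
  by (rule subspaceI) (auto simp: cen_def subspace_0 subspace_add subspace_scale br_lin)

lemma perp_derived:
  assumes L: "good L" shows "perp kf L (prodspan L L) = cen L"
proof
  show "perp kf L (prodspan L L) \<subseteq> cen L"
  proof
    fix z assume z: "z \<in> perp kf L (prodspan L L)"
    have "br x z = 0" if x: "x \<in> L" for x
    proof -
      have "kf (br x z) y = 0" if "y \<in> L" for y
        using z kf_inv'[of x z y] prodspan_mem[OF x that] by (simp add: perp_def)
      moreover have "br x z \<in> L" using x z good_br[OF L] by (simp add: perp_def)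
      ultimately show ?thesis using good_nd[OF L] by (simp add: nondeg_def)
    qed
    then show "z \<in> cen L" using z by (simp add: cen_def perp_def)
  qed
  show "cen L \<subseteq> perp kf L (prodspan L L)"
  proof
    fix z assume z: "z \<in> cen L"
    have s: "subspace {w. kf z w = 0}" by (rule subspaceI) (auto simp: kf_simps)
    have "prodspan L L \<subseteq> {w. kf z w = 0}"
    proof (rule prodspan_minimal[OF s])
      fix x y assume "x \<in> L" "y \<in> L"
      then have "kf (br x z) y = 0" using z by (simp add: cen_def kf_simps)
      then show "br x y \<in> {w. kf z w = 0}" using kf_inv'[of x z y] by simp
    qed
    then show "z \<in> perp kf L (prodspan L L)" using z by (auto simp: perp_def cen_def)
  qed
qed

lemma cen_closed:
  assumes L: "good L" and z: "z \<in> cen L" and z': "\<And>y. br z y = 0 \<Longrightarrow> br z' y = 0"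
  shows "z' \<in> cen L"
proof -
  have "br z' x = 0" if "x \<in> L" for x using z z'[of x] that br_0_commute by (auto simp: cen_def)
  moreover have "z' \<in> L" using good_closed[OF L _ z', of z] z by (simp add: cen_def)
  ultimately show ?thesis using br_0_commute by (auto simp: cen_def)
qed

lemma cen_nilp_zero:
  assumes L: "good L" and z: "z \<in> cen L" "nilp (br z)" shows "z = 0"
proof -
  have "kf z y = 0" if "y \<in> L" for y
    using kf_nilp_commute[OF z(2), of y] z(1) that br_0_commute by (auto simp: cen_def)
  then show ?thesis using good_nd[OF L] z by (auto simp: nondeg_def cen_def)
qed

text \<open>The conjugate of \<open>z\<close> given by \<open>conj_elt\<close> is again central, so orthogonality makes \<open>z\<close> nilpotent.\<close>
lemma cen_perp_zero:
  assumes L: "good L" and z: "z \<in> cen L" "\<And>w. w \<in> cen L \<Longrightarrow> kf z w = 0" shows "z = 0"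
proof -
  obtain z' where z': "\<And>y. br z y = 0 \<Longrightarrow> br z' y = 0" "kf z' z = 0 \<Longrightarrow> nilp (br z)" using conj_elt[of z] by blast
  have "z' \<in> cen L" by (rule cen_closed[OF L z(1) z'(1)])
  then have "nilp (br z)" using z(2)[of z'] z'(2) kf_sym[of z z'] by simp
  then show ?thesis by (rule cen_nilp_zero[OF L z(1)])
qed

lemma derived_L: "good L \<Longrightarrow> prodspan L L \<subseteq> L"
  using good_br good_subspace by (intro prodspan_minimal) auto

lemma cen_derived_zero:
  assumes L: "good L" and z: "z \<in> cen L" "z \<in> prodspan L L" shows "z = 0"
proof (rule cen_perp_zero[OF L z(1)])
  fix w assume "w \<in> cen L"
  then have "kf w z = 0" using perp_derived[OF L] z(2) by (auto simp: perp_def)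
  then show "kf z w = 0" using kf_sym by simp
qed

lemma cen_derived_sum:
  assumes L: "good L" and x: "x \<in> L"
  obtains z d where "z \<in> cen L" "d \<in> prodspan L L" "x = z + d"
proof -
  note sL = good_subspace[OF L]
  have sc: "subspace (cen L)" by (rule subspace_cen[OF sL])
  let ?S = "{z + d |z d. z \<in> cen L \<and> d \<in> prodspan L L}"
  have sS: "subspace ?S" by (rule subspace_sums[OF sc subspace_prodspan])
  have i0: "cen L \<inter> prodspan L L = {0}" using cen_derived_zero[OF L] subspace_0[OF sc] subspace_0[OF subspace_prodspan] by auto
  have "dim ?S = dim L"
    using dim_sum_Int[OF sc subspace_prodspan, of L L] i0
      dim_perp[OF is_form_kf good_nd[OF L] subspace_prodspan derived_L[OF L]] perp_derived[OF L] by simp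
  moreover have "?S \<subseteq> L" using derived_L[OF L] subspace_add[OF sL] by (auto simp: cen_def)
  ultimately have "?S = L" using subspace_dim_equal[OF sS sL] by simp
  then show thesis using x that by blast
qed

text \<open>\<open>L\<close> is the direct sum of its centre and its derived algebra, and central
  parts do not affect brackets. Hence rank and centraliser dimension change by the same amount
  between \<open>L\<close> and \<open>[L, L]\<close>.\<close>

lemma zc_cen_split:
  assumes L: "good L" and z: "z \<in> cen L" and d: "d \<in> prodspan L L"
  shows "dim (zc L (z + d)) = dim (cen L) + dim (zc (prodspan L L) d)"
proof -
  note sL = good_subspace[OF L]
  let ?D = "prodspan L L"
  have sD: "subspace (zc ?D d)" unfolding zc_def by (intro subspace_inter subspace_prodspan lin_subspace_kernel[OF lin_br])
  have sc: "subspace (cen L)" by (rule subspace_cen[OF sL])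
  have dL: "d \<in> L" using d derived_L[OF L] by blast
  have bz: "br z y = 0" if "y \<in> L" for y using z that br_0_commute by (auto simp: cen_def)
  have "zc L (z + d) = {x + y |x y. x \<in> cen L \<and> y \<in> zc ?D d}"
  proof
    show "zc L (z + d) \<subseteq> {x + y |x y. x \<in> cen L \<and> y \<in> zc ?D d}"
    proof
      fix v assume v: "v \<in> zc L (z + d)"
      then have vL: "v \<in> L" "br d v = 0" using bz by (auto simp: zc_def br_lin)
      obtain x y where xy: "x \<in> cen L" "y \<in> ?D" "v = x + y" using cen_derived_sum[OF L vL(1)] .
      have "br d x = 0" using xy(1) dL by (simp add: cen_def)
      then have "y \<in> zc ?D d" using xy vL by (simp add: zc_def br_lin)
      then show "v \<in> {x + y |x y. x \<in> cen L \<and> y \<in> zc ?D d}" using xy by blast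
    qed
    show "{x + y |x y. x \<in> cen L \<and> y \<in> zc ?D d} \<subseteq> zc L (z + d)"
    proof clarify
      fix x y assume x: "x \<in> cen L" and y: "y \<in> zc ?D d"
      have "y \<in> L" "x \<in> L" using x y derived_L[OF L] by (auto simp: zc_def cen_def)
      moreover have "br d x = 0" using x dL by (simp add: cen_def)
      ultimately show "x + y \<in> zc L (z + d)" using bz y sL by (auto simp: zc_def br_lin subspace_add)
    qed
  qed
  moreover have "cen L \<inter> zc ?D d = {0}"
    using cen_derived_zero[OF L] subspace_0[OF sc] subspace_0[OF sD] by (auto simp: zc_def)
  ultimately show ?thesis using dim_sum_Int[OF sc sD] by simp
qed

lemma lie_rank_derived:
  assumes L: "good L"
  shows "lie_rank sc br L = dim (cen L) + lie_rank sc br (prodspan L L)"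
proof -
  let ?D = "prodspan L L"
  have "0 \<in> ?D" using subspace_0[OF subspace_prodspan] .
  then obtain d where d: "d \<in> ?D" "\<And>d'. d' \<in> ?D \<Longrightarrow> dim (zc ?D d) \<le> dim (zc ?D d')"
    using ex_has_least_nat[of "\<lambda>d. d \<in> ?D" 0 "\<lambda>d. dim (zc ?D d)"] by blast
  have rD: "lie_rank sc br ?D = dim (zc ?D d)" by (rule lie_rank_eqI[OF d])
  have c0: "0 \<in> cen L" using subspace_0[OF subspace_cen[OF good_subspace[OF L]]] .
  have zd: "dim (zc L d) = dim (cen L) + dim (zc ?D d)" if "d \<in> ?D" for d using zc_cen_split[OF L c0 that] by simp
  have "lie_rank sc br L = dim (zc L d)"
  proof (rule lie_rank_eqI)
    show "d \<in> L" using d derived_L[OF L] by blast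
    fix x assume "x \<in> L"
    then obtain z y where "z \<in> cen L" "y \<in> ?D" "x = z + y" using cen_derived_sum[OF L] by metis
    then show "dim (zc L d) \<le> dim (zc L x)" using zc_cen_split[OF L, of z y] zd[OF d(1)] d(2) by simp
  qed
  then show ?thesis using zd[OF d(1)] rD by simp
qed

lemma nilp_in_derived:
  assumes L: "good L" and x: "x \<in> L" "nilp (br x)" shows "x \<in> prodspan L L"
proof -
  have "x \<in> perp kf L (cen L)"
    using kf_nilp_commute[OF x(2)] x(1) by (auto simp: perp_def cen_def)
  then show ?thesis
    using perp_perp[OF is_form_kf good_nd[OF L] subspace_prodspan derived_L[OF L]] perp_derived[OF L] by simp
qed

text \<open>Nilpotence is given on \<open>[L, L]\<close> only, but ad x maps \<open>L\<close> into
  it and so is nilpotent on \<open>L\<close>. Hence the semisimple part \<open>u\<close> is central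
  in \<open>L\<close>; being also orthogonal to the centre, it vanishes.\<close>

lemma derived_nilp:
  assumes L: "good L" and x: "x \<in> prodspan L L" and n: "ad_nilpotent_on br (prodspan L L) x"
  shows "nilp (br x)"
proof -
  note sL = good_subspace[OF L]
  have xL: "x \<in> L" using x derived_L[OF L] by blast
  obtain u v where uv: "x = u + v" "semis u" "nilp (br v)" "\<And>y. br x y = 0 \<Longrightarrow> br u y = 0" "u \<in> L" "v \<in> L"
      "\<And>a y. br x y = a *s y \<Longrightarrow> br u y = a *s y" using good_jordan[OF L xL] by metis
  have "br x u = 0" using uv(4)[OF br_self] br_0_commute by blast
  then have uv0: "br u v = 0" using uv(1) br_0_commute[of x u] by (simp add: br_lin br_self)
  have "br u y = 0" if y: "y \<in> L" for y
  proof -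
    obtain k where k: "\<forall>y\<in>prodspan L L. (br x ^^ k) y = 0" using n by (auto simp: ad_nilpotent_on_def)
    have xn: "\<exists>k. (br x ^^ k) y = 0" if "y \<in> L" for y
    proof -
      have "br x y \<in> prodspan L L" using prodspan_mem[OF xL that] .
      then have "(br x ^^ Suc k) y = 0" using k by (simp add: funpow_swap1)
      then show ?thesis by blast
    qed
    \<comment> \<open>An eigenvector of ad x inside the \<open>a\<close>-eigenspace of ad u again
      has eigenvalue \<open>a\<close>, against the nilpotence of ad x on \<open>L\<close>.\<close>
    have "gcomp (br u) a y = 0" if a: "a \<noteq> 0" for a
    proof (rule ccontr)
      assume c: "gcomp (br u) a y \<noteq> 0"
      have cL: "gcomp (br u) a y \<in> L" by (rule good_comp[OF L uv(5) y])
      let ?W = "L \<inter> {w. br u w = a *s w}"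
      have sW: "subspace ?W" using sL lin_subspace_kernel[OF lin_shift[OF lin_br, of u a]]
        by (intro subspace_inter) auto
      have W: "br x w \<in> ?W" if "w \<in> ?W" for w
      proof -
        have "br u x = 0" using uv(1) uv0 by (simp add: br_lin br_self)
        then show ?thesis using that xL good_br[OF L] jacobi[of u x w] by (simp add: br_lin)
      qed
      have "gcomp (br u) a y \<in> ?W" using cL semis_comp[OF uv(2), of a y] by simp
      from ex_eigenvector[OF lin_br sW W this c]
      obtain b w where w: "w \<in> ?W" "w \<noteq> 0" "br x w = b *s w" by metis
      have "b *s w = a *s w" using uv(7)[OF w(3)] w(1) by simp
      then have ba: "br x w = a *s w" using w(3) by simp
      have "(br x ^^ k) w = a ^ k *s w" for k by (induction k) (simp_all add: ba br_lin mult.commute)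
      then show False using xn[of w] w a by auto
    qed
    then have "gcomp (br u) a y \<in> {w. br u w = 0}" for a
      using semis_comp[OF uv(2), of 0 y] by (cases "a = 0") (auto simp: br_lin)
    then show ?thesis using grge_comp_sum[of u y "{w. br u w = 0}"] lin_subspace_kernel[OF lin_br] by blast
  qed
  then have uc: "u \<in> cen L" using uv(5) br_0_commute by (auto simp: cen_def)
  have "u = 0"
  proof (rule cen_perp_zero[OF L uc])
    fix w assume w: "w \<in> cen L"
    have "kf w x = 0" using w x perp_derived[OF L] by (auto simp: perp_def)
    moreover have "kf v w = 0" using kf_nilp_commute[OF uv(3)] w uv(6) by (auto simp: cen_def)
    ultimately show "kf u w = 0" using uv(1) kf_sym[of w x] by (simp add: kf_simps)
  qed
  then show ?thesis using uv by simp
qed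

text \<open>The centre adds its dimension both to the rank and to the centraliser, and nilpotent
  elements of \<open>L\<close> lie in \<open>[L, L]\<close> because they are orthogonal to the
  centre.\<close>

lemma regular_nilpotent_iff:
  assumes L: "good L"
  shows "regular_nilpotent_in sc br L x \<longleftrightarrow> x \<in> L \<and> nilp (br x) \<and> dim (zc L x) = lie_rank sc br L"
proof -
  let ?D = "prodspan L L"
  have c0: "0 \<in> cen L" using subspace_0[OF subspace_cen[OF good_subspace[OF L]]] .
  have zd: "dim (zc L d) = dim (cen L) + dim (zc ?D d)" if "d \<in> ?D" for d using zc_cen_split[OF L c0 that] by simp
  have def: "regular_nilpotent_in sc br L x \<longleftrightarrow> x \<in> ?D \<and> ad_nilpotent_on br ?D x \<and> dim (zc ?D x) = lie_rank sc br ?D"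
    by (simp add: regular_nilpotent_in_def Let_def zc_centralizer)
  have "ad_nilpotent_on br ?D x" if "nilp (br x)" using that by (auto simp: nilp_def ad_nilpotent_on_def)
  moreover have "dim (zc ?D x) = lie_rank sc br ?D \<longleftrightarrow> dim (zc L x) = lie_rank sc br L" if "x \<in> ?D"
    using zd[OF that] lie_rank_derived[OF L] by simp
  ultimately show ?thesis unfolding def
    using nilp_in_derived[OF L, of x] derived_nilp[OF L, of x] derived_L[OF L] by blast
qed

subsection \<open>Exponentials and the adjoint group\<close>

lemma exp_ad_eq:
  assumes n: "(br x ^^ n) y = 0"
  shows "exp_ad sc br x y = (\<Sum>k<n. (1 / fact k) *s (br x ^^ k) y)"
proof -
  let ?t = "\<lambda>k. (1 / fact k) *s (br x ^^ k) y"
  let ?N = "card Basis"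
  have N: "(br x ^^ ?N) y = 0" by (rule nilp_power_dim[OF lin_br n])
  have 1: "?t k = 0" if "k \<ge> n" for k using funpow_0_mono[OF lin_br n that] by simp
  have 2: "?t k = 0" if "k > ?N" for k using funpow_0_mono[OF lin_br N, of k] that by simp
  have "exp_ad sc br x y = (\<Sum>k\<le>?N. ?t k)" by (simp add: exp_ad_def)
  also have "\<dots> = (\<Sum>k\<in>{..?N} \<union> {..<n}. ?t k)"
    by (rule sum.mono_neutral_left) (use 2 in \<open>auto simp del: scale_eq_0_iff\<close>)
  also have "\<dots> = (\<Sum>k<n. ?t k)"
    by (rule sum.mono_neutral_right) (use 1 in \<open>auto simp del: scale_eq_0_iff\<close>)
  finally show ?thesis .
qed

lemma exp_ad_nilp:
  assumes x: "nilp (br x)" and n: "n \<ge> card Basis"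
  shows "exp_ad sc br x y = (\<Sum>k<n. (1 / fact k) *s (br x ^^ k) y)"
proof (rule exp_ad_eq)
  obtain m where "(br x ^^ m) y = 0" using x by (auto simp: nilp_def)
  from nilp_power_dim[OF lin_br this] show "(br x ^^ n) y = 0" using funpow_0_mono[OF lin_br _ n] by blast
qed

lemma lin_exp_ad: "lin (exp_ad sc br x)"
  unfolding exp_ad_def by (intro lin_sums lin_smult lin_funpow lin_br)

lemma exp_ad_expand:
  assumes x: "nilp (br x)"
  shows "exp_ad sc br x y = y + br x y + (\<Sum>k<card Basis. (1 / fact (Suc (Suc k))) *s (br x ^^ Suc (Suc k)) y)"
proof -
  have "exp_ad sc br x y = (\<Sum>k<Suc (Suc (card Basis)). (1 / fact k) *s (br x ^^ k) y)"
    by (rule exp_ad_nilp[OF x]) simp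
  then show ?thesis by (simp only: sum.lessThan_Suc_shift) (simp add: add.assoc)
qed

lemma ad_leibniz:
  "(br x ^^ n) (br y z) = (\<Sum>i\<le>n. of_nat (n choose i) *s br ((br x ^^ i) y) ((br x ^^ (n - i)) z))"
proof (induction n)
  case (Suc n)
  let ?b = "\<lambda>i j. br ((br x ^^ i) y) ((br x ^^ j) z)"
  have "(br x ^^ Suc n) (br y z) = (\<Sum>i\<le>n. of_nat (n choose i) *s (?b (Suc i) (n - i) + ?b i (Suc (n - i))))"
    unfolding funpow.simps comp_apply Suc by (simp add: br_sum br_lin jacobi[of x])
  also have "\<dots> = (\<Sum>i\<le>n. of_nat (n choose i) *s ?b (Suc i) (n - i)) + (\<Sum>i\<le>n. of_nat (n choose i) *s ?b i (Suc n - i))"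
    by (simp add: scale_right_distrib sum.distrib Suc_diff_le cong: sum.cong_simp)
  also have "(\<Sum>i\<le>n. of_nat (n choose i) *s ?b (Suc i) (n - i)) = (\<Sum>i\<le>Suc n. of_nat (if i = 0 then 0 else n choose (i - 1)) *s ?b i (Suc n - i))"
    by (subst sum.atMost_Suc_shift) (simp cong: sum.cong_simp)
  also have "(\<Sum>i\<le>n. of_nat (n choose i) *s ?b i (Suc n - i)) = (\<Sum>i\<le>Suc n. of_nat (n choose i) *s ?b i (Suc n - i))"
    by (simp)
  also have "(\<Sum>i\<le>Suc n. of_nat (if i = 0 then 0 else n choose (i - 1)) *s ?b i (Suc n - i)) + (\<Sum>i\<le>Suc n. of_nat (n choose i) *s ?b i (Suc n - i))
     = (\<Sum>i\<le>Suc n. of_nat (Suc n choose i) *s ?b i (Suc n - i))"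
    unfolding sum.distrib[symmetric]
  proof (rule sum.cong[OF refl])
    fix i
    have "(if i = 0 then 0 else n choose (i - 1)) + (n choose i) = (Suc n choose i)" by (cases i) auto
    then show "of_nat (if i = 0 then 0 else n choose (i - 1)) *s ?b i (Suc n - i) + of_nat (n choose i) *s ?b i (Suc n - i)
      = of_nat (Suc n choose i) *s ?b i (Suc n - i)"
      by (metis of_nat_add scale_left_distrib)
  qed
  finally show ?case .
qed simp

lemma fact_choose: "i \<le> n \<Longrightarrow> (1 / fact n) * of_nat (n choose i) = (1 / fact i) * (1 / fact (n - i) :: complex)"
  by (simp add: binomial_fact divide_simps)

lemma exp_ad_br:
  assumes x: "nilp (br x)"
  shows "exp_ad sc br x (br y z) = br (exp_ad sc br x y) (exp_ad sc br x z)"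
proof -
  let ?M = "card Basis"
  let ?g = "\<lambda>i j. ((1 / fact i) * (1 / fact j)) *s br ((br x ^^ i) y) ((br x ^^ j) z)"
  have z0: "(br x ^^ i) v = 0" if i: "i \<ge> ?M" for i v
  proof -
    obtain m where "(br x ^^ m) v = 0" using x by (auto simp: nilp_def)
    from nilp_power_dim[OF lin_br this] show ?thesis using funpow_0_mono[OF lin_br _ i] by blast
  qed
  \<comment> \<open>The cut-off \<open>2 * ?M\<close> makes the triangle of index pairs contain the
    square on which both iterates can be nonzero.\<close>
  have "exp_ad sc br x (br y z) = (\<Sum>n<2 * ?M. (1 / fact n) *s (br x ^^ n) (br y z))"
    by (rule exp_ad_nilp[OF x]) simp
  also have "\<dots> = (\<Sum>n<2 * ?M. \<Sum>i\<le>n. ?g i (n - i))"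
  proof (rule sum.cong[OF refl])
    fix n
    have "(1 / fact n) *s (br x ^^ n) (br y z) = (\<Sum>i\<le>n. ((1 / fact n) * of_nat (n choose i)) *s br ((br x ^^ i) y) ((br x ^^ (n - i)) z))"
      unfolding ad_leibniz by (simp add: scale_sum_right)
    also have "\<dots> = (\<Sum>i\<le>n. ?g i (n - i))" by (rule sum.cong[OF refl]) (simp only: fact_choose atMost_iff)
    finally show "(1 / fact n) *s (br x ^^ n) (br y z) = (\<Sum>i\<le>n. ?g i (n - i))" .
  qed
  also have "\<dots> = (\<Sum>(i, j)\<in>{(i, j). i + j < 2 * ?M}. ?g i j)" by (rule sum.triangle_reindex[symmetric])
  also have "\<dots> = (\<Sum>(i, j)\<in>{..<?M} \<times> {..<?M}. ?g i j)"
  proof (rule sum.mono_neutral_right)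
    show "finite {(i, j). i + j < 2 * ?M}"
      by (rule finite_subset[of _ "{..<2 * ?M} \<times> {..<2 * ?M}"]) auto
    show "\<forall>p\<in>{(i, j). i + j < 2 * ?M} - {..<?M} \<times> {..<?M}. (case p of (i, j) \<Rightarrow> ?g i j) = 0"
    proof
      fix p assume p: "p \<in> {(i, j). i + j < 2 * ?M} - {..<?M} \<times> {..<?M}"
      obtain i j where ij: "p = (i, j)" by (cases p)
      then have "i \<ge> ?M \<or> j \<ge> ?M" using p by auto
      then have "?g i j = 0" using z0 by (auto simp: br_lin)
      then show "(case p of (i, j) \<Rightarrow> ?g i j) = 0" using ij by simp
    qed
  qed auto
  also have "\<dots> = br (\<Sum>i<?M. (1 / fact i) *s (br x ^^ i) y) (\<Sum>j<?M. (1 / fact j) *s (br x ^^ j) z)"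
  proof -
    have "br (\<Sum>i<?M. (1 / fact i) *s (br x ^^ i) y) (\<Sum>j<?M. (1 / fact j) *s (br x ^^ j) z) = (\<Sum>i<?M. \<Sum>j<?M. ?g i j)"
      unfolding br_sum_left by (simp only: br_sum br_scale scale_scale scale_sum_right mult.commute)
    then show ?thesis by (simp only: sum.cartesian_product)
  qed
  also have "\<dots> = br (exp_ad sc br x y) (exp_ad sc br x z)"
    using exp_ad_nilp[OF x order.refl, of y] exp_ad_nilp[OF x order.refl, of z] by simp
  finally show ?thesis .
qed

lemma ad_neg_pow: "(br (- x) ^^ n) v = (-1) ^ n *s (br x ^^ n) v"
  by (induction n) (auto simp: br_lin)

lemma nilp_neg: "nilp (br x) \<Longrightarrow> nilp (br (- x))"
  unfolding nilp_def by (simp add: ad_neg_pow)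

lemma exp_ad_inverse:
  assumes x: "nilp (br x)"
  shows "exp_ad sc br (- x) (exp_ad sc br x y) = y"
proof -
  let ?M = "Suc (card Basis)"
  let ?g = "\<lambda>i j. ((1 / fact i) * (1 / fact j) * (-1) ^ i) *s (br x ^^ (i + j)) y"
  have z0: "(br x ^^ i) v = 0" if i: "i \<ge> ?M" for i v
  proof -
    obtain m where "(br x ^^ m) v = 0" using x by (auto simp: nilp_def)
    from nilp_power_dim[OF lin_br this] show ?thesis using funpow_0_mono[OF lin_br _, of "card Basis" x v i] i by simp
  qed
  have e: "exp_ad sc br (- x) v = (\<Sum>i<?M. ((1 / fact i) * (-1) ^ i) *s (br x ^^ i) v)" for v
    using exp_ad_nilp[OF nilp_neg[OF x], of ?M v] unfolding ad_neg_pow by (simp del: sum.lessThan_Suc)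
  have "exp_ad sc br (- x) (exp_ad sc br x y) = (\<Sum>i<?M. ((1 / fact i) * (-1) ^ i) *s (br x ^^ i) (\<Sum>j<?M. (1 / fact j) *s (br x ^^ j) y))"
    unfolding e using exp_ad_nilp[OF x, of ?M y] by simp
  also have "\<dots> = (\<Sum>i<?M. \<Sum>j<?M. ?g i j)"
    by (simp add: lin_sum[OF lin_funpow[OF lin_br]] lin_scale[OF lin_funpow[OF lin_br]] funpow_add scale_sum_right mult_ac del: sum.lessThan_Suc)
  also have "\<dots> = (\<Sum>(i, j)\<in>{..<?M} \<times> {..<?M}. ?g i j)" by (simp only: sum.cartesian_product)
  also have "\<dots> = (\<Sum>(i, j)\<in>{(i, j). i + j < ?M}. ?g i j)"
  proof (rule sum.mono_neutral_right)
    show "\<forall>p\<in>{..<?M} \<times> {..<?M} - {(i, j). i + j < ?M}. (case p of (i, j) \<Rightarrow> ?g i j) = 0"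
    proof
      fix p assume p: "p \<in> {..<?M} \<times> {..<?M} - {(i, j). i + j < ?M}"
      obtain i j where ij: "p = (i, j)" by (cases p)
      then have "?M \<le> i + j" using p by auto
      then have "?g i j = 0" using z0[of "i + j" y] by simp
      then show "(case p of (i, j) \<Rightarrow> ?g i j) = 0" using ij by simp
    qed
  qed auto
  also have "\<dots> = (\<Sum>n<?M. \<Sum>i\<le>n. ?g i (n - i))" by (rule sum.triangle_reindex)
  also have "\<dots> = (\<Sum>n<?M. if n = 0 then y else 0)"
  proof (rule sum.cong[OF refl])
    fix n
    have "(\<Sum>i\<le>n. ?g i (n - i)) = (\<Sum>i\<le>n. ((1 / fact n) * ((-1) ^ i * of_nat (n choose i))) *s (br x ^^ n) y)"
    proof (rule sum.cong[OF refl])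
      fix i assume "i \<in> {..n}"
      then have i: "i \<le> n" by simp
      have "(1 / fact i) * (1 / fact (n - i)) * (-1) ^ i = (1 / fact n) * ((-1) ^ i * of_nat (n choose i) :: complex)"
        unfolding fact_choose[OF i, symmetric] by (simp only: mult_ac)
      then show "?g i (n - i) = ((1 / fact n) * ((-1) ^ i * of_nat (n choose i))) *s (br x ^^ n) y"
        using i by (simp only: le_add_diff_inverse)
    qed
    also have "\<dots> = ((1 / fact n) * (\<Sum>i\<le>n. (-1) ^ i * of_nat (n choose i))) *s (br x ^^ n) y"
      by (simp add: scale_sum_left sum_distrib_left)
    also have "\<dots> = (if n = 0 then y else 0)" using choose_alternating_sum[of n, where ?'a = complex] by auto
    finally show "(\<Sum>i\<le>n. ?g i (n - i)) = (if n = 0 then y else 0)" .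
  qed
  also have "\<dots> = y" by simp
  finally show ?thesis .
qed

section \<open>Automorphisms and groups generated by exponentials\<close>

definition aut :: "('g \<Rightarrow> 'g) \<Rightarrow> bool" where
  "aut \<phi> \<longleftrightarrow> lin \<phi> \<and> bij \<phi> \<and> (\<forall>x y. \<phi> (br x y) = br (\<phi> x) (\<phi> y))"

lemma aut_lin: "aut \<phi> \<Longrightarrow> lin \<phi>" and aut_bij: "aut \<phi> \<Longrightarrow> bij \<phi>"
  and aut_br: "aut \<phi> \<Longrightarrow> \<phi> (br x y) = br (\<phi> x) (\<phi> y)"
  by (auto simp: aut_def)

lemma aut_eq_0: "aut \<phi> \<Longrightarrow> \<phi> x = 0 \<longleftrightarrow> x = 0"
  using aut_bij aut_lin lin_0 by (metis bij_is_inj injD)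

lemma aut_exp_ad:
  assumes x: "nilp (br x)" shows "aut (exp_ad sc br x)"
proof -
  have "exp_ad sc br (- (- x)) (exp_ad sc br (- x) y) = y" for y by (rule exp_ad_inverse[OF nilp_neg[OF x]])
  then have "bij (exp_ad sc br x)"
    using exp_ad_inverse[OF x] by (intro o_bij[of "exp_ad sc br (- x)"]) auto
  then show ?thesis using lin_exp_ad exp_ad_br[OF x] by (simp add: aut_def)
qed

lemma aut_comp: "aut \<phi> \<Longrightarrow> aut \<psi> \<Longrightarrow> aut (\<phi> \<circ> \<psi>)"
  by (auto simp: aut_def lin_def bij_comp)

lemma aut_id: "aut id"
  by (simp add: aut_def lin_def)

text \<open>Nilpotence is required in the whole algebra, so that the exponentials are automorphisms
  of it; the set \<open>m\<close> records which subspaces are preserved (\<open>grp_stable\<close>)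
  and which vectors are fixed (\<open>grp_fix\<close>).\<close>

inductive_set grp :: "'g set \<Rightarrow> ('g \<Rightarrow> 'g) set" for m where
  grp_id: "id \<in> grp m"
| grp_step: "\<phi> \<in> grp m \<Longrightarrow> x \<in> m \<Longrightarrow> nilp (br x) \<Longrightarrow> exp_ad sc br x \<circ> \<phi> \<in> grp m"

lemma grp_exp: "x \<in> m \<Longrightarrow> nilp (br x) \<Longrightarrow> exp_ad sc br x \<in> grp m"
  using grp_step[OF grp_id, of x m] by simp

lemma grp_comp: "\<phi> \<in> grp m \<Longrightarrow> \<psi> \<in> grp m \<Longrightarrow> \<phi> \<circ> \<psi> \<in> grp m"
  by (induction rule: grp.induct) (auto simp: comp_assoc intro: grp_step)

lemma grp_aut: "\<phi> \<in> grp m \<Longrightarrow> aut \<phi>"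
  by (induction rule: grp.induct) (blast intro: aut_id aut_comp aut_exp_ad)+

lemma grp_mono: assumes "m \<subseteq> m'" "\<phi> \<in> grp m" shows "\<phi> \<in> grp m'"
  using assms(2,1) by (induction rule: grp.induct) (auto intro: grp_id grp_step)

lemma grp_adjoint: "\<phi> \<in> grp m \<Longrightarrow> \<phi> \<in> adjoint_group sc br"
  by (induction rule: grp.induct) (blast intro: adjoint_group.intros nilpotent_elt_nilp[THEN iffD2])+

lemma grp_inv:
  assumes "subspace m" "\<phi> \<in> grp m"
  shows "\<exists>\<psi>\<in>grp m. (\<forall>x. \<psi> (\<phi> x) = x) \<and> (\<forall>x. \<phi> (\<psi> x) = x)"
  using assms(2)
proof (induction rule: grp.induct)
  case grp_id
  then show ?case by (intro bexI[of _ id]) (auto intro: grp.grp_id)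
next
  case (grp_step \<phi> x)
  then obtain \<psi> where p: "\<psi> \<in> grp m" "\<And>x. \<psi> (\<phi> x) = x" "\<And>x. \<phi> (\<psi> x) = x" by blast
  have "\<psi> \<circ> exp_ad sc br (- x) \<in> grp m"
    using p(1) grp_step.hyps assms(1) by (intro grp_comp grp_exp nilp_neg) (auto intro: subspace_neg)
  moreover have "exp_ad sc br x (exp_ad sc br (- x) y) = y" for y
    using exp_ad_inverse[OF nilp_neg[OF grp_step.hyps(3)], of y] by simp
  ultimately show ?case using p exp_ad_inverse[OF grp_step.hyps(3)]
    by (intro bexI[of _ "\<psi> \<circ> exp_ad sc br (- x)"]) auto
qed

lemma grp_stable:
  assumes W: "subspace W" "\<And>x w. x \<in> m \<Longrightarrow> w \<in> W \<Longrightarrow> br x w \<in> W" and "\<phi> \<in> grp m" "w \<in> W"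
  shows "\<phi> w \<in> W"
  using assms(3,4)
proof (induction arbitrary: w rule: grp.induct)
  case (grp_step \<phi> x)
  have "(br x ^^ k) v \<in> W" if "v \<in> W" for k v using that grp_step.hyps W(2) by (induction k) auto
  then have "exp_ad sc br x v \<in> W" if "v \<in> W" for v
    unfolding exp_ad_def using that by (intro subspace_sum subspace_scale W(1)) auto
  then show ?case using grp_step by simp
qed simp

lemma grp_fix:
  assumes "\<And>x. x \<in> m \<Longrightarrow> br x w = 0" and "\<phi> \<in> grp m"
  shows "\<phi> w = w"
  using assms(2)
proof (induction rule: grp.induct)
  case (grp_step \<phi> x)
  have "exp_ad sc br x w = (\<Sum>k<1. (1 / fact k) *s (br x ^^ k) w)"
    by (rule exp_ad_eq) (use assms(1)[OF grp_step.hyps(2)] in simp)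
  then show ?case using grp_step by simp
qed simp

subsection \<open>Transport along automorphisms\<close>

lemma aut_pow_shift: "aut \<phi> \<Longrightarrow> ((\<lambda>u. br (\<phi> s) u - a *s u) ^^ n) (\<phi> v) = \<phi> (((\<lambda>u. br s u - a *s u) ^^ n) v)"
  by (induction n) (auto simp: aut_br lin_diff[OF aut_lin] lin_scale[OF aut_lin])

lemma aut_gev: "aut \<phi> \<Longrightarrow> \<phi> v \<in> gev (br (\<phi> s)) a \<longleftrightarrow> v \<in> gev (br s) a"
  by (simp add: gev_def aut_pow_shift aut_eq_0)

lemma aut_spec: assumes "aut \<phi>" shows "spec (br (\<phi> s)) = spec (br s)"
proof -
  have "gev (br (\<phi> s)) a \<noteq> {0} \<longleftrightarrow> gev (br s) a \<noteq> {0}" for a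
  proof -
    have "gev (br t) a \<noteq> {0} \<longleftrightarrow> (\<exists>v. v \<in> gev (br t) a \<and> v \<noteq> 0)" for t
      using subspace_0[OF subspace_gev[OF lin_br]] by blast
    moreover have "(\<exists>v. v \<in> gev (br (\<phi> s)) a \<and> v \<noteq> 0) \<longleftrightarrow> (\<exists>v. \<phi> v \<in> gev (br (\<phi> s)) a \<and> \<phi> v \<noteq> 0)"
      using aut_bij[OF assms] by (metis bij_pointE)
    ultimately show ?thesis using aut_gev[OF assms] aut_eq_0[OF assms] by simp
  qed
  then show ?thesis by (simp add: spec_def)
qed

lemma aut_comp_eq:
  assumes \<phi>: "aut \<phi>" shows "gcomp (br (\<phi> s)) a (\<phi> v) = \<phi> (gcomp (br s) a v)"
proof -
  have "gcomp (br (\<phi> s)) a (\<phi> v) = (\<lambda>a. \<phi> (gcomp (br s) a v)) a"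
  proof (rule comp_eqI[OF lin_br])
    show "\<phi> (gcomp (br s) a v) \<in> gev (br (\<phi> s)) a" for a using aut_gev[OF \<phi>] comp_gev[OF lin_br] by blast
    show "finite (spec (br s))" by (rule finite_spec[OF lin_br])
    show "\<phi> (gcomp (br s) a v) = 0" if "a \<notin> spec (br s)" for a
      using comp_not_spec[OF lin_br that] aut_eq_0[OF \<phi>] by simp
    show "\<phi> v = (\<Sum>a\<in>spec (br s). \<phi> (gcomp (br s) a v))"
      using lin_sum[OF aut_lin[OF \<phi>], of "\<lambda>a. gcomp (br s) a v" "spec (br s)"] sum_comp[OF lin_br, of s v] by simp
  qed
  then show ?thesis .
qed

lemma aut_semis: assumes \<phi>: "aut \<phi>" and s: "semis s" shows "semis (\<phi> s)"
  unfolding semis_def diag_def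
proof (intro conjI allI ballI lin_br)
  fix a v assume v: "v \<in> gev (br (\<phi> s)) a"
  obtain u where u: "v = \<phi> u" using aut_bij[OF \<phi>] by (metis bij_pointE)
  then have "br s u = a *s u" using v aut_gev[OF \<phi>] semis_gev[OF s] by blast
  then show "br (\<phi> s) v = a *s v" unfolding u using aut_br[OF \<phi>, of s u] lin_scale[OF aut_lin[OF \<phi>]] by simp
qed

lemma aut_intel: "aut \<phi> \<Longrightarrow> intel s \<Longrightarrow> intel (\<phi> s)"
  by (simp add: intel_def aut_semis aut_spec)

lemma aut_zc:
  assumes \<phi>: "aut \<phi>" and L: "\<And>v. \<phi> v \<in> L \<longleftrightarrow> v \<in> L"
  shows "zc L (\<phi> s) = \<phi> ` zc L s"
proof
  show "zc L (\<phi> s) \<subseteq> \<phi> ` zc L s"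
  proof
    fix v assume v: "v \<in> zc L (\<phi> s)"
    obtain u where u: "v = \<phi> u" using aut_bij[OF \<phi>] by (metis bij_pointE)
    then have "u \<in> zc L s" using v L aut_br[OF \<phi>, of s u] aut_eq_0[OF \<phi>] by (simp add: zc_def)
    then show "v \<in> \<phi> ` zc L s" using u by blast
  qed
  show "\<phi> ` zc L s \<subseteq> zc L (\<phi> s)"
    using L aut_br[OF \<phi>, of s] lin_0[OF aut_lin[OF \<phi>]] by (auto simp: zc_def simp flip: aut_br[OF \<phi>])
qed

lemma aut_dim: assumes "aut \<phi>" "subspace W" shows "dim (\<phi> ` W) = dim W"
  by (rule dim_lin_inj[OF aut_lin[OF assms(1)] assms(2)]) (use aut_eq_0[OF assms(1)] in auto)

lemma aut_dim_zc:
  assumes \<phi>: "aut \<phi>" and L: "\<And>v. \<phi> v \<in> L \<longleftrightarrow> v \<in> L" "subspace L"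
  shows "dim (zc L (\<phi> s)) = dim (zc L s)"
proof -
  have "subspace (zc L s)" unfolding zc_def by (intro subspace_inter L(2) lin_subspace_kernel[OF lin_br])
  then show ?thesis using aut_zc[OF \<phi> L(1)] aut_dim[OF \<phi>] by simp
qed

lemma aut_reg:
  assumes \<phi>: "aut \<phi>" and L: "\<And>v. \<phi> v \<in> L \<longleftrightarrow> v \<in> L" and s: "reg L s"
  shows "reg L (\<phi> s)"
proof -
  have "abel (\<phi> ` zc L s)"
    using regD(3)[OF s] aut_br[OF \<phi>] lin_0[OF aut_lin[OF \<phi>]] by (auto simp: abel_def simp flip: aut_br[OF \<phi>])
  then show ?thesis using s aut_semis[OF \<phi>] aut_zc[OF \<phi> L] L by (simp add: reg_def)
qed

lemma aut_bb: "aut \<phi> \<Longrightarrow> (\<And>v. \<phi> v \<in> L \<longleftrightarrow> v \<in> L) \<Longrightarrow> \<phi> v \<in> bb L (\<phi> s) \<longleftrightarrow> v \<in> bb L s"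
  by (auto simp: bb_def aut_comp_eq aut_eq_0)

lemma aut_sl2: "aut \<phi> \<Longrightarrow> sl2_triple sc br e h f \<Longrightarrow> sl2_triple sc br (\<phi> e) (\<phi> h) (\<phi> f)"
  by (auto simp: sl2_triple_def lin_scale[OF aut_lin] lin_neg[OF aut_lin] simp flip: aut_br)

lemma aut_kf: assumes \<phi>: "aut \<phi>" shows "kf (\<phi> x) (\<phi> y) = kf x y"
proof -
  obtain \<psi> where \<psi>: "lin \<psi>" "\<And>x. \<psi> (\<phi> x) = x"
    using ex_lin_left_inverse[OF aut_lin[OF \<phi>] subspace_UNIV] aut_eq_0[OF \<phi>] by (metis UNIV_I)
  have \<psi>2: "\<phi> (\<psi> x) = x" for x
  proof -
    obtain u where "x = \<phi> u" using aut_bij[OF \<phi>] by (metis bij_pointE)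
    then show ?thesis using \<psi>(2) by simp
  qed
  have "br (\<phi> x) (br (\<phi> y) z) = \<phi> (br x (br y (\<psi> z)))" for z
    using aut_br[OF \<phi>] \<psi>2 by metis
  then have "kf (\<phi> x) (\<phi> y) = tr (\<lambda>z. \<phi> (br x (br y (\<psi> z))))" by (simp add: kf_def)
  also have "\<dots> = tr (\<lambda>z. br x (br y (\<psi> (\<phi> z))))"
    using tr_cyclic[OF aut_lin[OF \<phi>] lin_compose[OF lin_br lin_compose[OF lin_br \<psi>(1)]], of x y] .
  also have "\<dots> = kf x y" using \<psi>(2) by (simp add: kf_def)
  finally show ?thesis .
qed

lemma grp_mem_iff:
  assumes L: "subspace L" "\<And>x w. x \<in> m \<Longrightarrow> w \<in> L \<Longrightarrow> br x w \<in> L" and m: "subspace m" and \<phi>: "\<phi> \<in> grp m"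
  shows "\<phi> v \<in> L \<longleftrightarrow> v \<in> L"
proof -
  obtain \<psi> where "\<psi> \<in> grp m" "\<And>x. \<psi> (\<phi> x) = x" using grp_inv[OF m \<phi>] by blast
  then show ?thesis using grp_stable[OF L, where \<phi> = \<phi> and w = v] grp_stable[OF L, where \<phi> = \<psi> and w = "\<phi> v"] \<phi> by auto
qed

lemma good_grp_iff: "good L \<Longrightarrow> \<phi> \<in> grp L \<Longrightarrow> \<phi> v \<in> L \<longleftrightarrow> v \<in> L"
  using grp_mem_iff[OF good_subspace _ good_subspace] good_br by metis

subsection \<open>Unipotent conjugation\<close>

lemma grge_mono: "m \<le> n \<Longrightarrow> grge h W n \<subseteq> grge h W m"
  by (force simp: grge_def)

lemma gr_grge: "x \<in> W \<Longrightarrow> x \<in> gr h m \<Longrightarrow> x \<in> grge h W m"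
  using comp_of_gev[OF lin_br eigenvector_gev[of "br h" x "of_int m"]]
  by (auto simp: grge_def gr_def split: if_splits)

lemma br_grge:
  assumes W: "\<And>w. w \<in> W \<Longrightarrow> br u w \<in> W" and u: "u \<in> gr h j" and w: "w \<in> grge h W k"
  shows "br u w \<in> grge h W (k + j)"
proof -
  have ug: "u \<in> gev (br h) (of_int j)" by (rule eigenvector_gev) (use u in \<open>simp add: gr_def\<close>)
  have "\<exists>i\<ge>k + j. a = of_int i" if a: "gcomp (br h) a (br u w) \<noteq> 0" for a
  proof -
    have "gcomp (br h) a (br u w) = br u (gcomp (br h) (a - of_int j) w)" using comp_shift[OF ug, of "a - of_int j" w] by simp
    then have "gcomp (br h) (a - of_int j) w \<noteq> 0" using a by (auto simp: br_lin)
    then obtain i where i: "i \<ge> k" "a - of_int j = of_int i" using w by (auto simp: grge_def)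
    then have "a = of_int (i + j)" by (simp add: algebra_simps)
    then show ?thesis using i(1) by (intro exI[of _ "i + j"]) auto
  qed
  then show ?thesis using W w by (simp add: grge_def)
qed

lemma grge_eventually_0:
  obtains N where "\<And>k W. k \<ge> N \<Longrightarrow> grge h W k \<subseteq> {0}"
proof -
  let ?F = "{i::int. of_int i \<in> spec (br h)}"
  have "finite ?F" using finite_vimageI[OF finite_spec[OF lin_br, of h], of "of_int :: int \<Rightarrow> complex"]
    by (simp add: vimage_def inj_def)
  then obtain N where N: "\<And>i. i \<in> ?F \<Longrightarrow> i < N"
    by (metis finite_int_iff_bounded lessThan_iff abs_less_iff image_subset_iff minus_less_iff)
  have "w = 0" if k: "k \<ge> N" and w: "w \<in> grge h W k" for k w W
  proof -
    have "gcomp (br h) a w = 0" for a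
    proof (rule ccontr)
      assume a: "gcomp (br h) a w \<noteq> 0"
      then obtain i where "i \<ge> k" "a = of_int i" using w by (auto simp: grge_def)
      moreover have "a \<in> spec (br h)" using a comp_not_spec[OF lin_br] by blast
      ultimately show False using N[of i] k by auto
    qed
    then show ?thesis using sum_comp[OF lin_br, of h w] by simp
  qed
  then show thesis using that by blast
qed

text \<open>The lowest component of \<open>\<nu>\<close> is removed by one exponential, at the cost of terms of higher degree.\<close>
lemma unip_conj:
  assumes H: "semis H" and m: "subalg m" "\<And>w. w \<in> m \<Longrightarrow> br H w \<in> m" and a: "a \<in> gr H d" "\<And>w. w \<in> m \<Longrightarrow> br w a \<in> m"
    and surj: "\<And>j \<nu>. j \<ge> 1 \<Longrightarrow> \<nu> \<in> m \<Longrightarrow> \<nu> \<in> gr H (d + j) \<Longrightarrow> \<exists>u\<in>m. u \<in> gr H j \<and> br a u = \<nu>"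
    and \<nu>: "\<nu> \<in> grge H m (d + 1)"
  shows "\<exists>\<phi>\<in>grp m. \<phi> (a + \<nu>) = a"
proof -
  obtain N where N: "\<And>k W. k \<ge> N \<Longrightarrow> grge H W k \<subseteq> {0}" using grge_eventually_0 by blast
  have sm: "subspace m" and bm: "\<And>x y. x \<in> m \<Longrightarrow> y \<in> m \<Longrightarrow> br x y \<in> m" using m by (auto simp: subalg_def)
  have "\<exists>\<phi>\<in>grp m. \<phi> (a + \<nu>) = a" if "\<nu> \<in> grge H m (d + j)" "j \<ge> 1" for j \<nu>
    using that
  proof (induction "nat (N - (d + j))" arbitrary: j \<nu> rule: less_induct)
    case less
    show ?case
    proof (cases "d + j \<ge> N")
      case True
      then have "\<nu> = 0" using N less.prems by blast
      then show ?thesis by (intro bexI[of _ id]) (auto intro: grp_id)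
    next
      case False
      let ?v = "gcomp (br H) (of_int (d + j)) \<nu>"
      let ?G = "grge H m (d + (j + 1))"
      have sG: "subspace ?G" by (rule subspace_grge[OF sm])
      have vm: "?v \<in> m" using comp_mem[OF lin_br sm m(2)] less.prems by (simp add: grge_def)
      have vg: "?v \<in> gr H (d + j)" using semis_comp[OF H, of "of_int (d + j)" \<nu>] by (simp add: gr_def)
      obtain u where u: "u \<in> m" "u \<in> gr H j" "br a u = ?v" using surj[OF less.prems(2) vm vg] by blast
      have un: "nilp (br u)" using eigen_nilp[of H u "of_int j"] u(2) less.prems(2) by (simp add: gr_def)
      have bu: "br u w \<in> grge H m (k + j)" if "w \<in> grge H m k" for w k
        by (rule br_grge[OF bm[OF u(1)] u(2) that])
      have up: "(br u ^^ Suc i) w \<in> grge H m (k + j)" if "w \<in> grge H m k" for w k i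
      proof (induction i)
        case 0 then show ?case using bu[OF that] by simp
      next
        case (Suc i)
        have "br u ((br u ^^ Suc i) w) \<in> grge H m (k + j + j)" by (rule bu[OF Suc])
        then show ?case using grge_mono[of "k + j" "k + j + j" H m] less.prems(2) by auto
      qed
      have upG: "(br u ^^ Suc i) w \<in> ?G" if "w \<in> grge H m (d + j)" for w i
        using up[OF that, of i] grge_mono[of "d + (j + 1)" "d + j + j" H m] less.prems(2) by auto
      have ua: "br u a = - ?v" using u(3) br_skew[of u a] by simp
      have vG: "- ?v \<in> grge H m (d + j)"
        using gr_grge[OF vm vg] subspace_neg[OF subspace_grge[OF sm]] by blast
      \<comment> \<open>The error after one exponential has three parts, each of degree at least
        \<open>d + j + 1\<close>: the terms on \<open>a\<close> from the quadratic one onwards, the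
        change of \<nu>, and \<nu> without its lowest component.\<close>
      have A: "exp_ad sc br u a - a + ?v \<in> ?G"
      proof -
        have "exp_ad sc br u a - a + ?v = (\<Sum>k<card Basis. (1 / fact (Suc (Suc k))) *s (br u ^^ Suc (Suc k)) a)"
          unfolding exp_ad_expand[OF un] ua by simp
        also have "\<dots> \<in> ?G"
        proof (intro subspace_sum[OF sG] subspace_scale[OF sG])
          fix k
          have "(br u ^^ Suc (Suc k)) a = (br u ^^ Suc k) (- ?v)" unfolding ua[symmetric] by (simp add: funpow_swap1)
          then show "(br u ^^ Suc (Suc k)) a \<in> ?G" using upG[OF vG] by simp
        qed
        finally show ?thesis .
      qed
      have B: "exp_ad sc br u \<nu> - \<nu> \<in> ?G"
      proof -
        have "exp_ad sc br u \<nu> - \<nu> = br u \<nu> + (\<Sum>k<card Basis. (1 / fact (Suc (Suc k))) *s (br u ^^ Suc (Suc k)) \<nu>)"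
          unfolding exp_ad_expand[OF un] by simp
        also have "\<dots> \<in> ?G"
        proof (intro subspace_add[OF sG] subspace_sum[OF sG] subspace_scale[OF sG])
          show "br u \<nu> \<in> ?G" using upG[OF less.prems(1), of 0] by simp
        qed (rule upG[OF less.prems(1)])
        finally show ?thesis .
      qed
      have C: "\<nu> - ?v \<in> ?G"
      proof -
        have "\<nu> - ?v \<in> m" using less.prems vm sm by (auto simp: grge_def intro: subspace_diff)
        moreover have "\<exists>i\<ge>d + (j + 1). b = of_int i" if b: "gcomp (br H) b (\<nu> - ?v) \<noteq> 0" for b
        proof -
          have "b \<noteq> of_int (d + j)" using b by (auto simp: lin_diff[OF lin_comp[OF lin_br]] comp_comp)
          then have "gcomp (br H) b \<nu> \<noteq> 0" using b by (simp add: lin_diff[OF lin_comp[OF lin_br]] comp_comp)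
          then obtain i where i: "i \<ge> d + j" "b = of_int i" using less.prems by (auto simp: grge_def)
          then have "i \<noteq> d + j" using \<open>b \<noteq> of_int (d + j)\<close> by blast
          then show ?thesis using i by (intro exI[of _ i]) auto
        qed
        ultimately show ?thesis by (simp add: grge_def)
      qed
      have e: "exp_ad sc br u (a + \<nu>) = a + ((exp_ad sc br u a - a + ?v) + (exp_ad sc br u \<nu> - \<nu>) + (\<nu> - ?v))"
        by (simp add: lin_add[OF lin_exp_ad])
      have "(exp_ad sc br u a - a + ?v) + (exp_ad sc br u \<nu> - \<nu>) + (\<nu> - ?v) \<in> ?G"
        by (intro subspace_add[OF sG] A B C)
      moreover have "nat (N - (d + (j + 1))) < nat (N - (d + j))" using False by simp
      ultimately obtain \<phi> where \<phi>: "\<phi> \<in> grp m" "\<phi> (exp_ad sc br u (a + \<nu>)) = a"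
        using less.hyps[of "j + 1"] less.prems(2) e by (metis add_increasing2 zero_le_one)
      have "\<phi> \<circ> exp_ad sc br u \<in> grp m" by (rule grp_comp[OF \<phi>(1) grp_exp[OF u(1) un]])
      then show ?thesis using \<phi>(2) by (intro bexI[of _ "\<phi> \<circ> exp_ad sc br u"]) auto
    qed
  qed
  from this[OF \<nu>] show ?thesis by simp
qed

text \<open>\<open>unip_conj\<close> with \<open>d = 0\<close>: ad s acts on degree \<open>j\<close>
  as the scalar \<open>j\<close>, so a preimage is a multiple. Integrality of \<open>s\<close> makes
  every positive eigenvalue at least 1.\<close>

lemma nn_conj:
  assumes s: "intel s" and m: "subalg m" "\<And>w. w \<in> m \<Longrightarrow> br s w \<in> m" "m \<subseteq> nn UNIV s" and \<nu>: "\<nu> \<in> m"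
  shows "\<exists>\<phi>\<in>grp m. \<phi> (s + \<nu>) = s"
proof (rule unip_conj[OF intel_semis[OF s] m(1,2), where d = 0])
  have sm: "subspace m" using m by (simp add: subalg_def)
  show "s \<in> gr s 0" by (simp add: gr_def br_self)
  show "br w s \<in> m" if "w \<in> m" for w using m(2)[OF that] br_skew[of w s] subspace_neg[OF sm] by simp
  show "\<exists>u\<in>m. u \<in> gr s j \<and> br s u = \<nu>" if "j \<ge> 1" "\<nu> \<in> m" "\<nu> \<in> gr s (0 + j)" for j \<nu>
  proof (intro bexI conjI)
    show "(1 / of_int j) *s \<nu> \<in> m" using that sm by (intro subspace_scale)
    show "(1 / of_int j) *s \<nu> \<in> gr s j" using that subspace_gr by (auto intro: subspace_scale)
    show "br s ((1 / of_int j) *s \<nu>) = \<nu>" using that by (simp add: br_lin gr_def)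
  qed
  show "\<nu> \<in> grge s m (0 + 1)"
  proof -
    have "\<exists>i\<ge>1. a = of_int i" if a: "gcomp (br s) a \<nu> \<noteq> 0" for a
    proof -
      have "a \<in> spec (br s)" using a comp_not_spec[OF lin_br] by blast
      then obtain i where i: "a = of_int i" using s by (auto simp: intel_def)
      have "cpos a" using a \<nu> m(3) by (auto simp: nn_def)
      then show ?thesis using i cpos_int by (intro exI[of _ i]) auto
    qed
    then show ?thesis using \<nu> by (simp add: grge_def)
  qed
qed

text \<open>The difference h1 - h centralises \<open>e\<close> and lies in the image of ad e, so by
  \<open>kim_span\<close> its weights under \<open>h\<close> are positive, and
  \<open>unip_conj\<close> inside the centraliser of \<open>e\<close> moves \<open>h1\<close> to
  \<open>h\<close>. Then \<open>f\<close> is forced, because ad e is injective in degree -2.\<close>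

theorem sl2_conjugate:
  assumes t: "sl2_triple sc br e h f" and t1: "sl2_triple sc br e h1 f1"
  obtains \<phi> where "\<phi> \<in> grp UNIV" "\<phi> e = e" "\<phi> h1 = h" "\<phi> f1 = f"
proof -
  note d = sl2D[OF t] and d1 = sl2D[OF t1]
  let ?m = "zc UNIV e"
  have sm: "subspace ?m" unfolding zc_def by (intro subspace_inter subspace_UNIV lin_subspace_kernel[OF lin_br])
  have m: "subalg ?m" using sm by (auto simp: subalg_def zc_def jacobi[of e] br_lin)
  have eh: "br e h = (-2) *s e" "br e h1 = (-2) *s e" using br_skew[of e h] br_skew[of e h1] d d1 by auto
  have mh: "br h w \<in> ?m" if "w \<in> ?m" for w
    using that jacobi[of e h w] eh by (simp add: zc_def br_lin)
  define \<nu> where "\<nu> = h1 - h"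
  have \<nu>m: "\<nu> \<in> ?m" using eh by (simp add: \<nu>_def zc_def br_lin)
  have "\<nu> = br e (f1 - f)" using d d1 by (simp add: \<nu>_def br_lin)
  then have "\<nu> \<in> kim e 1" using \<nu>m by (auto simp: kim_def zc_def)
  then have "\<nu> \<in> span {v \<in> kim e 1. \<exists>n\<ge>1. br h v = of_nat n *s v}" by (rule kim_span[OF d(1,3)])
  moreover have "{v \<in> kim e 1. \<exists>n\<ge>1. br h v = of_nat n *s v} \<subseteq> grge h ?m 1"
  proof clarify
    fix v and n :: nat assume v: "v \<in> kim e 1" "1 \<le> n" "br h v = of_nat n *s v"
    have "v \<in> grge h ?m (int n)" by (rule gr_grge) (use v in \<open>auto simp: kim_def zc_def gr_def\<close>)
    then show "v \<in> grge h ?m 1" using grge_mono[of 1 "int n" h ?m] v(2) by auto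
  qed
  ultimately have \<nu>g: "\<nu> \<in> grge h ?m (0 + 1)" 
    using span_minimal[OF _ subspace_grge[OF sm, of h 1], THEN subsetD] by (metis (no_types, lifting) add_0)
  have "\<exists>\<phi>\<in>grp ?m. \<phi> (h + \<nu>) = h"
  proof (rule unip_conj[OF sl2_semis[OF t] m mh _ _ _ \<nu>g])
    show "h \<in> gr h 0" by (simp add: gr_def br_self)
    show "br w h \<in> ?m" if "w \<in> ?m" for w using mh[OF that] br_skew[of w h] subspace_neg[OF sm] by simp
    show "\<exists>u\<in>?m. u \<in> gr h j \<and> br h u = \<mu>" if "j \<ge> 1" "\<mu> \<in> ?m" "\<mu> \<in> gr h (0 + j)" for j \<mu>
    proof (intro bexI conjI)
      show "(1 / of_int j) *s \<mu> \<in> ?m" using that sm by (intro subspace_scale)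
      show "(1 / of_int j) *s \<mu> \<in> gr h j" using that subspace_gr by (auto intro: subspace_scale)
      show "br h ((1 / of_int j) *s \<mu>) = \<mu>" using that by (simp add: br_lin gr_def)
    qed
  qed
  then obtain \<phi> where \<phi>: "\<phi> \<in> grp ?m" "\<phi> h1 = h" by (auto simp: \<nu>_def)
  have a: "aut \<phi>" using \<phi> grp_aut by blast
  have \<phi>e: "\<phi> e = e" by (rule grp_fix[OF _ \<phi>(1)]) (use br_0_commute in \<open>auto simp: zc_def\<close>)
  have t2: "sl2_triple sc br e h (\<phi> f1)" using aut_sl2[OF a t1] \<phi> \<phi>e by simp
  note d2 = sl2D[OF t2]
  have "\<phi> f1 - f = 0"
  proof (rule sl2_inj[OF t, of _ "-2"])
    show "\<phi> f1 - f \<in> gr h (- 2)" using d d2 by (simp add: gr_def br_lin scale_right_diff_distrib)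
    show "br e (\<phi> f1 - f) = 0" using d d2 by (simp add: br_lin)
  qed simp
  then show thesis using that[of \<phi>] \<phi> \<phi>e grp_mono[of ?m UNIV] by auto
qed

subsection \<open>Weyl elements\<close>

lemma exp_e:
  assumes t: "sl2_triple sc br e h f"
  shows "exp_ad sc br (c *s e) e = e" "exp_ad sc br (c *s e) h = h - (2 * c) *s e"
    "exp_ad sc br (c *s e) f = f + c *s h - (c * c) *s e"
proof -
  note d = sl2D[OF t]
  have eh: "br e h = (-2) *s e" using br_skew[of e h] d by simp
  have "exp_ad sc br (c *s e) e = (\<Sum>k<1. (1 / fact k) *s (br (c *s e) ^^ k) e)"
    by (rule exp_ad_eq) (simp add: br_lin br_self)
  then show "exp_ad sc br (c *s e) e = e" by simp
  have "exp_ad sc br (c *s e) h = (\<Sum>k<2. (1 / fact k) *s (br (c *s e) ^^ k) h)"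
    by (rule exp_ad_eq) (simp add: br_lin br_self eh numeral_2_eq_2)
  then show "exp_ad sc br (c *s e) h = h - (2 * c) *s e" by (simp add: numeral_2_eq_2 br_lin eh mult.commute)
  have "exp_ad sc br (c *s e) f = (\<Sum>k<3. (1 / fact k) *s (br (c *s e) ^^ k) f)"
    by (rule exp_ad_eq) (simp add: br_lin br_self eh d numeral_3_eq_3)
  then show "exp_ad sc br (c *s e) f = f + c *s h - (c * c) *s e"
    by (simp add: numeral_3_eq_3 br_lin eh d fact_numeral field_simps)
qed

text \<open>In SL2 this is the matrix with rows (0, c) and (-1/c, 0), a representative of the
  reflection.\<close>

definition weyl :: "'g \<Rightarrow> 'g \<Rightarrow> complex \<Rightarrow> 'g \<Rightarrow> 'g" where
  "weyl e f c = exp_ad sc br (c *s e) \<circ> (exp_ad sc br ((- 1 / c) *s f) \<circ> exp_ad sc br (c *s e))"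

lemma nilp_scale: assumes "nilp (br x)" shows "nilp (br (c *s x))"
proof -
  have "(br (c *s x) ^^ n) v = c ^ n *s (br x ^^ n) v" for n v
    by (induction n) (auto simp: br_lin mult.commute)
  then show ?thesis using assms unfolding nilp_def by force
qed

lemma weyl_grp:
  assumes t: "sl2_triple sc br e h f" and m: "subspace m" "e \<in> m" "f \<in> m"
  shows "weyl e f c \<in> grp m"
  unfolding weyl_def using sl2_nilp[OF t] m
  by (intro grp_comp grp_exp nilp_scale subspace_scale)

lemma weyl_fix:
  assumes t: "sl2_triple sc br e h f" and z: "br e z = 0" "br f z = 0"
  shows "weyl e f c z = z"
proof -
  have "weyl e f c \<in> grp (span {e, f})" by (rule weyl_grp[OF t]) (auto intro: span_base)
  moreover have "br x z = 0" if "x \<in> span {e, f}" for x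
    using that by (induction rule: span_induct_alt) (auto simp: br_lin z)
  ultimately show ?thesis using grp_fix by blast
qed

lemma weyl_triple:
  assumes t: "sl2_triple sc br e h f" and c: "c \<noteq> 0"
  shows "weyl e f c e = (- 1 / (c * c)) *s f" "weyl e f c h = - h" "weyl e f c f = (- (c * c)) *s e"
proof -
  note E = exp_e[OF t, of c] and F = exp_e[OF sl2_flip[OF t], of "- 1 / c"]
  note lE = lin_exp_ad[of "c *s e"] and lF = lin_exp_ad[of "(- 1 / c) *s f"]
  have Fh: "exp_ad sc br ((- 1 / c) *s f) h = h - (2 / c) *s f"
    using F(2) lin_neg[OF lF, of h] by (simp add: algebra_simps) 
  have Fe: "exp_ad sc br ((- 1 / c) *s f) e = e + (1 / c) *s h - (1 / (c * c)) *s f"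
    using F(3) by simp
  note simps = lin_add[OF lE] lin_diff[OF lE] lin_scale[OF lE] lin_neg[OF lE] lin_add[OF lF] lin_diff[OF lF] lin_scale[OF lF] lin_neg[OF lF]
    E F(1) Fh Fe scale_right_distrib scale_right_diff_distrib
  have 1: "c * (1 / c) = 1" "(c * c) * (1 / (c * c)) = 1" "1 / (c * c) * (c * c) = 1" "1 / c * (2 * c) = 2" "1 / (c * c) * c = 1 / c"
     "c * (2 / c) = 2" "2 * c * (1 / c) = 2" "2 * c * (1 / (c * c)) = 2 / c" "c * c * (1 / c) = c"
    using c by auto
  have two: "2 *s x = x + x" for x using scale_left_distrib[of 1 1 x] by simp
  have "weyl e f c e = exp_ad sc br (c *s e) (e + (1 / c) *s h - (1 / (c * c)) *s f)"
    unfolding weyl_def comp_apply E(1) Fe ..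
  also have "\<dots> = e + ((1 / c) *s h - (1 / c * (2 * c)) *s e) - ((1 / (c * c)) *s f + (1 / (c * c) * c) *s h - (1 / (c * c) * (c * c)) *s e)"
    by (simp only: simps scale_scale)
  also have "\<dots> = (- 1 / (c * c)) *s f" unfolding 1 two by simp
  finally show "weyl e f c e = (- 1 / (c * c)) *s f" .
  have "weyl e f c h = exp_ad sc br (c *s e) (h - (2 / c) *s f - ((2 * c) *s e + (2 * c * (1 / c)) *s h - (2 * c * (1 / (c * c))) *s f))"
    unfolding weyl_def comp_apply E(2) by (simp only: simps scale_scale)
  also have "h - (2 / c) *s f - ((2 * c) *s e + (2 * c * (1 / c)) *s h - (2 * c * (1 / (c * c))) *s f) = - h - (2 * c) *s e"
    unfolding 1 two by simp
  also have "exp_ad sc br (c *s e) (- h - (2 * c) *s e) = - h" by (simp only: simps) simp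
  finally show "weyl e f c h = - h" .
  have "weyl e f c f = exp_ad sc br (c *s e) (f + (c *s h - (c * (2 / c)) *s f) - ((c * c) *s e + (c * c * (1 / c)) *s h - ((c * c) * (1 / (c * c))) *s f))"
    unfolding weyl_def comp_apply E(3) by (simp only: simps scale_scale)
  also have "f + (c *s h - (c * (2 / c)) *s f) - ((c * c) *s e + (c * c * (1 / c)) *s h - ((c * c) * (1 / (c * c))) *s f) = (- (c * c)) *s e"
    unfolding 1 two by simp
  also have "exp_ad sc br (c *s e) ((- (c * c)) *s e) = (- (c * c)) *s e" by (simp only: simps)
  finally show "weyl e f c f = (- (c * c)) *s e" .
qed

text \<open>The product of the matrices of \<open>weyl\<close> for \<open>?d\<close> and for 1 is
  diagonal with entries -d and -1/d; it scales \<open>e\<close> by the square of \<open>?d\<close>,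
  whence the square root of \<open>c\<close>.\<close>

lemma torus_scale:
  assumes t: "sl2_triple sc br e h f" and c: "c \<noteq> 0"
  obtains \<phi> where "\<phi> \<in> grp UNIV" "\<phi> e = c *s e" "\<And>z. br e z = 0 \<Longrightarrow> br f z = 0 \<Longrightarrow> \<phi> z = z"
proof -
  let ?d = "csqrt c"
  have d: "?d \<noteq> 0" "?d * ?d = c" using c power2_csqrt[of c] by (auto simp: power2_eq_square)
  let ?w = "weyl e f ?d \<circ> weyl e f 1"
  have g: "?w \<in> grp UNIV" by (intro grp_comp weyl_grp[OF t] subspace_UNIV) auto
  have a: "aut (weyl e f ?d)" by (intro grp_aut[where m = UNIV] weyl_grp[OF t] subspace_UNIV) auto
  have "?w e = weyl e f ?d (- f)" using weyl_triple(1)[OF t, of 1] by simp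
  also have "\<dots> = - weyl e f ?d f" by (rule lin_neg[OF aut_lin[OF a]])
  also have "\<dots> = c *s e" using weyl_triple(3)[OF t d(1)] d(2) by simp
  finally have "?w e = c *s e" .
  then show thesis using that[of ?w] g weyl_fix[OF t] by auto
qed

subsection \<open>Conjugacy of regular integral elements\<close>

lemma subalg_nn: assumes L: "good L" shows "subalg (nn L s)"
  unfolding subalg_def
  using br_bb_nn[OF good_subalg[OF L]] nn_bb subspace_nn[OF good_subspace[OF L]] by blast

text \<open>By \<open>bb_covered\<close>, \<open>s1\<close> differs from an element \<open>x\<close>
  of both Borels by an element of \<open>nn L s1\<close>, and \<open>nn_conj\<close> conjugates one
  into the other. The group involved is generated from \<open>nn L s1\<close> and therefore
  preserves \<open>bb L s1\<close>.\<close>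

lemma reg_conj_into_bb:
  assumes L: "good L" and s: "reg L s1" "reg L s2" and i: "intel s1"
  obtains \<phi> where "\<phi> \<in> grp L" "\<phi> s1 \<in> bb L s2" "bb L (\<phi> s1) = bb L s1"
proof -
  note sL = good_subspace[OF L] and s1 = regD[OF s(1)]
  let ?n = "nn L s1"
  have "s1 \<in> zc L s1" using s1 by (simp add: zc_def br_self)
  then have s1b: "s1 \<in> bb L s1" using zc_bb by blast
  obtain x y where xy: "x \<in> bb L s1" "x \<in> bb L s2" "y \<in> ?n" "s1 = x + y" using bb_covered[OF L s s1b] .
  have n: "subalg ?n" "subspace ?n" using subalg_nn[OF L] subspace_nn[OF sL] by auto
  have "\<exists>\<phi>\<in>grp ?n. \<phi> (s1 + (- y)) = s1"
  proof (rule nn_conj[OF i n(1)])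
    show "br s1 w \<in> ?n" if "w \<in> ?n" for w by (rule br_bb_nn[OF good_subalg[OF L] s1b that])
    show "?n \<subseteq> nn UNIV s1" by (auto simp: nn_def)
    show "- y \<in> ?n" by (rule subspace_neg[OF n(2) xy(3)])
  qed
  then obtain \<phi> where \<phi>: "\<phi> \<in> grp ?n" "\<phi> x = s1" using xy(4) by auto
  obtain \<psi> where \<psi>: "\<psi> \<in> grp ?n" "\<And>x. \<psi> (\<phi> x) = x" "\<And>x. \<phi> (\<psi> x) = x" using grp_inv[OF n(2) \<phi>(1)] by blast
  have x: "\<psi> s1 = x" using \<psi>(2)[of x] \<phi>(2) by simp
  have \<psi>L: "\<psi> \<in> grp L" by (rule grp_mono[OF nn_L \<psi>(1)])
  have a: "aut \<psi>" using grp_aut \<psi>L by blast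
  note mem = good_grp_iff[OF L \<psi>L]
  have bbm: "\<psi> v \<in> bb L s1 \<longleftrightarrow> v \<in> bb L s1" for v
    by (rule grp_mem_iff[OF subspace_bb[OF sL] _ n(2) \<psi>(1)]) (use br_bb_bb[OF good_subalg[OF L]] nn_bb in blast)
  have ex: "\<exists>u. v = \<psi> u" for v using \<psi>(2) by metis
  have "v \<in> bb L (\<psi> s1) \<longleftrightarrow> v \<in> bb L s1" for v
    using ex[of v] aut_bb[OF a mem, where s = s1] bbm by auto
  then show thesis using that[OF \<psi>L] x xy(2) by blast
qed

text \<open>Let \<sigma> be the component of \<open>s2\<close> in \<open>zc L s1\<close>. Since
  \<open>zc L s1\<close> lies in both Borels, s2 - \<sigma> lies in both nilradicals, and
  \<open>nn_conj\<close> for \<open>s2\<close> removes it.\<close>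

lemma reg_conj_aux:
  assumes L: "good L" and s: "reg L s1" "reg L s2" and i: "intel s2" and m: "s1 \<in> bb L s2" "s2 \<in> bb L s1"
  obtains \<phi> where "\<phi> \<in> grp L" "\<phi> s2 \<in> zc L s1"
proof -
  note sL = good_subspace[OF L] and s1 = regD[OF s(1)] and s2 = regD[OF s(2)]
  let ?A = "bb L s1 \<inter> bb L s2"
  have sA: "subspace ?A" by (intro subspace_inter subspace_bb sL)
  have s1b: "s1 \<in> bb L s1" and s2b: "s2 \<in> bb L s2"
    using s1 s2 zc_bb by (auto simp: zc_def br_self intro: zc_bb[THEN subsetD])
  have Ast: "br s1 v \<in> ?A" if "v \<in> ?A" for v using that s1b m(1) br_bb_bb[OF good_subalg[OF L]] by blast
  have tA: "\<tau> \<in> ?A" if t: "\<tau> \<in> zc L s1" for \<tau>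
  proof -
    have "\<tau> \<in> bb L s1" using t zc_bb by blast
    then obtain \<alpha> \<nu> where an: "\<alpha> \<in> bb L s1" "\<alpha> \<in> bb L s2" "\<nu> \<in> nn L s1" "\<tau> = \<alpha> + \<nu>" using bb_covered[OF L s] by metis
    have "gcomp (br s1) 0 \<nu> = 0" using an(3) not_cpos_0 by (auto simp: nn_def)
    moreover have "gcomp (br s1) 0 \<tau> = \<tau>" using comp_0_fix[of s1 \<tau> 0] t by (simp add: zc_def)
    ultimately have "gcomp (br s1) 0 \<alpha> = \<tau>" using an(4) lin_add[OF lin_comp[OF lin_br], of s1 0 \<alpha> \<nu>] by simp
    then show ?thesis using comp_mem[OF lin_br sA Ast, of \<alpha> 0] an by auto
  qed
  let ?\<sigma> = "gcomp (br s1) 0 s2"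
  have \<sigma>: "?\<sigma> \<in> zc L s1" by (rule comp0_zc[OF L s1(1,2) s2(1)])
  let ?\<nu> = "s2 - ?\<sigma>"
  have "?\<nu> \<in> nn L s1" by (rule bb_minus_comp[OF L s1(1) m(2)])
  moreover have "?\<nu> \<in> bb L s2" using s2b tA[OF \<sigma>] subspace_diff[OF subspace_bb[OF sL]] by blast
  ultimately have \<nu>: "?\<nu> \<in> nn L s1" "?\<nu> \<in> nn L s2" using nn_bb_nn[OF L s] by auto
  let ?m = "nn L s1 \<inter> nn L s2"
  have sm: "subspace ?m" by (intro subspace_inter subspace_nn sL)
  have "\<exists>\<phi>\<in>grp ?m. \<phi> (s2 + (- ?\<nu>)) = s2"
  proof (rule nn_conj[OF i])
    show "subalg ?m" using sm subalg_nn[OF L] by (auto simp: subalg_def)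
    show "br s2 w \<in> ?m" if "w \<in> ?m" for w using that br_bb_nn[OF good_subalg[OF L]] m(2) s2b by blast
    show "?m \<subseteq> nn UNIV s2" by (auto simp: nn_def)
    show "- ?\<nu> \<in> ?m" using \<nu> sm subspace_neg by blast
  qed
  then obtain \<phi> where \<phi>: "\<phi> \<in> grp ?m" "\<phi> ?\<sigma> = s2" by auto
  obtain \<psi> where \<psi>: "\<psi> \<in> grp ?m" "\<And>x. \<psi> (\<phi> x) = x" using grp_inv[OF sm \<phi>(1)] by blast
  have "\<psi> \<in> grp L" by (rule grp_mono[OF _ \<psi>(1)]) (auto simp: nn_def)
  moreover have "\<psi> s2 = ?\<sigma>" using \<psi>(2)[of ?\<sigma>] \<phi>(2) by simp
  ultimately show thesis using that \<sigma> by metis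
qed

text \<open>Each element is first moved into the Borel of the other. Because this leaves both Borels
  unchanged, the two moves do not interfere and \<open>reg_conj_aux\<close> applies to the
  results.\<close>

lemma reg_conj:
  assumes L: "good L" and s: "reg L s1" "reg L s2" and i: "intel s1" "intel s2"
  obtains \<phi> where "\<phi> \<in> grp L" "\<phi> s2 \<in> zc L s1"
proof -
  note sL = good_subspace[OF L]
  obtain \<phi>1 where p1: "\<phi>1 \<in> grp L" "\<phi>1 s1 \<in> bb L s2" "bb L (\<phi>1 s1) = bb L s1"
    using reg_conj_into_bb[OF L s i(1)] by metis
  obtain \<phi>2 where p2: "\<phi>2 \<in> grp L" "\<phi>2 s2 \<in> bb L s1" "bb L (\<phi>2 s2) = bb L s2"
    using reg_conj_into_bb[OF L s(2,1) i(2)] by metis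
  have a: "aut \<phi>1" "aut \<phi>2" using p1 p2 grp_aut by auto
  have r: "reg L (\<phi>1 s1)" "reg L (\<phi>2 s2)"
    using aut_reg[OF a(1) good_grp_iff[OF L p1(1)] s(1)] aut_reg[OF a(2) good_grp_iff[OF L p2(1)] s(2)] by auto
  obtain \<phi> where p: "\<phi> \<in> grp L" "\<phi> (\<phi>2 s2) \<in> zc L (\<phi>1 s1)"
    using reg_conj_aux[OF L r aut_intel[OF a(2) i(2)]] p1 p2 by metis
  obtain \<psi> where q: "\<psi> \<in> grp L" "\<And>x. \<psi> (\<phi>1 x) = x" using grp_inv[OF sL p1(1)] by blast
  have "zc L (\<psi> (\<phi>1 s1)) = \<psi> ` zc L (\<phi>1 s1)" by (rule aut_zc[OF grp_aut[OF q(1)] good_grp_iff[OF L q(1)]])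
  then have "\<psi> (\<phi> (\<phi>2 s2)) \<in> zc L s1" using p q by auto
  moreover have "\<psi> \<circ> (\<phi> \<circ> \<phi>2) \<in> grp L" using p q p2 grp_comp by blast
  ultimately show thesis using that[of "\<psi> \<circ> (\<phi> \<circ> \<phi>2)"] by simp
qed

subsection \<open>Roots of an abelian centraliser\<close>

text \<open>For generic \<open>c\<close> the sum of an eigenvalue of \<open>y\<close> and
  \<open>c\<close> times an eigenvalue of \<open>t\<close> determines both.\<close>

lemma semis_separate:
  assumes s: "semis y" "semis t" "br y t = 0"
  obtains c where "semis (y + c *s t)" "\<And>a. \<exists>p q. \<forall>v. br (y + c *s t) v = a *s v \<longrightarrow> br y v = p *s v \<and> br t v = q *s v"
proof -
  let ?Y = "spec (br y)" and ?T = "spec (br t)"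
  \<comment> \<open>The ratios are the values of \<open>c\<close> for which two different pairs of
    eigenvalues give the same sum.\<close>
  let ?F = "insert 0 ((\<lambda>((a, a'), (b, b')). (a' - a) / (b - b')) ` ((?Y \<times> ?Y) \<times> (?T \<times> ?T)))"
  have "finite ?F" using finite_spec[OF lin_br] by blast
  then obtain c where c: "c \<notin> ?F" using ex_new_if_finite[OF infinite_UNIV_char_0] by blast
  have c0: "c \<noteq> 0" using c by blast
  have inj: "a = a'" if m: "a \<in> ?Y" "a' \<in> ?Y" "b \<in> ?T" "b' \<in> ?T" and e: "a + c * b = a' + c * b'" for a a' b b'
  proof (cases "b = b'")
    case False
    have "c * (b - b') = a' - a" using e by (simp add: algebra_simps)
    then have "c = (a' - a) / (b - b')" using False by (simp add: field_simps)
    then have "c \<in> ?F" using m by (intro insertI2 image_eqI[of _ _ "((a, a'), (b, b'))"]) auto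
    then show ?thesis using c by blast
  qed (use e in simp)
  have comm: "br y (br t x) = br t (br y x)" for x
    using jacobi[of y t x] s(3) by (simp add: br_lin)
  have sep: "\<exists>p q. \<forall>v. br (y + c *s t) v = a *s v \<longrightarrow> br y v = p *s v \<and> br t v = q *s v" for a
  proof -
    have key: "gcomp (br y) p v = 0 \<or> (p \<in> ?Y \<and> (a - p) / c \<in> ?T \<and> br t (gcomp (br y) p v) = ((a - p) / c) *s gcomp (br y) p v)"
      if v: "br (y + c *s t) v = a *s v" for v p
    proof (cases "gcomp (br y) p v = 0")
      case False
      let ?u = "gcomp (br y) p v"
      have "br (y + c *s t) ?u = gcomp (br y) p (br (y + c *s t) v)"
        by (rule comp_commute[symmetric, OF lin_br lin_br]) (simp add: br_lin comm)
      also have "\<dots> = a *s ?u" unfolding v by (rule lin_scale[OF lin_comp[OF lin_br]])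
      finally have "p *s ?u + c *s br t ?u = a *s ?u" using semis_comp[OF s(1)] by (simp add: br_lin)
      then have "c *s br t ?u = (a - p) *s ?u" by (simp add: scale_left_diff_distrib algebra_simps)
      then have "(1 / c) *s (c *s br t ?u) = (1 / c) *s ((a - p) *s ?u)" by simp
      then have e: "br t ?u = ((a - p) / c) *s ?u" using c0 by simp
      then have "(a - p) / c \<in> ?T" using False eigenvector_gev[of "br t" ?u] by (auto simp: spec_def)
      moreover have "p \<in> ?Y" using False comp_not_spec[OF lin_br] by blast
      ultimately show ?thesis using e by blast
    qed simp
    show ?thesis
    proof (cases "\<exists>p. p \<in> ?Y \<and> (a - p) / c \<in> ?T")
      case True
      then obtain p where p: "p \<in> ?Y" "(a - p) / c \<in> ?T" by blast
      have uniq: "p' = p" if "p' \<in> ?Y" "(a - p') / c \<in> ?T" for p'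
        by (rule inj[OF that(1) p(1) that(2) p(2)]) (use c0 in simp)
      have "br y v = p *s v \<and> br t v = ((a - p) / c) *s v" if v: "br (y + c *s t) v = a *s v" for v
      proof -
        have z: "gcomp (br y) p' v = 0" if "p' \<noteq> p" for p' using key[OF v, of p'] uniq[of p'] that by blast
        have "v = (\<Sum>p'\<in>?Y. if p' = p then gcomp (br y) p v else 0)"
          using sum_comp[OF lin_br, of y v] sum.cong[OF refl, of ?Y "\<lambda>p'. gcomp (br y) p' v" "\<lambda>p'. if p' = p then gcomp (br y) p v else 0"] z
          by auto
        then have vp: "v = gcomp (br y) p v" using p finite_spec[OF lin_br] by simp
        then have "br y v = p *s v" using semis_comp[OF s(1), of p v] by simp
        moreover have "br t v = ((a - p) / c) *s v" using key[OF v, of p] vp by (cases "v = 0") (auto simp: br_lin)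
        ultimately show ?thesis by blast
      qed
      then show ?thesis by blast
    next
      case False
      have "v = 0" if v: "br (y + c *s t) v = a *s v" for v
      proof -
        have "gcomp (br y) p v = 0" for p using key[OF v, of p] False by blast
        then show ?thesis using sum_comp[OF lin_br, of y v] by simp
      qed
      then have "br y v = 0 *s v \<and> br t v = 0 *s v" if "br (y + c *s t) v = a *s v" for v
        using that by (metis br_lin(5) scale_zero_right)
      then show ?thesis by blast
    qed
  qed
  then show thesis using that[of c] semis_add[OF s] by blast
qed

text \<open>That is, every eigenspace of \<open>ad y\<close> lies in a single weight space of \<open>T\<close>.\<close>
definition separating :: "'g set \<Rightarrow> 'g \<Rightarrow> bool" where
  "separating T y \<longleftrightarrow> y \<in> T \<and> semis y \<and> (\<forall>t\<in>T. \<forall>a. \<exists>b. \<forall>v. br y v = a *s v \<longrightarrow> br t v = b *s v)"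

lemma ex_separating:
  assumes L: "good L" and s: "reg L s"
  shows "\<exists>y. separating (zc L s) y"
proof -
  let ?T = "zc L s"
  have sT: "subspace ?T" using good_subspace[OF good_zc[OF L regD(2,1)[OF s]]] .
  have ab: "br x y = 0" if "x \<in> ?T" "y \<in> ?T" for x y using regD(3)[OF s] that by (auto simp: abel_def)
  have tor: "semis x" if "x \<in> ?T" for x by (rule reg_toral[OF L s that])
  obtain F where F: "F \<subseteq> ?T" "independent F" "?T \<subseteq> span F" using maximal_independent_subset by blast
  have fF: "finite F" using F finiteI_independent by blast
  have "\<exists>y\<in>?T. \<forall>t\<in>F. \<forall>a. \<exists>b. \<forall>v. br y v = a *s v \<longrightarrow> br t v = b *s v"
    using fF F(1)
  proof (induction F rule: finite_induct)
    case empty then show ?case using subspace_0[OF sT] by blast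
  next
    case (insert t F)
    then obtain y where y: "y \<in> ?T" "\<And>t a. t \<in> F \<Longrightarrow> \<exists>b. \<forall>v. br y v = a *s v \<longrightarrow> br t v = b *s v" by blast
    have t: "t \<in> ?T" using insert by blast
    obtain c where c: "\<And>a. \<exists>p q. \<forall>v. br (y + c *s t) v = a *s v \<longrightarrow> br y v = p *s v \<and> br t v = q *s v"
      using semis_separate[OF tor[OF y(1)] tor[OF t] ab[OF y(1) t]] by metis
    have "y + c *s t \<in> ?T" using y t sT by (intro subspace_add subspace_scale)
    moreover have "\<exists>b. \<forall>v. br (y + c *s t) v = a *s v \<longrightarrow> br t' v = b *s v" if t': "t' \<in> insert t F" for t' a
    proof -
      obtain p q where pq: "\<And>v. br (y + c *s t) v = a *s v \<Longrightarrow> br y v = p *s v \<and> br t v = q *s v" using c[of a] by blast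
      show ?thesis
      proof (cases "t' = t")
        case False
        then obtain b where "\<forall>v. br y v = p *s v \<longrightarrow> br t' v = b *s v" using y(2)[of t' p] t' by blast
        then show ?thesis using pq by blast
      qed (use pq in blast)
    qed
    ultimately show ?case by blast
  qed
  then obtain y where y: "y \<in> ?T" "\<And>t a. t \<in> F \<Longrightarrow> \<exists>b. \<forall>v. br y v = a *s v \<longrightarrow> br t v = b *s v" by blast
  have "\<exists>b. \<forall>v. br y v = a *s v \<longrightarrow> br t v = b *s v" if "t \<in> span F" for t a
    using that
  proof (induction rule: span_induct_alt)
    case base
    have "\<forall>v. br y v = a *s v \<longrightarrow> br 0 v = 0 *s v" by (simp add: br_lin)
    then show ?case by blast
  next
    case (step c x z)
    obtain b where b: "\<And>v. br y v = a *s v \<Longrightarrow> br x v = b *s v" using y(2)[OF step(1)] by blast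
    obtain b' where b': "\<And>v. br y v = a *s v \<Longrightarrow> br z v = b' *s v" using step by blast
    have "\<forall>v. br y v = a *s v \<longrightarrow> br (c *s x + z) v = (c * b + b') *s v"
      using b b' by (simp add: br_lin scale_left_distrib)
    then show ?case by blast
  qed
  then have "separating ?T y" using y(1) tor F(3) unfolding separating_def by blast
  then show ?thesis by blast
qed

text \<open>Pair \<open>v\<close> with a vector \<open>w\<close> of the opposite eigenvalue of a
  separating element; separation makes \<open>w\<close> a weight vector for minus \<alpha>. The
  bracket \<open>[v, w]\<close> is then rescaled to a coroot.\<close>

lemma root_sl2:
  assumes L: "good L" and s: "reg L s" and v: "v \<in> L" "v \<noteq> 0" "\<And>t. t \<in> zc L s \<Longrightarrow> br t v = \<alpha> t *s v"
    and nz: "t0 \<in> zc L s" "\<alpha> t0 \<noteq> 0"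
  obtains h f where "h \<in> zc L s" "f \<in> L" "sl2_triple sc br v h f" "\<And>t. t \<in> zc L s \<Longrightarrow> br t f = (- \<alpha> t) *s f"
proof -
  let ?T = "zc L s"
  have sT: "subspace ?T" using good_subspace[OF good_zc[OF L regD(2,1)[OF s]]] .
  have TL: "?T \<subseteq> L" by (auto simp: zc_def)
  obtain y where y: "separating ?T y" using ex_separating[OF L s] by blast
  have yT: "y \<in> ?T" and ys: "semis y" and sep: "\<And>t a. t \<in> ?T \<Longrightarrow> \<exists>b. \<forall>v. br y v = a *s v \<longrightarrow> br t v = b *s v"
    using y by (auto simp: separating_def)
  have yL: "y \<in> L" using yT TL by blast
  let ?a = "\<alpha> y"
  have va: "br y v = ?a *s v" by (rule v(3)[OF yT])
  obtain w0 where w0: "w0 \<in> L" "kf v w0 \<noteq> 0" using good_nd[OF L] v by (auto simp: nondeg_def)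
  define w where "w = gcomp (br y) (- ?a) w0"
  have wL: "w \<in> L" unfolding w_def by (rule good_comp[OF L yL w0(1)])
  have wa: "br y w = (- ?a) *s w" unfolding w_def by (rule semis_comp[OF ys])
  have kvw: "kf v w \<noteq> 0"
  proof -
    have c: "gcomp (br y) a v = (if a = ?a then v else 0)" for a
      by (rule comp_of_gev[OF lin_br eigenvector_gev[where T = "br y", OF va]])
    have "v \<in> gev (br y) ?a" by (rule eigenvector_gev[where T = "br y", OF va])
    then have asp: "?a \<in> spec (br y)" using v(2) by (auto simp: spec_def)
    have "kf v w0 = (\<Sum>a\<in>spec (br y). if a = ?a then kf v w else 0)"
      unfolding kf_comp[OF ys, of v w0] by (rule sum.cong) (auto simp: c w_def kf_simps)
    also have "\<dots> = kf v w" using asp finite_spec[OF lin_br] by simp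
    finally show ?thesis using w0 by simp
  qed
  have tw: "br t w = (- \<alpha> t) *s w" if t: "t \<in> ?T" for t
  proof -
    obtain b where b: "br t w = b *s w" using sep[OF t, of "- ?a"] wa by blast
    have "\<alpha> t * kf v w = kf (br t v) w" using v(3)[OF t] by (simp add: kf_simps)
    also have "\<dots> = - (b * kf v w)" unfolding kf_inv' b by (simp add: kf_simps)
    finally have "(\<alpha> t + b) * kf v w = 0" by (simp add: algebra_simps)
    then have "b = - \<alpha> t" using kvw by (simp add: add_eq_0_iff)
    then show ?thesis using b by simp
  qed
  let ?h = "br v w"
  have sTs: "s \<in> ?T" using regD(1)[OF s] by (simp add: zc_def br_self)
  have hT: "?h \<in> ?T"
    using good_br[OF L v(1) wL] jacobi[of s v w] v(3)[OF sTs] tw[OF sTs] by (simp add: zc_def br_lin)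
  have h0: "?h \<noteq> 0"
  proof
    assume "?h = 0"
    then have "0 = kf t0 (br v w)" by (simp add: kf_simps)
    also have "\<dots> = kf (br t0 v) w" by (rule kf_inv[symmetric])
    also have "\<dots> = \<alpha> t0 * kf v w" using v(3)[OF nz(1)] by (simp add: kf_simps)
    finally show False using nz(2) kvw by simp
  qed
  \<comment> \<open>If \<alpha> vanished on \<open>[v, w]\<close>, the element of
    \<open>conj_elt\<close> would kill \<open>v\<close> too and be orthogonal to
    \<open>[v, w]\<close>. Then \<open>[v, w]\<close> would be both nilpotent and semisimple, hence
    zero.\<close>
  have ah: "\<alpha> ?h \<noteq> 0"
  proof
    assume a0: "\<alpha> ?h = 0"
    have hv: "br ?h v = 0" using v(3)[OF hT] a0 by simp
    obtain h' where h': "\<And>y. br ?h y = 0 \<Longrightarrow> br h' y = 0" "kf h' ?h = 0 \<Longrightarrow> nilp (br ?h)" using conj_elt[of ?h] by blast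
    have "kf h' ?h = kf (br h' v) w" by (rule kf_inv[symmetric])
    then have "kf h' ?h = 0" using h'(1)[OF hv] by (simp add: kf_simps)
    then have "nilp (br ?h)" by (rule h'(2))
    then have "br ?h z = 0" for z using diag_nilp_zero reg_toral[OF L s hT] by (simp add: semis_def)
    then show False using h0 br_faithful by blast
  qed
  define c where "c = 2 / \<alpha> ?h"
  have c: "c * \<alpha> ?h = 2" using ah by (simp add: c_def)
  have "sl2_triple sc br v (c *s ?h) (c *s w)"
    unfolding sl2_triple_def using v(3)[OF hT] tw[OF hT] c by (simp add: br_lin mult.left_commute)
  then show thesis using that[of "c *s ?h" "c *s w"] hT sT wL good_subspace[OF L] tw
    by (auto simp: br_lin subspace_scale mult.commute)
qed

lemma intel_add:
  assumes i: "intel a" "intel b" "br a b = 0" shows "intel (a + of_int k *s b)"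
proof (rule intelI)
  show "semis (a + of_int k *s b)" by (rule semis_add) (use i in \<open>auto simp: intel_def\<close>)
  fix x
  have "x \<in> span {v \<in> UNIV. \<exists>p q. br a v = p *s v \<and> br b v = q *s v}"
    by (rule semis_joint_span) (use i in \<open>auto simp: intel_def\<close>)
  moreover have "{v \<in> UNIV. \<exists>p q. br a v = p *s v \<and> br b v = q *s v} \<subseteq> {v. \<exists>j::int. br (a + of_int k *s b) v = of_int j *s v}"
  proof clarify
    fix v p q assume v: "br a v = p *s v" "br b v = q *s v"
    show "\<exists>j::int. br (a + of_int k *s b) v = of_int j *s v"
    proof (cases "v = 0")
      case False
      obtain j1 j2 :: int where "p = of_int j1" "q = of_int j2" using intel_eigen[OF i(1) v(1) False] intel_eigen[OF i(2) v(2) False] by metis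
      then have "br (a + of_int k *s b) v = of_int (j1 + k * j2) *s v" using v by (simp add: br_lin scale_left_distrib)
      then show ?thesis by blast
    qed (simp add: br_lin)
  qed
  ultimately show "x \<in> span {v. \<exists>j::int. br (a + of_int k *s b) v = of_int j *s v}" using span_mono by blast
qed

text \<open>The value is the sum of the squares of the integral eigenvalues. It serves as a squared
  length with values in the natural numbers, so that minimal elements exist.\<close>

lemma kf_intel:
  assumes "intel h" obtains n :: nat where "kf h h = of_nat n" "n = 0 \<Longrightarrow> h = 0"
proof -
  have sm: "semis h" using assms by (simp add: intel_def)
  obtain C m where C: "is_basis C" "\<And>c. c \<in> C \<Longrightarrow> c \<in> gev (br h) (m c)" using ex_gev_basis[OF lin_br] by metis
  have e: "br h c = m c *s c" if "c \<in> C" for c using C(2)[OF that] semis_gev[OF sm] by blast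
  have c0: "c \<noteq> 0" if "c \<in> C" for c using C(1) that dependent_zero by (auto simp: is_basis_def)
  have "\<exists>i::int. m c = of_int i" if "c \<in> C" for c using intel_eigen[OF assms e[OF that] c0[OF that]] by metis
  then obtain i :: "'g \<Rightarrow> int" where i: "\<And>c. c \<in> C \<Longrightarrow> m c = of_int (i c)" by metis
  have "kf h h = (\<Sum>c\<in>C. m c * m c)"
    unfolding kf_def by (rule tr_eigenbasis[OF C(1) lin_compose[OF lin_br lin_br]]) (use e in \<open>simp add: br_lin\<close>)
  also have "\<dots> = (\<Sum>c\<in>C. of_nat (nat (i c * i c)))"
  proof (rule sum.cong[OF refl])
    fix c assume "c \<in> C"
    then have "m c * m c = of_int (i c * i c)" by (simp add: i)
    also have "\<dots> = of_nat (nat (i c * i c))" by (rule of_nat_nat[symmetric]) simp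
    finally show "m c * m c = of_nat (nat (i c * i c))" .
  qed
  finally have 1: "kf h h = of_nat (\<Sum>c\<in>C. nat (i c * i c))" by simp
  have "h = 0" if "(\<Sum>c\<in>C. nat (i c * i c)) = 0"
  proof -
    have "i c * i c \<le> 0" if "c \<in> C" for c using \<open>(\<Sum>c\<in>C. nat (i c * i c)) = 0\<close> that is_basis_finite[OF C(1)] by simp
    then have "i c = 0" if "c \<in> C" for c using that by (metis mult_eq_0_iff not_square_less_zero order_le_less)
    then have z: "br h c = 0" if "c \<in> C" for c using e[OF that] i[OF that] that by simp
    have "br h v = 0" for v
      using lin_span_eqI[where S = "br h" and T = "\<lambda>x. 0" and C = C and x = v] lin_br lin_zero z C(1)
      by (auto simp: is_basis_def)
    then show ?thesis by (rule br_faithful)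
  qed
  then show thesis by (rule that[OF 1])
qed

lemma reg_in_zc:
  assumes L: "good L" and s: "reg L s" "reg L s'" "s' \<in> zc L s"
  shows "zc L s' = zc L s"
proof -
  have "zc L s \<subseteq> zc L s'" 
  proof
    fix v assume v: "v \<in> zc L s"
    then have "br s' v = 0" using regD(3)[OF s(1)] s(3) unfolding abel_def by blast
    then show "v \<in> zc L s'" using v by (simp add: zc_def)
  qed
  moreover have "subspace (zc L s)" "subspace (zc L s')"
    using good_subspace[OF good_zc[OF L regD(2,1)[OF s(1)]]] good_subspace[OF good_zc[OF L regD(2,1)[OF s(2)]]] by auto
  ultimately have "zc L s = zc L s'" using dim_reg_eq[OF L s(1,2)] by (intro subspace_dim_equal) auto
  then show ?thesis by simp
qed

text \<open>Among the conjugates of \<open>s\<close> in \<open>z\<^sub>L(h)\<close>, one at minimal distance from \<open>h\<close> is dominant: a simple root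
  negative on it would give a reflection decreasing the distance.\<close>
lemma weyl_dominant:
  assumes L: "good L" and t: "sl2_triple sc br e h f" "e \<in> L" "h \<in> L" "f \<in> L" and h: "reg L h" and g1: "L \<inter> gr h 1 = {0}"
    and s: "s \<in> zc L h" "reg L s" "intel s"
  obtains \<phi> where "\<phi> \<in> grp L" "nn L (\<phi> s) = nn L h"
proof -
  let ?T = "zc L h"
  note sL = good_subspace[OF L]
  have ih: "intel h" by (rule sl2_intel[OF t(1)])
  have sT: "subspace ?T" using good_subspace[OF good_zc[OF L regD(2,1)[OF h]]] .
  have hT: "h \<in> ?T" using t by (simp add: zc_def br_self)
  have ab: "br x y = 0" if "x \<in> ?T" "y \<in> ?T" for x y using regD(3)[OF h] that by (auto simp: abel_def)
  define P where "P = (\<lambda>\<phi>. \<phi> \<in> grp L \<and> \<phi> s \<in> ?T)"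
  \<comment> \<open>The squared distance from \<open>h\<close>, read off as a natural number; the
    difference is integral because both elements are and they commute in \<open>?T\<close>.\<close>
  define N where "N = (\<lambda>\<phi>. THE n. kf (\<phi> s - h) (\<phi> s - h) = of_nat n)"
  have int: "intel (\<phi> s)" if "\<phi> \<in> grp L" for \<phi> using aut_intel[OF grp_aut[OF that] s(3)] .
  have Neq: "kf (\<phi> s - h) (\<phi> s - h) = of_nat (N \<phi>)" if p: "P \<phi>" for \<phi>
  proof -
    have "br (\<phi> s) h = 0" using p hT ab by (simp add: P_def)
    then have "intel (\<phi> s + of_int (-1) *s h)" using intel_add[OF int ih, of \<phi> "-1"] p unfolding P_def by blast
    then have "intel (\<phi> s - h)" by simp
    then obtain n where n: "kf (\<phi> s - h) (\<phi> s - h) = of_nat n" using kf_intel by metis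
    show ?thesis unfolding N_def by (rule theI[of _ n]) (use n in \<open>auto simp: of_nat_eq_iff\<close>)
  qed
  have "P id" using s grp_id by (simp add: P_def)
  then obtain \<phi> where p: "P \<phi>" and min: "\<And>\<psi>. P \<psi> \<Longrightarrow> N \<phi> \<le> N \<psi>"
    using ex_has_least_nat[of P id N] by blast
  define s' where "s' = \<phi> s"
  have \<phi>: "\<phi> \<in> grp L" and s'T: "s' \<in> ?T" using p by (auto simp: P_def s'_def)
  have i': "intel s'" using int[OF \<phi>] by (simp add: s'_def)
  have r': "reg L s'" unfolding s'_def by (rule aut_reg[OF grp_aut[OF \<phi>] good_grp_iff[OF L \<phi>] s(2)])
  have z': "zc L s' = ?T" by (rule reg_in_zc[OF L h r' s'T])
  have s'L: "s' \<in> L" using r' by (rule regD)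
  obtain y where y: "separating ?T y" using ex_separating[OF L h] by blast
  have yT: "y \<in> ?T" and ys: "semis y" and sep: "\<And>t a. t \<in> ?T \<Longrightarrow> \<exists>b. \<forall>v. br y v = a *s v \<longrightarrow> br t v = b *s v"
    using y by (auto simp: separating_def)
  \<comment> \<open>Degree 2 plays the role of the simple root spaces; higher degrees are generated
    from it below.\<close>
  let ?V = "L \<inter> gr h 2"
  have sV: "subspace ?V" by (intro subspace_inter sL subspace_gr)
  have VT: "br t v \<in> ?V" if "t \<in> ?T" "v \<in> ?V" for t v
  proof -
    have "t \<in> gr h 0" using that by (auto simp: zc_def gr_def)
    then show ?thesis using that gr_br[of t h 0 v 2] good_br[OF L] by (auto simp: zc_def)
  qed
  have V: "?V \<subseteq> nn L s'"
  proof
    fix v assume v: "v \<in> ?V"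
    have "cpos a" if a: "gcomp (br s') a v \<noteq> 0" for a
    proof (rule ccontr)
      assume na: "\<not> cpos a"
      let ?W = "?V \<inter> {u. br s' u = a *s u}"
      have sW: "subspace ?W" using lin_subspace_kernel[OF lin_shift[OF lin_br, of s' a]]
        by (intro subspace_inter[OF sV]) simp
      have WT: "br y u \<in> ?W" if "u \<in> ?W" for u
        using that VT[OF yT, of u] jacobi[of s' y u] ab[OF s'T yT] by (simp add: br_lin)
      have "gcomp (br s') a v \<in> ?W"
        using comp_mem[OF lin_br sV VT[OF s'T] v] semis_comp[OF intel_semis[OF i']] by blast
      from ex_eigenvector[OF lin_br sW WT this a] obtain c u where u: "u \<in> ?W" "u \<noteq> 0" "br y u = c *s u" by metis
      have "\<forall>t\<in>?T. \<exists>b. br t u = b *s u" using sep u(3) by blast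
      then obtain \<alpha> where \<alpha>: "\<And>t. t \<in> ?T \<Longrightarrow> br t u = \<alpha> t *s u" by metis
      have uL: "u \<in> L" and uh: "br h u = 2 *s u" and us: "br s' u = a *s u" using u by (auto simp: gr_def)
      have \<alpha>h: "\<alpha> h = 2" using \<alpha>[OF hT] uh u(2) by simp
      have \<alpha>s: "\<alpha> s' = a" using \<alpha>[OF s'T] us u(2) by simp
      have a0: "a \<noteq> 0"
      proof
        assume "a = 0"
        then have "u \<in> zc L s'" using us uL by (simp add: zc_def)
        then have "u \<in> ?T" using z' by simp
        then have "br h u = 0" by (simp add: zc_def)
        then show False using uh u(2) by simp
      qed
      obtain k :: int where k: "a = of_int k" using intel_eigen[OF i' us u(2)] by metis
      have km: "k < 0" using na a0 k cpos_int by (metis linorder_neqE_linordered_idom of_int_0)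
      obtain hu fu where hf: "hu \<in> ?T" "fu \<in> L" "sl2_triple sc br u hu fu" "\<And>t. t \<in> ?T \<Longrightarrow> br t fu = (- \<alpha> t) *s fu"
        using root_sl2[OF L h uL u(2) \<alpha> hT] \<alpha>h by (metis zero_neq_numeral)
      note d = sl2D[OF hf(3)]
      let ?w = "weyl u fu 1"
      have w: "?w \<in> grp L" by (rule weyl_grp[OF hf(3) sL uL hf(2)])
      have lw: "lin ?w" by (rule aut_lin[OF grp_aut[OF w]])
      \<comment> \<open>Subtracting \<open>a / 2\<close> times the coroot leaves a part killed by
        the root triple and hence fixed, while the coroot changes sign.\<close>
      have ws: "?w s' = s' - a *s hu"
      proof -
        let ?z = "s' - (a / 2) *s hu"
        have "br ?z u = 0" using us d(1) by (simp add: br_lin)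
        moreover have "br ?z fu = 0" using hf(4)[OF s'T] d(2) \<alpha>s by (simp add: br_lin)
        ultimately have "?w ?z = ?z" using weyl_fix[OF hf(3)] br_0_commute by blast
        then have "?w s' - (a / 2) *s ?w hu = s' - (a / 2) *s hu" by (simp add: lin_diff[OF lw] lin_scale[OF lw])
        then have "?w s' + (a / 2) *s hu = s' - (a / 2) *s hu" using weyl_triple(2)[OF hf(3), of 1] by simp
        then have "?w s' = s' - ((a / 2) *s hu + (a / 2) *s hu)" by (simp add: algebra_simps)
        then show ?thesis unfolding scale_left_distrib[symmetric] by simp
      qed
      have wT: "?w s' \<in> ?T" unfolding ws using s'T hf(1) sT by (intro subspace_diff subspace_scale)
      have Pw: "P (?w \<circ> \<phi>)" using grp_comp[OF w \<phi>] wT by (simp add: P_def s'_def)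
      obtain n where n: "kf hu hu = of_nat n" "n = 0 \<Longrightarrow> hu = 0" using kf_intel[OF sl2_intel[OF hf(3)]] by metis
      have hu0: "hu \<noteq> 0" using d(1) u(2) by (auto simp: br_lin)
      have n0: "n > 0" using n hu0 by auto
      \<comment> \<open>ad h and ad hu agree on the root vector \<open>fu\<close>, so invariance of
        the form replaces \<open>h\<close> by \<open>hu\<close>.\<close>
      have khh: "kf hu h = of_nat n"
      proof -
        have "br fu h = 2 *s fu" "br fu hu = 2 *s fu" using hf(4)[OF hT] \<alpha>h br_skew[of fu h] d(2) br_skew[of fu hu] by auto
        then have "kf (br u fu) h = kf (br u fu) hu" unfolding kf_inv by simp
        then show ?thesis using d(3) n(1) by simp
      qed
      have kss: "kf (?w s') (?w s') = kf s' s'" by (rule aut_kf[OF grp_aut[OF w]])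
      have kwh: "kf (?w s') h = kf s' h - a * of_nat n" unfolding ws by (simp add: kf_simps khh)
      have "kf (?w s' - h) (?w s' - h) = kf (s' - h) (s' - h) + 2 * a * of_nat n"
      proof -
        have x: "kf (x - h) (x - h) = kf x x - 2 * kf x h + kf h h" for x
          using kf_sym[of h x] by (simp add: kf_simps)
        show ?thesis unfolding x kss kwh by (simp add: algebra_simps)
      qed
      moreover have "kf (?w s' - h) (?w s' - h) = of_nat (N (?w \<circ> \<phi>))" using Neq[OF Pw] by (simp add: s'_def)
      moreover have "kf (s' - h) (s' - h) = of_nat (N \<phi>)" using Neq[OF p] by (simp add: s'_def)
      ultimately have "of_int (int (N (?w \<circ> \<phi>))) = (of_int (int (N \<phi>) + 2 * k * int n) :: complex)" using k by simp
      then have "int (N (?w \<circ> \<phi>)) = int (N \<phi>) + 2 * k * int n" using of_int_eq_iff by blast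
      moreover have "2 * k * int n < 0" using km n0 by (simp add: mult_neg_pos)
      ultimately show False using min[OF Pw] by simp
    qed
    then show "v \<in> nn L s'" using v by (simp add: nn_def)
  qed
  have st: "stable3 e h f L" by (rule good_stable3[OF L t(2,3,4)])
  have eV: "e \<in> nn L s'" using V t sl2D(1)[OF t(1)] by (auto simp: gr_def)
  \<comment> \<open>ad e maps degree i - 2 onto degree i, so all positive degrees are reached from
    degree 2; degree 1 is zero.\<close>
  have grn: "L \<inter> gr h (int i) \<subseteq> nn L s'" if "i \<ge> 1" for i
    using that
  proof (induction i rule: less_induct)
    case (less i)
    consider "i = 1" | "i = 2" | "i \<ge> 3" using less.prems by linarith
    then show ?case
    proof cases
      case 1 then show ?thesis using g1 subspace_0[OF subspace_nn[OF sL]] by auto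
    next
      case 2 then show ?thesis using V by simp
    next
      case 3
      show ?thesis
      proof
        fix w assume w: "w \<in> L \<inter> gr h (int i)"
        obtain u where u: "u \<in> L" "u \<in> gr h (int i - 2)" "br e u = w"
          using sl2_surj[OF t(1) st, of w "int i"] w 3 by auto
        have "u \<in> L \<inter> gr h (int (i - 2))" using u(1,2) 3 by simp
        moreover have "L \<inter> gr h (int (i - 2)) \<subseteq> nn L s'" by (rule less.IH) (use 3 in auto)
        ultimately have "u \<in> nn L s'" by blast
        then have "br e u \<in> nn L s'" using subalg_nn[OF L] eV by (auto simp: subalg_def)
        then show "w \<in> nn L s'" using u by simp
      qed
    qed
  qed
  have "nn L h \<subseteq> nn L s'"
  proof
    fix v assume v: "v \<in> nn L h"
    show "v \<in> nn L s'"
    proof (rule grge_comp_sum[of h, OF _ subspace_nn[OF sL]])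
      fix a
      show "gcomp (br h) a v \<in> nn L s'"
      proof (cases "gcomp (br h) a v = 0")
        case True then show ?thesis using subspace_0[OF subspace_nn[OF sL]] by simp
      next
        case False
        have "a \<in> spec (br h)" using False comp_not_spec[OF lin_br] by blast
        then obtain i where i: "a = of_int i" using ih by (auto simp: intel_def)
        have "i > 0" using v False i cpos_int by (auto simp: nn_def)
        then obtain j where j: "i = int j" "j \<ge> 1" by (metis One_nat_def Suc_leI pos_int_cases)
        have "gcomp (br h) a v \<in> L \<inter> gr h (int j)"
          using good_comp[OF L t(3), of v a] v semis_comp[OF regD(2)[OF h], of a v] i j by (simp add: nn_def gr_def)
        then show ?thesis using grn[OF j(2)] by blast
      qed
    qed
  qed
  moreover have "dim (nn L s') = dim (nn L h)" using dim_reg[OF L r'] dim_reg[OF L h] z' by simp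
  ultimately have "nn L s' = nn L h" using subspace_dim_equal[OF subspace_nn[OF sL] subspace_nn[OF sL]] by (metis order_refl)
  then show thesis using that[OF \<phi>] by (simp add: s'_def)
qed

text \<open>The bound on the centraliser forces \<open>[x, bb L h] = nn L h\<close> by dimension. In
  degree 2 this says that the component \<open>x2\<close> satisfies
  \<open>[x2, zc L h] = L \<inter> gr h 2\<close>, which makes \<open>x2\<close> part of a triple
  with neutral element \<open>h\<close>; \<open>unip_conj\<close> removes the higher components of
  \<open>x\<close>.\<close>

lemma regular_in_nn:
  assumes L: "good L" and t: "sl2_triple sc br e h f" "e \<in> L" "h \<in> L" "f \<in> L" and h: "reg L h" and g1: "L \<inter> gr h 1 = {0}"
    and x: "x \<in> nn L h" "dim (zc L x) \<le> dim (zc L h)"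
  obtains \<phi> y where "\<phi> \<in> grp L" "y \<in> L" "sl2_triple sc br (\<phi> x) h y"
proof -
  note sL = good_subspace[OF L] and hh = regD[OF h] and d = sl2D[OF t(1)]
  let ?n = "nn L h" and ?b = "bb L h" and ?T = "zc L h" and ?V = "L \<inter> gr h 2"
  have ih: "intel h" by (rule sl2_intel[OF t(1)])
  have xL: "x \<in> L" using x by (simp add: nn_def)
  have im: "br x ` ?b = ?n"
  proof -
    have sub: "br x ` ?b \<subseteq> ?n"
    proof clarify
      fix b assume "b \<in> ?b"
      then have "br b x \<in> ?n" using br_bb_nn[OF good_subalg[OF L] _ x(1)] by blast
      then show "br x b \<in> ?n" using br_skew[of x b] subspace_neg[OF subspace_nn[OF sL]] by simp
    qed
    have "dim ?b = dim {v \<in> ?b. br x v = 0} + dim (br x ` ?b)" by (rule rank_nullity[OF lin_br subspace_bb[OF sL]])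
    moreover have "dim {v \<in> ?b. br x v = 0} \<le> dim (zc L x)" by (rule dim_subset) (auto simp: zc_def bb_def)
    ultimately have "dim ?n \<le> dim (br x ` ?b)" using dim_bb[OF L h] x(2) by simp
    then show ?thesis
      using subspace_dim_equal[OF lin_subspace_image[OF lin_br subspace_bb[OF sL]] subspace_nn[OF sL] sub] by blast
  qed
  have xi: "\<exists>i\<ge>2. a = of_int i" if a: "gcomp (br h) a x \<noteq> 0" for a
  proof -
    have "a \<in> spec (br h)" using a comp_not_spec[OF lin_br] by blast
    then obtain i where i: "a = of_int i" using ih by (auto simp: intel_def)
    have "i > 0" using x(1) a i cpos_int by (auto simp: nn_def)
    moreover have "i \<noteq> 1"
    proof
      assume "i = 1"
      then have "gcomp (br h) a x \<in> L \<inter> gr h 1"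
        using good_comp[OF L t(3) xL, of a] semis_comp[OF hh(2), of a x] i by (simp add: gr_def)
      then show False using g1 a by blast
    qed
    ultimately show ?thesis using i by (intro exI[of _ i]) auto
  qed
  define x2 where "x2 = gcomp (br h) 2 x"
  have x2L: "x2 \<in> L" unfolding x2_def by (rule good_comp[OF L t(3) xL])
  have hx2: "br h x2 = 2 *s x2" unfolding x2_def by (rule semis_comp[OF hh(2)])
  have VT: "\<exists>\<tau>\<in>?T. br x2 \<tau> = w" if w: "w \<in> ?V" for w
  proof -
    have c: "gcomp (br h) a w = (if a = 2 then w else 0)" for a
      by (rule comp_of_gev[OF lin_br eigenvector_gev]) (use w in \<open>simp add: gr_def\<close>)
    have "w \<in> ?n" using w c cpos_int[of 2] by (auto simp: nn_def split: if_splits)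
    then obtain b where b: "b \<in> ?b" "w = br x b" using im by blast
    \<comment> \<open>Components of \<open>x\<close> start in degree 2 and those of \<open>b\<close>
      in degree 0, so a single product reaches degree 2.\<close>
    have z: "br (gcomp (br h) a x) (gcomp (br h) (2 - a) b) = 0" if "a \<noteq> 2" for a
    proof (rule ccontr)
      assume "br (gcomp (br h) a x) (gcomp (br h) (2 - a) b) \<noteq> 0"
      then have nz: "gcomp (br h) a x \<noteq> 0" "gcomp (br h) (2 - a) b \<noteq> 0" by (auto simp: br_lin)
      then obtain i where i: "i \<ge> 2" "a = of_int i" using xi by blast
      have "2 - a = 0 \<or> cpos (2 - a)" using nz b by (auto simp: bb_def)
      moreover have "2 - a = of_int (2 - i)" using i by simp
      ultimately have "2 - i \<ge> 0" using cpos_int[of "2 - i"] by (metis less_le_not_le linorder_linear of_int_eq_0_iff order_refl)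
      then have "i = 2" using i by simp
      then show False using i that by simp
    qed
    have "w = gcomp (br h) 2 (br x b)" using c[of 2] b by simp
    also have "\<dots> = (\<Sum>a\<in>spec (br h). if a = 2 then br x2 (gcomp (br h) 0 b) else 0)"
      unfolding comp_br by (rule sum.cong) (auto simp: z x2_def)
    also have "\<dots> = br x2 (gcomp (br h) 0 b)"
      using finite_spec[OF lin_br] comp_not_spec[OF lin_br, of 2 h x] by (auto simp: br_lin x2_def)
    finally have "w = br x2 (gcomp (br h) 0 b)" .
    moreover have "gcomp (br h) 0 b \<in> ?T" by (rule comp0_zc[OF L hh(1,2)]) (use b in \<open>simp add: bb_def\<close>)
    ultimately show ?thesis by blast
  qed
  \<comment> \<open>The degree 0 part of \<open>z\<close> commutes with \<open>x2\<close> and with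
    \<tau>, hence with \<open>e = [x2, \<tau>]\<close>, and is therefore orthogonal to
    \<open>h = [e, f]\<close>.\<close>
  have "kf h z = 0" if z: "z \<in> zc L x2" for z
  proof -
    let ?z = "gcomp (br h) 0 z"
    have zL: "z \<in> L" using z by (simp add: zc_def)
    have zT: "?z \<in> ?T" by (rule comp0_zc[OF L hh(1,2) zL])
    have "gcomp (br h) (0 + 2) (br x2 z) = br x2 ?z"
      by (rule comp_shift[OF eigenvector_gev[where T = "br h", OF hx2]])
    then have x2z: "br x2 ?z = 0" using z lin_0[OF lin_comp[OF lin_br]] by (simp add: zc_def)
    have "e \<in> ?V" using t(2) d(1) by (simp add: gr_def)
    then obtain \<tau> where \<tau>: "\<tau> \<in> ?T" "br x2 \<tau> = e" using VT by blast
    have "br ?z \<tau> = 0" using hh(3) zT \<tau> by (auto simp: abel_def)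
    then have ze: "br ?z e = 0" using jacobi[of ?z x2 \<tau>] \<tau>(2) x2z br_0_commute[of x2 ?z] by (simp add: br_lin)
    have "kf h z = (\<Sum>a\<in>spec (br h). if a = 0 then kf h ?z else 0)"
      unfolding kf_comp[OF hh(2), of h z] by (rule sum.cong) (auto simp: comp_0_fix br_self kf_simps)
    also have "\<dots> = kf h ?z"
      using finite_spec[OF lin_br] comp_not_spec[OF lin_br, of 0 h z] by (auto simp: kf_simps)
    also have "\<dots> = kf ?z (br e f)" using d(3) kf_sym by simp
    also have "\<dots> = kf (br ?z e) f" by (rule kf_inv[symmetric])
    also have "\<dots> = 0" using ze by (simp add: kf_simps)
    finally show ?thesis .
  qed
  then obtain w where w: "w \<in> L" "br x2 w = h" using image_br_perp[OF L x2L t(3)] by blast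
  define y where "y = gcomp (br h) (-2) w"
  have yL: "y \<in> L" unfolding y_def by (rule good_comp[OF L t(3) w(1)])
  have "gcomp (br h) (-2 + 2) (br x2 w) = br x2 y"
    unfolding y_def by (rule comp_shift[OF eigenvector_gev[where T = "br h", OF hx2]])
  then have "br x2 y = h" using w(2) comp_self by simp
  moreover have "br h y = (-2) *s y" unfolding y_def by (rule semis_comp[OF hh(2)])
  ultimately have t2: "sl2_triple sc br x2 h y" using hx2 by (simp add: sl2_triple_def)
  have st: "stable3 x2 h y L" by (rule good_stable3[OF L x2L t(3) yL])
  have "\<exists>\<phi>\<in>grp L. \<phi> (x2 + (x - x2)) = x2"
  proof (rule unip_conj[OF hh(2) good_subalg[OF L], where d = 2])
    show "br h w \<in> L" "br w x2 \<in> L" if "w \<in> L" for w using good_br[OF L] that t(3) x2L by auto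
    show "x2 \<in> gr h 2" using hx2 by (simp add: gr_def)
    show "\<exists>u\<in>L. u \<in> gr h j \<and> br x2 u = \<nu>" if jv: "j \<ge> 1" "\<nu> \<in> L" "\<nu> \<in> gr h (2 + j)" for j \<nu>
    proof -
      obtain u where "u \<in> L" "u \<in> gr h (2 + j - 2)" "br x2 u = \<nu>"
        using sl2_surj[OF t2 st jv(2,3)] jv(1) by (metis add_increasing zero_le_numeral)
      then show ?thesis by (intro bexI[of _ u]) auto
    qed
    show "x - x2 \<in> grge h L (2 + 1)"
    proof -
      have "\<exists>i\<ge>3. a = of_int i" if a: "gcomp (br h) a (x - x2) \<noteq> 0" for a
      proof -
        have a2: "a \<noteq> 2" using a by (auto simp: x2_def lin_diff[OF lin_comp[OF lin_br]] comp_comp)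
        then have "gcomp (br h) a x \<noteq> 0" using a by (simp add: x2_def lin_diff[OF lin_comp[OF lin_br]] comp_comp)
        then obtain i where i: "i \<ge> 2" "a = of_int i" using xi by blast
        then have "i \<noteq> 2" using a2 by auto
        then show ?thesis using i by (intro exI[of _ i]) auto
      qed
      moreover have "x - x2 \<in> L" using xL x2L sL by (intro subspace_diff)
      ultimately show ?thesis by (simp add: grge_def)
    qed
  qed
  then obtain \<phi> where "\<phi> \<in> grp L" "\<phi> x = x2" by auto
  then show thesis using that[of \<phi> y] yL t2 by simp
qed

text \<open>Regularity of \<open>x\<close> passes to the neutral element of a triple through it, so
  \<open>reg_conj\<close> and \<open>weyl_dominant\<close> bring that element into the chamber of
  \<open>h\<close>, and \<open>regular_in_nn\<close> takes over. A common neutral element is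
  obtained instead of \<phi> x = e; dimension counts require no more.\<close>

theorem regular_nilpotent_conj:
  assumes L: "good L" and t: "sl2_triple sc br e h f" "e \<in> L" "h \<in> L" "f \<in> L" and h: "reg L h" and g1: "L \<inter> gr h 1 = {0}"
    and x: "x \<in> L" "nilp (br x)" "dim (zc L x) = lie_rank sc br L"
  obtains \<phi> y where "\<phi> \<in> grp L" "y \<in> L" "sl2_triple sc br (\<phi> x) h y"
proof -
  obtain hx fx where hx: "hx \<in> L" "fx \<in> L" "sl2_triple sc br x hx fx" using jacobson_morozov[OF L x(1,2)] by blast
  have "dim (zc L hx) \<le> lie_rank sc br L"
    using sl2_dim[OF hx(3) good_stable3[OF L x(1) hx(1,2)]] x(3) gr0_zc by simp
  then have rx: "reg L hx" by (rule reg_if_dim[OF L sl2_semis[OF hx(3)] hx(1)])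
  have ix: "intel hx" by (rule sl2_intel[OF hx(3)])
  obtain \<phi> where p: "\<phi> \<in> grp L" "\<phi> hx \<in> zc L h" using reg_conj[OF L h rx sl2_intel[OF t(1)] ix] by blast
  have a: "aut \<phi>" using p grp_aut by blast
  have r1: "reg L (\<phi> hx)" by (rule aut_reg[OF a good_grp_iff[OF L p(1)] rx])
  obtain \<psi> where q: "\<psi> \<in> grp L" "nn L (\<psi> (\<phi> hx)) = nn L h"
    using weyl_dominant[OF L t h g1 p(2) r1 aut_intel[OF a ix]] by blast
  let ?\<chi> = "\<psi> \<circ> \<phi>"
  have c: "?\<chi> \<in> grp L" using grp_comp q p by blast
  have ac: "aut ?\<chi>" using c grp_aut by blast
  have "br (?\<chi> hx) (?\<chi> x) = 2 *s ?\<chi> x"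
    using sl2D(1)[OF hx(3)] aut_br[OF ac, of hx x] lin_scale[OF aut_lin[OF ac], of 2 x] by simp
  then have "gcomp (br (?\<chi> hx)) b (?\<chi> x) = (if b = 2 then ?\<chi> x else 0)" for b
    by (intro comp_of_gev[OF lin_br eigenvector_gev])
  then have "?\<chi> x \<in> nn L (?\<chi> hx)" using good_grp_iff[OF L c] x(1) cpos_int[of 2] by (auto simp: nn_def split: if_splits)
  then have xn: "?\<chi> x \<in> nn L h" using q(2) by simp
  have "dim (zc L (?\<chi> x)) \<le> dim (zc L h)"
    using aut_dim_zc[OF ac good_grp_iff[OF L c] good_subspace[OF L], of x] x(3) lie_rank_reg[OF L h] by simp
  from regular_in_nn[OF L t h g1 xn this] obtain \<theta> y where "\<theta> \<in> grp L" "y \<in> L" "sl2_triple sc br (\<theta> (?\<chi> x)) h y" by blast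
  then show thesis using that[of "\<theta> \<circ> ?\<chi>" y] grp_comp[OF _ c] by simp
qed

subsection \<open>Existence of regular nilpotent elements\<close>

text \<open>A separating element \<open>y\<close> of a Cartan subalgebra \<open>zc L s\<close> is
  itself regular: \<open>s\<close> acts on the kernel of ad y by one scalar, and that kernel
  contains \<open>s\<close>, on which the scalar is 0.\<close>

lemma ex_separating_reg:
  assumes L: "good L" shows "\<exists>y. reg L y \<and> separating (zc L y) y"
proof -
  obtain s where s: "reg L s" using ex_reg[OF L] by blast
  obtain y where y: "separating (zc L s) y" using ex_separating[OF L s] by blast
  have yT: "y \<in> zc L s" using y by (simp add: separating_def)
  have sT: "s \<in> zc L s" using regD(1)[OF s] by (simp add: zc_def br_self)
  have ab: "br a b = 0" if "a \<in> zc L s" "b \<in> zc L s" for a b using regD(3)[OF s] that by (auto simp: abel_def)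
  have "zc L y = zc L s"
  proof
    show "zc L y \<subseteq> zc L s"
    proof
      fix v assume v: "v \<in> zc L y"
      have "br s v = 0"
      proof (cases "s = 0")
        case False
        obtain b where b: "\<And>v. br y v = 0 *s v \<Longrightarrow> br s v = b *s v" using y sT unfolding separating_def by blast
        have "br s s = b *s s" using b[of s] ab[OF yT sT] by simp
        then have "b = 0" using False br_self[of s] by simp
        then show ?thesis using b[of v] v by (simp add: zc_def)
      qed (simp add: br_lin)
      then show "v \<in> zc L s" using v by (simp add: zc_def)
    qed
    show "zc L s \<subseteq> zc L y" using ab[OF yT] by (auto simp: zc_def)
  qed
  moreover from this have "reg L y" using s y yT by (simp add: reg_def separating_def zc_def)
  ultimately show ?thesis using y by metis
qed

end

section \<open>Roots, coroots and simple roots\<close>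

locale root_data = sslie sc Basis br
  for sc :: "complex \<Rightarrow> 'g::ab_group_add \<Rightarrow> 'g" (infixr "*s" 75) and Basis br +
  fixes L :: "'g set" and y :: 'g
  assumes L: "good L" and y: "reg L y" and sep: "separating (zc L y) y"
begin

abbreviation "T \<equiv> zc L y"

text \<open>Since \<open>y\<close> separates weights, a weight of \<open>T\<close> is coded by its
  value \<open>a\<close> at \<open>y\<close>, and \<open>wt a\<close> recovers the functional. The
  value is meaningful only when \<open>a\<close> is an eigenvalue of ad y.\<close>

definition wt :: "complex \<Rightarrow> 'g \<Rightarrow> complex" where
  "wt a t = (SOME b. \<forall>v. br y v = a *s v \<longrightarrow> br t v = b *s v)"

lemma wt: "t \<in> T \<Longrightarrow> br y v = a *s v \<Longrightarrow> br t v = wt a t *s v"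
proof -
  assume t: "t \<in> T" and v: "br y v = a *s v"
  have "\<exists>b. \<forall>v. br y v = a *s v \<longrightarrow> br t v = b *s v" using sep t by (simp add: separating_def)
  from someI_ex[OF this] show "br t v = wt a t *s v" unfolding wt_def using v by blast
qed

lemmas ys = regD(2)[OF y] and yL = regD(1)[OF y] and subspace_T = good_subspace[OF good_zc[OF L regD(2,1)[OF y]]]

lemma yT: "y \<in> T"
  using yL by (simp add: zc_def br_self)

lemma T_abel: "s \<in> T \<Longrightarrow> t \<in> T \<Longrightarrow> br s t = 0"
  using regD(3)[OF y] unfolding abel_def by blast

lemma T_L: "t \<in> T \<Longrightarrow> t \<in> L"
  by (simp add: zc_def)

definition R :: "complex set" where
  "R = {a. a \<noteq> 0 \<and> (\<exists>v\<in>L. v \<noteq> 0 \<and> br y v = a *s v)}"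

lemma R_spec: "a \<in> R \<Longrightarrow> a \<in> spec (br y)"
  using eigenvector_gev[of "br y"] by (auto simp: R_def spec_def)

lemma finite_R: "finite R"
  using finite_subset[OF _ finite_spec[OF lin_br, of y]] R_spec by blast

lemma wt_eq:
  assumes "v \<noteq> 0" "br y v = a *s v" "t \<in> T" "br t v = b *s v" shows "wt a t = b"
  using wt[OF assms(3,2)] assms by simp

definition is_root_triple :: "complex \<Rightarrow> 'g \<Rightarrow> 'g \<Rightarrow> 'g \<Rightarrow> bool" where
  "is_root_triple a e h f \<longleftrightarrow> e \<in> L \<and> e \<noteq> 0 \<and> br y e = a *s e \<and> h \<in> T \<and> f \<in> L \<and> sl2_triple sc br e h f \<and> (\<forall>t\<in>T. br t f = (- wt a t) *s f)"

lemma ex_root_triple: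
  assumes "a \<in> R"
  shows "\<exists>e h f. is_root_triple a e h f"
proof -
  obtain v where v: "v \<in> L" "v \<noteq> 0" "br y v = a *s v" "a \<noteq> 0" using assms by (auto simp: R_def)
  have "wt a y \<noteq> 0" using wt_eq[OF v(2,3) yT v(3)] v(4) by simp
  then obtain h f where "h \<in> T" "f \<in> L" "sl2_triple sc br v h f" "\<And>t. t \<in> T \<Longrightarrow> br t f = (- wt a t) *s f"
    using root_sl2[OF L y v(1,2) wt[OF _ v(3)] yT] by blast
  then show ?thesis using v unfolding is_root_triple_def by blast
qed

definition rt :: "complex \<Rightarrow> 'g \<times> 'g \<times> 'g" where
  "rt a = (SOME p. is_root_triple a (fst p) (fst (snd p)) (snd (snd p)))"

definition "E a = fst (rt a)"
definition "H a = fst (snd (rt a))"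
definition "F a = snd (snd (rt a))"

lemma root_triple:
  assumes "a \<in> R"
  shows "E a \<in> L" "E a \<noteq> 0" "br y (E a) = a *s E a" "H a \<in> T" "F a \<in> L" "sl2_triple sc br (E a) (H a) (F a)"
    "\<And>t. t \<in> T \<Longrightarrow> br t (F a) = (- wt a t) *s F a" "\<And>t. t \<in> T \<Longrightarrow> br t (E a) = wt a t *s E a" "F a \<noteq> 0" "H a \<noteq> 0"
proof -
  have "\<exists>p. is_root_triple a (fst p) (fst (snd p)) (snd (snd p))"
    using ex_root_triple[OF assms] by (metis fst_conv snd_conv)
  from someI_ex[OF this] have "is_root_triple a (E a) (H a) (F a)"
    unfolding E_def H_def F_def rt_def .
  then have *: "E a \<in> L \<and> E a \<noteq> 0 \<and> br y (E a) = a *s E a \<and> H a \<in> T \<and> F a \<in> L \<and> sl2_triple sc br (E a) (H a) (F a) \<and> (\<forall>t\<in>T. br t (F a) = (- wt a t) *s F a)"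
    unfolding is_root_triple_def .
  then show "E a \<in> L" "E a \<noteq> 0" "br y (E a) = a *s E a" "H a \<in> T" "F a \<in> L" "sl2_triple sc br (E a) (H a) (F a)"
    "\<And>t. t \<in> T \<Longrightarrow> br t (F a) = (- wt a t) *s F a" by auto
  show "\<And>t. t \<in> T \<Longrightarrow> br t (E a) = wt a t *s E a" using wt * by blast
  have "br (H a) (E a) = 2 *s E a" "br (E a) (F a) = H a" using * sl2D by blast+
  then show "H a \<noteq> 0" "F a \<noteq> 0" using * by (auto simp: br_lin)
qed

lemma wt_y: "a \<in> R \<Longrightarrow> wt a y = a"
  using root_triple(2,3)[of a] wt_eq[OF _ _ yT] by blast

lemma R_neg:
  assumes "a \<in> R" shows "- a \<in> R" "t \<in> T \<Longrightarrow> wt (- a) t = - wt a t"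
proof -
  have "br y (F a) = (- a) *s F a" using root_triple(7)[OF assms yT] wt_y[OF assms] by simp
  then show "- a \<in> R" "t \<in> T \<Longrightarrow> wt (- a) t = - wt a t"
    using root_triple[OF assms] assms wt_eq[of "F a" "- a" t "- wt a t"] by (auto simp: R_def)
qed

definition kap :: "complex \<Rightarrow> complex" where "kap a = kf (E a) (F a)"

text \<open>Through the Killing form the coroot \<open>H a\<close> becomes the root times
  \<open>kap a\<close>; evaluated at \<open>H a\<close> itself this makes \<open>kap a\<close> half
  the squared length of \<open>H a\<close>, hence positive.\<close>

lemma kf_H: assumes a: "a \<in> R" and t: "t \<in> T" shows "kf (H a) t = wt a t * kap a"
proof -
  have "br (F a) t = wt a t *s F a" using root_triple(7)[OF a t] br_skew[of "F a" t] by simp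
  then have "kf (br (E a) (F a)) t = wt a t * kap a" unfolding kf_inv by (simp add: kf_simps kap_def)
  then show ?thesis using sl2D(3)[OF root_triple(6)[OF a]] by simp
qed

lemma wt_H_self: "a \<in> R \<Longrightarrow> wt a (H a) = 2"
  using root_triple[of a] sl2D(1)[OF root_triple(6)] wt_eq by blast

lemma kap_pos:
  assumes a: "a \<in> R" obtains r where "r > 0" "kap a = complex_of_real r"
proof -
  obtain n where n: "kf (H a) (H a) = of_nat n" "n = 0 \<Longrightarrow> H a = 0" using kf_intel[OF sl2_intel[OF root_triple(6)[OF a]]] by metis
  have "2 * kap a = of_nat n" using kf_H[OF a root_triple(4)[OF a]] wt_H_self[OF a] n by simp
  then have "kap a = complex_of_real (real n / 2)" by (simp add: field_simps)
  moreover have "real n / 2 > 0" using n(2) root_triple(10)[OF a] by auto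
  ultimately show thesis using that by blast
qed

definition Rp :: "complex set" where "Rp = {a \<in> R. cpos a}"

definition S :: "complex set" where
  "S = {a \<in> Rp. \<not> (\<exists>b\<in>Rp. \<exists>c\<in>Rp. \<forall>t\<in>T. wt a t = wt b t + wt c t)}"

lemma S_Rp: "a \<in> S \<Longrightarrow> a \<in> Rp" and Rp_R: "a \<in> Rp \<Longrightarrow> a \<in> R" and S_R: "a \<in> S \<Longrightarrow> a \<in> R"
  by (auto simp: S_def Rp_def)

lemma finite_S: "finite S"
  using finite_subset[OF _ finite_R] S_R by blast

text \<open>A nonzero bracket would be a weight vector for a - b, so a - b or b - a would be a
  positive root, and then \<open>a\<close> or \<open>b\<close> would be a sum of two positive
  roots.\<close>

lemma simple_commute:
  assumes a: "a \<in> S" and b: "b \<in> S" and ab: "a \<noteq> b"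
  shows "br (E a) (F b) = 0"
proof (rule ccontr)
  let ?w = "br (E a) (F b)"
  assume w: "?w \<noteq> 0"
  note ra = root_triple[OF S_R[OF a]] and rb = root_triple[OF S_R[OF b]]
  have wL: "?w \<in> L" by (rule good_br[OF L ra(1) rb(5)])
  have tw: "br t ?w = (wt a t - wt b t) *s ?w" if "t \<in> T" for t
    using jacobi[of t "E a" "F b"] ra(8)[OF that] rb(7)[OF that] by (simp add: br_lin scale_left_diff_distrib)
  have yw: "br y ?w = (a - b) *s ?w" using tw[OF yT] wt_y S_R a b by simp
  have cR: "a - b \<in> R" using yw wL w ab by (auto simp: R_def)
  have wc: "wt (a - b) t = wt a t - wt b t" if "t \<in> T" for t by (rule wt_eq[OF w yw that tw[OF that]])
  show False
  proof (cases "cpos (a - b)")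
    case True
    then have "a - b \<in> Rp" using cR by (simp add: Rp_def)
    moreover have "\<forall>t\<in>T. wt a t = wt (a - b) t + wt b t" using wc by simp
    ultimately show False using a S_Rp[OF b] unfolding S_def by blast
  next
    case False
    then have "cpos (b - a)" using cpos_total[of "a - b"] ab by auto
    moreover have "b - a \<in> R" using R_neg(1)[OF cR] by simp
    ultimately have "b - a \<in> Rp" by (simp add: Rp_def)
    moreover have "\<forall>t\<in>T. wt b t = wt (b - a) t + wt a t" using wc R_neg(2)[OF cR] by auto
    ultimately show False using b S_Rp[OF a] unfolding S_def by blast
  qed
qed

text \<open>\<open>E a\<close> is killed by \<open>F b\<close>, hence is a highest weight vector for
  the flipped triple of \<open>b\<close>; its weight, minus \<open>wt a (H b)\<close>, is a natural
  number.\<close>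

lemma simple_kf:
  assumes a: "a \<in> S" and b: "b \<in> S" and ab: "a \<noteq> b"
  obtains r where "r \<le> 0" "kf (H a) (H b) = complex_of_real r"
proof -
  note ra = root_triple[OF S_R[OF a]] and rb = root_triple[OF S_R[OF b]]
  note d = sl2D[OF sl2_flip[OF rb(6)]]
  have "br (F b) (E a) = 0" using simple_commute[OF a b ab] br_0_commute by blast
  moreover have "br (- H b) (E a) = (- wt a (H b)) *s E a" using ra(8)[OF rb(4)] by (simp add: br_lin)
  ultimately obtain n where "- wt a (H b) = of_nat n" using ker_eigen[OF d(1,3), of "E a"] ra(2) by blast
  then have n: "wt a (H b) = - of_nat n" by (metis add.inverse_inverse)
  obtain r where r: "r > 0" "kap a = complex_of_real r" using kap_pos[OF S_R[OF a]] .
  have "kf (H a) (H b) = complex_of_real (- real n * r)" using kf_H[OF S_R[OF a] rb(4)] n r by simp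
  moreover have "- real n * r \<le> 0" using r by simp
  ultimately show thesis using that by blast
qed

lemma kf_T_eq:
  "\<exists>C m. finite C \<and> (\<forall>c\<in>C. c \<noteq> 0 \<and> br y c = m c *s c) \<and> span C = UNIV \<and>
    (\<forall>s\<in>T. \<forall>t\<in>T. kf s t = (\<Sum>c\<in>C. wt (m c) s * wt (m c) t))"
proof -
  obtain C m where C: "is_basis C" "\<And>c. c \<in> C \<Longrightarrow> c \<in> gev (br y) (m c)" using ex_gev_basis[OF lin_br] by metis
  have e: "br y c = m c *s c" if "c \<in> C" for c using C(2)[OF that] semis_gev[OF ys] by blast
  have c0: "c \<noteq> 0" if "c \<in> C" for c using C(1) that dependent_zero by (auto simp: is_basis_def)
  have "kf s t = (\<Sum>c\<in>C. wt (m c) s * wt (m c) t)" if "s \<in> T" "t \<in> T" for s t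
    unfolding kf_def
    by (rule tr_eigenbasis[OF C(1) lin_compose[OF lin_br lin_br]])
      (use wt[OF that(1) e] wt[OF that(2) e] in \<open>simp add: br_lin mult.commute\<close>)
  then show ?thesis using is_basis_finite[OF C(1)] C(1) e c0 by (intro exI[of _ C] exI[of _ m]) (simp add: is_basis_def)
qed

definition comb :: "(complex \<Rightarrow> complex) \<Rightarrow> 'g" where "comb c = (\<Sum>a\<in>S. c a *s H a)"

lemma comb_T: "comb c \<in> T"
  unfolding comb_def using subspace_T root_triple(4)[OF S_R] by (intro subspace_sum subspace_scale)

text \<open>Weights take integral values on coroots, so conjugating the coefficients conjugates the
  value.\<close>

lemma wt_comb_cnj:
  assumes v: "v \<noteq> 0" "br y v = a *s v"
  shows "wt a (comb (\<lambda>b. cnj (c b))) = cnj (wt a (comb c))"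
proof -
  have w: "wt a (comb c) = (\<Sum>b\<in>S. c b * wt a (H b))" for c
  proof (rule wt_eq[OF v comb_T])
    have "br (comb c) v = (\<Sum>b\<in>S. c b *s (wt a (H b) *s v))"
      unfolding comb_def br_sum_left using wt[OF root_triple(4)[OF S_R] v(2)] by (simp add: br_lin)
    then show "br (comb c) v = (\<Sum>b\<in>S. c b * wt a (H b)) *s v" by (simp add: scale_sum_left)
  qed
  have "cnj (wt a (H b)) = wt a (H b)" if b: "b \<in> S" for b
  proof -
    obtain i :: int where "wt a (H b) = of_int i"
      using intel_eigen[OF sl2_intel[OF root_triple(6)[OF S_R[OF b]]] wt[OF root_triple(4)[OF S_R[OF b]] v(2)] v(1)] by metis
    then show ?thesis by simp
  qed
  then show ?thesis unfolding w by simp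
qed

text \<open>\<open>comb (cnj \<circ> c)\<close> is the complex conjugate of \<open>comb c\<close> for the real form spanned by the coroots.\<close>
lemma comb_definite:
  assumes "kf (comb c) (comb (\<lambda>b. cnj (c b))) = 0" shows "comb c = 0"
proof -
  obtain C m where Cm: "finite C \<and> (\<forall>c\<in>C. c \<noteq> 0 \<and> br y c = m c *s c) \<and> span C = UNIV \<and>
    (\<forall>s\<in>T. \<forall>t\<in>T. kf s t = (\<Sum>c\<in>C. wt (m c) s * wt (m c) t))" using kf_T_eq by (elim exE)
  then have C: "finite C" "\<And>c. c \<in> C \<Longrightarrow> c \<noteq> 0 \<and> br y c = m c *s c" "span C = UNIV"
    "\<And>s t. s \<in> T \<Longrightarrow> t \<in> T \<Longrightarrow> kf s t = (\<Sum>c\<in>C. wt (m c) s * wt (m c) t)" by auto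
  have "(\<Sum>x\<in>C. wt (m x) (comb c) * cnj (wt (m x) (comb c))) = 0"
  proof -
    have "(\<Sum>x\<in>C. wt (m x) (comb c) * wt (m x) (comb (\<lambda>b. cnj (c b)))) = 0"
      using assms C(4)[OF comb_T comb_T, of c "\<lambda>b. cnj (c b)"] by simp
    moreover have "wt (m x) (comb (\<lambda>b. cnj (c b))) = cnj (wt (m x) (comb c))" if "x \<in> C" for x
      by (rule wt_comb_cnj) (use C(2)[OF that] in auto)
    ultimately show ?thesis by simp
  qed
  then have "complex_of_real (\<Sum>x\<in>C. (cmod (wt (m x) (comb c)))\<^sup>2) = 0"
    by (simp add: complex_norm_square del: of_real_power)
  then have "(\<Sum>x\<in>C. (cmod (wt (m x) (comb c)))\<^sup>2) = 0" using of_real_eq_0_iff by blast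
  then have "wt (m x) (comb c) = 0" if "x \<in> C" for x using that C(1) by (simp add: sum_nonneg_eq_0_iff)
  then have z: "br (comb c) x = 0" if "x \<in> C" for x using wt[OF comb_T] C(2) that by (metis scale_zero_left)
  have "br (comb c) v = 0" for v
    using lin_span_eqI[where S = "br (comb c)" and T = "\<lambda>x. 0" and C = C and x = v] lin_br lin_zero z C(3) by auto
  then show ?thesis by (rule br_faithful)
qed

lemma comb_cnj_zero: assumes "comb c = 0" shows "comb (\<lambda>b. cnj (c b)) = 0"
  by (rule comb_definite) (use assms in \<open>simp add: kf_simps\<close>)

text \<open>Pairing with \<open>y\<close> turns each coroot into a positive multiple of its root,
  and a nonempty sum of elements of the cone \<open>cpos\<close> cannot vanish.\<close>

lemma comb_real_pos:
  assumes "comb (\<lambda>a. complex_of_real (r a)) = 0" and "\<And>a. a \<in> S \<Longrightarrow> r a \<ge> 0" and a: "a \<in> S"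
  shows "r a = 0"
proof (rule ccontr)
  assume "r a \<noteq> 0"
  have e: "kf (comb (\<lambda>a. complex_of_real (r a))) y = (\<Sum>a\<in>S. complex_of_real (r a) * (a * kap a))"
    unfolding comb_def kf_sum by (rule sum.cong) (auto simp: kf_simps kf_H[OF S_R yT] wt_y S_R)
  have p: "complex_of_real (r b) * (b * kap b) = 0 \<or> cpos (complex_of_real (r b) * (b * kap b))" if b: "b \<in> S" for b
  proof -
    obtain k where k: "k > 0" "kap b = complex_of_real k" using kap_pos[OF S_R[OF b]] .
    have "cpos b" using S_Rp[OF b] by (simp add: Rp_def)
    then have "cpos (complex_of_real (r b * k) * b)" if "r b * k > 0"
      using that by (auto simp: cpos_def zero_less_mult_iff)
    then show ?thesis using assms(2)[OF b] k by (cases "r b = 0") (auto simp: mult_ac)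
  qed
  have pa: "cpos (complex_of_real (r a) * (a * kap a))"
  proof -
    obtain k where k: "k > 0" "kap a = complex_of_real k" using kap_pos[OF S_R[OF a]] .
    then have "complex_of_real (r a) * (a * kap a) \<noteq> 0" using \<open>r a \<noteq> 0\<close> S_R[OF a] by (auto simp: R_def)
    then show ?thesis using p[OF a] by blast
  qed
  have "sum g A = 0 \<or> cpos (sum g A)" if "finite A" "\<And>b. b \<in> A \<Longrightarrow> g b = 0 \<or> cpos (g b)" for g :: "complex \<Rightarrow> complex" and A
    using that
  proof (induction A rule: finite_induct)
    case (insert x A)
    have "g x = 0 \<or> cpos (g x)" "sum g A = 0 \<or> cpos (sum g A)" using insert by auto
    then show ?case using insert.hyps cpos_add[of "g x" "sum g A"] by auto
  qed simp
  from this[of "S - {a}"] have "(\<Sum>a\<in>S - {a}. complex_of_real (r a) * (a * kap a)) = 0 \<or> cpos (\<Sum>a\<in>S - {a}. complex_of_real (r a) * (a * kap a))"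
    using finite_S p by simp
  then have "cpos (\<Sum>a\<in>S. complex_of_real (r a) * (a * kap a))"
    using pa cpos_add[OF pa] finite_S a by (subst sum.remove[OF finite_S a]) auto
  then show False using e assms(1) not_cpos_0 by (simp add: kf_simps)
qed

text \<open>Splitting the coefficients into positive and negative parts gives equal vectors
  \<open>?p\<close> and \<open>?n\<close>. Their product is nonnegative as a square, and at most 0
  because distinct simple coroots never form an acute angle.\<close>

lemma comb_real_zero:
  assumes z: "comb (\<lambda>a. complex_of_real (r a)) = 0" and a: "a \<in> S"
  shows "r a = 0"
proof -
  define p where "p b = max (r b) 0" for b
  define n where "n b = max (- r b) 0" for b
  have pn: "r b = p b - n b" "p b \<ge> 0" "n b \<ge> 0" "p b * n b = 0" for b by (auto simp: p_def n_def max_def)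
  let ?p = "comb (\<lambda>b. complex_of_real (p b))" and ?n = "comb (\<lambda>b. complex_of_real (n b))"
  have "comb (\<lambda>a. complex_of_real (r a)) = ?p - ?n"
    unfolding comb_def by (simp add: pn(1) scale_left_diff_distrib sum_subtractf)
  then have eq: "?p = ?n" using z by simp
  obtain C m where Cm: "finite C \<and> (\<forall>c\<in>C. c \<noteq> 0 \<and> br y c = m c *s c) \<and> span C = UNIV \<and>
    (\<forall>s\<in>T. \<forall>t\<in>T. kf s t = (\<Sum>c\<in>C. wt (m c) s * wt (m c) t))" using kf_T_eq by (elim exE)
  then have C: "finite C" "\<And>c. c \<in> C \<Longrightarrow> c \<noteq> 0 \<and> br y c = m c *s c" "span C = UNIV"
    "\<And>s t. s \<in> T \<Longrightarrow> t \<in> T \<Longrightarrow> kf s t = (\<Sum>c\<in>C. wt (m c) s * wt (m c) t)" by auto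
  have "kf ?p ?p = (\<Sum>x\<in>C. wt (m x) ?p * cnj (wt (m x) ?p))"
    unfolding C(4)[OF comb_T comb_T]
  proof (rule sum.cong[OF refl])
    fix x assume x: "x \<in> C"
    have "wt (m x) ?p = cnj (wt (m x) ?p)"
      using wt_comb_cnj[of x "m x" "\<lambda>b. complex_of_real (p b)"] C(2)[OF x] by simp
    then show "wt (m x) ?p * wt (m x) ?p = wt (m x) ?p * cnj (wt (m x) ?p)" by (rule arg_cong)
  qed
  then have "kf ?p ?p = complex_of_real (\<Sum>x\<in>C. (cmod (wt (m x) ?p))\<^sup>2)"
    by (simp add: complex_norm_square del: of_real_power)
  then have ge: "Re (kf ?p ?p) \<ge> 0" "Im (kf ?p ?p) = 0" by (auto intro: sum_nonneg)
  have "kf ?p ?n = (\<Sum>b\<in>S. \<Sum>c\<in>S. complex_of_real (p b) * (complex_of_real (n c) * kf (H b) (H c)))"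
    unfolding comb_def kf_sum(1) by (simp add: kf_sum(2) kf_simps sum_distrib_left mult.left_commute)
  moreover have "Re (complex_of_real (p b) * (complex_of_real (n c) * kf (H b) (H c))) \<le> 0" if bc: "b \<in> S" "c \<in> S" for b c
  proof (cases "b = c")
    case True
    then show ?thesis using pn(4)[of b] by (auto simp: mult_eq_0_iff)
  next
    case False
    obtain q where "q \<le> 0" "kf (H b) (H c) = complex_of_real q" using simple_kf[OF bc False] .
    then show ?thesis using pn(2,3) by (simp add: mult_nonneg_nonpos)
  qed
  ultimately have "Re (kf ?p ?n) \<le> 0" by (auto intro!: sum_nonpos)
  then have "Re (kf ?p ?p) = 0" using ge eq by simp
  then have "kf ?p ?p = 0" using ge by (simp add: complex_eq_iff)
  then have p0: "?p = 0" using comb_definite[of "\<lambda>b. complex_of_real (p b)"] by simp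
  then have "p a = 0" "n a = 0"
    using comb_real_pos[of p, OF _ pn(2) a] comb_real_pos[of n, OF _ pn(3) a] eq by auto
  then show ?thesis using pn(1) by simp
qed

lemma comb_zero:
  assumes z: "comb c = 0" and a: "a \<in> S" shows "c a = 0"
proof -
  have z': "comb (\<lambda>b. cnj (c b)) = 0" by (rule comb_cnj_zero[OF z])
  have "comb (\<lambda>b. complex_of_real (Re (c b))) = (1 / 2) *s (comb c + comb (\<lambda>b. cnj (c b)))"
  proof -
    have "complex_of_real (Re w) = (1 / 2) * (w + cnj w)" for w by (simp add: complex_eq_iff)
    then show ?thesis unfolding comb_def sum.distrib[symmetric] scale_sum_right scale_left_distrib[symmetric]
      by (simp only: scale_scale)
  qed
  then have 1: "Re (c a) = 0" using z z' comb_real_zero[OF _ a, of "\<lambda>b. Re (c b)"] by simp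
  have "comb (\<lambda>b. complex_of_real (Im (c b))) = (1 / (2 * \<i>)) *s (comb c - comb (\<lambda>b. cnj (c b)))"
  proof -
    have "complex_of_real (Im w) = (1 / (2 * \<i>)) * (w - cnj w)" for w by (simp add: complex_eq_iff)
    then show ?thesis unfolding comb_def sum_subtractf[symmetric] scale_sum_right scale_left_diff_distrib[symmetric]
      by (simp only: scale_scale)
  qed
  then have "Im (c a) = 0" using z z' comb_real_zero[OF _ a, of "\<lambda>b. Im (c b)"] by simp
  with 1 show ?thesis by (simp add: complex_eq_iff)
qed

lemma H_inj: "inj_on H S"
proof (rule inj_onI, rule ccontr)
  fix a b assume ab: "a \<in> S" "b \<in> S" "H a = H b" "a \<noteq> b"
  define c :: "complex \<Rightarrow> complex" where "c x = (if x = a then 1 else if x = b then - 1 else 0)" for x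
  have "comb c = (\<Sum>x\<in>{a, b}. c x *s H x)" unfolding comb_def
    by (rule sum.mono_neutral_right[OF finite_S]) (use ab in \<open>auto simp: c_def\<close>)
  also have "\<dots> = 0" using ab by (simp add: c_def)
  finally have "c a = 0" using comb_zero ab by blast
  then show False by (simp add: c_def)
qed

lemma independent_H: "independent (H ` S)"
proof
  assume "dependent (H ` S)"
  then obtain u where u: "\<exists>w\<in>H ` S. u w \<noteq> 0" "(\<Sum>w\<in>H ` S. u w *s w) = 0"
    using finite_S by (auto simp: dependent_finite)
  have "comb (\<lambda>a. u (H a)) = 0" using u(2) by (simp add: comb_def sum.reindex[OF H_inj])
  then show False using comb_zero u(1) by blast
qed

lemma span_H_comb: "x \<in> span (H ` S) \<Longrightarrow> \<exists>c. x = comb c"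
proof (induction rule: span_induct_alt)
  case base
  show ?case by (rule exI[of _ "\<lambda>_. 0"]) (simp add: comb_def)
next
  case (step k x z)
  then obtain a c where a: "a \<in> S" "x = H a" and c: "z = comb c" by blast
  have "k *s x = (\<Sum>b\<in>S. (if b = a then k else 0) *s H b)"
  proof -
    have "(\<Sum>b\<in>S. (if b = a then k else 0) *s H b) = (\<Sum>b\<in>S. if b = a then k *s H a else 0)" by (rule sum.cong) auto
    then show ?thesis using a finite_S by simp
  qed
  then have "k *s x + z = comb (\<lambda>b. (if b = a then k else 0) + c b)"
    unfolding c comb_def by (simp add: scale_left_distrib sum.distrib)
  then show ?case by blast
qed

lemma comb_span: "comb c \<in> span (H ` S)"
  unfolding comb_def by (intro span_sum span_scale span_base) auto

lemma nondeg_span_H: "nondeg kf (span (H ` S))"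
  unfolding nondeg_def
proof (intro conjI ballI impI subspace_span)
  fix x assume x: "x \<in> span (H ` S)" "\<forall>y\<in>span (H ` S). kf x y = 0"
  obtain c where c: "x = comb c" using span_H_comb[OF x(1)] by blast
  have "kf x (comb (\<lambda>b. cnj (c b))) = 0" using x(2) comb_span by blast
  then show "x = 0" unfolding c by (rule comb_definite)
qed

text \<open>The neutral element \<open>d\<close> is the sum of the positive coroots in disguise: it
  takes the value 2 on every simple root and is found through nondegeneracy of the form on the span
  of the simple coroots. All roots then have nonzero even values at \<open>d\<close>, which gives
  both regularity and the vanishing of degree 1.\<close>

theorem regular_triple:
  obtains e h f where "e \<in> L" "h \<in> L" "f \<in> L" "sl2_triple sc br e h f" "reg L h" "L \<inter> gr h 1 = {0}"
proof -
  obtain d where d: "d \<in> span (H ` S)" "\<And>x. x \<in> H ` S \<Longrightarrow> kf d x = kf x x"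
    using nondeg_basis_values[OF is_form_kf nondeg_span_H span_superset independent_H, of "\<lambda>x. kf x x"] by blast
  obtain c where c: "d = comb c" using span_H_comb[OF d(1)] by blast
  have dT: "d \<in> T" unfolding c by (rule comb_T)
  have wS: "wt a d = 2" if a: "a \<in> S" for a
  proof -
    have "wt a d * kap a = kf (H a) d" using kf_H[OF S_R[OF a] dT] by simp
    also have "\<dots> = kf (H a) (H a)" using d(2)[of "H a"] a kf_sym[of "H a" d] by simp
    also have "\<dots> = 2 * kap a" using kf_H[OF S_R[OF a] root_triple(4)[OF S_R[OF a]]] wt_H_self[OF S_R[OF a]] by simp
    finally show ?thesis using kap_pos[OF S_R[OF a]] by (metis less_irrefl mult_cancel_right of_real_eq_0_iff)
  qed
  \<comment> \<open>A positive root that is not simple is a sum of two positive roots, each below it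
    in the order, so the number of positive roots below decreases.\<close>
  have wRp: "\<exists>n\<ge>1. wt a d = of_int (2 * n)" if "a \<in> Rp" for a
    using that
  proof (induction "card {b \<in> Rp. cpos (a - b)}" arbitrary: a rule: less_induct)
    case less
    show ?case
    proof (cases "a \<in> S")
      case True then show ?thesis using wS by (intro exI[of _ 1]) simp
    next
      case False
      then obtain b b' where b: "b \<in> Rp" "b' \<in> Rp" "\<And>t. t \<in> T \<Longrightarrow> wt a t = wt b t + wt b' t"
        using less.prems unfolding S_def by blast
      have ab: "a = b + b'" using b(3)[OF yT] wt_y Rp_R less.prems b by metis
      have fin: "finite {b \<in> Rp. cpos (a - b)}"
        by (rule finite_subset[OF _ finite_R]) (auto simp: Rp_def)
      have lt: "card {x \<in> Rp. cpos (u - x)} < card {b \<in> Rp. cpos (a - b)}" if u: "u \<in> Rp" "cpos (a - u)" for u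
      proof (rule psubset_card_mono[OF fin])
        have "cpos (a - x)" if "cpos (u - x)" for x using cpos_add[OF u(2) that] by simp
        moreover have "\<not> cpos (u - u)" using not_cpos_0 by simp
        ultimately show "{x \<in> Rp. cpos (u - x)} \<subset> {b \<in> Rp. cpos (a - b)}" using u by blast
      qed
      have "cpos (a - b)" "cpos (a - b')" using b ab by (auto simp: Rp_def)
      then have "\<exists>n\<ge>1. wt b d = of_int (2 * n)" "\<exists>n\<ge>1. wt b' d = of_int (2 * n)"
        using less.hyps[OF lt[OF b(1)] b(1)] less.hyps[OF lt[OF b(2)] b(2)] by auto
      then obtain n n' where "n \<ge> 1" "wt b d = of_int (2 * n)" "n' \<ge> 1" "wt b' d = of_int (2 * n')" by (elim exE conjE)
      then show ?thesis using b(3)[OF dT] by (intro exI[of _ "n + n'"]) auto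
    qed
  qed
  have wR: "\<exists>n. n \<noteq> 0 \<and> wt a d = of_int (2 * n)" if a: "a \<in> R" for a
  proof (cases "cpos a")
    case True
    then obtain n where "n \<ge> 1" "wt a d = of_int (2 * n)" using wRp[of a] a by (auto simp: Rp_def)
    then show ?thesis by (intro exI[of _ n]) auto
  next
    case False
    then have "cpos (- a)" using a cpos_total[of a] by (auto simp: R_def)
    then obtain n where n: "n \<ge> 1" "wt (- a) d = of_int (2 * n)" using wRp[of "- a"] R_neg(1)[OF a] by (auto simp: Rp_def)
    then have "- wt a d = of_int (2 * n)" using R_neg(2)[OF a dT] by simp
    then have "- (- wt a d) = - of_int (2 * n)" by (rule arg_cong)
    then show ?thesis using n(1) by (intro exI[of _ "- n"]) simp
  qed
  have comps: "gcomp (br y) a v = 0 \<or> wt a d = k" if v: "v \<in> L" "br d v = k *s v" for v a k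
  proof -
    have "br d (gcomp (br y) a v) = gcomp (br y) a (br d v)"
      by (rule comp_commute[symmetric, OF lin_br lin_br]) (use T_abel[OF dT yT] jacobi[of d y] in \<open>simp add: br_lin\<close>)
    then have "wt a d *s gcomp (br y) a v = k *s gcomp (br y) a v"
      using wt[OF dT semis_comp[OF ys]] lin_scale[OF lin_comp[OF lin_br]] v(2) by simp
    then show ?thesis by auto
  qed
  have aR: "a \<in> R" if "gcomp (br y) a v \<noteq> 0" "a \<noteq> 0" "v \<in> L" for a v
    using that semis_comp[OF ys, of a v] good_comp[OF L yL that(3)] by (auto simp: R_def)
  have zd: "zc L d = T"
  proof
    show "T \<subseteq> zc L d" using T_abel[OF dT] T_L by (auto simp: zc_def)
    show "zc L d \<subseteq> T"
    proof
      fix v assume v: "v \<in> zc L d"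
      then have vL: "v \<in> L" "br d v = 0 *s v" by (auto simp: zc_def)
      have "gcomp (br y) a v \<in> T" for a
      proof (cases "gcomp (br y) a v = 0")
        case False
        have "a = 0"
        proof (rule ccontr)
          assume "a \<noteq> 0"
          then have "a \<in> R" using aR False vL by blast
          then show False using wR[of a] comps[OF vL, of a] False by auto
        qed
        then show ?thesis using comp0_zc[OF L yL ys vL(1)] by simp
      qed (use subspace_0[OF subspace_T] in simp)
      then show "v \<in> T" by (rule grge_comp_sum[OF _ subspace_T])
    qed
  qed
  have g1: "L \<inter> gr d 1 = {0}"
  proof -
    have "v = 0" if v: "v \<in> L" "br d v = 1 *s v" for v
    proof -
      have "gcomp (br y) a v = 0" for a
      proof (rule ccontr)
        assume nz: "gcomp (br y) a v \<noteq> 0"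
        have w1: "wt a d = 1" using comps[OF v, of a] nz by blast
        show False
        proof (cases "a = 0")
          case True
          have "gcomp (br y) 0 v \<in> T" by (rule comp0_zc[OF L yL ys v(1)])
          then have "br d (gcomp (br y) 0 v) = 0" using T_abel[OF dT] by blast
          then show False using wt[OF dT semis_comp[OF ys], of a v] w1 nz True by simp
        next
          case False
          then obtain n where "wt a d = of_int (2 * n)" using wR[OF aR[OF nz False v(1)]] by blast
          then have "(of_int (2 * n) :: complex) = of_int 1" using w1 by simp
          then have "2 * n = 1" using of_int_eq_iff by blast
          then show False by presburger
        qed
      qed
      then show ?thesis using sum_comp[OF lin_br, of y v] by simp
    qed
    then show ?thesis using subspace_0[OF good_subspace[OF L]] by (auto simp: gr_def br_lin)
  qed
  \<comment> \<open>Only the \<open>E a\<close> carry the coefficients of \<open>d\<close> in terms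
    of coroots; mixed brackets vanish by \<open>simple_commute\<close>, and so
    \<open>[e, f] = d\<close>.\<close>
  define e where "e = (\<Sum>a\<in>S. c a *s E a)"
  define f where "f = (\<Sum>a\<in>S. F a)"
  have eL: "e \<in> L" and fL: "f \<in> L"
    unfolding e_def f_def using root_triple(1,5)[OF S_R] good_subspace[OF L]
    by (auto intro!: subspace_sum subspace_scale)
  have "br d e = (\<Sum>a\<in>S. 2 *s (c a *s E a))"
    unfolding e_def br_sum by (rule sum.cong) (auto simp: br_lin root_triple(8)[OF S_R dT] wS mult.commute)
  then have de: "br d e = 2 *s e" by (simp add: e_def scale_sum_right)
  have "br d f = (\<Sum>a\<in>S. (-2) *s F a)"
    unfolding f_def br_sum by (rule sum.cong) (auto simp: br_lin root_triple(7)[OF S_R dT] wS)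
  then have df: "br d f = (-2) *s f" by (simp only: f_def scale_sum_right)
  have "br e f = (\<Sum>a\<in>S. c a *s (\<Sum>b\<in>S. br (E a) (F b)))"
    unfolding e_def f_def br_sum_left by (simp only: br_scale br_sum scale_sum_right)
  also have "\<dots> = (\<Sum>a\<in>S. c a *s H a)"
  proof (rule sum.cong[OF refl])
    fix a assume a: "a \<in> S"
    have "(\<Sum>b\<in>S. br (E a) (F b)) = (\<Sum>b\<in>S. if b = a then H a else 0)"
      by (rule sum.cong) (use simple_commute[OF a] sl2D(3)[OF root_triple(6)[OF S_R[OF a]]] in auto)
    then show "c a *s (\<Sum>b\<in>S. br (E a) (F b)) = c a *s H a" using a finite_S by simp
  qed
  finally have "br e f = d" using c by (simp add: comb_def)
  then have "sl2_triple sc br e d f" using de df by (simp add: sl2_triple_def)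
  moreover have "reg L d" using dT zd T_L reg_toral[OF L y dT] regD(3)[OF y] by (simp add: reg_def)
  ultimately show thesis using that[OF eL T_L[OF dT] fL] g1 by blast
qed

end

context sslie
begin

lemma ex_regular_triple:
  assumes L: "good L"
  obtains e h f where "e \<in> L" "h \<in> L" "f \<in> L" "sl2_triple sc br e h f" "reg L h" "L \<inter> gr h 1 = {0}"
proof -
  obtain y where y: "reg L y" "separating (zc L y) y" using ex_separating_reg[OF L] by blast
  interpret root_data sc Basis br L y by unfold_locales (use L y in auto)
  show thesis using regular_triple that by blast
qed

subsection \<open>Rectangular principal nilpotent pairs\<close>

text \<open>The algebra is spanned by strings below highest weight vectors. An element of the
  centraliser is orthogonal to the image of ad f and to nonzero weights, and highest weight vectors
  of weight 0 lie in the centraliser.\<close>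

lemma good_sl2_centralizer:
  assumes t: "sl2_triple sc br e h f"
  shows "good (centralizer br {e, h, f})"
proof -
  let ?k = "centralizer br {e, h, f}"
  note d = sl2D[OF t]
  have "nondeg kf ?k"
    unfolding nondeg_def
  proof (intro conjI ballI impI subspace_centralizer)
    fix z assume z: "z \<in> ?k" "\<forall>y\<in>?k. kf z y = 0"
    have zz: "br e z = 0" "br h z = 0" "br f z = 0" using z by (auto simp: centralizer_def)
    have s: "subspace {x. kf z x = 0}" by (rule subspaceI) (auto simp: kf_simps)
    have "{(br f ^^ i) v |i j v. br e v = 0 \<and> br h v = of_nat j *s v \<and> i \<le> j} \<subseteq> {x. kf z x = 0}"
    proof clarify
      fix i j v assume v: "br e v = 0" "br h v = of_nat j *s v"
      show "kf z ((br f ^^ i) v) = 0"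
      proof (cases i)
        case (Suc i')
        then show ?thesis using kf_range[OF zz(3)] by simp
      next
        case 0
        show ?thesis
        proof (cases "j = 0")
          case False
          then show ?thesis using kf_eigen[of h z 0 v "of_nat j"] zz v 0 by simp
        next
          case True
          then have hv: "br h v = 0" using v by simp
          have "br f v = 0"
          proof (rule sl2_inj[OF t, of _ "-2"])
            show "br f v \<in> gr h (- 2)" using jacobi[of h f v] d hv by (simp add: gr_def br_lin)
            show "br e (br f v) = 0" using jacobi[of e f v] d hv v by (simp add: br_lin)
          qed simp
          then have "v \<in> ?k" using v hv by (simp add: centralizer_def)
          then show ?thesis using z 0 by simp
        qed
      qed
    qed
    then have "kf z x = 0" for x using sl2_span[OF t, of x] span_minimal[OF _ s] by blast
    then show "z = 0" using kf_nd by (simp add: nondeg_def)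
  qed
  then show ?thesis unfolding good_def by blast
qed

lemma stable3_commuting:
  assumes "br e x = 0" "br h x = 0" "br f x = 0"
  shows "stable3 e h f (zc UNIV x)"
proof -
  have "br x (br a w) = 0" if "br a x = 0" "br x w = 0" for a w
    using jacobi[of x a w] that br_0_commute[of a x] by (simp add: br_lin)
  moreover have "subspace (zc UNIV x)" unfolding zc_def by (intro subspace_inter subspace_UNIV lin_subspace_kernel[OF lin_br])
  ultimately show ?thesis using assms by (simp add: stable3_def zc_def)
qed

lemma zc_zc_centralizer: "zc (zc UNIV x) e = centralizer br {e, x}"
  by (auto simp: zc_def centralizer_def)

lemma zc_gr0: "zc UNIV x \<inter> gr h 0 = zc (gr h 0) x"
  by (auto simp: zc_def)

lemma gr0_eq: "gr h 0 = zc UNIV h"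
  by (auto simp: zc_def gr_def)

lemma regular_in_iff: "regular_in sc br W x \<longleftrightarrow> x \<in> W \<and> dim (zc W x) = lie_rank sc br W"
  by (simp add: regular_in_def zc_centralizer)

lemma rank_gr0:
  assumes t: "sl2_triple sc br e h f"
  shows "good (gr h 0)" "lie_rank sc br (gr h 0) = lie_rank sc br UNIV"
  unfolding gr0_eq using good_zc[OF good_UNIV sl2_semis[OF t]] lie_rank_zc[OF good_UNIV sl2_semis[OF t]] by auto

text \<open>ad e maps onto each positive degree from two degrees below and is injective on negative
  degrees, so the vanishing of degree 1 spreads to all odd degrees in both directions.\<close>

lemma even_if_gr1:
  assumes t: "sl2_triple sc br e h f" and g1: "gr h 1 = {0}" and i: "odd i"
  shows "gr h i = {0}"
proof -
  have st: "stable3 e h f UNIV" by (simp add: stable3_def)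
  have pos: "gr h (2 * int n + 1) = {0}" for n
  proof (induction n)
    case 0 then show ?case using g1 by simp
  next
    case (Suc n)
    have "w = 0" if w: "w \<in> gr h (2 * int (Suc n) + 1)" for w
    proof -
      have "2 * int (Suc n) + 1 \<ge> 1" by simp
      from sl2_surj[OF t st UNIV_I w this]
      obtain u where u: "u \<in> gr h (2 * int (Suc n) + 1 - 2)" "br e u = w" by blast
      have "2 * int (Suc n) + 1 - 2 = 2 * int n + 1" by simp
      then have "u \<in> gr h (2 * int n + 1)" using u(1) by (simp only:)
      then have "u = 0" using Suc by blast
      then show ?thesis using u(2) by (simp add: br_lin)
    qed
    then show ?case using subspace_0[OF subspace_gr] by blast
  qed
  have neg: "gr h (1 - 2 * int n) = {0}" for n
  proof (induction n)
    case 0 then show ?case using g1 by simp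
  next
    case (Suc n)
    have "v = 0" if v: "v \<in> gr h (1 - 2 * int (Suc n))" for v
    proof (rule sl2_inj[OF t v])
      have "br e v \<in> gr h (2 + (1 - 2 * int (Suc n)))" by (rule gr_br[OF _ v]) (use sl2D(1)[OF t] in \<open>simp add: gr_def\<close>)
      moreover have "2 + (1 - 2 * int (Suc n)) = 1 - 2 * int n" by simp
      ultimately show "br e v = 0" using Suc by auto
    qed simp
    then show ?case using subspace_0[OF subspace_gr] by blast
  qed
  obtain j where j: "i = 2 * j + 1" using i by (metis oddE)
  show ?thesis
  proof (cases "j \<ge> 0")
    case True
    then have "i = 2 * int (nat j) + 1" using j by simp
    then show ?thesis using pos[of "nat j"] by (simp only:)
  next
    case False
    then have "i = 1 - 2 * int (nat (- j))" using j by simp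
    then show ?thesis using neg[of "nat (- j)"] by (simp only:)
  qed
qed

lemma rectangular_imp_even_regular:
  assumes t: "sl2_triple sc br e h f"
    and t1: "sl2_triple sc br e h1 f1" and t2: "sl2_triple sc br e' h2 f2"
    and comm: "\<And>a b. a \<in> {e, h1, f1} \<Longrightarrow> b \<in> {e', h2, f2} \<Longrightarrow> br a b = 0"
    and dm: "dim (centralizer br {e, e'}) = lie_rank sc br UNIV"
  defines "k \<equiv> centralizer br {e, h, f}"
  shows "gr h 1 = {0}" "\<And>x. regular_nilpotent_in sc br k x \<Longrightarrow> regular_in sc br (gr h 0) x"
proof -
  \<comment> \<open>The triple through \<open>e\<close> that belongs to the pair may differ from the
    given one; conjugating it, with \<open>e\<close> fixed, moves the partner into
    \<open>k\<close>.\<close>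
  obtain \<phi> where p: "\<phi> \<in> grp UNIV" "\<phi> e = e" "\<phi> h1 = h" "\<phi> f1 = f" by (rule sl2_conjugate[OF t t1])
  have a: "aut \<phi>" using p grp_aut by blast
  define x h' f' where "x = \<phi> e'" and "h' = \<phi> h2" and "f' = \<phi> f2"
  have tx: "sl2_triple sc br x h' f'" unfolding x_def h'_def f'_def by (rule aut_sl2[OF a t2])
  have c0: "br (\<phi> b) (\<phi> c) = 0" if "b \<in> {e, h1, f1}" "c \<in> {e', h2, f2}" for b c
    using comm[OF that] aut_br[OF a, of b c] lin_0[OF aut_lin[OF a]] by simp
  have "\<phi> c \<in> k" if "c \<in> {e', h2, f2}" for c
    using c0[OF _ that, of e] c0[OF _ that, of h1] c0[OF _ that, of f1] p(2-4) by (simp add: k_def centralizer_def)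
  then have xk: "x \<in> k" "h' \<in> k" "f' \<in> k" by (simp_all add: x_def h'_def f'_def)
  have gk: "good k" unfolding k_def by (rule good_sl2_centralizer[OF t])
  have g0: "good (gr h 0)" and r0: "lie_rank sc br (gr h 0) = lie_rank sc br UNIV" using rank_gr0[OF t] by auto
  have k0: "k \<subseteq> gr h 0" by (auto simp: k_def centralizer_def gr_def)
  have cx: "br e x = 0" "br h x = 0" "br f x = 0" using xk(1) by (auto simp: k_def centralizer_def)
  have "centralizer br {e, x} = \<phi> ` centralizer br {e, e'}"
  proof -
    have "\<phi> v \<in> centralizer br {e, x} \<longleftrightarrow> v \<in> centralizer br {e, e'}" for v
    proof -
      have "br e (\<phi> v) = \<phi> (br e v)" "br x (\<phi> v) = \<phi> (br e' v)"
        using aut_br[OF a] p(2) x_def by metis+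
      then show ?thesis using aut_eq_0[OF a] by (simp add: centralizer_def)
    qed
    then have vi: "\<phi> -` centralizer br {e, x} = centralizer br {e, e'}" by blast
    have "surj \<phi>" using aut_bij[OF a] by (rule bij_is_surj)
    then have "\<phi> ` (\<phi> -` centralizer br {e, x}) = centralizer br {e, x}" by (rule surj_image_vimage_eq)
    then show ?thesis using vi by simp
  qed
  then have rk: "dim (centralizer br {e, x}) = lie_rank sc br UNIV" using aut_dim[OF a subspace_centralizer] dm by simp
  have "dim (zc (zc UNIV x) e) = dim (zc UNIV x \<inter> gr h 0) + dim (zc UNIV x \<inter> gr h 1)"
    by (rule sl2_dim[OF t stable3_commuting[OF cx]])
  then have split: "lie_rank sc br UNIV = dim (zc (gr h 0) x) + dim (zc UNIV x \<inter> gr h 1)"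
    using rk by (simp add: zc_zc_centralizer zc_gr0)
  have "dim (zc (gr h 0) x) \<ge> lie_rank sc br UNIV" using lie_rank_le[OF g0] xk(1) k0 r0 by force
  then have reg0: "dim (zc (gr h 0) x) = lie_rank sc br (gr h 0)" and z1: "dim (zc UNIV x \<inter> gr h 1) = 0"
    using split r0 by auto
  have z1': "zc UNIV x \<inter> gr h 1 \<subseteq> {0}" using z1 by simp
  \<comment> \<open>ad x preserves degree 1 and is nilpotent, but has no kernel there.\<close>
  show g1: "gr h 1 = {0}"
  proof (rule ccontr)
    assume "gr h 1 \<noteq> {0}"
    then obtain v where v: "v \<in> gr h 1" "v \<noteq> 0" using subspace_0[OF subspace_gr] by blast
    obtain n where n: "\<And>v. (br x ^^ n) v = 0" using sl2_nilp(1)[OF tx] by (auto simp: nilp_def)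
    have "x \<in> gr h 0" using xk(1) k0 by blast
    then have st: "(br x ^^ i) v \<in> gr h 1" for i
      by (induction i) (use v gr_br[of x h 0 _ 1] in auto)
    have "(br x ^^ i) v \<noteq> 0" for i
    proof (induction i)
      case (Suc i)
      then show ?case using z1' st[of i] by (auto simp: zc_def)
    qed (use v in simp)
    then show False using n by blast
  qed
  have in0: "x \<in> gr h 0" "h' \<in> gr h 0" "f' \<in> gr h 0" using xk k0 by auto
  have sh: "semis h'" by (rule sl2_semis[OF tx])
  have st0: "stable3 x h' f' (gr h 0)" by (rule good_stable3[OF g0 in0])
  have d0: "dim (zc (gr h 0) x) = dim (zc (gr h 0) h') + dim (gr h 0 \<inter> gr h' 1)"
    using sl2_dim[OF tx st0] gr0_zc by simp
  then have "dim (zc (gr h 0) h') \<le> lie_rank sc br (gr h 0)" using reg0 by simp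
  \<comment> \<open>Regularity of \<open>h'\<close> in the larger algebra \<open>gr h 0\<close>
    passes to \<open>k\<close>, which provides the reference triple for
    \<open>regular_nilpotent_conj\<close>.\<close>
  then have rh: "reg (gr h 0) h'" by (rule reg_if_dim[OF g0 sh in0(2)])
  then have "dim (gr h 0 \<inter> gr h' 1) = 0" using d0 reg0 lie_rank_reg[OF g0] by simp
  then have h1: "gr h 0 \<inter> gr h' 1 \<subseteq> {0}" by simp
  have rk': "reg k h'"
    using rh xk(2) k0 abel_subset[of "zc (gr h 0) h'" "zc k h'"] by (auto simp: reg_def zc_def)
  have k1: "k \<inter> gr h' 1 = {0}" using h1 k0 subspace_0[OF good_subspace[OF gk]] subspace_0[OF subspace_gr] by blast
  show "regular_in sc br (gr h 0) w" if w: "regular_nilpotent_in sc br k w" for w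
  proof -
    have w': "w \<in> k" "nilp (br w)" "dim (zc k w) = lie_rank sc br k" using w regular_nilpotent_iff[OF gk] by auto
    obtain \<psi> y where q: "\<psi> \<in> grp k" "y \<in> k" "sl2_triple sc br (\<psi> w) h' y"
      using regular_nilpotent_conj[OF gk tx xk rk' k1 w'] by blast
    have \<psi>0: "\<psi> v \<in> gr h 0 \<longleftrightarrow> v \<in> gr h 0" for v
      by (rule grp_mem_iff[OF subspace_gr _ good_subspace[OF gk] q(1)]) (use k0 good_br[OF g0] in auto)
    have "dim (zc (gr h 0) (\<psi> w)) = dim (zc (gr h 0) w)" by (rule aut_dim_zc[OF grp_aut[OF q(1)] \<psi>0 subspace_gr])
    moreover have "\<psi> w \<in> gr h 0" using \<psi>0 w'(1) k0 by blast
    then have "stable3 (\<psi> w) h' y (gr h 0)" using good_stable3[OF g0] in0 q(2) k0 by blast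
    \<comment> \<open>Both triples have the neutral element \<open>h'\<close>, and
      \<open>sl2_dim\<close> expresses the centraliser dimension through \<open>h'\<close>
      alone.\<close>
    from sl2_dim[OF q(3) this] have "dim (zc (gr h 0) (\<psi> w)) = dim (zc (gr h 0) x)"
      using d0 gr0_zc by simp
    ultimately show ?thesis using reg0 w'(1) k0 by (auto simp: regular_in_iff)
  qed
qed

lemma even_regular_imp_pair:
  assumes t: "sl2_triple sc br e h f" and g1: "gr h 1 = {0}"
  defines "k \<equiv> centralizer br {e, h, f}"
  assumes x: "regular_nilpotent_in sc br k x" and r: "regular_in sc br (gr h 0) x"
  shows "principal_nilpotent_pair sc br e x" "rectangular_pnp sc br e x"
proof -
  have gk: "good k" unfolding k_def by (rule good_sl2_centralizer[OF t])
  have x': "x \<in> k" "nilp (br x)" using x regular_nilpotent_iff[OF gk] by auto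
  obtain h' f' where tx: "h' \<in> k" "f' \<in> k" "sl2_triple sc br x h' f'" using jacobson_morozov[OF gk x'] by blast
  have cx: "br e x = 0" "br h x = 0" "br f x = 0" using x'(1) by (auto simp: k_def centralizer_def)
  have "dim (zc (zc UNIV x) e) = dim (zc UNIV x \<inter> gr h 0) + dim (zc UNIV x \<inter> gr h 1)"
    by (rule sl2_dim[OF t stable3_commuting[OF cx]])
  moreover have "zc UNIV x \<inter> gr h 1 \<subseteq> {0}" using g1 by blast
  then have "dim (zc UNIV x \<inter> gr h 1) = 0" by simp
  ultimately have dm: "dim (centralizer br {e, x}) = lie_rank sc br UNIV"
    using r rank_gr0(2)[OF t] by (simp add: zc_zc_centralizer zc_gr0 regular_in_iff)
  \<comment> \<open>The tori of the two commuting triples scale \<open>e\<close> and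
    \<open>x\<close> independently, since each fixes what commutes with its own triple.\<close>
  have "\<exists>\<phi>\<in>adjoint_group sc br. \<phi> e = c *s e \<and> \<phi> x = c' *s x" if c: "c \<noteq> 0" "c' \<noteq> 0" for c c'
  proof -
    obtain \<phi> where p: "\<phi> \<in> grp UNIV" "\<phi> e = c *s e" "\<And>z. br e z = 0 \<Longrightarrow> br f z = 0 \<Longrightarrow> \<phi> z = z"
      by (rule torus_scale[OF t c(1)]) blast
    obtain \<psi> where q: "\<psi> \<in> grp UNIV" "\<psi> x = c' *s x" "\<And>z. br x z = 0 \<Longrightarrow> br f' z = 0 \<Longrightarrow> \<psi> z = z"
      by (rule torus_scale[OF tx(3) c(2)]) blast
    have "br e f' = 0" using tx(2) by (simp add: k_def centralizer_def)
    then have "\<psi> e = e" using q(3) cx(1) br_0_commute by metis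
    moreover have "\<phi> x = x" using p(3) cx by blast
    then have "\<phi> (\<psi> x) = c' *s x" using q(2) lin_scale[OF aut_lin[OF grp_aut[OF p(1)]]] by simp
    moreover have "\<phi> \<circ> \<psi> \<in> adjoint_group sc br" by (rule grp_adjoint[OF grp_comp[OF p(1) q(1)]])
    ultimately show ?thesis using p(2) by (intro bexI[of _ "\<phi> \<circ> \<psi>"]) auto
  qed
  then show pn: "principal_nilpotent_pair sc br e x"
    unfolding principal_nilpotent_pair_def using cx(1) dm by blast
  have "\<forall>a\<in>{e, h, f}. \<forall>b\<in>{x, h', f'}. br a b = 0" using x'(1) tx(1,2) by (auto simp: k_def centralizer_def)
  then show "rectangular_pnp sc br e x" unfolding rectangular_pnp_def using pn t tx(3) by blast
qed

lemma rectangular_iff_even_regular: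
  assumes t: "sl2_triple sc br e h f"
  defines "k \<equiv> centralizer br {e, h, f}"
  shows "((\<exists>e'. rectangular_pnp sc br e e' \<or> rectangular_pnp sc br e' e) \<longleftrightarrow>
           ((\<forall>i::int. odd i \<longrightarrow> gr h i = {0}) \<and>
            (\<forall>x. regular_nilpotent_in sc br k x \<longrightarrow> regular_in sc br (gr h 0) x)))
     \<and> (((\<forall>i::int. odd i \<longrightarrow> gr h i = {0}) \<and>
            (\<forall>x. regular_nilpotent_in sc br k x \<longrightarrow> regular_in sc br (gr h 0) x))
         \<longrightarrow> (\<forall>e'. regular_nilpotent_in sc br k e' \<longrightarrow> principal_nilpotent_pair sc br e e'))"
    (is "(?i \<longleftrightarrow> ?ii) \<and> (?ii \<longrightarrow> ?m)")
proof -
  have "?ii" if "?i"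
  proof -
    from that
    obtain e' where e': "rectangular_pnp sc br e e' \<or> rectangular_pnp sc br e' e" by blast
    \<comment> \<open>Both orders of the pair are brought to the form with \<open>e\<close> in
      front.\<close>
    have "\<exists>h1 f1 h2 f2. sl2_triple sc br e h1 f1 \<and> sl2_triple sc br e' h2 f2 \<and>
        (\<forall>a\<in>{e, h1, f1}. \<forall>b\<in>{e', h2, f2}. br a b = 0) \<and> dim (centralizer br {e, e'}) = lie_rank sc br UNIV"
      using e'
    proof
      assume "rectangular_pnp sc br e e'"
      then show ?thesis unfolding rectangular_pnp_def principal_nilpotent_pair_def by blast
    next
      assume r: "rectangular_pnp sc br e' e"
      then obtain h1 f1 h2 f2 where q: "sl2_triple sc br e' h1 f1" "sl2_triple sc br e h2 f2"
          "\<forall>a\<in>{e', h1, f1}. \<forall>b\<in>{e, h2, f2}. br a b = 0"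
        unfolding rectangular_pnp_def by blast
      have "\<forall>a\<in>{e, h2, f2}. \<forall>b\<in>{e', h1, f1}. br a b = 0" using q(3) br_0_commute by blast
      moreover have "dim (centralizer br {e, e'}) = lie_rank sc br UNIV"
        using r unfolding rectangular_pnp_def principal_nilpotent_pair_def by (simp add: insert_commute)
      ultimately show ?thesis using q by blast
    qed
    then obtain h1 f1 h2 f2 where q: "sl2_triple sc br e h1 f1" "sl2_triple sc br e' h2 f2"
        "\<forall>a\<in>{e, h1, f1}. \<forall>b\<in>{e', h2, f2}. br a b = 0" "dim (centralizer br {e, e'}) = lie_rank sc br UNIV" by blast
    have c: "br a b = 0" if "a \<in> {e, h1, f1}" "b \<in> {e', h2, f2}" for a b using q(3) that by blast
    note R = rectangular_imp_even_regular[OF t q(1,2) c q(4)]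
    show "?ii" unfolding k_def using even_if_gr1[OF t R(1)] R(2) by blast
  qed
  moreover have "?i" if ii: "?ii"
  proof -
    have gk: "good k" unfolding k_def by (rule good_sl2_centralizer[OF t])
    \<comment> \<open>The condition on regular nilpotent elements of \<open>k\<close> could hold
      vacuously, so one has to be constructed; a triple with regular neutral element and no degree 1
      supplies it.\<close>
    obtain e' h' f' where e': "e' \<in> k" "h' \<in> k" "f' \<in> k" "sl2_triple sc br e' h' f'" "reg k h'" "k \<inter> gr h' 1 = {0}"
      using ex_regular_triple[OF gk] .
    have "dim (zc k e') = lie_rank sc br k"
      using sl2_dim[OF e'(4) good_stable3[OF gk e'(1,2,3)]] e'(6) gr0_zc lie_rank_reg[OF gk e'(5)] by simp
    then have rn: "regular_nilpotent_in sc br k e'" using regular_nilpotent_iff[OF gk] e'(1) sl2_nilp(1)[OF e'(4)] by blast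
    have "gr h 1 = {0}" using ii by simp
    from even_regular_imp_pair(2)[OF t this rn[unfolded k_def]] show ?i using ii rn unfolding k_def by blast
  qed
  moreover have "?m" if ii: "?ii"
  proof -
    have "gr h 1 = {0}" using ii by simp
    then show ?m using even_regular_imp_pair(1)[OF t] ii unfolding k_def by blast
  qed
  ultimately show ?thesis by blast
qed

end

section \<open>From the axioms to a basis and a nondegenerate Killing form\<close>

lemma sslie_of_semisimple:
  fixes sc :: "complex \<Rightarrow> 'g::ab_group_add \<Rightarrow> 'g"
  assumes ss: "semisimple_lie sc br"
  obtains Basis where "sslie sc Basis br"
proof -
  have la: "lie_algebra sc br" using ss by (simp add: semisimple_lie_def)
  have vs: "vector_space sc" using la by (simp add: lie_algebra_def)
  interpret vector_space sc by (rule vs)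
  obtain B where B: "finite B" "span B = UNIV" using la unfolding lie_algebra_def by blast
  obtain C where C: "C \<subseteq> B" "independent C" "B \<subseteq> span C" using maximal_independent_subset[of B] by blast
  have "span C = UNIV" using C(3) B(2) by (metis span_mono span_span top.extremum_uniqueI)
  then have fd: "finite_dimensional_vector_space sc C"
    using C B(1) finite_subset by unfold_locales auto
  interpret finite_dimensional_vector_space sc C by (rule fd)
  interpret lie sc C br
    by unfold_locales (use la in \<open>auto simp: lie_algebra_def\<close>)
  have "sslie sc C br" by unfold_locales (rule kf_nondeg[OF ss])
  then show thesis by (rule that)
qed

theorem theorem8p1:
  fixes sc :: "complex \<Rightarrow> 'g::ab_group_add \<Rightarrow> 'g"
    and br :: "'g \<Rightarrow> 'g \<Rightarrow> 'g"
    and e h f :: 'g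
  assumes "semisimple_lie sc br"
    and "nilpotent_elt br e"
    and "sl2_triple sc br e h f"
  defines "k \<equiv> centralizer br {e, h, f}"
  shows "((\<exists>e'. rectangular_pnp sc br e e' \<or> rectangular_pnp sc br e' e) \<longleftrightarrow>
           ((\<forall>i::int. odd i \<longrightarrow> grade_space sc br h i = {0}) \<and>
            (\<forall>x. regular_nilpotent_in sc br k x \<longrightarrow> regular_in sc br (grade_space sc br h 0) x)))
     \<and> (((\<forall>i::int. odd i \<longrightarrow> grade_space sc br h i = {0}) \<and>
            (\<forall>x. regular_nilpotent_in sc br k x \<longrightarrow> regular_in sc br (grade_space sc br h 0) x))
         \<longrightarrow> (\<forall>e'. regular_nilpotent_in sc br k e' \<longrightarrow> principal_nilpotent_pair sc br e e'))"
proof -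
  obtain Basis where "sslie sc Basis br" using sslie_of_semisimple[OF assms(1)] .
  then interpret sslie sc Basis br .
  show ?thesis unfolding k_def by (rule rectangular_iff_even_regular[OF assms(3)])
qed

end
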